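(* Fix $k\in\mathbb Z_{\ge1}$. Let $\widehat Z_k$ be a positive random variable with density $\widehat g_k(x)=\frac{\sqrt\pi}{2}\frac{(2k-2)!!}{(2k-1)!!}\frac{\partial^2}{\partial x^2}\mathbb P(\mathbf T_{FS}(k)>x)$, $x>0$, where $\mathbf T_{FS}(k)$ is the smallest positive eigenvalue of a $2k\times2k$ aGUE matrix $\frac{\mathbf i}{2}(Y-Y^T)$ ($Y$ with i.i.d. $N(0,1)$ entries). Let $\mathcal X'_k$ be the determinantal point process described in the context, and for $l\ge0$ let $Z'_l$ be the coordinate of the particle of $\mathcal X'_k$ on level $l$ closest to the origin. Then: (i) if $k=1$, $\widehat Z_1$ has the same law as $Z'_3$; (ii) if $k\ge2$, $\widehat Z_k$ has the same law as $\min\{Z'_{2k-1},Z'_{2k+1}\}$.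
   Context: $\mathcal X'_k$ is the determinantal point process on $\mathbb Z_{\ge0}\times\mathbb R_{\ge0}$ (reference measure: counting measure on the first coordinate times Lebesgue measure on the second) with correlation kernel, for $x_1,x_2\in\mathbb Z_{\ge0}$, $u_1,u_2>0$, $$K'_k(x_1,u_1;x_2,u_2)=\mathbf 1_{\{u_2<u_1,\,x_2<x_1\}}\frac{(u_2-u_1)^{x_1-x_2-1}}{(x_1-x_2-1)!}+\frac{1}{(2\pi\mathbf i)^2}\oint_{C_z[0,\infty)}dz\oint_{C_w[0,x_1)}dw\,\frac{\Gamma(-w)}{\Gamma(z+1)}\frac{\Gamma(z+x_2+1)}{\Gamma(x_1-w)}\frac{\Gamma(-\frac{z+x_2}{2})}{\Gamma(\frac{-x_1+w+1}{2})}\cdot\frac{z+x_2-2k}{z+x_2-2k+1}\cdot\frac{x_1-w-2k}{x_1-w-2k-1}\cdot\frac{u_1^wu_2^z}{w+z+x_2-x_1+1},$$ with values at $u_1=0$ or $u_2=0$ defined as limits. The contours $C_z[0,\infty)$ and $C_w[0,x_1)$ are counterclockwise, enclose exactly the integers in $[0,\infty)$ and in $[0,x_1)$ respectively, stay uniformly bounded away from these integers, and are arranged so that $w+z+x_2-x_1+1$ stays uniformly bounded away from $0$ and no residue arises from the factor $1/(w+z+x_2-x_1+1)$ when integrating in $w$ first; the $z$-integral over the unbounded contour is understood as the (convergent) sum of the residues it encloses (limit of contours $C_z[0,m)$, $m\to\infty$). The $l$-th level of $\mathcal X'_k$ is its restriction to $\{l\}\times\mathbb R_{\ge0}$. *)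

theory Defs
  imports "HOL-Probability.Probability" "HOL-Complex_Analysis.Complex_Analysis"
begin

fun dfact :: "nat \<Rightarrow> nat" where
  "dfact 0 = 1"
| "dfact (Suc 0) = 1"
| "dfact (Suc (Suc n)) = Suc (Suc n) * dfact n"

definition Kint :: "nat \<Rightarrow> nat \<Rightarrow> real \<Rightarrow> nat \<Rightarrow> real \<Rightarrow> complex \<Rightarrow> complex \<Rightarrow> complex" where
  "Kint k x1 u1 x2 u2 w z =
     Gamma (- w) * rGamma (z + 1)
   * Gamma (z + of_nat x2 + 1) * rGamma (of_nat x1 - w)
   * Gamma (- (z + of_nat x2) / 2) * rGamma ((- of_nat x1 + w + 1) / 2)
   * ((z + of_nat x2 - 2 * of_nat k) / (z + of_nat x2 - 2 * of_nat k + 1))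
   * ((of_nat x1 - w - 2 * of_nat k) / (of_nat x1 - w - 2 * of_nat k - 1))
   * (complex_of_real u1 powr w) * (complex_of_real u2 powr z)
   / (w + z + of_nat x2 - of_nat x1 + 1)"

text \<open>The double contour integral (1/(2 pi i))^2 oint dz oint dw, written as the
  sum of the enclosed residues: first in w at the integers 0..x1-1 (no residue from
  the factor 1/(w+z+x2-x1+1)), then in z at all integers n >= 0, the latter being the
  convergent limit of the partial sums over n < m.\<close>
definition Kprime :: "nat \<Rightarrow> nat \<times> real \<Rightarrow> nat \<times> real \<Rightarrow> complex" where
  "Kprime k p1 p2 = (case p1 of (x1, u1) \<Rightarrow> case p2 of (x2, u2) \<Rightarrow>
     (if u2 < u1 \<and> x2 < x1
      then complex_of_real ((u2 - u1) ^ (x1 - x2 - 1) / fact (x1 - x2 - 1)) else 0)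
   + (\<Sum>n. residue (\<lambda>z. \<Sum>m<x1. residue (\<lambda>w. Kint k x1 u1 x2 u2 w z) (of_nat m))
                   (of_nat n)))"

definition detn :: "nat \<Rightarrow> (nat \<Rightarrow> nat \<Rightarrow> complex) \<Rightarrow> complex" where
  "detn n A = (\<Sum>p | p permutes {..<n}. of_int (sign p) * (\<Prod>i<n. A i (p i)))"

definition Xmeas :: "(nat \<times> real) measure" where
  "Xmeas = count_space UNIV \<Otimes>\<^sub>M restrict_space lborel {0..}"

definition cnt :: "'a set \<Rightarrow> ennreal" where
  "cnt S = (if finite S then of_nat (card S) else \<infinity>)"

definition is_DPP :: "'a measure \<Rightarrow> ('a \<Rightarrow> (nat \<times> real) set)
                       \<Rightarrow> (nat \<times> real \<Rightarrow> nat \<times> real \<Rightarrow> complex) \<Rightarrow> bool" where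
  "is_DPP M xi K \<longleftrightarrow>
     prob_space M \<and>
     (\<forall>\<omega>\<in>space M. xi \<omega> \<subseteq> space Xmeas) \<and>
     (\<forall>A\<in>sets Xmeas. (\<lambda>\<omega>. cnt (xi \<omega> \<inter> A)) \<in> borel_measurable M) \<and>
     (\<forall>l a b. AE \<omega> in M. finite (xi \<omega> \<inter> ({l} \<times> {a..b}))) \<and>
     (\<exists>\<rho> :: nat \<Rightarrow> (nat \<Rightarrow> nat \<times> real) \<Rightarrow> real.
        (\<forall>n y. 0 \<le> \<rho> n y) \<and>
        (\<forall>n. \<rho> n \<in> borel_measurable (PiM {..<n} (\<lambda>_. Xmeas))) \<and>
        (\<forall>n A. (\<forall>i<n. A i \<in> sets Xmeas) \<and> disjoint_family_on A {..<n} \<longrightarrow>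
           (\<integral>\<^sup>+ \<omega>. (\<Prod>i<n. cnt (xi \<omega> \<inter> A i)) \<partial>M)
           = (\<integral>\<^sup>+ y. indicator (PiE {..<n} A) y * ennreal (\<rho> n y) \<partial>(PiM {..<n} (\<lambda>_. Xmeas)))) \<and>
        (\<forall>n. AE y in PiM {..<n} (\<lambda>_. Xmeas).
               detn n (\<lambda>i j. K (y i) (y j)) = complex_of_real (\<rho> n y)))"

text \<open>Coordinate of the particle on level l closest to the origin (+oo if none).\<close>
definition Zlev :: "('a \<Rightarrow> (nat \<times> real) set) \<Rightarrow> nat \<Rightarrow> 'a \<Rightarrow> ereal" where
  "Zlev xi l \<omega> = Inf (ereal ` {u. (l, u) \<in> xi \<omega>})"

definition real_gaussian_matrix :: "'b measure \<Rightarrow> nat \<Rightarrow> ('b \<Rightarrow> nat \<times> nat \<Rightarrow> real) \<Rightarrow> bool" where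
  "real_gaussian_matrix P N Y \<longleftrightarrow>
     prob_space P \<and>
     prob_space.indep_vars P (\<lambda>_. borel) (\<lambda>ij \<omega>. Y \<omega> ij) ({..<N} \<times> {..<N}) \<and>
     (\<forall>ij\<in>{..<N} \<times> {..<N}. distributed P lborel (\<lambda>\<omega>. Y \<omega> ij) (\<lambda>x. ennreal (std_normal_density x)))"

definition aGUE :: "(nat \<times> nat \<Rightarrow> real) \<Rightarrow> nat \<Rightarrow> nat \<Rightarrow> complex" where
  "aGUE Y i j = (\<i> / 2) * complex_of_real (Y (i, j) - Y (j, i))"

definition is_eigenvalue :: "nat \<Rightarrow> (nat \<Rightarrow> nat \<Rightarrow> complex) \<Rightarrow> real \<Rightarrow> bool" where
  "is_eigenvalue N H lam \<longleftrightarrow>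
     (\<exists>v :: nat \<Rightarrow> complex. (\<exists>i<N. v i \<noteq> 0) \<and>
        (\<forall>i<N. (\<Sum>j<N. H i j * v j) = complex_of_real lam * v i))"

definition TFS :: "nat \<Rightarrow> (nat \<times> nat \<Rightarrow> real) \<Rightarrow> real" where
  "TFS k Y = Inf {lam. lam > 0 \<and> is_eigenvalue (2 * k) (aGUE Y) lam}"

definition ghat :: "nat \<Rightarrow> 'b measure \<Rightarrow> ('b \<Rightarrow> nat \<times> nat \<Rightarrow> real) \<Rightarrow> real \<Rightarrow> real" where
  "ghat k P Y x =
     (if x > 0 then
        sqrt pi / 2 * real (dfact (2 * k - 2)) / real (dfact (2 * k - 1))
        * deriv (deriv (\<lambda>t. measure P {\<omega> \<in> space P. TFS k (Y \<omega>) > t})) x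
      else 0)"

end

theory Submission
  imports Defs "Jordan_Normal_Form.Schur_Decomposition"
begin

text \<open>
  On the levels \<open>2k - 1\<close> and \<open>2k + 1\<close> the residues turn the kernel into a two-level kernel of ranks \<open>k - 1\<close> and \<open>k\<close>,
  so almost surely these levels carry at most \<open>k - 1\<close> and \<open>k\<close> particles. The correlation function of order \<open>2k - 1\<close>
  with all slots occupied factors into three determinants; applying Andreief's identity twice, its integral over
  \<open>(t, \<infinity>)\<close> is a multiple of the derivative of the Hankel determinant \<open>det (\<integral> u \<ge> t. u^(2i+2j) exp (-u^2))\<close>,
  and the multiple equals one at \<open>t = 0\<close>. Hence all slots are occupied and this is the probability that no particle lies below \<open>t\<close>.
  On the other side, matching moments through loop equations shows that the squared positive eigenvalues of the aGUE matrix
  have a joint density proportional to a squared Vandermonde determinant, so that the Hankel determinant is the tail of the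
  smallest one up to normalization.
\<close>

section \<open>Gaussian moments and loop equations\<close>

text \<open>Loop equations take the place of a change of variables to eigenvalues: integration by
  parts in the matrix entries and in the points of the Vandermonde ensemble leads to one and the
  same recursion with a unique solution. Whether polynomial moments determine a law is a question
  avoided as follows. The recursion holds for the weight exp (- b x^2) with every b > 0; taking b =
  1 + s gives moments under the extra weight exp (- s p), p the sum of squares, and such weights
  build cutoffs to bounded regions, where Weierstrass approximation applies.

  The constant in \<open>ghat\<close> is a quotient of two values at 0. The tail of the smallest
  eigenvalue is proportional to \<open>hdet k\<close>, that of the lowest particle to
  \<open>rdet k\<close>, which is minus the derivative of \<open>hdet k\<close>. The factor sqrt pi
  / 2 * (2k-2)!! / (2k-1)!! exchanges the normalization by \<open>hdet k 0\<close> for the one by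
  \<open>rdet k 0\<close>.

  The sign of the integrated correlation function is never computed: the absolute value at t = 0 is
  known, and the function is nonnegative.\<close>

inductive polyfun :: "'i set \<Rightarrow> (('i \<Rightarrow> real) \<Rightarrow> real) \<Rightarrow> bool" for I where
  polyfun_const: "polyfun I (\<lambda>_. c)"
| polyfun_coord: "e \<in> I \<Longrightarrow> polyfun I (\<lambda>x. x e)"
| polyfun_add: "polyfun I F \<Longrightarrow> polyfun I G \<Longrightarrow> polyfun I (\<lambda>x. F x + G x)"
| polyfun_mult: "polyfun I F \<Longrightarrow> polyfun I G \<Longrightarrow> polyfun I (\<lambda>x. F x * G x)"

lemma polyfun_cmult: "polyfun I F \<Longrightarrow> polyfun I (\<lambda>x. c * F x)"
  by (intro polyfun_mult polyfun_const)

lemma polyfun_minus: "polyfun I F \<Longrightarrow> polyfun I (\<lambda>x. - F x)"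
  using polyfun_cmult[of I F "-1"] by simp

lemma polyfun_diff: "polyfun I F \<Longrightarrow> polyfun I G \<Longrightarrow> polyfun I (\<lambda>x. F x - G x)"
  using polyfun_add[OF _ polyfun_minus, of I F G] by simp

lemma polyfun_sum: "(\<And>a. a \<in> S \<Longrightarrow> polyfun I (F a)) \<Longrightarrow> polyfun I (\<lambda>x. \<Sum>a\<in>S. F a x)"
  by (induction S rule: infinite_finite_induct) (auto intro: polyfun_const polyfun_add)

lemma polyfun_prod: "(\<And>a. a \<in> S \<Longrightarrow> polyfun I (F a)) \<Longrightarrow> polyfun I (\<lambda>x. \<Prod>a\<in>S. F a x)"
  by (induction S rule: infinite_finite_induct) (auto intro: polyfun_const polyfun_mult)

lemma polyfun_power: "polyfun I F \<Longrightarrow> polyfun I (\<lambda>x. F x ^ n)"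
  by (induction n) (auto intro: polyfun_const polyfun_mult)

lemma polyfun_mono: "polyfun I F \<Longrightarrow> I \<subseteq> J \<Longrightarrow> polyfun J F"
  by (induction rule: polyfun.induct) (auto intro: polyfun.intros)

lemma polyfun_cong: "polyfun I F \<Longrightarrow> (\<And>e. e \<in> I \<Longrightarrow> x e = y e) \<Longrightarrow> F x = F y"
  by (induction rule: polyfun.induct) auto

lemma polyfun_measurable:
  "polyfun I F \<Longrightarrow> F \<in> borel_measurable (Pi\<^sub>M I (\<lambda>_. borel))"
  by (induction rule: polyfun.induct) auto

text \<open>The bound is a product over the coordinates, so that integrability against a product
  measure reduces to moments in one variable. One common exponent makes the bounds of two functions
  comparable.\<close>

lemma polyfun_bound:
  assumes "polyfun I F" "finite I"
  shows "\<exists>C n. 0 \<le> C \<and> (\<forall>x. \<bar>F x\<bar> \<le> C * (\<Prod>e\<in>I. (1 + \<bar>x e\<bar>) ^ n))"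
  using assms(1)
proof (induction rule: polyfun.induct)
  case (polyfun_const c)
  show ?case by (rule exI[of _ "\<bar>c\<bar>"], rule exI[of _ 0]) auto
next
  case (polyfun_coord e)
  have "\<bar>x e\<bar> \<le> (\<Prod>e\<in>I. (1 + \<bar>x e\<bar>) ^ 1)" for x :: "_ \<Rightarrow> real"
  proof -
    have "1 + \<bar>x e\<bar> \<le> (1 + \<bar>x e\<bar>) * (\<Prod>e\<in>I-{e}. (1 + \<bar>x e\<bar>))"
      using prod_ge_1[of "I-{e}" "\<lambda>e. 1 + \<bar>x e\<bar>"] by (simp add: mult_le_cancel_left1)
    also have "\<dots> = (\<Prod>e\<in>I. (1 + \<bar>x e\<bar>))"
      using assms(2) polyfun_coord by (simp add: prod.remove)
    finally show ?thesis by simp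
  qed
  then show ?case by (intro exI[of _ 1]) auto
next
  case (polyfun_add F G)
  then obtain C n D m where b: "0 \<le> C" "0 \<le> D" "\<And>x. \<bar>F x\<bar> \<le> C * (\<Prod>e\<in>I. (1 + \<bar>x e\<bar>) ^ n)"
     "\<And>x. \<bar>G x\<bar> \<le> D * (\<Prod>e\<in>I. (1 + \<bar>x e\<bar>) ^ m)" by blast
  have "\<bar>F x + G x\<bar> \<le> (C + D) * (\<Prod>e\<in>I. (1 + \<bar>x e\<bar>) ^ (n + m))" for x
  proof -
    have "(\<Prod>e\<in>I. (1 + \<bar>x e\<bar>) ^ n) \<le> (\<Prod>e\<in>I. (1 + \<bar>x e\<bar>) ^ (n + m))"
      "(\<Prod>e\<in>I. (1 + \<bar>x e\<bar>) ^ m) \<le> (\<Prod>e\<in>I. (1 + \<bar>x e\<bar>) ^ (n + m))"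
      by (auto intro!: prod_mono power_increasing)
    then have "C * (\<Prod>e\<in>I. (1 + \<bar>x e\<bar>) ^ n) + D * (\<Prod>e\<in>I. (1 + \<bar>x e\<bar>) ^ m)
       \<le> C * (\<Prod>e\<in>I. (1 + \<bar>x e\<bar>) ^ (n + m)) + D * (\<Prod>e\<in>I. (1 + \<bar>x e\<bar>) ^ (n + m))"
      using b by (intro add_mono mult_left_mono) auto
    moreover have "\<bar>F x + G x\<bar> \<le> \<bar>F x\<bar> + \<bar>G x\<bar>" by simp
    ultimately show ?thesis using b(3)[of x] b(4)[of x] unfolding distrib_right by linarith
  qed
  then show ?case using b by (intro exI[of _ "C + D"] exI[of _ "n + m"]) auto
next
  case (polyfun_mult F G)
  then obtain C n D m where b: "0 \<le> C" "0 \<le> D" "\<And>x. \<bar>F x\<bar> \<le> C * (\<Prod>e\<in>I. (1 + \<bar>x e\<bar>) ^ n)"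
     "\<And>x. \<bar>G x\<bar> \<le> D * (\<Prod>e\<in>I. (1 + \<bar>x e\<bar>) ^ m)" by blast
  have "\<bar>F x * G x\<bar> \<le> (C * D) * (\<Prod>e\<in>I. (1 + \<bar>x e\<bar>) ^ (n + m))" for x
  proof -
    have "\<bar>F x * G x\<bar> \<le> (C * (\<Prod>e\<in>I. (1 + \<bar>x e\<bar>) ^ n)) * (D * (\<Prod>e\<in>I. (1 + \<bar>x e\<bar>) ^ m))"
      unfolding abs_mult using b by (intro mult_mono) (auto intro!: mult_nonneg_nonneg prod_nonneg)
    also have "\<dots> = (C * D) * (\<Prod>e\<in>I. (1 + \<bar>x e\<bar>) ^ (n + m))"
      by (simp add: power_add prod.distrib)
    finally show ?thesis .
  qed
  then show ?case using b by (intro exI[of _ "C * D"] exI[of _ "n + m"]) auto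
qed

text \<open>Isolates the one coordinate that integration by parts touches. The clause that
  \<open>c j x\<close> vanishes beyond n lets sums of different lengths be padded when two
  decompositions are added or multiplied.\<close>

lemma polyfun_decomp:
  assumes "polyfun I F"
  shows "\<exists>n c. (\<forall>j. polyfun (I - {e}) (c j)) \<and> (\<forall>j>n. \<forall>x. c j x = 0) \<and>
           (\<forall>x. F x = (\<Sum>j\<le>n. c j x * x e ^ j))"
  using assms
proof (induction rule: polyfun.induct)
  case (polyfun_const c)
  show ?case by (rule exI[of _ 0], rule exI[of _ "\<lambda>j x. if j = 0 then c else 0"])
     (auto intro: polyfun.polyfun_const)
next
  case (polyfun_coord e')
  show ?case
  proof (cases "e' = e")
    case True
    show ?thesis by (rule exI[of _ 1], rule exI[of _ "\<lambda>j x. if j = 1 then 1 else 0"])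
       (auto intro: polyfun.polyfun_const simp: True)
  next
    case False
    have "polyfun (I - {e}) (\<lambda>x. if j = (0::nat) then x e' else 0)" for j
      by (cases "j = 0") (use False polyfun_coord in \<open>simp_all add: polyfun.polyfun_const polyfun.polyfun_coord\<close>)
    then show ?thesis
      by (intro exI[of _ 0] exI[of _ "\<lambda>j x. if j = 0 then x e' else 0"]) auto
  qed
next
  case (polyfun_add F G)
  from polyfun_add.IH(1) obtain n c where b1: "\<And>j. polyfun (I - {e}) (c j)"
     "\<And>j x. j > n \<Longrightarrow> c j x = 0" "\<And>x. F x = (\<Sum>j\<le>n. c j x * x e ^ j)" by blast
  from polyfun_add.IH(2) obtain m d where b2: "\<And>j. polyfun (I - {e}) (d j)"
     "\<And>j x. j > m \<Longrightarrow> d j x = 0" "\<And>x. G x = (\<Sum>j\<le>m. d j x * x e ^ j)" by blast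
  note b = b1(1) b2(1) b1(2) b2(2) b1(3) b2(3)
  have "F x + G x = (\<Sum>j\<le>n+m. (c j x + d j x) * x e ^ j)" for x
  proof -
    have "F x = (\<Sum>j\<le>n+m. c j x * x e ^ j)" "G x = (\<Sum>j\<le>n+m. d j x * x e ^ j)"
      unfolding b(5,6) by (intro sum.mono_neutral_left; auto simp: b)+
    then show ?thesis by (simp add: sum.distrib algebra_simps)
  qed
  then show ?case
    by (intro exI[of _ "n+m"] exI[of _ "\<lambda>j x. c j x + d j x"]) (auto intro: polyfun.polyfun_add b simp: b)
next
  case (polyfun_mult F G)
  from polyfun_mult.IH(1) obtain n c where b1: "\<And>j. polyfun (I - {e}) (c j)"
     "\<And>j x. j > n \<Longrightarrow> c j x = 0" "\<And>x. F x = (\<Sum>j\<le>n. c j x * x e ^ j)" by blast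
  from polyfun_mult.IH(2) obtain m d where b2: "\<And>j. polyfun (I - {e}) (d j)"
     "\<And>j x. j > m \<Longrightarrow> d j x = 0" "\<And>x. G x = (\<Sum>j\<le>m. d j x * x e ^ j)" by blast
  note b = b1(1) b2(1) b1(2) b2(2) b1(3) b2(3)
  have *: "F x * G x = (\<Sum>r\<le>n+m. (\<Sum>i\<le>r. c i x * d (r - i) x) * x e ^ r)" for x
    unfolding b(5,6) by (rule polynomial_product) (auto simp: b)
  have "(\<Sum>i\<le>r. c i x * d (r - i) x) = 0" if "r > n + m" for r x
  proof (rule sum.neutral, safe)
    fix i assume "i \<le> r"
    show "c i x * d (r - i) x = 0" using that b(3)[of i x] b(4)[of "r - i" x] by (cases "i > n") auto
  qed
  then show ?case using *
    by (intro exI[of _ "n+m"] exI[of _ "\<lambda>r x. \<Sum>i\<le>r. c i x * d (r - i) x"])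
       (auto intro!: polyfun_sum polyfun.polyfun_mult b)
qed

section \<open>Gaussian product measures and integration by parts\<close>

definition gauss :: "real \<Rightarrow> real measure" where
  "gauss b = density lborel (\<lambda>x. ennreal (sqrt (b / pi) * exp (- b * x\<^sup>2)))"

lemma gauss_eq_normal:
  assumes "b > 0"
  shows "gauss b = density lborel (\<lambda>x. ennreal (normal_density 0 (sqrt (1 / (2 * b))) x))"
  using assms by (simp add: gauss_def normal_density_def real_sqrt_divide field_simps)

lemma sets_gauss [simp, measurable_cong]: "sets (gauss b) = sets borel"
  and space_gauss [simp]: "space (gauss b) = UNIV"
  by (simp_all add: gauss_def)

lemma prob_space_gauss: "b > 0 \<Longrightarrow> prob_space (gauss b)"
  unfolding gauss_eq_normal by (intro prob_space_normal_density) auto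

lemma integrable_gauss_power: "b > 0 \<Longrightarrow> integrable (gauss b) (\<lambda>x. x ^ n)"
  using integrable_normal_moment[of "sqrt (1 / (2 * b))" 0 n]
  by (simp add: gauss_eq_normal integrable_density)

text \<open>Integration by parts in one variable, read off from the closed form of the even moments
  and the vanishing of the odd ones. For n = 0 the truncated exponent n - 1 is harmless because of
  the factor n.\<close>

lemma gauss_moment_step:
  assumes b: "b > 0"
  shows "2 * b * integral\<^sup>L (gauss b) (\<lambda>x. x ^ (n + 1)) = real n * integral\<^sup>L (gauss b) (\<lambda>x. x ^ (n - 1))"
proof -
  have eq: "integral\<^sup>L (gauss b) (\<lambda>x. x ^ n)
      = integral\<^sup>L lborel (\<lambda>x. normal_density 0 (sqrt (1 / (2 * b))) x * (x - 0) ^ n)" for n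
    using b by (simp add: gauss_eq_normal integral_density)
  have odd: "integral\<^sup>L (gauss b) (\<lambda>x. x ^ (2 * j + 1)) = 0" for j
    unfolding eq by (rule integral_normal_moment_odd) (use b in auto)
  have even: "integral\<^sup>L (gauss b) (\<lambda>x. x ^ (2 * j)) = fact (2 * j) / ((4 * b)^j * fact j)" for j
    unfolding eq by (subst integral_normal_moment_even) (use b in \<open>auto simp: field_simps\<close>)
  show ?thesis
  proof (cases "even n")
    case True
    then obtain j where j: "n = 2 * j" by (elim evenE)
    have "real n * integral\<^sup>L (gauss b) (\<lambda>x. x ^ (n - 1)) = 0"
    proof (cases j)
      case (Suc i)
      then have "n - 1 = 2 * i + 1" using j by simp
      then show ?thesis using odd[of i] by simp
    qed (simp add: j)
    then show ?thesis using odd[of j] j by simp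
  next
    case False
    then obtain j where j: "n = 2 * j + 1" by (elim oddE)
    have "fact (2 * (j + 1)) = (2 * real j + 2) * (2 * real j + 1) * fact (2 * j)"
      by (simp add: algebra_simps)
    moreover have 1: "integral\<^sup>L (gauss b) (\<lambda>x. x ^ (n + 1)) = fact (2 * (j + 1)) / ((4 * b)^(j + 1) * fact (j + 1))"
      using even[of "j + 1"] j by simp
    moreover have 2: "integral\<^sup>L (gauss b) (\<lambda>x. x ^ (n - 1)) = fact (2 * j) / ((4 * b)^j * fact j)"
      using even[of j] j by simp
    ultimately show ?thesis using b unfolding 1 2
      by (simp add: divide_simps j del: fact_Suc mult_Suc_right) (simp add: algebra_simps)
  qed
qed

lemma integrable_gauss_bound: 
  assumes "b > 0" shows "integrable (gauss b) (\<lambda>x. (1 + \<bar>x\<bar>) ^ n)"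
proof -
  have "integrable (gauss b) (\<lambda>x. \<bar>x\<bar> ^ j)" for j
    using integrable_norm[OF integrable_gauss_power[OF assms, of j]] by (simp add: power_abs)
  then show ?thesis
    unfolding binomial_ring add.commute[of 1] by (intro Bochner_Integration.integrable_sum) auto
qed

text \<open>The parameter b stays free: passing from b = 1 to b = 1 + s is how exponential weights
  enter later.\<close>

abbreviation gaussn :: "real \<Rightarrow> 'i set \<Rightarrow> ('i \<Rightarrow> real) measure" where
  "gaussn b I \<equiv> Pi\<^sub>M I (\<lambda>_. gauss b)"

lemma product_sigma_finite_gauss: "b > 0 \<Longrightarrow> product_sigma_finite (\<lambda>_. gauss b)"
  by (intro product_sigma_finite.intro prob_space_imp_sigma_finite prob_space_gauss)

lemma prob_space_gaussn: "b > 0 \<Longrightarrow> prob_space (gaussn b I)"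
  by (intro prob_space_PiM prob_space_gauss)

lemma sets_gaussn [measurable_cong]: "sets (gaussn b I) = sets (Pi\<^sub>M I (\<lambda>_. borel))"
  by (intro sets_PiM_cong) auto

lemma polyfun_measurable_gaussn: "polyfun I F \<Longrightarrow> F \<in> borel_measurable (gaussn b I)"
  using polyfun_measurable[of I F] measurable_cong_sets[OF sets_gaussn refl] by blast

lemma polyfun_integrable:
  assumes "polyfun I F" "finite I" "b > 0"
  shows "integrable (gaussn b I) F"
proof -
  interpret product_sigma_finite "\<lambda>_. gauss b" by (rule product_sigma_finite_gauss[OF assms(3)])
  obtain C n where C: "\<And>x. \<bar>F x\<bar> \<le> C * (\<Prod>e\<in>I. (1 + \<bar>x e\<bar>) ^ n)" "0 \<le> C"
    using polyfun_bound[OF assms(1,2)] by blast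
  have "integrable (gaussn b I) (\<lambda>x. C * (\<Prod>e\<in>I. (1 + \<bar>x e\<bar>) ^ n))"
    by (intro integrable_mult_right product_integrable_prod assms integrable_gauss_bound)
  then show ?thesis
    by (rule Bochner_Integration.integrable_bound)
       (use C in \<open>auto intro!: AE_I2 polyfun_measurable_gaussn assms simp: abs_mult prod_nonneg\<close>)
qed

lemma gaussn_split_coord:
  assumes "finite I" "e \<in> I" "b > 0" "polyfun (I - {e}) c"
  shows "(\<integral>x. c x * x e ^ j \<partial>gaussn b I) = (\<integral>x. c x \<partial>gaussn b (I - {e})) * (\<integral>x. x ^ j \<partial>gauss b)"
proof -
  interpret product_sigma_finite "\<lambda>_. gauss b" by (rule product_sigma_finite_gauss[OF assms(3)])
  have I: "I = insert e (I - {e})" using assms by auto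
  have pf: "polyfun I (\<lambda>x. c x * x e ^ j)"
    by (intro polyfun_mult polyfun_power polyfun_coord assms polyfun_mono[OF assms(4)]) auto
  have "(\<integral>x. c x * x e ^ j \<partial>gaussn b I) = (\<integral>x. c x * x e ^ j \<partial>gaussn b (insert e (I - {e})))"
    using I by simp
  also have "\<dots> = (\<integral>x. (\<integral>y. c (x(e := y)) * y ^ j \<partial>gauss b) \<partial>gaussn b (I - {e}))"
    by (subst product_integral_insert) (use polyfun_integrable[OF pf] assms I in auto)
  also have "\<dots> = (\<integral>x. (\<integral>y. c x * y ^ j \<partial>gauss b) \<partial>gaussn b (I - {e}))"
  proof -
    have "c (x(e := y)) = c x" for x y
      by (rule polyfun_cong[OF assms(4)]) auto
    then show ?thesis by simp
  qed
  finally show ?thesis by simp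
qed

text \<open>Stein's identity for polynomial functions. The derivative is a hypothesis on each
  coordinate line, so that it can be supplied by the usual differentiation rules; that it is again a
  polynomial function then follows from the decomposition by powers of \<open>x e\<close>.\<close>

lemma gaussn_stein:
  assumes "polyfun I F" "finite I" "e \<in> I" "b > 0"
    and D: "\<And>x. ((\<lambda>t. F (x(e := t))) has_real_derivative F' x) (at (x e))"
  shows "polyfun I F'" 
    and "2 * b * (\<integral>x. x e * F x \<partial>gaussn b I) = (\<integral>x. F' x \<partial>gaussn b I)"
proof -
  obtain n c where c: "\<And>j. polyfun (I - {e}) (c j)" "\<And>x. F x = (\<Sum>j\<le>n. c j x * x e ^ j)"
    using polyfun_decomp[OF assms(1), of e] by blast
  have cI: "polyfun I (c j)" for j by (rule polyfun_mono[OF c(1)]) auto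
  have F': "F' x = (\<Sum>j\<le>n. c j x * (real j * x e ^ (j - 1)))" for x
  proof -
    have "F (x(e := t)) = (\<Sum>j\<le>n. c j x * t ^ j)" for t
      unfolding c(2) by (intro sum.cong refl arg_cong2[of _ _ _ _ times] polyfun_cong[OF c(1)]) auto
    moreover have "((\<lambda>t. \<Sum>j\<le>n. c j x * t ^ j) has_real_derivative 
       (\<Sum>j\<le>n. c j x * (real j * x e ^ (j - 1)))) (at (x e))"
      by (auto intro!: derivative_eq_intros sum.cong)
    ultimately show ?thesis using D[of x] DERIV_unique by force
  qed
  show pF': "polyfun I F'"
    unfolding F'[abs_def] by (intro polyfun_sum polyfun_mult cI polyfun_const polyfun_power polyfun_coord assms)
  have int: "integrable (gaussn b I) (\<lambda>x. c j x * x e ^ i)" for i j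
    by (intro polyfun_integrable polyfun_mult cI polyfun_power polyfun_coord assms)
  have "(\<integral>x. x e * F x \<partial>gaussn b I) = (\<integral>x. (\<Sum>j\<le>n. c j x * x e ^ (j + 1)) \<partial>gaussn b I)"
    unfolding c(2) by (intro Bochner_Integration.integral_cong refl) (simp add: sum_distrib_left mult_ac)
  also have "\<dots> = (\<Sum>j\<le>n. (\<integral>x. c j x \<partial>gaussn b (I - {e})) * (\<integral>x. x ^ (j + 1) \<partial>gauss b))"
    unfolding gaussn_split_coord[OF assms(2,3,4) c(1), symmetric] by (rule Bochner_Integration.integral_sum[OF int])
  finally have "2 * b * (\<integral>x. x e * F x \<partial>gaussn b I) = 
     (\<Sum>j\<le>n. (\<integral>x. c j x \<partial>gaussn b (I - {e})) * (2 * b * (\<integral>x. x ^ (j + 1) \<partial>gauss b)))"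
    by (simp add: sum_distrib_left mult_ac)
  also have "\<dots> = (\<Sum>j\<le>n. (\<integral>x. c j x * x e ^ (j - 1) \<partial>gaussn b I) * real j)"
    unfolding gauss_moment_step[OF assms(4)] gaussn_split_coord[OF assms(2,3,4) c(1)] by (simp add: mult_ac)
  also have "\<dots> = (\<integral>x. (\<Sum>j\<le>n. c j x * x e ^ (j - 1) * real j) \<partial>gaussn b I)"
    by (subst Bochner_Integration.integral_sum) (use int in auto)
  also have "\<dots> = (\<integral>x. F' x \<partial>gaussn b I)"
    unfolding F' by (intro Bochner_Integration.integral_cong refl) (simp add: mult_ac)
  finally show "2 * b * (\<integral>x. x e * F x \<partial>gaussn b I) = (\<integral>x. F' x \<partial>gaussn b I)" .
qed

section \<open>Products of power sums and their recursion\<close>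

definition PL :: "(nat \<Rightarrow> real) \<Rightarrow> nat list \<Rightarrow> real" where
  "PL q ls = prod_list (map q ls)"

lemma PL_simps [simp]: "PL q [] = 1" "PL q (l # ls) = q l * PL q ls"
  by (simp_all add: PL_def)

fun DPL :: "(nat \<Rightarrow> real) \<Rightarrow> (nat \<Rightarrow> real) \<Rightarrow> nat list \<Rightarrow> real" where
  "DPL q d [] = 0"
| "DPL q d (l # ls) = d l * PL q ls + q l * DPL q d ls"

text \<open>The merging term of the loop equations, kept as a formal list of weighted products: it
  describes the effect on \<open>PL q ls\<close> of the derivation sending \<open>q l\<close> to
  \<open>l * q (m + l)\<close>. In this form a functional on lists can be applied to it without
  mentioning q.\<close>

fun join_terms :: "nat \<Rightarrow> nat list \<Rightarrow> (real \<times> nat list) list" where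
  "join_terms m [] = []"
| "join_terms m (l # ls) = (real l, (m + l) # ls) # map (\<lambda>(c, l'). (c, l # l')) (join_terms m ls)"

lemma polyfun_PL: "(\<And>l. polyfun I (\<lambda>x. q x l)) \<Longrightarrow> polyfun I (\<lambda>x. PL (q x) ls)"
  by (induction ls) (auto intro: polyfun_const polyfun_mult)

lemma DERIV_PL:
  "(\<And>l. ((\<lambda>t. q t l) has_real_derivative d l) (at t0)) \<Longrightarrow>
   ((\<lambda>t. PL (q t) ls) has_real_derivative DPL (q t0) d ls) (at t0)"
  by (induction ls) (auto intro!: derivative_eq_intros)

lemma DPL_sum: "(\<Sum>i\<in>S. c i * DPL q (d i) ls) = DPL q (\<lambda>l. \<Sum>i\<in>S. c i * d i l) ls"
proof (induction ls)
  case (Cons a ls)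
  have "(\<Sum>i\<in>S. c i * (d i a * PL q ls)) = (\<Sum>i\<in>S. c i * d i a) * PL q ls"
    by (simp only: sum_distrib_right mult.assoc)
  moreover have "(\<Sum>i\<in>S. c i * (q a * DPL q (d i) ls)) = q a * (\<Sum>i\<in>S. c i * DPL q (d i) ls)"
    by (simp add: sum_distrib_left mult_ac)
  ultimately show ?case by (simp add: Cons distrib_left sum.distrib)
qed simp

lemma DPL_cmult: "DPL q (\<lambda>l. c * d l) ls = c * DPL q d ls"
  by (induction ls) (simp_all add: algebra_simps)

lemma DPL_join_terms:
  "DPL q (\<lambda>l. real l * q (m + l)) ls = (\<Sum>(c, l')\<leftarrow>join_terms m ls. c * PL q l')"
proof (induction ls)
  case (Cons l ls)
  have "(\<Sum>(c, l')\<leftarrow>map (\<lambda>(c, l'). (c, l # l')) xs. c * PL q l') = q l * (\<Sum>(c, l')\<leftarrow>xs. c * PL q l')" for xs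
    by (induction xs) (auto simp: algebra_simps)
  then show ?case using Cons by simp
qed simp

lemma sum_list_join_terms: "(c, l') \<in> set (join_terms m ls) \<Longrightarrow> sum_list l' = m + sum_list ls"
  by (induction ls arbitrary: c l') auto

text \<open>Schwinger-Dyson equations for the moments of products of power sums. The sum over a
  comes from splitting one power sum, the list from merging two; \<open>\<kappa>\<close> is the
  value of the power sum of order 0.\<close>

definition loop_eq :: "real \<Rightarrow> real \<Rightarrow> (nat list \<Rightarrow> real) \<Rightarrow> bool" where
  "loop_eq b \<kappa> e \<longleftrightarrow> (\<forall>ls. e (0 # ls) = \<kappa> * e ls) \<and>
     (\<forall>m ls. b * e (Suc m # ls) = (\<Sum>a\<le>m. e (a # (m - a) # ls)) - e (m # ls) / 2
        + (\<Sum>(c, l')\<leftarrow>join_terms m ls. c * e l'))"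

text \<open>Every list on the right of the equation for \<open>Suc m\<close> has a total smaller by
  one, and the rule for 0 keeps the total but shortens the list. Hence the induction on (total,
  length), which leaves the value at \<open>[]\<close> as the only freedom.\<close>

lemma loop_eq_unique:
  assumes "loop_eq b \<kappa> e" "loop_eq b \<kappa> e'" "b \<noteq> 0" "e [] = e' []"
  shows "e ls = e' ls"
proof (induction ls rule: wf_induct_rule[OF wf_measures[of "[sum_list, length]"]])
  case (1 ls)
  show ?case
  proof (cases ls)
    case Nil then show ?thesis using assms by simp
  next
    case (Cons m ls')
    show ?thesis
    proof (cases m)
      case 0
      have "e ls' = e' ls'" by (rule 1) (simp add: Cons 0)
      then show ?thesis using assms unfolding loop_eq_def Cons 0 by simp
    next
      case (Suc n)
      have ih: "e l = e' l" if "sum_list l = n + sum_list ls'" for l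
        by (rule 1) (use that in \<open>simp add: Cons Suc\<close>)
      have 1: "map (\<lambda>(c, l'). c * e l') (join_terms n ls') = map (\<lambda>(c, l'). c * e' l') (join_terms n ls')"
        by (intro map_cong refl) (auto dest!: sum_list_join_terms simp: ih)
      have "b * e (Suc n # ls') = b * e' (Suc n # ls')"
        using assms(1,2) unfolding loop_eq_def by (simp add: ih 1)
      then show ?thesis using assms(3) by (simp add: Cons Suc)
    qed
  qed
qed

section \<open>Loop equations of the squared Vandermonde weight\<close>

definition prs :: "nat \<Rightarrow> (nat \<times> nat) set" where
  "prs n = {(i, j). i < j \<and> j < n}"

lemma finite_prs [simp]: "finite (prs n)"
  by (rule finite_subset[of _ "{..<n} \<times> {..<n}"]) (auto simp: prs_def)

lemma prs_Suc: "prs (Suc n) = prs n \<union> (\<lambda>i. (i, n)) ` {..<n}"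
  by (auto simp: prs_def less_Suc_eq)

lemma sum_prs:
  fixes g :: "nat \<Rightarrow> nat \<Rightarrow> real"
  assumes "\<And>a b. a < n \<Longrightarrow> b < n \<Longrightarrow> g a b = g b a"
  shows "(\<Sum>a<n. \<Sum>b<n. g a b) = 2 * (\<Sum>(a, b)\<in>prs n. g a b) + (\<Sum>a<n. g a a)"
  using assms
proof (induction n)
  case (Suc n)
  have inj: "inj_on (\<lambda>i. (i, n)) {..<n}" by (auto intro: inj_onI)
  have "(\<Sum>(a, b)\<in>prs (Suc n). g a b) = (\<Sum>(a, b)\<in>prs n. g a b) + (\<Sum>a<n. g a n)"
    unfolding prs_Suc by (subst sum.union_disjoint) (simp_all add: sum.reindex[OF inj], auto simp: prs_def)
  moreover have "(\<Sum>a<n. g n a) = (\<Sum>a<n. g a n)"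
    using Suc.prems by (intro sum.cong) auto
  moreover have "(\<Sum>a<n. \<Sum>b<n. g a b) = 2 * (\<Sum>(a, b)\<in>prs n. g a b) + (\<Sum>a<n. g a a)"
    using Suc by auto
  ultimately show ?case by (simp add: sum.distrib)
qed (simp add: prs_def)

text \<open>Logarithmic differentiation in the form f' = f * q, which stays meaningful where a
  factor vanishes.\<close>

lemma DERIV_prod_log:
  assumes "finite S" "\<And>j. j \<in> S \<Longrightarrow> (f j has_real_derivative f j t * q j) (at t)"
  shows "((\<lambda>t. \<Prod>j\<in>S. f j t) has_real_derivative (\<Prod>j\<in>S. f j t) * (\<Sum>j\<in>S. q j)) (at t)"
  using assms
proof (induction S)
  case (insert j S)
  then show ?case by (auto intro!: derivative_eq_intros simp: algebra_simps)
qed simp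

definition psum :: "nat \<Rightarrow> (nat \<Rightarrow> real) \<Rightarrow> nat \<Rightarrow> real" where
  "psum n x m = (\<Sum>i<n. x i ^ (2 * m))"

definition vdm2 :: "nat \<Rightarrow> (nat \<Rightarrow> real) \<Rightarrow> real" where
  "vdm2 n x = (\<Prod>(a, b)\<in>prs n. ((x b)\<^sup>2 - (x a)\<^sup>2)\<^sup>2)"

lemma polyfun_psum: "polyfun {..<n} (\<lambda>x. psum n x m)"
  unfolding psum_def by (intro polyfun_sum polyfun_power polyfun_coord) auto

lemma polyfun_vdm2: "polyfun {..<n} (vdm2 n)"
proof -
  have "polyfun {..<n} (\<lambda>x. \<Prod>p\<in>prs n. ((x (snd p))\<^sup>2 - (x (fst p))\<^sup>2)\<^sup>2)"
    by (intro polyfun_prod polyfun_power polyfun_diff polyfun_coord) (auto simp: prs_def)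
  then show ?thesis by (simp add: vdm2_def[abs_def] case_prod_beta)
qed

definition vdm_log :: "(nat \<Rightarrow> real) \<Rightarrow> nat \<Rightarrow> nat \<times> nat \<Rightarrow> real" where
  "vdm_log x i p = (case p of (a, b) \<Rightarrow>
     (if b = i then 4 * x i / ((x b)\<^sup>2 - (x a)\<^sup>2) else 0) + (if a = i then 4 * x i / ((x a)\<^sup>2 - (x b)\<^sup>2) else 0))"

lemma DERIV_vdm2:
  "((\<lambda>t. vdm2 n (x(i := t))) has_real_derivative vdm2 n x * (\<Sum>p\<in>prs n. vdm_log x i p)) (at (x i))"
proof -
  \<comment> \<open>Where two squares coincide the quotient in \<open>vdm_log\<close> is c / 0 = 0;
    the identity covers this case because both sides are then 0.\<close>
  have aux: "d\<^sup>2 * (c / d) = c * d" for c d :: real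
    by (cases "d = 0") (auto simp: power2_eq_square)
  have "((\<lambda>t. case p of (a, b) \<Rightarrow> (((x(i := t)) b)\<^sup>2 - ((x(i := t)) a)\<^sup>2)\<^sup>2) has_real_derivative
     (case p of (a, b) \<Rightarrow> (((x(i := x i)) b)\<^sup>2 - ((x(i := x i)) a)\<^sup>2)\<^sup>2) * vdm_log x i p) (at (x i))"
    if "p \<in> prs n" for p
  proof -
    obtain a b where p: "p = (a, b)" "a < b" using \<open>p \<in> prs n\<close> by (cases p) (auto simp: prs_def)
    consider "b = i" | "a = i" "b \<noteq> i" | "a \<noteq> i" "b \<noteq> i" by blast
    then show ?thesis
    proof cases
      case 1
      then have "((\<lambda>t. (t\<^sup>2 - (x a)\<^sup>2)\<^sup>2) has_real_derivative
         ((x i)\<^sup>2 - (x a)\<^sup>2)\<^sup>2 * (4 * x i / ((x i)\<^sup>2 - (x a)\<^sup>2))) (at (x i))"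
        unfolding aux by (auto intro!: derivative_eq_intros)
      then show ?thesis using p 1 by (simp add: vdm_log_def)
    next
      case 2
      then have "((\<lambda>t. ((x b)\<^sup>2 - t\<^sup>2)\<^sup>2) has_real_derivative
         ((x b)\<^sup>2 - (x i)\<^sup>2)\<^sup>2 * (4 * x i / ((x i)\<^sup>2 - (x b)\<^sup>2))) (at (x i))"
        unfolding power2_commute[of "(x b)\<^sup>2"] aux by (auto intro!: derivative_eq_intros)
      then show ?thesis using p 2 by (simp add: vdm_log_def)
    next
      case 3
      then show ?thesis using p by (simp add: vdm_log_def)
    qed
  qed
  from DERIV_prod_log[OF finite_prs this]
  show ?thesis by (simp add: vdm2_def)
qed

text \<open>With y = x^2, the two contributions of a pair combine to a divided difference of
  y^(m+1), which is a sum of products of powers. Completing the sum over pairs to all (a, b) adds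
  the diagonal, that is m + 1 copies of \<open>psum n x m\<close>. Where \<open>vdm2\<close>
  vanishes there is nothing to show, so the divisions are legitimate.\<close>

lemma vdm_log_sum:
  "vdm2 n x * (\<Sum>i<n. x i ^ (2 * m + 1) * (\<Sum>p\<in>prs n. vdm_log x i p))
   = vdm2 n x * (2 * ((\<Sum>a\<le>m. psum n x a * psum n x (m - a)) - (real m + 1) * psum n x m))"
proof (cases "vdm2 n x = 0")
  case False
  then have ne: "(x b)\<^sup>2 \<noteq> (x a)\<^sup>2" if "(a, b) \<in> prs n" for a b
    using that unfolding vdm2_def by (auto simp: prod_zero_iff)
  define y where "y i = (x i)\<^sup>2" for i
  have "(\<Sum>i<n. x i ^ (2 * m + 1) * (\<Sum>p\<in>prs n. vdm_log x i p)) 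
     = (\<Sum>p\<in>prs n. \<Sum>i<n. x i ^ (2 * m + 1) * vdm_log x i p)"
    by (simp add: sum_distrib_left sum.swap[of _ "prs n"])
  also have "\<dots> = (\<Sum>(a, b)\<in>prs n. 4 * (\<Sum>c\<le>m. y b ^ c * y a ^ (m - c)))"
  proof (intro sum.cong refl, clarify)
    fix a b assume p: "(a, b) \<in> prs n"
    then have ab: "a < n" "b < n" "a \<noteq> b" by (auto simp: prs_def)
    have "(\<Sum>i<n. x i ^ (2 * m + 1) * vdm_log x i (a, b)) = 
       (\<Sum>i<n. if b = i then x b ^ (2 * m + 1) * (4 * x b / ((x b)\<^sup>2 - (x a)\<^sup>2)) else 0) +
       (\<Sum>i<n. if a = i then x a ^ (2 * m + 1) * (4 * x a / ((x a)\<^sup>2 - (x b)\<^sup>2)) else 0)"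
      unfolding sum.distrib[symmetric] by (intro sum.cong) (auto simp: vdm_log_def algebra_simps)
    also have "\<dots> = 4 * y b ^ Suc m / (y b - y a) + 4 * y a ^ Suc m / (y a - y b)"
    proof -
      have "x i ^ (2 * m + 1) * (4 * x i / d) = 4 * ((x i)\<^sup>2) ^ Suc m / d" for i d
        by (simp add: power_mult power2_eq_square)
      then show ?thesis using ab by (simp only: y_def sum.delta' finite_lessThan lessThan_iff if_True)
    qed
    also have "\<dots> = 4 * ((y b ^ Suc m - y a ^ Suc m) / (y b - y a))"
      using ne[OF p] by (simp add: y_def divide_simps) (simp add: algebra_simps)
    also have "\<dots> = 4 * (\<Sum>c\<le>m. y b ^ c * y a ^ (m - c))"
      using ne[OF p] unfolding diff_power_eq_sum by (simp add: y_def lessThan_Suc_atMost)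
    finally show "(\<Sum>i<n. x i ^ (2 * m + 1) * vdm_log x i (a, b)) = 4 * (\<Sum>c\<le>m. y b ^ c * y a ^ (m - c))" .
  qed
  also have "\<dots> = 2 * (2 * (\<Sum>(a, b)\<in>prs n. (\<Sum>c\<le>m. y b ^ c * y a ^ (m - c))))"
    by (simp add: sum_distrib_left case_prod_beta)
  also have "2 * (\<Sum>(a, b)\<in>prs n. (\<Sum>c\<le>m. y b ^ c * y a ^ (m - c))) = 
     (\<Sum>a<n. \<Sum>b<n. \<Sum>c\<le>m. y b ^ c * y a ^ (m - c)) - (\<Sum>a<n. \<Sum>c\<le>m. y a ^ c * y a ^ (m - c))"
  proof -
    have "(\<Sum>c\<le>m. y b ^ c * y a ^ (m - c)) = (\<Sum>c\<le>m. y a ^ c * y b ^ (m - c))" for a b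
      by (rule sum.reindex_bij_witness[of _ "\<lambda>c. m - c" "\<lambda>c. m - c"]) auto
    from sum_prs[of n "\<lambda>a b. \<Sum>c\<le>m. y b ^ c * y a ^ (m - c)", OF this] show ?thesis by simp
  qed
  also have "(\<Sum>a<n. \<Sum>c\<le>m. y a ^ c * y a ^ (m - c)) = (real m + 1) * psum n x m"
  proof -
    have "(\<Sum>c\<le>m. y a ^ c * y a ^ (m - c)) = (real m + 1) * x a ^ (2 * m)" for a
      by (simp add: power_add[symmetric] y_def power_mult)
    then show ?thesis by (simp add: psum_def sum_distrib_left)
  qed
  also have "(\<Sum>a<n. \<Sum>b<n. \<Sum>c\<le>m. y b ^ c * y a ^ (m - c)) = (\<Sum>c\<le>m. psum n x c * psum n x (m - c))"
  proof -
    have "(\<Sum>a<n. \<Sum>b<n. \<Sum>c\<le>m. y b ^ c * y a ^ (m - c)) = (\<Sum>c\<le>m. \<Sum>a<n. \<Sum>b<n. y b ^ c * y a ^ (m - c))"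
      by (simp add: sum.swap[of _ "{..m}"])
    moreover have "(\<Sum>a<n. \<Sum>b<n. y b ^ c * y a ^ (m - c)) = psum n x c * psum n x (m - c)" for c
      unfolding psum_def y_def power_mult sum_product by (rule sum.swap)
    ultimately show ?thesis by simp
  qed
  finally show ?thesis by simp
qed simp

text \<open>Integration by parts in x i, applied to x i ^ (2m + 1) times weight and product, summed
  over i. The direct derivative contributes 2m + 1 copies of \<open>psum n x m\<close> and the
  Vandermonde factor removes 2m + 2; the remaining - 1 becomes the term - 1/2 after division by
  2.\<close>

lemma vdm2_loop:
  assumes b: "b > 0"
  shows "loop_eq b (real n) (\<lambda>ls. \<integral>x. vdm2 n x * PL (psum n x) ls \<partial>gaussn b {..<n})"
  unfolding loop_eq_def
proof (intro conjI allI)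
  fix ls
  have "psum n x 0 = real n" for x by (simp add: psum_def)
  then show "(\<integral>x. vdm2 n x * PL (psum n x) (0 # ls) \<partial>gaussn b {..<n}) = real n * (\<integral>x. vdm2 n x * PL (psum n x) ls \<partial>gaussn b {..<n})"
    by (simp add: mult_ac flip: integral_mult_right_zero)
next
  fix m ls
  have pV: "polyfun {..<n} (\<lambda>x. vdm2 n x * PL (psum n x) ls)" for ls
    by (intro polyfun_mult polyfun_vdm2 polyfun_PL polyfun_psum)
  note int = polyfun_integrable[OF pV finite_lessThan b]
  define F where "F i x = x i ^ (2 * m + 1) * (vdm2 n x * PL (psum n x) ls)" for i x
  define F' where "F' i x = (2 * real m + 1) * x i ^ (2 * m) * (vdm2 n x * PL (psum n x) ls)
     + x i ^ (2 * m + 1) * (vdm2 n x * (\<Sum>p\<in>prs n. vdm_log x i p) * PL (psum n x) ls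
     + vdm2 n x * DPL (psum n x) (\<lambda>l. 2 * real l * x i ^ (2 * l - 1)) ls)" for i x
  have pF: "polyfun {..<n} (F i)" if "i < n" for i
    unfolding F_def by (intro polyfun_mult pV polyfun_power polyfun_coord) (use that in auto)
  have D: "((\<lambda>t. F i (x(i := t))) has_real_derivative F' i x) (at (x i))" if "i < n" for i x
  proof -
    have "((\<lambda>t. psum n (x(i := t)) l) has_real_derivative 2 * real l * x i ^ (2 * l - 1)) (at (x i))" for l
    proof -
      have "psum n (x(i := t)) l = t ^ (2 * l) + (\<Sum>j\<in>{..<n} - {i}. x j ^ (2 * l))" for t
        unfolding psum_def using that by (subst sum.remove[of _ i]) (auto intro: sum.cong)
      then show ?thesis by (auto intro!: derivative_eq_intros)
    qed
    from DERIV_PL[of "\<lambda>t. psum n (x(i := t))", OF this]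
    have "((\<lambda>t. PL (psum n (x(i := t))) ls) has_real_derivative 
        DPL (psum n x) (\<lambda>l. 2 * real l * x i ^ (2 * l - 1)) ls) (at (x i))" by simp
    from DERIV_mult[OF DERIV_vdm2[of n x i] this]
    have 1: "((\<lambda>t. vdm2 n (x(i := t)) * PL (psum n (x(i := t))) ls) has_real_derivative
       (vdm2 n x * (\<Sum>p\<in>prs n. vdm_log x i p) * PL (psum n x) ls
     + vdm2 n x * DPL (psum n x) (\<lambda>l. 2 * real l * x i ^ (2 * l - 1)) ls)) (at (x i))"
      by (simp add: algebra_simps)
    have "((\<lambda>t. t ^ (2 * m + 1)) has_real_derivative (2 * real m + 1) * x i ^ (2 * m)) (at (x i))"
      using DERIV_pow[of "2 * m + 1" "x i"] by (simp add: algebra_simps)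
    from DERIV_mult[OF this 1] show ?thesis unfolding F_def F'_def by (simp add: algebra_simps)
  qed
  have pF': "polyfun {..<n} (F' i)" if "i < n" for i
    by (rule gaussn_stein(1)[OF pF _ _ b D]) (use that in auto)
  have st: "2 * b * (\<integral>x. x i * F i x \<partial>gaussn b {..<n}) = (\<integral>x. F' i x \<partial>gaussn b {..<n})" if "i < n" for i
    by (rule gaussn_stein(2)[OF pF _ _ b D]) (use that in auto)
  have sF: "(\<Sum>i<n. x i * F i x) = vdm2 n x * PL (psum n x) (Suc m # ls)" for x
  proof -
    have "(\<Sum>i<n. x i * F i x) = (\<Sum>i<n. x i ^ (2 * Suc m)) * (vdm2 n x * PL (psum n x) ls)"
      unfolding F_def sum_distrib_right by (intro sum.cong) (auto simp: mult_ac)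
    then show ?thesis by (simp add: psum_def mult_ac)
  qed
  have sF': "(\<Sum>i<n. F' i x) = 2 * ((\<Sum>a\<le>m. vdm2 n x * PL (psum n x) (a # (m - a) # ls))
     - vdm2 n x * PL (psum n x) (m # ls) / 2 + (\<Sum>(c, l')\<leftarrow>join_terms m ls. c * (vdm2 n x * PL (psum n x) l')))" for x
  proof -
    have 1: "(\<Sum>i<n. x i ^ (2 * m + 1) * DPL (psum n x) (\<lambda>l. 2 * real l * x i ^ (2 * l - 1)) ls)
       = 2 * (\<Sum>(c, l')\<leftarrow>join_terms m ls. c * PL (psum n x) l')"
    proof -
      have "(\<Sum>i<n. x i ^ (2 * m + 1) * (2 * real l * x i ^ (2 * l - 1))) = 2 * (real l * psum n x (m + l))" for l
      proof (cases l)
        case (Suc l')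
        have "x i ^ (2 * m + 1) * (2 * real l * x i ^ (2 * l - 1)) = 2 * real l * x i ^ (2 * (m + l))" for i
        proof -
          have "2 * m + 1 + (2 * l - 1) = 2 * (m + l)" using Suc by simp
          then have "x i ^ (2 * m + 1) * x i ^ (2 * l - 1) = x i ^ (2 * (m + l))"
            by (simp only: power_add[symmetric])
          then show ?thesis unfolding mult.left_commute[of "x i ^ (2 * m + 1)"] by (rule arg_cong)
        qed
        note * = this
        show ?thesis unfolding psum_def sum_distrib_left by (intro sum.cong refl, subst *) simp
      qed simp
      then show ?thesis unfolding DPL_sum DPL_join_terms[symmetric] by (simp add: DPL_cmult)
    qed
    have "(\<Sum>i<n. F' i x) = (2 * real m + 1) * psum n x m * (vdm2 n x * PL (psum n x) ls)
       + (vdm2 n x * (\<Sum>i<n. x i ^ (2 * m + 1) * (\<Sum>p\<in>prs n. vdm_log x i p))) * PL (psum n x) ls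
       + vdm2 n x * (\<Sum>i<n. x i ^ (2 * m + 1) * DPL (psum n x) (\<lambda>l. 2 * real l * x i ^ (2 * l - 1)) ls)"
      unfolding F'_def psum_def by (simp add: sum.distrib sum_distrib_left sum_distrib_right algebra_simps)
    also have "\<dots> = 2 * (vdm2 n x * PL (psum n x) ls) * (\<Sum>a\<le>m. psum n x a * psum n x (m - a))
       - vdm2 n x * PL (psum n x) (m # ls) + vdm2 n x * (2 * (\<Sum>(c, l')\<leftarrow>join_terms m ls. c * PL (psum n x) l'))"
      unfolding vdm_log_sum 1 by (simp add: algebra_simps)
    also have "vdm2 n x * (2 * (\<Sum>(c, l')\<leftarrow>join_terms m ls. c * PL (psum n x) l')) = 
       2 * (\<Sum>(c, l')\<leftarrow>join_terms m ls. c * (vdm2 n x * PL (psum n x) l'))"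
      by (simp add: sum_list_const_mult[symmetric] case_prod_beta mult_ac)
    also have "2 * (vdm2 n x * PL (psum n x) ls) * (\<Sum>a\<le>m. psum n x a * psum n x (m - a)) = 
       2 * (\<Sum>a\<le>m. vdm2 n x * PL (psum n x) (a # (m - a) # ls))"
      by (simp add: sum_distrib_left mult_ac)
    finally show ?thesis by simp
  qed
  have sl: "integrable (gaussn b {..<n}) (\<lambda>x. \<Sum>(c, l')\<leftarrow>ts. c * (vdm2 n x * PL (psum n x) l')) \<and>
     (\<integral>x. (\<Sum>(c, l')\<leftarrow>ts. c * (vdm2 n x * PL (psum n x) l')) \<partial>gaussn b {..<n})
      = (\<Sum>(c, l')\<leftarrow>ts. c * (\<integral>x. vdm2 n x * PL (psum n x) l' \<partial>gaussn b {..<n}))" for ts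
    by (induction ts) (use int in auto)
  have "2 * b * (\<integral>x. vdm2 n x * PL (psum n x) (Suc m # ls) \<partial>gaussn b {..<n})
     = (\<Sum>i<n. 2 * b * (\<integral>x. x i * F i x \<partial>gaussn b {..<n}))"
  proof -
    have "(\<integral>x. (\<Sum>i<n. x i * F i x) \<partial>gaussn b {..<n}) = (\<Sum>i<n. (\<integral>x. x i * F i x \<partial>gaussn b {..<n}))"
      by (rule Bochner_Integration.integral_sum) (auto intro!: polyfun_integrable b polyfun_mult polyfun_coord pF)
    then show ?thesis unfolding sF by (simp add: sum_distrib_left)
  qed
  also have "\<dots> = (\<integral>x. (\<Sum>i<n. F' i x) \<partial>gaussn b {..<n})"
    by (subst Bochner_Integration.integral_sum) (auto intro!: polyfun_integrable b pF' simp: st)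
  also have "\<dots> = 2 * ((\<Sum>a\<le>m. \<integral>x. vdm2 n x * PL (psum n x) (a # (m - a) # ls) \<partial>gaussn b {..<n})
       - (\<integral>x. vdm2 n x * PL (psum n x) (m # ls) \<partial>gaussn b {..<n}) / 2
       + (\<Sum>(c, l')\<leftarrow>join_terms m ls. c * (\<integral>x. vdm2 n x * PL (psum n x) l' \<partial>gaussn b {..<n})))"
    unfolding sF' conjunct2[OF sl, symmetric]
    using int conjunct1[OF sl] 
    by (simp add: Bochner_Integration.integral_sum Bochner_Integration.integral_add Bochner_Integration.integral_diff
        Bochner_Integration.integrable_sum Bochner_Integration.integrable_diff del: PL_simps)
  finally show "b * (\<integral>x. vdm2 n x * PL (psum n x) (Suc m # ls) \<partial>gaussn b {..<n}) =
       (\<Sum>a\<le>m. \<integral>x. vdm2 n x * PL (psum n x) (a # (m - a) # ls) \<partial>gaussn b {..<n})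
       - (\<integral>x. vdm2 n x * PL (psum n x) (m # ls) \<partial>gaussn b {..<n}) / 2
       + (\<Sum>(c, l')\<leftarrow>join_terms m ls. c * (\<integral>x. vdm2 n x * PL (psum n x) l' \<partial>gaussn b {..<n}))" by simp
qed

section \<open>Loop equations of Gaussian skew-symmetric matrices\<close>

definition skewm :: "(nat \<times> nat \<Rightarrow> real) \<Rightarrow> nat \<Rightarrow> nat \<Rightarrow> real" where
  "skewm x i j = (if i < j then x (i, j) else if j < i then - x (j, i) else 0)"

text \<open>Powers are written entrywise, so that they are visibly polynomial functions of the
  matrix entries and can be differentiated by induction; \<open>mpow_mat\<close> links them to
  matrix powers.\<close>

fun mpow :: "nat \<Rightarrow> (nat \<Rightarrow> nat \<Rightarrow> 'a::comm_ring_1) \<Rightarrow> nat \<Rightarrow> nat \<Rightarrow> nat \<Rightarrow> 'a" where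
  "mpow N A 0 i j = (if i = j then 1 else 0)"
| "mpow N A (Suc n) i j = (\<Sum>l<N. A i l * mpow N A n l j)"

definition mtr :: "nat \<Rightarrow> (nat \<Rightarrow> nat \<Rightarrow> 'a::comm_ring_1) \<Rightarrow> nat \<Rightarrow> 'a" where
  "mtr N A n = (\<Sum>i<N. mpow N A n i i)"

lemma mpow_add: "i < N \<Longrightarrow> (\<Sum>l<N. mpow N A m i l * mpow N A n l j) = mpow N A (m + n) i j"
proof (induction m arbitrary: i)
  case 0
  have "(\<Sum>l<N. mpow N A 0 i l * mpow N A n l j) = (\<Sum>l<N. if l = i then mpow N A n i j else 0)"
    by (intro sum.cong) auto
  then show ?case using 0 by simp
next
  case (Suc m)
  have "(\<Sum>l<N. mpow N A (Suc m) i l * mpow N A n l j) = (\<Sum>l<N. \<Sum>r<N. A i r * (mpow N A m r l * mpow N A n l j))"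
    by (simp add: sum_distrib_right mult.assoc)
  also have "\<dots> = (\<Sum>r<N. \<Sum>l<N. A i r * (mpow N A m r l * mpow N A n l j))" by (rule sum.swap)
  also have "\<dots> = (\<Sum>r<N. A i r * mpow N A (m + n) r j)"
    by (intro sum.cong refl) (simp add: Suc.IH sum_distrib_left[symmetric])
  finally show ?case by simp
qed

lemma mpow_Suc_right: 
  assumes "i < N" "j < N" shows "mpow N A (Suc n) i j = (\<Sum>l<N. mpow N A n i l * A l j)"
proof -
  have "mpow N A 1 l j = A l j" for l
  proof -
    have "mpow N A 1 l j = (\<Sum>r<N. if r = j then A l j else 0)" unfolding One_nat_def mpow.simps by (intro sum.cong) auto
    then show ?thesis using assms by simp
  qed
  then show ?thesis using mpow_add[OF assms(1), of A n 1 j] by simp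
qed

lemma skewm_swap: "skewm x j i = - skewm x i j"
  by (simp add: skewm_def)

lemma mpow_skewm: "i < N \<Longrightarrow> j < N \<Longrightarrow> mpow N (skewm x) n j i = (-1) ^ n * mpow N (skewm x) n i j"
proof (induction n arbitrary: i j)
  case (Suc n)
  have "mpow N (skewm x) (Suc n) j i = (\<Sum>l<N. skewm x j l * mpow N (skewm x) n l i)" by simp
  also have "\<dots> = (\<Sum>l<N. (- skewm x l j) * ((-1) ^ n * mpow N (skewm x) n i l))"
    by (intro sum.cong refl arg_cong2[of _ _ _ _ times] skewm_swap Suc.IH) (use Suc.prems in auto)
  also have "\<dots> = (-1) ^ Suc n * (\<Sum>l<N. mpow N (skewm x) n i l * skewm x l j)"
    by (simp add: sum_distrib_left mult_ac)
  finally show ?case unfolding mpow_Suc_right[OF Suc.prems] .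
qed simp

lemma polyfun_mpow:
  "i < N \<Longrightarrow> j < N \<Longrightarrow> polyfun (prs N) (\<lambda>x. mpow N (skewm x) n i j)"
proof (induction n arbitrary: i)
  case (Suc n)
  have "polyfun (prs N) (\<lambda>x. skewm x i l)" if "l < N" for l
    using that Suc.prems unfolding skewm_def
    by (cases i l rule: linorder_cases) (auto intro!: polyfun_coord polyfun_const polyfun_minus simp: prs_def)
  then show ?case using Suc by (auto intro!: polyfun_sum polyfun_mult)
qed (auto intro: polyfun_const)

text \<open>Product rule for A^n in the direction E_ij - E_ji; s counts the factors to the left of
  the differentiated one.\<close>

definition mpow_deriv where
  "mpow_deriv N A i j n a b = (\<Sum>s<n. mpow N A s a i * mpow N A (n - 1 - s) j b - mpow N A s a j * mpow N A (n - 1 - s) i b)"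

lemma DERIV_mpow:
  assumes ij: "i < j" "j < N" and "a < N"
  shows "((\<lambda>t. mpow N (skewm (x((i, j) := t))) n a b) has_real_derivative mpow_deriv N (skewm x) i j n a b) (at (x (i, j)))"
  using \<open>a < N\<close>
proof (induction n arbitrary: a)
  case 0
  show ?case by (simp add: mpow_deriv_def)
next
  case (Suc n)
  let ?A = "skewm x"
  have dA: "((\<lambda>t. skewm (x((i, j) := t)) a l) has_real_derivative (if a = i \<and> l = j then 1 else 0) - (if a = j \<and> l = i then 1 else 0)) (at (x (i, j)))" for l
    unfolding skewm_def using ij
    by (cases a l rule: linorder_cases; cases "a = i"; cases "a = j"; cases "l = i"; cases "l = j")
       (auto intro!: derivative_eq_intros)
  have "((\<lambda>t. mpow N (skewm (x((i, j) := t))) (Suc n) a b) has_real_derivative 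
     (\<Sum>l<N. ((if a = i \<and> l = j then 1 else 0) - (if a = j \<and> l = i then 1 else 0)) * mpow N ?A n l b
         + mpow_deriv N ?A i j n l b * ?A a l)) (at (x (i, j)))"
    unfolding mpow.simps
    by (rule DERIV_sum, rule DERIV_cong, rule DERIV_mult[OF dA Suc.IH]) auto
  also have "(\<Sum>l<N. ((if a = i \<and> l = j then 1 else 0) - (if a = j \<and> l = i then 1 else 0)) * mpow N ?A n l b
         + mpow_deriv N ?A i j n l b * ?A a l) = mpow_deriv N ?A i j (Suc n) a b"
  proof -
    have "(\<Sum>l<N. ((if a = i \<and> l = j then 1 else 0) - (if a = j \<and> l = i then 1 else 0)) * mpow N ?A n l b)
      = (\<Sum>l<N. if l = j then (if a = i then mpow N ?A n j b else 0) else 0) - (\<Sum>l<N. if l = i then (if a = j then mpow N ?A n i b else 0) else 0)"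
      unfolding sum_subtractf[symmetric] by (intro sum.cong) auto
    also have "\<dots> = mpow N ?A 0 a i * mpow N ?A n j b - mpow N ?A 0 a j * mpow N ?A n i b"
      using ij by auto
    finally have 1: "(\<Sum>l<N. ((if a = i \<and> l = j then 1 else 0) - (if a = j \<and> l = i then 1 else 0)) * mpow N ?A n l b)
       = mpow N ?A 0 a i * mpow N ?A n j b - mpow N ?A 0 a j * mpow N ?A n i b" .
    have "(\<Sum>l<N. mpow_deriv N ?A i j n l b * ?A a l) = 
      (\<Sum>s<n. \<Sum>l<N. (mpow N ?A s l i * mpow N ?A (n - 1 - s) j b - mpow N ?A s l j * mpow N ?A (n - 1 - s) i b) * ?A a l)"
      unfolding mpow_deriv_def by (simp add: sum_distrib_right) (rule sum.swap)
    also have "\<dots> = (\<Sum>s<n. mpow N ?A (Suc s) a i * mpow N ?A (n - 1 - s) j b - mpow N ?A (Suc s) a j * mpow N ?A (n - 1 - s) i b)"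
      by (intro sum.cong refl, simp only: mpow.simps sum_distrib_right sum_subtractf[symmetric])
         (intro sum.cong refl, simp add: algebra_simps)
    finally have 2: "(\<Sum>l<N. mpow_deriv N ?A i j n l b * ?A a l) = \<dots>" .
    show ?thesis unfolding sum.distrib 1 2
      by (simp add: mpow_deriv_def sum.lessThan_Suc_shift del: mpow.simps sum.lessThan_Suc)
  qed
  finally show ?case .
qed

text \<open>Half the trace of (iA)^(2m): the eigenvalues of iA come in pairs of opposite sign, and
  each pair is to count once.\<close>

definition mpsum :: "nat \<Rightarrow> (nat \<times> nat \<Rightarrow> real) \<Rightarrow> nat \<Rightarrow> real" where
  "mpsum N x m = (-1) ^ m * mtr N (skewm x) (2 * m) / 2"

lemma mtr_even: "mtr N (skewm x) (2 * m) = 2 * (-1) ^ m * mpsum N x m"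
  by (simp add: mpsum_def)

lemma mtr_odd: assumes "odd n" shows "mtr N (skewm x) n = 0"
  unfolding mtr_def
proof (rule sum.neutral, safe)
  fix i assume "i < N"
  from mpow_skewm[OF this this, of x n] show "mpow N (skewm x) n i i = 0" using assms by simp
qed

lemma polyfun_mpsum: "polyfun (prs N) (\<lambda>x. mpsum N x m)"
proof -
  have "mpsum N = (\<lambda>x m. ((-1) ^ m / 2) * (\<Sum>i<N. mpow N (skewm x) (2 * m) i i))"
    by (simp add: mpsum_def mtr_def fun_eq_iff)
  then show ?thesis by (simp only:) (intro polyfun_cmult polyfun_sum polyfun_mpow, auto)
qed

text \<open>Cyclicity of the trace makes all 2l positions of the differentiated factor equal, and
  the antisymmetry of odd powers merges the two terms of the direction E_ij - E_ji.\<close>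

lemma DERIV_mpsum:
  assumes ij: "i < j" "j < N"
  shows "((\<lambda>t. mpsum N (x((i, j) := t)) l) has_real_derivative
     (-1) ^ l * (2 * real l * mpow N (skewm x) (2 * l - 1) j i)) (at (x (i, j)))"
proof -
  let ?P = "mpow N (skewm x)"
  have "((\<lambda>t. mpsum N (x((i, j) := t)) l) has_real_derivative
     (-1) ^ l * (\<Sum>a<N. mpow_deriv N (skewm x) i j (2 * l) a a) / 2) (at (x (i, j)))"
    unfolding mpsum_def mtr_def
    by (intro DERIV_cdivide DERIV_cmult DERIV_sum DERIV_mpow ij) auto
  moreover have "(\<Sum>a<N. mpow_deriv N (skewm x) i j (2 * l) a a) = 2 * (2 * real l * ?P (2 * l - 1) j i)"
  proof -
    have *: "(\<Sum>a<N. ?P s a u * ?P (2 * l - 1 - s) v a) = ?P (2 * l - 1) v u" if "s < 2 * l" "v < N" for s u v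
    proof -
      have "(\<Sum>a<N. ?P s a u * ?P (2 * l - 1 - s) v a) = (\<Sum>a<N. ?P (2 * l - 1 - s) v a * ?P s a u)"
        by (simp add: mult.commute)
      also have "\<dots> = ?P (2 * l - 1 - s + s) v u" by (rule mpow_add[OF that(2)])
      finally show ?thesis using that by simp
    qed
    have "(\<Sum>a<N. mpow_deriv N (skewm x) i j (2 * l) a a)
      = (\<Sum>s<2*l. (\<Sum>a<N. ?P s a i * ?P (2 * l - 1 - s) j a) - (\<Sum>a<N. ?P s a j * ?P (2 * l - 1 - s) i a))"
      unfolding mpow_deriv_def by (subst sum.swap) (simp add: sum_subtractf)
    also have "\<dots> = (\<Sum>s<2*l. ?P (2 * l - 1) j i - ?P (2 * l - 1) i j)"
      using ij by (intro sum.cong refl arg_cong2[of _ _ _ _ "(-)"] *) auto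
    also have "?P (2 * l - 1) i j = (-1) ^ (2 * l - 1) * ?P (2 * l - 1) j i"
      by (rule mpow_skewm) (use ij in auto)
    finally show ?thesis by (cases l) simp_all
  qed
  ultimately show ?thesis by (simp add: mult_ac)
qed

text \<open>Integration by parts in the entry (i, j), applied to the entry (j, i) of A^(2m+1); the
  sum over i < j is completed to all pairs by symmetry. Of the products tr A^s * tr A^(2m-s) only
  those with even s survive, which is the splitting term. The other sum, of (-1)^s * tr A^(2m) over
  s, collapses to one trace and yields the same - 1/2 as the Vandermonde weight.\<close>

lemma mat_loop:
  assumes b: "b > 0"
  shows "loop_eq b (real N / 2) (\<lambda>ls. \<integral>x. PL (mpsum N x) ls \<partial>gaussn b (prs N))"
  unfolding loop_eq_def
proof (intro conjI allI)
  fix ls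
  have p0: "mpsum N x 0 = real N / 2" for x by (simp add: mpsum_def mtr_def)
  show "(\<integral>x. PL (mpsum N x) (0 # ls) \<partial>gaussn b (prs N)) = real N / 2 * (\<integral>x. PL (mpsum N x) ls \<partial>gaussn b (prs N))"
    unfolding PL_simps p0 by (rule integral_mult_right_zero)
next
  fix m ls
  let ?P = "\<lambda>x. mpow N (skewm x)"
  have pP: "polyfun (prs N) (\<lambda>x. PL (mpsum N x) ls)" for ls
    by (intro polyfun_PL polyfun_mpsum)
  note int = polyfun_integrable[OF pP finite_prs b]
  define F where "F p x = ?P x (2 * m + 1) (snd p) (fst p) * PL (mpsum N x) ls" for p x
  define F' where "F' p x = (case p of (i, j) \<Rightarrow> mpow_deriv N (skewm x) i j (2 * m + 1) j i * PL (mpsum N x) ls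
    + ?P x (2 * m + 1) j i * DPL (mpsum N x) (\<lambda>l. (-1) ^ l * (2 * real l * ?P x (2 * l - 1) j i)) ls)" for p x
  have pF: "polyfun (prs N) (F p)" if "p \<in> prs N" for p
    unfolding F_def by (intro polyfun_mult pP polyfun_mpow) (use that in \<open>auto simp: prs_def\<close>)
  have D: "((\<lambda>t. F p (x(p := t))) has_real_derivative F' p x) (at (x p))" if "p \<in> prs N" for p x
  proof -
    obtain i j where p: "p = (i, j)" "i < j" "j < N" using \<open>p \<in> prs N\<close> by (cases p) (auto simp: prs_def)
    from DERIV_PL[of "\<lambda>t. mpsum N (x(p := t))", OF DERIV_mpsum[OF p(2,3), folded p(1)]]
    have 1: "((\<lambda>t. PL (mpsum N (x(p := t))) ls) has_real_derivative
        DPL (mpsum N x) (\<lambda>l. (-1) ^ l * (2 * real l * ?P x (2 * l - 1) j i)) ls) (at (x p))" by simp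
    have "((\<lambda>t. ?P (x(p := t)) (2 * m + 1) j i) has_real_derivative mpow_deriv N (skewm x) i j (2 * m + 1) j i) (at (x p))"
      unfolding p(1) by (rule DERIV_mpow[OF p(2,3) p(3)])
    from DERIV_mult[OF this 1] show ?thesis
      unfolding F_def F'_def p(1) by (simp add: algebra_simps del: mpow.simps)
  qed
  have pF': "polyfun (prs N) (F' p)" if "p \<in> prs N" for p
    by (rule gaussn_stein(1)[OF pF _ _ b D]) (use that in auto)
  have st: "2 * b * (\<integral>x. x p * F p x \<partial>gaussn b (prs N)) = (\<integral>x. F' p x \<partial>gaussn b (prs N))" if "p \<in> prs N" for p
    by (rule gaussn_stein(2)[OF pF _ _ b D]) (use that in auto)
  have anti: "?P x n j i = (-1) ^ n * ?P x n i j" if "i < N" "j < N" for x n i j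
    using that by (rule mpow_skewm)
  have odd0: "?P x n i i = 0" if "i < N" "odd n" for x n i
    using anti[OF that(1) that(1), of x n] that(2) by simp
  have sF: "(\<Sum>p\<in>prs N. x p * F p x) = (-1) ^ (m + 1) * PL (mpsum N x) (Suc m # ls)" for x
  proof -
    have "mtr N (skewm x) (2 * Suc m) = (\<Sum>i<N. \<Sum>j<N. skewm x i j * ?P x (2 * m + 1) j i)"
      by (simp add: mtr_def)
    also have "\<dots> = 2 * (\<Sum>(i, j)\<in>prs N. skewm x i j * ?P x (2 * m + 1) j i) + (\<Sum>i<N. skewm x i i * ?P x (2 * m + 1) i i)"
    proof (rule sum_prs)
      fix i j assume ij: "i < N" "j < N"
      have "?P x (2 * m + 1) j i = - ?P x (2 * m + 1) i j"
        using anti[OF ij, of x "2 * m + 1"] by (simp del: mpow.simps)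
      then show "skewm x i j * ?P x (2 * m + 1) j i = skewm x j i * ?P x (2 * m + 1) i j"
        using skewm_swap[of x j i] by (simp del: mpow.simps)
    qed
    also have "\<dots> = 2 * (\<Sum>p\<in>prs N. x p * ?P x (2 * m + 1) (snd p) (fst p))"
      by (auto simp: skewm_def prs_def intro!: sum.cong simp del: mpow.simps)
    finally have "(\<Sum>p\<in>prs N. x p * ?P x (2 * m + 1) (snd p) (fst p)) = (-1) ^ (m + 1) * mpsum N x (Suc m)"
      unfolding mtr_even by simp
    then show ?thesis unfolding F_def by (simp add: sum_distrib_right[symmetric] mult.assoc[symmetric] del: mpow.simps)
  qed
  have sF': "(\<Sum>p\<in>prs N. F' p x) = 2 * (-1) ^ (m + 1) * ((\<Sum>a\<le>m. PL (mpsum N x) (a # (m - a) # ls))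
     - PL (mpsum N x) (m # ls) / 2 + (\<Sum>(c, l')\<leftarrow>join_terms m ls. c * PL (mpsum N x) l'))" for x
  proof -
    let ?A = "skewm x" and ?p = "mpsum N x"
    define g where "g i j = mpow_deriv N ?A i j (2 * m + 1) j i" for i j
    have g: "g i j = (\<Sum>s\<le>2*m. ?P x s j i * ?P x (2 * m - s) j i) - (\<Sum>s\<le>2*m. ?P x s j j * ?P x (2 * m - s) i i)" for i j
      by (simp add: g_def mpow_deriv_def sum_subtractf lessThan_Suc_atMost)
    have gs: "g i j = g j i" if "i < N" "j < N" for i j
    proof -
      have "(\<Sum>s\<le>2*m. ?P x s j i * ?P x (2 * m - s) j i) = (\<Sum>s\<le>2*m. ?P x s i j * ?P x (2 * m - s) i j)"
      proof (intro sum.cong refl)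
        fix s assume "s \<in> {..2*m}"
        then have 1: "(-1::real) ^ s * (-1) ^ (2 * m - s) = 1" by (simp add: power_add[symmetric])
        have 2: "((-1) ^ s * a) * ((-1) ^ (2 * m - s) * b) = ((-1) ^ s * (-1) ^ (2 * m - s)) * (a * b)" for a b :: real
          by (simp only: mult_ac)
        show "?P x s j i * ?P x (2 * m - s) j i = ?P x s i j * ?P x (2 * m - s) i j"
          unfolding anti[OF that, of x s] anti[OF that, of x "2 * m - s"] 2 1 by simp
      qed
      moreover have "(\<Sum>s\<le>2*m. ?P x s j j * ?P x (2 * m - s) i i) = (\<Sum>s\<le>2*m. ?P x s i i * ?P x (2 * m - s) j j)"
        by (rule sum.reindex_bij_witness[of _ "\<lambda>c. 2 * m - c" "\<lambda>c. 2 * m - c"]) auto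
      ultimately show ?thesis unfolding g by simp
    qed
    have g0: "g i i = 0" for i by (simp add: g_def mpow_deriv_def)
    have sg: "(\<Sum>i<N. \<Sum>j<N. g i j) = mtr N ?A (2 * m) - (\<Sum>s\<le>2*m. mtr N ?A s * mtr N ?A (2 * m - s))"
    proof -
      have "(\<Sum>i<N. \<Sum>j<N. \<Sum>s\<le>2*m. ?P x s j i * ?P x (2 * m - s) j i) = (\<Sum>s\<le>2*m. (-1) ^ s * mtr N ?A (2 * m))"
      proof -
        have "(\<Sum>i<N. \<Sum>j<N. \<Sum>s\<le>2*m. ?P x s j i * ?P x (2 * m - s) j i) = (\<Sum>s\<le>2*m. \<Sum>i<N. \<Sum>j<N. ?P x s j i * ?P x (2 * m - s) j i)"
          by (simp add: sum.swap[of _ "{..2*m}"])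
        also have "\<dots> = (\<Sum>s\<le>2*m. \<Sum>i<N. (-1) ^ s * ?P x (2 * m) i i)"
        proof (intro sum.cong refl)
          fix s i assume "s \<in> {..2*m}" "i \<in> {..<N}"
          then have "(\<Sum>j<N. ?P x s j i * ?P x (2 * m - s) j i) = (-1) ^ s * (\<Sum>j<N. ?P x s i j * ?P x (2 * m - s) j i)"
            unfolding sum_distrib_left by (intro sum.cong refl) (simp add: anti[of i _ x s])
          also have "\<dots> = (-1) ^ s * ?P x (2 * m) i i"
            using \<open>s \<in> _\<close> \<open>i \<in> _\<close> by (subst mpow_add) auto
          finally show "(\<Sum>j<N. ?P x s j i * ?P x (2 * m - s) j i) = (-1) ^ s * ?P x (2 * m) i i" .
        qed
        finally show ?thesis by (simp add: mtr_def sum_distrib_left)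
      qed
      also have "\<dots> = mtr N ?A (2 * m)"
      proof -
        have "(\<Sum>s\<le>2*m. (-1::real) ^ s) = 1" by (induction m) simp_all
        then show ?thesis by (simp add: sum_distrib_right[symmetric])
      qed
      finally have 1: "(\<Sum>i<N. \<Sum>j<N. \<Sum>s\<le>2*m. ?P x s j i * ?P x (2 * m - s) j i) = mtr N ?A (2 * m)" .
      have "(\<Sum>i<N. \<Sum>j<N. \<Sum>s\<le>2*m. ?P x s j j * ?P x (2 * m - s) i i) = (\<Sum>s\<le>2*m. \<Sum>i<N. \<Sum>j<N. ?P x s j j * ?P x (2 * m - s) i i)"
        by (simp add: sum.swap[of _ "{..2*m}"])
      also have "\<dots> = (\<Sum>s\<le>2*m. mtr N ?A s * mtr N ?A (2 * m - s))"
        unfolding mtr_def sum_product by (intro sum.cong refl sum.swap)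
      finally have 2: "(\<Sum>i<N. \<Sum>j<N. \<Sum>s\<le>2*m. ?P x s j j * ?P x (2 * m - s) i i) = \<dots>" .
      show ?thesis unfolding g sum_subtractf 1 2 ..
    qed
    have "(\<Sum>s\<le>2*m. mtr N ?A s * mtr N ?A (2 * m - s)) = (\<Sum>a\<le>m. mtr N ?A (2 * a) * mtr N ?A (2 * m - 2 * a))"
    proof -
      have inj: "inj_on (\<lambda>a. 2 * a) {..m}" by (auto intro: inj_onI)
      have "(\<Sum>s\<le>2*m. mtr N ?A s * mtr N ?A (2 * m - s)) = (\<Sum>s\<in>(\<lambda>a. 2 * a) ` {..m}. mtr N ?A s * mtr N ?A (2 * m - s))"
      proof (rule sum.mono_neutral_right)
        show "\<forall>s\<in>{..2*m} - (\<lambda>a. 2 * a) ` {..m}. mtr N ?A s * mtr N ?A (2 * m - s) = 0"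
        proof
          fix s assume s: "s \<in> {..2*m} - (\<lambda>a. 2 * a) ` {..m}"
          have "odd s"
          proof
            assume "even s" then obtain a where "s = 2 * a" by (elim evenE)
            then show False using s by auto
          qed
          then show "mtr N ?A s * mtr N ?A (2 * m - s) = 0" by (simp add: mtr_odd)
        qed
      qed auto
      also have "\<dots> = (\<Sum>a\<le>m. mtr N ?A (2 * a) * mtr N ?A (2 * m - 2 * a))"
        by (simp add: sum.reindex[OF inj])
      finally show ?thesis .
    qed
    also have "\<dots> = (\<Sum>a\<le>m. 4 * (-1) ^ m * (?p a * ?p (m - a)))"
    proof (intro sum.cong refl)
      fix a assume "a \<in> {..m}"
      then have "(-1::real) ^ a * (-1) ^ (m - a) = (-1) ^ m" by (simp add: power_add[symmetric])
      moreover have "2 * m - 2 * a = 2 * (m - a)" by simp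
      ultimately show "mtr N ?A (2 * a) * mtr N ?A (2 * m - 2 * a) = 4 * (-1) ^ m * (?p a * ?p (m - a))"
        by (simp only: mtr_even) (simp add: algebra_simps)
    qed
    finally have sgg: "(\<Sum>i<N. \<Sum>j<N. g i j) = 2 * (-1) ^ m * ?p m - 4 * (-1) ^ m * (\<Sum>a\<le>m. ?p a * ?p (m - a))"
      unfolding sg mtr_even by (simp add: sum_distrib_left mult_ac)
    have sg2: "(\<Sum>(i, j)\<in>prs N. g i j) = (-1) ^ m * ?p m - 2 * (-1) ^ m * (\<Sum>a\<le>m. ?p a * ?p (m - a))"
      using sum_prs[of N g, OF gs] sgg by (simp add: g0)
    have sd: "(\<Sum>(i, j)\<in>prs N. ?P x (2 * m + 1) j i * ((-1) ^ l * (2 * real l * ?P x (2 * l - 1) j i))) = 2 * (-1) ^ (m + 1) * (real l * ?p (m + l))" for l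
    proof (cases l)
      case (Suc l')
      define h where "h i j = ?P x (2 * m + 1) j i * ?P x (2 * l - 1) j i" for i j
      have hs: "h i j = h j i" if "i < N" "j < N" for i j
        unfolding h_def using anti[OF that, of x "2 * m + 1"] anti[OF that, of x "2 * l - 1"] Suc by (simp del: mpow.simps)
      have h0: "h i i = 0" if "i < N" for i unfolding h_def using odd0[OF that, of "2 * m + 1" x] by simp
      have "(\<Sum>i<N. \<Sum>j<N. h i j) = (\<Sum>i<N. - ?P x (2 * (m + l)) i i)"
      proof (intro sum.cong refl)
        fix i assume i: "i \<in> {..<N}"
        then have "(\<Sum>j<N. h i j) = - (\<Sum>j<N. ?P x (2 * m + 1) i j * ?P x (2 * l - 1) j i)"
          unfolding h_def sum_negf[symmetric]
        proof (intro sum.cong refl)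
          fix j assume "j \<in> {..<N}"
          with i have "?P x (2 * m + 1) j i = - ?P x (2 * m + 1) i j"
            using anti[of i j x "2 * m + 1"] by (simp del: mpow.simps)
          then show "?P x (2 * m + 1) j i * ?P x (2 * l - 1) j i = - (?P x (2 * m + 1) i j * ?P x (2 * l - 1) j i)"
            by (simp del: mpow.simps)
        qed
        also have "(\<Sum>j<N. ?P x (2 * m + 1) i j * ?P x (2 * l - 1) j i) = ?P x (2 * (m + l)) i i"
          using i by (subst mpow_add) (auto simp: Suc simp del: mpow.simps)
        finally show "(\<Sum>j<N. h i j) = - ?P x (2 * (m + l)) i i" .
      qed
      also have "\<dots> = - mtr N ?A (2 * (m + l))" by (simp add: mtr_def sum_negf)
      finally have "2 * (\<Sum>(i, j)\<in>prs N. h i j) = - mtr N ?A (2 * (m + l))"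
        using sum_prs[of N h, OF hs] by (simp add: h0)
      then have "(\<Sum>(i, j)\<in>prs N. h i j) = (-1) ^ (m + 1) * (-1) ^ l * ?p (m + l)"
        unfolding mtr_even by (simp add: power_add)
      moreover have "(\<Sum>(i, j)\<in>prs N. ?P x (2 * m + 1) j i * ((-1) ^ l * (2 * real l * ?P x (2 * l - 1) j i))) =
         (-1) ^ l * 2 * real l * (\<Sum>(i, j)\<in>prs N. h i j)"
        unfolding h_def sum_distrib_left by (intro sum.cong) auto
      moreover have "(-1::real) ^ l * (-1) ^ l = 1" by (simp add: power_add[symmetric])
      ultimately show ?thesis by (simp add: mult_ac)
    qed (simp add: case_prod_beta)
    have "(\<Sum>p\<in>prs N. F' p x) = (\<Sum>(i, j)\<in>prs N. g i j) * PL ?p ls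
       + (\<Sum>p\<in>prs N. ?P x (2 * m + 1) (snd p) (fst p) * DPL ?p (\<lambda>l. (-1) ^ l * (2 * real l * ?P x (2 * l - 1) (snd p) (fst p))) ls)"
      unfolding F'_def g_def by (simp add: case_prod_beta sum.distrib sum_distrib_right del: mpow.simps)
    also have "(\<Sum>p\<in>prs N. ?P x (2 * m + 1) (snd p) (fst p) * DPL ?p (\<lambda>l. (-1) ^ l * (2 * real l * ?P x (2 * l - 1) (snd p) (fst p))) ls)
       = 2 * (-1) ^ (m + 1) * (\<Sum>(c, l')\<leftarrow>join_terms m ls. c * PL ?p l')"
      unfolding DPL_sum sd[unfolded case_prod_beta] DPL_cmult DPL_join_terms ..
    moreover have "(\<Sum>a\<le>m. PL ?p (a # (m - a) # ls)) = (\<Sum>a\<le>m. ?p a * ?p (m - a)) * PL ?p ls"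
      by (simp add: sum_distrib_right mult.assoc)
    ultimately show ?thesis unfolding sg2 by (simp add: algebra_simps)
  qed
  have sl: "integrable (gaussn b (prs N)) (\<lambda>x. \<Sum>(c, l')\<leftarrow>ts. c * PL (mpsum N x) l') \<and>
     (\<integral>x. (\<Sum>(c, l')\<leftarrow>ts. c * PL (mpsum N x) l') \<partial>gaussn b (prs N))
      = (\<Sum>(c, l')\<leftarrow>ts. c * (\<integral>x. PL (mpsum N x) l' \<partial>gaussn b (prs N)))" for ts
    by (induction ts) (use int in auto)
  have "2 * b * ((-1) ^ (m + 1) * (\<integral>x. PL (mpsum N x) (Suc m # ls) \<partial>gaussn b (prs N)))
     = (\<Sum>p\<in>prs N. 2 * b * (\<integral>x. x p * F p x \<partial>gaussn b (prs N)))"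
  proof -
    have "(\<integral>x. (\<Sum>p\<in>prs N. x p * F p x) \<partial>gaussn b (prs N)) = (\<Sum>p\<in>prs N. (\<integral>x. x p * F p x \<partial>gaussn b (prs N)))"
      by (rule Bochner_Integration.integral_sum) (auto intro!: polyfun_integrable b polyfun_mult polyfun_coord pF)
    then show ?thesis unfolding sF by (simp add: sum_distrib_left)
  qed
  also have "\<dots> = (\<integral>x. (\<Sum>p\<in>prs N. F' p x) \<partial>gaussn b (prs N))"
    by (subst Bochner_Integration.integral_sum) (auto intro!: polyfun_integrable b pF' simp: st)
  also have "\<dots> = 2 * (-1) ^ (m + 1) * ((\<Sum>a\<le>m. \<integral>x. PL (mpsum N x) (a # (m - a) # ls) \<partial>gaussn b (prs N))
       - (\<integral>x. PL (mpsum N x) (m # ls) \<partial>gaussn b (prs N)) / 2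
       + (\<Sum>(c, l')\<leftarrow>join_terms m ls. c * (\<integral>x. PL (mpsum N x) l' \<partial>gaussn b (prs N))))"
    unfolding sF' conjunct2[OF sl, symmetric]
    using int conjunct1[OF sl] 
    by (simp add: Bochner_Integration.integral_sum Bochner_Integration.integral_add Bochner_Integration.integral_diff
        Bochner_Integration.integrable_sum Bochner_Integration.integrable_diff del: PL_simps)
  finally have *: "2 * (-1) ^ (m + 1) * (b * (\<integral>x. PL (mpsum N x) (Suc m # ls) \<partial>gaussn b (prs N))) =
      2 * (-1) ^ (m + 1) * ((\<Sum>a\<le>m. \<integral>x. PL (mpsum N x) (a # (m - a) # ls) \<partial>gaussn b (prs N))
       - (\<integral>x. PL (mpsum N x) (m # ls) \<partial>gaussn b (prs N)) / 2
       + (\<Sum>(c, l')\<leftarrow>join_terms m ls. c * (\<integral>x. PL (mpsum N x) l' \<partial>gaussn b (prs N))))"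
    by (simp only: mult.assoc mult.left_commute[of b])
  show "b * (\<integral>x. PL (mpsum N x) (Suc m # ls) \<partial>gaussn b (prs N)) =
       (\<Sum>a\<le>m. \<integral>x. PL (mpsum N x) (a # (m - a) # ls) \<partial>gaussn b (prs N))
       - (\<integral>x. PL (mpsum N x) (m # ls) \<partial>gaussn b (prs N)) / 2
       + (\<Sum>(c, l')\<leftarrow>join_terms m ls. c * (\<integral>x. PL (mpsum N x) l' \<partial>gaussn b (prs N)))"
    by (rule mult_left_cancel[THEN iffD1, OF _ *]) simp
qed

section \<open>Determinants and spectra\<close>

lemma det_leibniz:
  "det (mat n n (\<lambda>(i, j). A i j)) = (\<Sum>p | p permutes {..<n}. of_int (sign p) * (\<Prod>i<n. A i (p i)))"
proof -
  have "det (mat n n (\<lambda>(i, j). A i j)) = (\<Sum>p\<in>{p. p permutes {0..<n}}. of_int (sign p) * (\<Prod>i = 0..<n. mat n n (\<lambda>(i, j). A i j) $$ (i, p i)))"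
    by (rule det_def') simp
  also have "\<dots> = (\<Sum>p | p permutes {..<n}. of_int (sign p) * (\<Prod>i<n. A i (p i)))"
    unfolding lessThan_atLeast0[symmetric]
  proof (intro sum.cong refl arg_cong2[of _ _ _ _ times] prod.cong)
    fix p i assume "p \<in> {p. p permutes {..<n}}" "i \<in> {..<n}"
    then have "p i < n" using permutes_in_image[of p "{..<n}" i] by simp
    then show "mat n n (\<lambda>(i, j). A i j) $$ (i, p i) = A i (p i)" using \<open>i \<in> {..<n}\<close> by simp
  qed
  finally show ?thesis .
qed

text \<open>A rectangular form: p rows are integrated and the other q - p rows are constant. After
  expanding both determinants, replacing \<pi> by its composition with \<sigma> shows that each of
  the p! permutations \<sigma> contributes the same determinant; the constant rows are not moved by
  \<sigma>.\<close>

lemma andreief: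
  fixes f g :: "nat \<Rightarrow> 'a \<Rightarrow> real" and c :: "nat \<Rightarrow> nat \<Rightarrow> real"
  assumes M: "sigma_finite_measure M" and pq: "p \<le> q"
    and int: "\<And>a j. a < p \<Longrightarrow> j < q \<Longrightarrow> integrable M (\<lambda>x. f a x * g j x)"
  defines "F \<equiv> \<lambda>x. det (mat p p (\<lambda>(i, a). f a (x i))) * det (mat q q (\<lambda>(i, j). if i < p then g j (x i) else c i j))"
  shows "integrable (Pi\<^sub>M {..<p} (\<lambda>_. M)) F"
    and "integral\<^sup>L (Pi\<^sub>M {..<p} (\<lambda>_. M)) F = fact p * det (mat q q (\<lambda>(i, j). if i < p then (\<integral>x. f i x * g j x \<partial>M) else c i j))"
proof -
  interpret product_sigma_finite "\<lambda>_::nat. M" using M by (intro product_sigma_finite.intro)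
  define C where "C \<pi> = (\<Prod>i=p..<q. c i (\<pi> i))" for \<pi> :: "nat \<Rightarrow> nat"
  define G where "G \<sigma> \<pi> x = (\<Prod>i<p. f (\<sigma> i) (x i) * g (\<pi> i) (x i))" for \<sigma> \<pi> :: "nat \<Rightarrow> nat" and x :: "nat \<Rightarrow> 'a"
  define m where "m a j = (\<integral>x. f a x * g j x \<partial>M)" for a j
  have split: "{..<q} = {..<p} \<union> {p..<q}" using pq by auto
  have prodsplit: "(\<Prod>i<q. if i < p then h i else c i (\<pi> i)) = (\<Prod>i<p. h i) * C \<pi>" for h :: "nat \<Rightarrow> real" and \<pi>
    unfolding split C_def by (subst prod.union_disjoint) (auto intro!: arg_cong2[of _ _ _ _ times] prod.cong)
  have F: "F = (\<lambda>x. \<Sum>\<sigma> | \<sigma> permutes {..<p}. \<Sum>\<pi> | \<pi> permutes {..<q}. (of_int (sign \<sigma>) * of_int (sign \<pi>) * C \<pi>) * G \<sigma> \<pi> x)"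
    unfolding F_def det_leibniz sum_product
    by (intro ext sum.cong refl) (simp only: prodsplit G_def prod.distrib, simp only: mult_ac)
  have perm: "\<sigma> i < p" if "\<sigma> permutes {..<p}" "i < p" for \<sigma> i
    using permutes_in_image[OF that(1), of i] that by simp
  have permq: "\<pi> i < q" if "\<pi> permutes {..<q}" "i < p" for \<pi> i
    using permutes_in_image[OF that(1), of i] that pq by simp
  have iG: "integrable (Pi\<^sub>M {..<p} (\<lambda>_. M)) (G \<sigma> \<pi>)" 
    if "\<sigma> permutes {..<p}" "\<pi> permutes {..<q}" for \<sigma> \<pi>
    unfolding G_def[abs_def]
  proof (rule product_integrable_prod[of "{..<p}" "\<lambda>i y. f (\<sigma> i) y * g (\<pi> i) y"])
    fix i assume "i \<in> {..<p}"
    then show "integrable M (\<lambda>x. f (\<sigma> i) x * g (\<pi> i) x)" by (intro int[OF perm[OF that(1)] permq[OF that(2)]]) auto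
  qed simp
  have G: "integral\<^sup>L (Pi\<^sub>M {..<p} (\<lambda>_. M)) (G \<sigma> \<pi>) = (\<Prod>i<p. m (\<sigma> i) (\<pi> i))"
     if "\<sigma> permutes {..<p}" "\<pi> permutes {..<q}" for \<sigma> \<pi>
    unfolding G_def[abs_def] m_def
  proof (rule product_integral_prod[of "{..<p}" "\<lambda>i y. f (\<sigma> i) y * g (\<pi> i) y"])
    fix i assume "i \<in> {..<p}"
    then show "integrable M (\<lambda>x. f (\<sigma> i) x * g (\<pi> i) x)" by (intro int[OF perm[OF that(1)] permq[OF that(2)]]) auto
  qed simp
  show "integrable (Pi\<^sub>M {..<p} (\<lambda>_. M)) F" unfolding F
    by (intro Bochner_Integration.integrable_sum integrable_mult_right iG) auto
  have "integral\<^sup>L (Pi\<^sub>M {..<p} (\<lambda>_. M)) F = (\<Sum>\<sigma> | \<sigma> permutes {..<p}. \<Sum>\<pi> | \<pi> permutes {..<q}. (of_int (sign \<sigma>) * of_int (sign \<pi>) * C \<pi>) * (\<Prod>i<p. m (\<sigma> i) (\<pi> i)))"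
    unfolding F
  proof (subst Bochner_Integration.integral_sum)
    fix \<sigma> assume "\<sigma> \<in> {\<sigma>. \<sigma> permutes {..<p}}"
    then show "integrable (Pi\<^sub>M {..<p} (\<lambda>_. M)) (\<lambda>x. \<Sum>\<pi> | \<pi> permutes {..<q}. (of_int (sign \<sigma>) * of_int (sign \<pi>) * C \<pi>) * G \<sigma> \<pi> x)"
      by (intro Bochner_Integration.integrable_sum integrable_mult_right iG) auto
  next
    show "(\<Sum>\<sigma> | \<sigma> permutes {..<p}. \<integral>x. (\<Sum>\<pi> | \<pi> permutes {..<q}. (of_int (sign \<sigma>) * of_int (sign \<pi>) * C \<pi>) * G \<sigma> \<pi> x) \<partial>Pi\<^sub>M {..<p} (\<lambda>_. M))
      = (\<Sum>\<sigma> | \<sigma> permutes {..<p}. \<Sum>\<pi> | \<pi> permutes {..<q}. (of_int (sign \<sigma>) * of_int (sign \<pi>) * C \<pi>) * (\<Prod>i<p. m (\<sigma> i) (\<pi> i)))"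
    proof (intro sum.cong refl)
      fix \<sigma> assume s: "\<sigma> \<in> {\<sigma>. \<sigma> permutes {..<p}}"
      have "(\<integral>x. (\<Sum>\<pi> | \<pi> permutes {..<q}. (of_int (sign \<sigma>) * of_int (sign \<pi>) * C \<pi>) * G \<sigma> \<pi> x) \<partial>Pi\<^sub>M {..<p} (\<lambda>_. M))
        = (\<Sum>\<pi> | \<pi> permutes {..<q}. \<integral>x. (of_int (sign \<sigma>) * of_int (sign \<pi>) * C \<pi>) * G \<sigma> \<pi> x \<partial>Pi\<^sub>M {..<p} (\<lambda>_. M))"
        by (rule Bochner_Integration.integral_sum) (use s in \<open>intro integrable_mult_right iG, auto\<close>)
      then show "(\<integral>x. (\<Sum>\<pi> | \<pi> permutes {..<q}. (of_int (sign \<sigma>) * of_int (sign \<pi>) * C \<pi>) * G \<sigma> \<pi> x) \<partial>Pi\<^sub>M {..<p} (\<lambda>_. M))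
        = (\<Sum>\<pi> | \<pi> permutes {..<q}. (of_int (sign \<sigma>) * of_int (sign \<pi>) * C \<pi>) * (\<Prod>i<p. m (\<sigma> i) (\<pi> i)))"
        using s by (simp add: G)
    qed
  qed
  also have "\<dots> = (\<Sum>\<sigma> | \<sigma> permutes {..<p}. det (mat q q (\<lambda>(i, j). if i < p then m i j else c i j)))"
  proof (intro sum.cong refl)
    fix \<sigma> assume "\<sigma> \<in> {\<sigma>. \<sigma> permutes {..<p}}"
    then have \<sigma>: "\<sigma> permutes {..<p}" by simp
    have \<sigma>q: "\<sigma> permutes {..<q}" by (rule permutes_subset[OF \<sigma>]) (use pq in auto)
    have pm: "permutation \<sigma>" using \<sigma> permutation_permutes by blast
    have ss: "of_int (sign \<sigma>) * of_int (sign \<sigma>) = (1::real)" by (simp add: sign_def)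
    have "(\<Sum>\<pi> | \<pi> permutes {..<q}. (of_int (sign \<sigma>) * of_int (sign \<pi>) * C \<pi>) * (\<Prod>i<p. m (\<sigma> i) (\<pi> i)))
       = (\<Sum>\<pi> | \<pi> permutes {..<q}. (of_int (sign \<sigma>) * of_int (sign (\<pi> \<circ> \<sigma>)) * C (\<pi> \<circ> \<sigma>)) * (\<Prod>i<p. m (\<sigma> i) ((\<pi> \<circ> \<sigma>) i)))"
      by (rule sum.reindex_bij_witness[of _ "\<lambda>\<pi>. \<pi> \<circ> \<sigma>" "\<lambda>\<pi>. \<pi> \<circ> Hilbert_Choice.inv \<sigma>"])
         (auto simp: o_assoc[symmetric] permutes_inv_o[OF \<sigma>q] intro!: permutes_compose \<sigma>q permutes_inv)
    also have "\<dots> = (\<Sum>\<pi> | \<pi> permutes {..<q}. of_int (sign \<pi>) * ((\<Prod>i<p. m i (\<pi> i)) * C \<pi>))"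
    proof (intro sum.cong refl)
      fix \<pi> assume "\<pi> \<in> {\<pi>. \<pi> permutes {..<q}}"
      then have pp: "permutation \<pi>" using permutation_permutes by blast
      have es: "sign (\<pi> \<circ> \<sigma>) = sign \<pi> * sign \<sigma>" by (rule sign_compose[OF pp pm])
      have eC: "C (\<pi> \<circ> \<sigma>) = C \<pi>"
        unfolding C_def by (intro prod.cong refl) (use \<sigma> in \<open>auto simp: permutes_def\<close>)
      have em: "(\<Prod>i<p. m (\<sigma> i) ((\<pi> \<circ> \<sigma>) i)) = (\<Prod>i<p. m i (\<pi> i))"
        using prod.permute[OF \<sigma>, of "\<lambda>i. m i (\<pi> i)"] by (simp add: o_def)
      show "of_int (sign \<sigma>) * of_int (sign (\<pi> \<circ> \<sigma>)) * C (\<pi> \<circ> \<sigma>) * (\<Prod>i<p. m (\<sigma> i) ((\<pi> \<circ> \<sigma>) i)) = of_int (sign \<pi>) * ((\<Prod>i<p. m i (\<pi> i)) * C \<pi>)"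
      proof -
        have "s * (r * s) * u * v = (s * s) * (r * (v * u))" for s r u v :: real
          by (simp only: mult_ac)
        then show ?thesis
          using es eC em ss
          by (simp only: of_int_mult mult_1_left)
      qed
    qed
    finally show "(\<Sum>\<pi> | \<pi> permutes {..<q}. (of_int (sign \<sigma>) * of_int (sign \<pi>) * C \<pi>) * (\<Prod>i<p. m (\<sigma> i) (\<pi> i)))
       = det (mat q q (\<lambda>(i, j). if i < p then m i j else c i j))"
      unfolding det_leibniz by (simp only: prodsplit)
  qed
  finally show "integral\<^sup>L (Pi\<^sub>M {..<p} (\<lambda>_. M)) F = fact p * det (mat q q (\<lambda>(i, j). if i < p then (\<integral>x. f i x * g j x \<partial>M) else c i j))"
    unfolding m_def by (simp add: card_permutations)
qed

text \<open>Multiplication by the unitriangular matrix of coefficients of the Newton polynomials (X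
  - y 0) ... (X - y (a - 1)) keeps the determinant and makes the matrix lower triangular.\<close>

lemma det_vandermonde:
  fixes y :: "nat \<Rightarrow> real"
  shows "det (mat n n (\<lambda>(i, a). y i ^ a)) = (\<Prod>(a, b)\<in>prs n. y b - y a)"
proof -
  define P where "P a = (\<Prod>b<a. [:- y b, 1:])" for a
  have deg: "degree (P a) = a" for a
    unfolding P_def by (subst degree_prod_eq_sum_degree) auto
  have lc: "coeff (P a) a = 1" for a
  proof -
    have "monic (P a)" unfolding P_def by (rule monic_prod) simp
    then show ?thesis by (simp add: deg)
  qed
  define T where "T = mat n n (\<lambda>(c, a). coeff (P a) c)"
  define W where "W = mat n n (\<lambda>(i, a). y i ^ a)"
  define L where "L = mat n n (\<lambda>(i, a). poly (P a) (y i))"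
  have "W * T = L"
  proof (rule eq_matI)
    fix i a assume "i < dim_row L" "a < dim_col L"
    then have ia: "i < n" "a < n" by (auto simp: L_def)
    have "poly (P a) (y i) = (\<Sum>c\<le>a. coeff (P a) c * y i ^ c)" by (simp add: poly_altdef deg)
    also have "\<dots> = (\<Sum>c<n. coeff (P a) c * y i ^ c)"
      by (rule sum.mono_neutral_left) (use ia in \<open>auto simp: coeff_eq_0 deg\<close>)
    finally show "(W * T) $$ (i, a) = L $$ (i, a)" using ia
      by (simp add: W_def T_def L_def scalar_prod_def lessThan_atLeast0 mult.commute)
  qed (auto simp: W_def T_def L_def)
  moreover have "det T = 1"
  proof -
    have "det T = prod_list (diag_mat T)"
      by (rule det_upper_triangular[of _ n]) (auto simp: T_def upper_triangular_def coeff_eq_0 deg)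
    also have "diag_mat T = map (\<lambda>_. 1) [0..<n]" unfolding diag_mat_def T_def by (auto simp: lc)
    finally show ?thesis by (simp add: prod_list_replicate map_replicate_const)
  qed
  moreover have "det L = (\<Prod>i<n. \<Prod>b<i. y i - y b)"
  proof -
    have "poly (P a) (y i) = 0" if "i < a" for i a
      unfolding P_def poly_prod using that by (auto intro!: prod_zero)
    then have "det L = prod_list (diag_mat L)"
      by (intro det_lower_triangular[of n]) (auto simp: L_def)
    also have "diag_mat L = map (\<lambda>i. \<Prod>b<i. y i - y b) [0..<n]"
      unfolding diag_mat_def L_def by (auto simp: P_def poly_prod)
    finally show ?thesis by (simp add: prod.distinct_set_conv_list[symmetric] lessThan_atLeast0)
  qed
  moreover have "(\<Prod>(a, b)\<in>prs n. y b - y a) = (\<Prod>i<n. \<Prod>b<i. y i - y b)"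
  proof (induction n)
    case (Suc n)
    have inj: "inj_on (\<lambda>i. (i, n)) {..<n}" by (auto intro: inj_onI)
    show ?case unfolding prs_Suc 
      by (subst prod.union_disjoint) (simp_all add: prod.reindex[OF inj] Suc, auto simp: prs_def)
  qed (simp add: prs_def)
  moreover have "det (W * T) = det W * det T" by (rule det_mult[of _ n]) (auto simp: W_def T_def)
  ultimately show ?thesis unfolding W_def by simp
qed

lemma vdm2_det: "vdm2 n x = (det (mat n n (\<lambda>(i, a). x i ^ (2 * a))))\<^sup>2"
  using det_vandermonde[of n "\<lambda>i. (x i)\<^sup>2"]
  by (simp add: vdm2_def power_mult case_prod_beta prod_power_distrib)

text \<open>The factors \<phi> are absorbed into the rows of one of the two Vandermonde
  determinants. This serves the normalization (\<phi> = 1) as well as the gap event (\<phi> an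
  indicator).\<close>

lemma vdm2_prod:
  fixes \<phi> :: "real \<Rightarrow> real"
  assumes b: "b > 0" and [measurable]: "\<phi> \<in> borel_measurable borel" and bd: "\<And>u. \<bar>\<phi> u\<bar> \<le> 1"
  shows "integrable (gaussn b {..<n}) (\<lambda>x. vdm2 n x * (\<Prod>i<n. \<phi> (x i)))"
    and "(\<integral>x. vdm2 n x * (\<Prod>i<n. \<phi> (x i)) \<partial>gaussn b {..<n}) =
       fact n * det (mat n n (\<lambda>(i, j). \<integral>u. u ^ (2 * (i + j)) * \<phi> u \<partial>gauss b))"
proof -
  have sf: "sigma_finite_measure (gauss b)" by (intro prob_space_imp_sigma_finite prob_space_gauss b)
  have int: "integrable (gauss b) (\<lambda>x. x ^ (2 * a) * \<phi> x * x ^ (2 * j))" for a j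
  proof (rule Bochner_Integration.integrable_bound[OF integrable_gauss_power[OF b, of "2 * a + 2 * j"]])
    show "AE x in gauss b. norm (x ^ (2 * a) * \<phi> x * x ^ (2 * j)) \<le> norm (x ^ (2 * a + 2 * j))"
    proof (rule AE_I2)
      fix x
      have "norm (x ^ (2 * a) * \<phi> x * x ^ (2 * j)) = \<bar>x ^ (2 * a + 2 * j)\<bar> * \<bar>\<phi> x\<bar>"
        by (simp add: abs_mult power_add mult_ac)
      also have "\<dots> \<le> \<bar>x ^ (2 * a + 2 * j)\<bar> * 1" by (intro mult_left_mono bd) auto
      finally show "norm (x ^ (2 * a) * \<phi> x * x ^ (2 * j)) \<le> norm (x ^ (2 * a + 2 * j))" by simp
    qed
  qed simp
  have *: "vdm2 n x * (\<Prod>i<n. \<phi> (x i)) = det (mat n n (\<lambda>(i, a). x i ^ (2 * a) * \<phi> (x i))) *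
     det (mat n n (\<lambda>(i, j). if i < n then x i ^ (2 * j) else 0))" for x
  proof -
    have "det (mat n n (\<lambda>(i, a). x i ^ (2 * a) * \<phi> (x i))) = (\<Prod>i<n. \<phi> (x i)) * det (mat n n (\<lambda>(i, a). x i ^ (2 * a)))"
      unfolding det_leibniz sum_distrib_left by (intro sum.cong refl) (simp add: prod.distrib mult_ac)
    moreover have "det (mat n n (\<lambda>(i, j). if i < n then x i ^ (2 * j) else 0)) = det (mat n n (\<lambda>(i, j). x i ^ (2 * j)))"
      by (intro arg_cong[of _ _ det] cong_mat) auto
    ultimately show ?thesis by (simp add: vdm2_det power2_eq_square)
  qed
  have "det (mat n n (\<lambda>(i, j). if i < n then (\<integral>x. x ^ (2 * i) * \<phi> x * x ^ (2 * j) \<partial>gauss b) else 0)) =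
     det (mat n n (\<lambda>(i, j). \<integral>u. u ^ (2 * (i + j)) * \<phi> u \<partial>gauss b))"
    by (intro arg_cong[of _ _ det] cong_mat) (auto simp: power_add mult_ac)
  then show "(\<integral>x. vdm2 n x * (\<Prod>i<n. \<phi> (x i)) \<partial>gaussn b {..<n}) =
       fact n * det (mat n n (\<lambda>(i, j). \<integral>u. u ^ (2 * (i + j)) * \<phi> u \<partial>gauss b))"
    unfolding * using andreief(2)[OF sf order_refl, of n "\<lambda>a x. x ^ (2 * a) * \<phi> x" "\<lambda>j x. x ^ (2 * j)" "\<lambda>_ _. 0"] int
    by simp
  show "integrable (gaussn b {..<n}) (\<lambda>x. vdm2 n x * (\<Prod>i<n. \<phi> (x i)))"
    unfolding * using andreief(1)[OF sf order_refl, of n "\<lambda>a x. x ^ (2 * a) * \<phi> x" "\<lambda>j x. x ^ (2 * j)" "\<lambda>_ _. 0"] int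
    by simp
qed

lemma gauss_even_moment:
  assumes b: "b > 0" shows "integral\<^sup>L (gauss b) (\<lambda>x. x ^ (2 * j)) = (1 / b) ^ j * integral\<^sup>L (gauss 1) (\<lambda>x. x ^ (2 * j))"
proof (induction j)
  case 0
  then show ?case using prob_space.prob_space[OF prob_space_gauss[OF b]] prob_space.prob_space[OF prob_space_gauss[of 1]] by simp
next
  case (Suc j)
  have "2 * b * integral\<^sup>L (gauss b) (\<lambda>x. x ^ (2 * Suc j)) = real (2 * j + 1) * integral\<^sup>L (gauss b) (\<lambda>x. x ^ (2 * j))" if "b > 0" for b
    using gauss_moment_step[OF that, of "2 * j + 1"] by simp
  from this[OF b] this[of 1] show ?case unfolding Suc using b by (simp add: field_simps del: mult_Suc_right)
qed

text \<open>In the Leibniz expansion of the Hankel determinant every term has total moment order 2 n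
  (n - 1), and a moment of order 2j scales like b^(-j).\<close>

lemma vdm2_scale:
  assumes b: "b > 0"
  shows "(\<integral>x. vdm2 n x \<partial>gaussn b {..<n}) = (1 / b) ^ (n * (n - 1)) * (\<integral>x. vdm2 n x \<partial>gaussn 1 {..<n})"
proof -
  have Z: "(\<integral>x. vdm2 n x \<partial>gaussn b {..<n}) = fact n * det (mat n n (\<lambda>(i, j). \<integral>u. u ^ (2 * (i + j)) \<partial>gauss b))" if "b > 0" for b
    using vdm2_prod(2)[OF that, of "\<lambda>_. 1" n] by simp
  have s: "(\<Sum>i<n. 2 * i) = n * (n - 1)" 
  proof -
    have "2 * (\<Sum>i<n. i) = n * (n - 1)" by (induction n) (auto simp: algebra_simps)
    then show ?thesis by (simp add: sum_distrib_left)
  qed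
  have "det (mat n n (\<lambda>(i, j). \<integral>u. u ^ (2 * (i + j)) \<partial>gauss b)) = (1 / b) ^ (n * (n - 1)) * det (mat n n (\<lambda>(i, j). \<integral>u. u ^ (2 * (i + j)) \<partial>gauss 1))"
    unfolding det_leibniz sum_distrib_left
  proof (intro sum.cong refl)
    fix p assume "p \<in> {p. p permutes {..<n}}"
    then have p: "p permutes {..<n}" by simp
    have "(\<Sum>i<n. i + p i) = n * (n - 1)"
      using sum.permute[OF p, of "\<lambda>i. i"] s by (simp add: sum.distrib o_def sum_distrib_left[symmetric])
    then have "(\<Prod>i<n. (1 / b) ^ (i + p i)) = (1 / b) ^ (n * (n - 1))" by (simp only: power_sum[symmetric])
    then show "of_int (sign p) * (\<Prod>i<n. \<integral>u. u ^ (2 * (i + p i)) \<partial>gauss b) = (1 / b) ^ (n * (n - 1)) * (of_int (sign p) * (\<Prod>i<n. \<integral>u. u ^ (2 * (i + p i)) \<partial>gauss 1))"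
      unfolding gauss_even_moment[OF b] prod.distrib by simp
  qed
  then show ?thesis using Z[OF b] Z[of 1] by simp
qed

section \<open>Hermitian matrices: traces of powers and eigenvalues\<close>

definition herm :: "(nat \<times> nat \<Rightarrow> real) \<Rightarrow> nat \<Rightarrow> nat \<Rightarrow> complex" where
  "herm x i j = \<i> * complex_of_real (skewm x i j)"

lemma mpow_herm: "mpow N (herm x) n i j = \<i> ^ n * complex_of_real (mpow N (skewm x) n i j)"
  by (induction n arbitrary: i) (simp_all add: herm_def sum_distrib_left mult_ac)

lemma mtr_herm: "mtr N (herm x) (2 * m) = complex_of_real (2 * mpsum N x m)"
  by (simp add: mtr_def mpow_herm mpsum_def power_mult sum_distrib_left[symmetric])

lemma mpow_mat:
  assumes "i < N" "j < N"
  shows "mpow N A n i j = (mat N N (\<lambda>(i, j). A i j) ^\<^sub>m n) $$ (i, j)"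
  using assms(2)
proof (induction n arbitrary: j)
  case 0 then show ?case using assms by simp
next
  case (Suc n)
  let ?A = "mat N N (\<lambda>(i, j). A i j)"
  have P: "?A ^\<^sub>m n \<in> carrier_mat N N" by (rule pow_carrier_mat) simp
  have "mpow N A (Suc n) i j = (\<Sum>l<N. mpow N A n i l * A l j)"
    by (rule mpow_Suc_right) (use assms Suc in auto)
  also have "\<dots> = (\<Sum>l<N. (?A ^\<^sub>m n) $$ (i, l) * A l j)"
    by (intro sum.cong refl) (use Suc in auto)
  also have "\<dots> = (?A ^\<^sub>m n * ?A) $$ (i, j)"
    using P assms Suc by (simp add: times_mat_def scalar_prod_def lessThan_atLeast0)
  finally show ?case by simp
qed

definition trc :: "'a::comm_ring_1 mat \<Rightarrow> 'a" where
  "trc A = (\<Sum>i<dim_row A. A $$ (i, i))"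

lemma trc_comm:
  assumes "A \<in> carrier_mat n n" "B \<in> carrier_mat n n"
  shows "trc (A * B) = trc (B * A)"
proof -
  have "trc (A * B) = (\<Sum>i<n. \<Sum>l<n. A $$ (i, l) * B $$ (l, i))"
    using assms by (auto simp: trc_def times_mat_def scalar_prod_def lessThan_atLeast0 intro!: sum.cong)
  also have "\<dots> = (\<Sum>l<n. \<Sum>i<n. B $$ (l, i) * A $$ (i, l))"
    by (subst sum.swap) (simp add: mult.commute)
  also have "\<dots> = trc (B * A)"
    using assms by (auto simp: trc_def times_mat_def scalar_prod_def lessThan_atLeast0 intro!: sum.cong)
  finally show ?thesis .
qed

lemma upper_triangular_pow:
  assumes B: "B \<in> carrier_mat n n" "upper_triangular B" and "i < n" "j < n" "j \<le> i"
  shows "(B ^\<^sub>m m) $$ (i, j) = (if i = j then (B $$ (i, i)) ^ m else 0)"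
  using assms(3-)
proof (induction m arbitrary: i j)
  case 0 then show ?case using B by auto
next
  case (Suc m)
  have P: "B ^\<^sub>m m \<in> carrier_mat n n" by (rule pow_carrier_mat[OF B(1)])
  have "(B ^\<^sub>m Suc m) $$ (i, j) = (\<Sum>l<n. (B ^\<^sub>m m) $$ (i, l) * B $$ (l, j))"
    using P B Suc by (simp add: times_mat_def scalar_prod_def lessThan_atLeast0)
  also have "\<dots> = (\<Sum>l<n. if l = i then (if i = j then (B $$ (i, i)) ^ Suc m else 0) else 0)"
  proof (intro sum.cong refl)
    fix l assume l: "l \<in> {..<n}"
    have z: "B $$ (l, j) = 0" if "j < l" using B l that unfolding upper_triangular_def by auto
    show "(B ^\<^sub>m m) $$ (i, l) * B $$ (l, j) = (if l = i then (if i = j then (B $$ (i, i)) ^ Suc m else 0) else 0)"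
    proof (cases "l \<le> i")
      case True
      then show ?thesis using Suc.IH[of i l] l Suc.prems z by (auto simp: power_commutes)
    next
      case False
      then show ?thesis using z Suc.prems by auto
    qed
  qed
  finally show ?case using Suc.prems by simp
qed

text \<open>Schur triangularization: A^m is similar to the m-th power of a triangular matrix with
  diagonal es, and the trace is invariant under similarity.\<close>

lemma trc_pow_eigenvalues:
  fixes A :: "complex mat"
  assumes A: "A \<in> carrier_mat n n" and c: "char_poly A = (\<Prod>e\<leftarrow>es. [:- e, 1:])"
  shows "trc (A ^\<^sub>m m) = (\<Sum>e\<leftarrow>es. e ^ m)"
proof -
  obtain B P Q where s: "schur_decomposition A es = (B, P, Q)" by (cases "schur_decomposition A es") auto
  from schur_decomposition[OF A c s] have w: "similar_mat_wit A B P Q" and u: "upper_triangular B" and d: "diag_mat B = es" by auto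
  from similar_mat_witD2[OF A w] have car: "B \<in> carrier_mat n n" "P \<in> carrier_mat n n" "Q \<in> carrier_mat n n" by auto
  from similar_mat_wit_pow[OF w, of m] have w': "similar_mat_wit (A ^\<^sub>m m) (B ^\<^sub>m m) P Q" .
  have Am: "A ^\<^sub>m m \<in> carrier_mat n n" by (rule pow_carrier_mat[OF A])
  from similar_mat_witD2[OF Am w'] have e: "A ^\<^sub>m m = P * (B ^\<^sub>m m) * Q" "Q * P = 1\<^sub>m n" "B ^\<^sub>m m \<in> carrier_mat n n" by auto
  have "trc (A ^\<^sub>m m) = trc (Q * (P * (B ^\<^sub>m m)))"
    unfolding e(1) by (rule trc_comm[of _ n]) (use car e in auto)
  also have "Q * (P * (B ^\<^sub>m m)) = B ^\<^sub>m m"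
    using assoc_mult_mat[OF car(3,2) e(3)] left_mult_one_mat[OF e(3)] unfolding e(2) by simp
  also have "trc (B ^\<^sub>m m) = (\<Sum>i<n. B $$ (i, i) ^ m)"
    using e(3) car(1) upper_triangular_pow[OF car(1) u] by (simp add: trc_def)
  also have "\<dots> = (\<Sum>e\<leftarrow>es. e ^ m)"
    using car(1) unfolding d[symmetric] diag_mat_def
    by (simp add: o_def sum.distinct_set_conv_list[symmetric] lessThan_atLeast0)
  finally show ?thesis .
qed

lemma is_eigenvalue_iff_eigenvalue:
  "is_eigenvalue N H lam \<longleftrightarrow> eigenvalue (mat N N (\<lambda>(i, j). H i j)) (complex_of_real lam)"
proof
  assume "is_eigenvalue N H lam"
  then obtain v where v: "\<exists>i<N. v i \<noteq> 0" "\<And>i. i < N \<Longrightarrow> (\<Sum>j<N. H i j * v j) = complex_of_real lam * v i"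
    unfolding is_eigenvalue_def by blast
  show "eigenvalue (mat N N (\<lambda>(i, j). H i j)) (complex_of_real lam)"
    unfolding eigenvalue_def eigenvector_def
  proof (intro exI[of _ "vec N v"] conjI)
    show "vec N v \<noteq> 0\<^sub>v (dim_row (mat N N (\<lambda>(i, j). H i j)))"
    proof
      assume a: "vec N v = 0\<^sub>v (dim_row (mat N N (\<lambda>(i, j). H i j)))"
      from v(1) obtain i where i: "i < N" "v i \<noteq> 0" by blast
      from arg_cong[OF a, of "\<lambda>w. vec_index w i"] i show False by simp
    qed
    show "mat N N (\<lambda>(i, j). H i j) *\<^sub>v vec N v = complex_of_real lam \<cdot>\<^sub>v vec N v"
      by (rule eq_vecI) (auto simp: scalar_prod_def v(2)[unfolded lessThan_atLeast0])
  qed auto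
next
  assume "eigenvalue (mat N N (\<lambda>(i, j). H i j)) (complex_of_real lam)"
  then obtain w where w: "w \<in> carrier_vec N" "w \<noteq> 0\<^sub>v N" "mat N N (\<lambda>(i, j). H i j) *\<^sub>v w = complex_of_real lam \<cdot>\<^sub>v w"
    unfolding eigenvalue_def eigenvector_def by auto
  show "is_eigenvalue N H lam" unfolding is_eigenvalue_def
  proof (intro exI[of _ "\<lambda>i. vec_index w i"] conjI allI impI)
    show "\<exists>i<N. vec_index w i \<noteq> 0"
    proof (rule ccontr)
      assume "\<not> ?thesis"
      then have "w = 0\<^sub>v N" using w(1) by (intro eq_vecI) auto
      then show False using w(2) by simp
    qed
    fix i assume "i < N"
    then show "(\<Sum>j<N. H i j * vec_index w j) = complex_of_real lam * vec_index w i"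
      using arg_cong[OF w(3), of "\<lambda>w. vec_index w i"] w(1)
      by (simp add: scalar_prod_def lessThan_atLeast0)
  qed
qed

lemma herm_eigenvalue_real:
  assumes "eigenvalue (mat N N (\<lambda>(i, j). herm x i j)) c"
  shows "c \<in> \<real>"
proof -
  obtain w where w: "w \<in> carrier_vec N" "w \<noteq> 0\<^sub>v N" "mat N N (\<lambda>(i, j). herm x i j) *\<^sub>v w = c \<cdot>\<^sub>v w"
    using assms unfolding eigenvalue_def eigenvector_def by auto
  define v where "v i = vec_index w i" for i
  have ev: "(\<Sum>j<N. herm x i j * v j) = c * v i" if "i < N" for i
    using arg_cong[OF w(3), of "\<lambda>w. vec_index w i"] w(1) that
    by (simp add: scalar_prod_def lessThan_atLeast0 v_def)
  define S where "S = (\<Sum>i<N. cnj (v i) * v i)"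
  define q where "q = (\<Sum>i<N. \<Sum>j<N. cnj (v i) * herm x i j * v j)"
  have q: "q = c * S"
    unfolding q_def S_def by (simp add: ev mult.assoc sum_distrib_left[symmetric]) (simp add: sum_distrib_left mult_ac)
  have "cnj (herm x i j) = herm x j i" for i j
    unfolding herm_def using skewm_swap[of x j i] by simp
  then have "cnj q = (\<Sum>i<N. \<Sum>j<N. v i * herm x j i * cnj (v j))" unfolding q_def by simp
  also have "\<dots> = q" unfolding q_def by (subst sum.swap) (simp add: mult_ac)
  finally have "cnj q = q" .
  moreover have "cnj S = S" unfolding S_def by (simp add: mult.commute)
  moreover have "S \<noteq> 0"
  proof
    assume "S = 0"
    have "S = complex_of_real (\<Sum>i<N. (cmod (v i))\<^sup>2)"
      unfolding S_def by (simp add: complex_norm_square[symmetric] mult.commute)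
    with \<open>S = 0\<close> have "(\<Sum>i<N. (cmod (v i))\<^sup>2) = 0" by (metis of_real_eq_0_iff)
    then have "\<forall>i<N. v i = 0" by (subst (asm) sum_nonneg_eq_0_iff) auto
    then have "w = 0\<^sub>v N" using w(1) unfolding v_def by (intro eq_vecI) auto
    then show False using w(2) by simp
  qed
  ultimately have "cnj c = c" unfolding q by simp
  then show ?thesis by (simp add: complex_is_Real_iff complex_eq_iff)
qed

text \<open>The list carries the multiplicities that the power sums see, while
  \<open>is_eigenvalue\<close> sees only its set of entries.\<close>

lemma herm_spectrum:
  obtains hs :: "real list" where "length hs = N" "\<And>m. 2 * mpsum N x m = (\<Sum>h\<leftarrow>hs. h ^ (2 * m))"
    "\<And>lam. is_eigenvalue N (herm x) lam \<longleftrightarrow> lam \<in> set hs"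
proof -
  let ?A = "mat N N (\<lambda>(i, j). herm x i j)"
  have A: "?A \<in> carrier_mat N N" by simp
  from char_poly_factorized[OF A] obtain es where es: "char_poly ?A = (\<Prod>e\<leftarrow>es. [:- e, 1:])" "length es = N" by blast
  have ev: "eigenvalue ?A e \<longleftrightarrow> e \<in> set es" for e
    unfolding eigenvalue_root_char_poly[OF A] es(1) by (induction es) (auto simp: poly_prod_list)
  have re: "e = complex_of_real (Re e)" if "e \<in> set es" for e
    using herm_eigenvalue_real[of N x e] that ev by simp
  define hs where "hs = map Re es"
  have es_hs: "es = map complex_of_real hs"
    unfolding hs_def map_map by (rule map_idI[symmetric]) (use re in auto)
  show thesis
  proof (rule that)
    show "length hs = N" using es(2) by (simp add: hs_def)
    show "2 * mpsum N x m = (\<Sum>h\<leftarrow>hs. h ^ (2 * m))" for m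
    proof -
      have "complex_of_real (2 * mpsum N x m) = mtr N (herm x) (2 * m)" by (simp only: mtr_herm)
      also have "\<dots> = trc (?A ^\<^sub>m (2 * m))"
        unfolding mtr_def trc_def by (simp add: mpow_mat)
      also have "\<dots> = (\<Sum>e\<leftarrow>es. e ^ (2 * m))" by (rule trc_pow_eigenvalues[OF A es(1)])
      also have "\<dots> = complex_of_real (\<Sum>h\<leftarrow>hs. h ^ (2 * m))"
        unfolding es_hs by (induction hs) simp_all
      finally show ?thesis by (simp only: of_real_eq_iff)
    qed
    show "is_eigenvalue N (herm x) lam \<longleftrightarrow> lam \<in> set hs" for lam
      unfolding is_eigenvalue_iff_eigenvalue ev unfolding es_hs by auto
  qed
qed

section \<open>The law of the smallest positive eigenvalue\<close>

text \<open>Integrability is bundled with the equality so that the relation passes through linear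
  combinations and dominated limits. The factor c will be the total mass of the Vandermonde
  ensemble.\<close>

definition agree :: "'a measure \<Rightarrow> 'b measure \<Rightarrow> real \<Rightarrow> ('a \<Rightarrow> real) \<Rightarrow> ('b \<Rightarrow> real) \<Rightarrow> bool" where
  "agree \<mu> \<nu> c f g \<longleftrightarrow> integrable \<mu> f \<and> integrable \<nu> g \<and> c * integral\<^sup>L \<mu> f = integral\<^sup>L \<nu> g"

lemma agree_sum:
  assumes "\<And>a. a \<in> S \<Longrightarrow> agree \<mu> \<nu> c (f a) (g a)"
  shows "agree \<mu> \<nu> c (\<lambda>x. \<Sum>a\<in>S. k a * f a x) (\<lambda>x. \<Sum>a\<in>S. k a * g a x)"
proof -
  have "c * (\<Sum>a\<in>S. k a * integral\<^sup>L \<mu> (f a)) = (\<Sum>a\<in>S. k a * integral\<^sup>L \<nu> (g a))"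
    unfolding sum_distrib_left
    by (intro sum.cong refl) (use assms in \<open>auto simp: agree_def mult.left_commute\<close>)
  then show ?thesis
    using assms unfolding agree_def
    by (auto simp: Bochner_Integration.integral_sum intro!: Bochner_Integration.integrable_sum)
qed

lemma agree_lim:
  assumes a: "\<And>m. agree \<mu> \<nu> c (f m) (g m)"
    and f: "\<And>x. x \<in> space \<mu> \<Longrightarrow> (\<lambda>m. f m x) \<longlonglongrightarrow> F x" and g: "\<And>x. x \<in> space \<nu> \<Longrightarrow> (\<lambda>m. g m x) \<longlonglongrightarrow> G x"
    and bf: "integrable \<mu> Bf" "\<And>m x. x \<in> space \<mu> \<Longrightarrow> \<bar>f m x\<bar> \<le> Bf x"
    and bg: "integrable \<nu> Bg" "\<And>m x. x \<in> space \<nu> \<Longrightarrow> \<bar>g m x\<bar> \<le> Bg x"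
  shows "agree \<mu> \<nu> c F G"
proof -
  have mf: "f m \<in> borel_measurable \<mu>" and mg: "g m \<in> borel_measurable \<nu>" for m
    using a[of m] by (auto simp: agree_def)
  have mF: "F \<in> borel_measurable \<mu>" by (rule borel_measurable_LIMSEQ_real[OF f mf])
  have mG: "G \<in> borel_measurable \<nu>" by (rule borel_measurable_LIMSEQ_real[OF g mg])
  have 1: "integrable \<mu> F" "(\<lambda>m. integral\<^sup>L \<mu> (f m)) \<longlonglongrightarrow> integral\<^sup>L \<mu> F"
  proof -
    have 1: "AE x in \<mu>. (\<lambda>m. f m x) \<longlonglongrightarrow> F x" and 2: "\<And>m. AE x in \<mu>. norm (f m x) \<le> Bf x" using f bf by auto
    show "integrable \<mu> F" "(\<lambda>m. integral\<^sup>L \<mu> (f m)) \<longlonglongrightarrow> integral\<^sup>L \<mu> F"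
      by (rule integrable_dominated_convergence[OF mF mf bf(1) 1 2]) (rule integral_dominated_convergence[OF mF mf bf(1) 1 2])
  qed
  have 2: "integrable \<nu> G" "(\<lambda>m. integral\<^sup>L \<nu> (g m)) \<longlonglongrightarrow> integral\<^sup>L \<nu> G"
  proof -
    have 1: "AE x in \<nu>. (\<lambda>m. g m x) \<longlonglongrightarrow> G x" and 2: "\<And>m. AE x in \<nu>. norm (g m x) \<le> Bg x" using g bg by auto
    show "integrable \<nu> G" "(\<lambda>m. integral\<^sup>L \<nu> (g m)) \<longlonglongrightarrow> integral\<^sup>L \<nu> G"
      by (rule integrable_dominated_convergence[OF mG mg bg(1) 1 2]) (rule integral_dominated_convergence[OF mG mg bg(1) 1 2])
  qed
  have "(\<lambda>m. c * integral\<^sup>L \<mu> (f m)) \<longlonglongrightarrow> c * integral\<^sup>L \<mu> F" by (intro tendsto_mult_left 1)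
  then have "(\<lambda>m. integral\<^sup>L \<nu> (g m)) \<longlonglongrightarrow> c * integral\<^sup>L \<mu> F" using a by (simp add: agree_def)
  from LIMSEQ_unique[OF this 2(2)] 1 2 show ?thesis by (simp add: agree_def)
qed

definition pws :: "real \<Rightarrow> nat \<Rightarrow> (nat \<Rightarrow> real) \<Rightarrow> nat \<Rightarrow> real" where
  "pws w n y m = w * (\<Sum>i<n. y i ^ m)"

definition cutoff :: "nat \<Rightarrow> real \<Rightarrow> real" where
  "cutoff R r = max 0 (min 1 (real R + 1 - r))"

text \<open>Two configurations whose weighted power sums have matching moments, also under the
  weights exp (- s p) with p the first power sum; the locale carries this over to events about
  positions. The weights w are 1/2 for the 2k squared eigenvalues, which come in equal pairs, and 1
  for the k points of the Vandermonde ensemble.\<close>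

locale moment_match =
  fixes \<mu> :: "'a measure" and n :: nat and w :: real and y :: "'a \<Rightarrow> nat \<Rightarrow> real"
    and \<nu> :: "'b measure" and n' :: nat and w' :: real and y' :: "'b \<Rightarrow> nat \<Rightarrow> real" and c :: real
  assumes fin: "finite_measure \<mu>" "finite_measure \<nu>" and w: "w > 0" "w' > 0"
    and y: "\<And>x i. i < n \<Longrightarrow> 0 \<le> y x i" "\<And>x i. i < n' \<Longrightarrow> 0 \<le> y' x i"
    and int: "\<And>ls. integrable \<mu> (\<lambda>x. PL (pws w n (y x)) ls)" "\<And>ls. integrable \<nu> (\<lambda>x. PL (pws w' n' (y' x)) ls)"
    and match: "\<And>ls s. agree \<mu> \<nu> c (\<lambda>x. PL (pws w n (y x)) ls * exp (- real s * pws w n (y x) 1))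
        (\<lambda>x. PL (pws w' n' (y' x)) ls * exp (- real s * pws w' n' (y' x) 1))"
begin

lemma pws_nonneg: "0 \<le> pws w n (y x) m" "0 \<le> pws w' n' (y' x') m"
  using y w by (auto simp: pws_def intro!: sum_nonneg mult_nonneg_nonneg)

text \<open>In the variable q = exp (- r), r the first power sum, the weights exp (- s r) are the
  powers of q. The cutoff is q times a continuous function of q on [0, 1], which polynomials
  approximate uniformly.\<close>

lemma match_cutoff:
  "agree \<mu> \<nu> c (\<lambda>x. PL (pws w n (y x)) ls * cutoff R (pws w n (y x) 1))
      (\<lambda>x. PL (pws w' n' (y' x)) ls * cutoff R (pws w' n' (y' x) 1))"
proof -
  \<comment> \<open>The cutoff vanishes for r \<ge> R + 1, that is for q \<le> q0. Clamping q at q0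
    keeps \<open>X\<close> continuous up to q = 0, where ln and the quotient are singular.\<close>
  define q0 where "q0 = exp (- (real R + 1))"
  have q0: "0 < q0" by (simp add: q0_def)
  define X where "X q = cutoff R (- ln (max q q0)) / max q q0" for q
  have Xeq: "exp (- r) * X (exp (- r)) = cutoff R r" if "r \<ge> 0" for r
  proof (cases "r \<le> real R + 1")
    case True
    then have "max (exp (- r)) q0 = exp (- r)" by (simp add: q0_def)
    then show ?thesis by (simp add: X_def)
  next
    case False
    then have "max (exp (- r)) q0 = q0" by (simp add: q0_def)
    then show ?thesis using False by (simp add: X_def q0_def cutoff_def)
  qed
  have cX: "continuous_on {0..1} X"
    unfolding X_def cutoff_def using q0 by (intro continuous_intros) (auto simp: max_def)
  have "\<exists>Q. real_polynomial_function Q \<and> (\<forall>q\<in>{0..1}. \<bar>X q - Q q\<bar> < 1 / (real m + 1))" for m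
  proof -
    have "0 < 1 / (real m + 1)" by simp
    obtain g where "real_polynomial_function g" "\<And>x. x \<in> {0..1} \<Longrightarrow> \<bar>X x - g x\<bar> < 1 / (real m + 1)"
      by (rule Stone_Weierstrass_real_polynomial_function[OF compact_Icc cX \<open>0 < 1 / (real m + 1)\<close>], erule that, blast)
    then show ?thesis by blast
  qed
  then obtain Q where Q: "\<And>m. real_polynomial_function (Q m)" "\<And>m q. q \<in> {0..1} \<Longrightarrow> \<bar>X q - Q m q\<bar> < 1 / (real m + 1)"
    by metis
  have lim: "(\<lambda>m. Q m q) \<longlonglongrightarrow> X q" if "q \<in> {0..1}" for q
  proof (rule LIMSEQ_I)
    fix e :: real assume "e > 0"
    then obtain m0 where m0: "1 / (real m0 + 1) < e" using reals_Archimedean by (metis inverse_eq_divide of_nat_Suc add.commute)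
    have "norm (Q m q - X q) < e" if "m \<ge> m0" for m
    proof -
      have "1 / (real m + 1) \<le> 1 / (real m0 + 1)" using that by (simp add: frac_le)
      then show ?thesis using Q(2)[OF \<open>q \<in> {0..1}\<close>, of m] m0 by (simp add: abs_minus_commute)
    qed
    then show "\<exists>m0. \<forall>m\<ge>m0. norm (Q m q - X q) < e" by blast
  qed
  obtain B where "\<forall>u\<in>X ` {0..1}. norm u \<le> B"
    using compact_imp_bounded[OF compact_continuous_image[OF cX compact_Icc]] unfolding bounded_iff by blast
  then have B: "\<bar>X q\<bar> \<le> B" if "q \<in> {0..1}" for q using that by auto
  have QB: "\<bar>Q m q\<bar> \<le> B + 1" if "q \<in> {0..1}" for m q
  proof -
    have "1 / (real m + 1) \<le> 1" by simp
    then show ?thesis using Q(2)[OF that, of m] B[OF that] by linarith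
  qed
  have ex: "exp (- r) \<in> {0..1}" if "r \<ge> 0" for r :: real using that by auto
  have bd: "\<bar>P * (exp (- r) * Q m (exp (- r)))\<bar> \<le> (B + 1) * \<bar>P\<bar>" if "r \<ge> 0" for P r m
  proof -
    have "\<bar>exp (- r)\<bar> * \<bar>Q m (exp (- r))\<bar> \<le> 1 * (B + 1)"
      using QB[OF ex[OF that], of m] that by (intro mult_mono) auto
    then have "\<bar>P\<bar> * (\<bar>exp (- r)\<bar> * \<bar>Q m (exp (- r))\<bar>) \<le> \<bar>P\<bar> * (1 * (B + 1))"
      by (rule mult_left_mono) simp
    then show ?thesis by (simp add: abs_mult mult.commute)
  qed
  show ?thesis
  proof (rule agree_lim)
    fix m
    obtain a d where ad: "Q m = (\<lambda>x. \<Sum>i\<le>d. a i * x ^ i)" using Q(1)[of m] real_polynomial_function_iff_sum by blast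
    have e: "P * (exp (- r) * Q m (exp (- r))) = (\<Sum>i\<le>d. a i * (P * exp (- real (Suc i) * r)))" for P r
      unfolding ad sum_distrib_left
    proof (intro sum.cong refl)
      fix i
      have "exp (- r) * exp (- r) ^ i = exp (- real (Suc i) * r)"
        unfolding exp_of_nat_mult[symmetric] exp_add[symmetric] by (simp add: algebra_simps)
      then show "P * (exp (- r) * (a i * exp (- r) ^ i)) = a i * (P * exp (- real (Suc i) * r))"
        by (simp add: mult.left_commute mult.assoc)
    qed
    show "agree \<mu> \<nu> c (\<lambda>x. PL (pws w n (y x)) ls * (exp (- pws w n (y x) 1) * Q m (exp (- pws w n (y x) 1))))
      (\<lambda>x. PL (pws w' n' (y' x)) ls * (exp (- pws w' n' (y' x) 1) * Q m (exp (- pws w' n' (y' x) 1))))"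
      unfolding e by (rule agree_sum, rule match)
  next
    fix x
    show "(\<lambda>m. PL (pws w n (y x)) ls * (exp (- pws w n (y x) 1) * Q m (exp (- pws w n (y x) 1)))) \<longlonglongrightarrow> PL (pws w n (y x)) ls * cutoff R (pws w n (y x) 1)"
      unfolding Xeq[OF pws_nonneg(1), symmetric] by (intro tendsto_mult_left lim ex pws_nonneg)
  next
    fix x
    show "(\<lambda>m. PL (pws w' n' (y' x)) ls * (exp (- pws w' n' (y' x) 1) * Q m (exp (- pws w' n' (y' x) 1)))) \<longlonglongrightarrow> PL (pws w' n' (y' x)) ls * cutoff R (pws w' n' (y' x) 1)"
      unfolding Xeq[OF pws_nonneg(2), symmetric] by (intro tendsto_mult_left lim ex pws_nonneg)
  next
    show "integrable \<mu> (\<lambda>x. (B + 1) * \<bar>PL (pws w n (y x)) ls\<bar>)" "integrable \<nu> (\<lambda>x. (B + 1) * \<bar>PL (pws w' n' (y' x)) ls\<bar>)"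
      using int by auto
  qed (auto intro!: bd pws_nonneg)
qed

text \<open>Each factor of the power is a combination of power sums and is absorbed by putting its
  order in front of ls.\<close>

lemma match_linear_power:
  "agree \<mu> \<nu> c (\<lambda>x. (\<Sum>a\<le>d. q a * pws w n (y x) a) ^ j * PL (pws w n (y x)) ls * cutoff R (pws w n (y x) 1))
      (\<lambda>x. (\<Sum>a\<le>d. q a * pws w' n' (y' x) a) ^ j * PL (pws w' n' (y' x)) ls * cutoff R (pws w' n' (y' x) 1))"
proof (induction j arbitrary: ls)
  case 0 then show ?case using match_cutoff by simp
next
  case (Suc j)
  have e: "(\<Sum>a\<le>d. q a * p a) ^ Suc j * PL p ls * C = (\<Sum>a\<le>d. q a * ((\<Sum>a\<le>d. q a * p a) ^ j * PL p (a # ls) * C))" for p C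
    by (simp add: sum_distrib_left sum_distrib_right mult_ac del: sum_distrib_left[symmetric])
  show ?case unfolding e by (rule agree_sum, rule Suc)
qed

lemma pws_poly: "(\<Sum>a\<le>d. q a * pws v k z a) = v * (\<Sum>i<k. \<Sum>a\<le>d. q a * z i ^ a)"
proof -
  have "(\<Sum>a\<le>d. q a * pws v k z a) = (\<Sum>a\<le>d. \<Sum>i<k. v * (q a * z i ^ a))"
    by (simp add: pws_def sum_distrib_left mult_ac)
  also have "\<dots> = (\<Sum>i<k. \<Sum>a\<le>d. v * (q a * z i ^ a))" by (rule sum.swap)
  finally show ?thesis by (simp add: sum_distrib_left)
qed

lemma cutoff_bounds: "0 \<le> cutoff R r" "cutoff R r \<le> 1" "cutoff R r \<noteq> 0 \<Longrightarrow> r \<le> real R + 1"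
  by (auto simp: cutoff_def)

lemma bound_coord:
  fixes v :: real
  assumes "v > 0" "\<And>i. i < k \<Longrightarrow> 0 \<le> z i" "pws v k z 1 \<le> r" "i < k"
  shows "z i \<in> {0..r / v}"
proof -
  have "z i \<le> (\<Sum>i<k. z i)" by (rule member_le_sum) (use assms in auto)
  moreover have "(\<Sum>i<k. z i) \<le> r / v" using assms(1,3) by (simp add: pws_def field_simps)
  ultimately show ?thesis using assms by auto
qed

lemma cutoff_exp_bound:
  assumes "v > 0" "\<And>i. i < k \<Longrightarrow> 0 \<le> z i" "\<And>u. u \<in> {0..(real R + 1) / v} \<Longrightarrow> \<bar>h u\<bar> \<le> B"
    and "\<bar>E\<bar> \<le> exp \<bar>v * (\<Sum>i<k. h (z i))\<bar>" 
  shows "\<bar>E * cutoff R (pws v k z 1)\<bar> \<le> exp (v * (real k * B))"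
proof (cases "cutoff R (pws v k z 1) = 0")
  case False
  from cutoff_bounds(3)[OF this] have r: "pws v k z 1 \<le> real R + 1" .
  have "\<bar>\<Sum>i<k. h (z i)\<bar> \<le> (\<Sum>i<k. \<bar>h (z i)\<bar>)" by (rule sum_abs)
  also have "\<dots> \<le> (\<Sum>i<k. B)" by (intro sum_mono assms(3) bound_coord[OF assms(1,2) r]) auto
  finally have "\<bar>v * (\<Sum>i<k. h (z i))\<bar> \<le> v * (real k * B)" using assms(1) by (simp add: abs_mult)
  then have "\<bar>E\<bar> \<le> exp (v * (real k * B))" using assms(4) by (meson exp_le_cancel_iff order_trans)
  moreover have "\<bar>E * cutoff R (pws v k z 1)\<bar> \<le> \<bar>E\<bar> * 1"
    unfolding abs_mult using cutoff_bounds[of R] by (intro mult_left_mono) auto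
  ultimately show ?thesis by linarith
qed simp

lemma const_integrable: "integrable \<mu> (\<lambda>_. a :: real)" "integrable \<nu> (\<lambda>_. a :: real)"
  using fin by (auto intro!: finite_measure.integrable_const)

text \<open>Taylor series of exp. On the support of the cutoff the coordinates are nonnegative with
  bounded sum, hence bounded, and the partial sums have a constant majorant.\<close>

lemma match_exp_poly:
  fixes q :: "nat \<Rightarrow> real" and d :: nat
  defines "h \<equiv> \<lambda>u. \<Sum>a\<le>d. q a * u ^ a"
  shows "agree \<mu> \<nu> c (\<lambda>x. exp (w * (\<Sum>i<n. h (y x i))) * cutoff R (pws w n (y x) 1))
      (\<lambda>x. exp (w' * (\<Sum>i<n'. h (y' x i))) * cutoff R (pws w' n' (y' x) 1))"
proof -
  have ch: "continuous_on S h" for S unfolding h_def by (intro continuous_intros)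
  have "\<exists>B. \<forall>u\<in>{0..r}. \<bar>h u\<bar> \<le> B" for r
    using compact_imp_bounded[OF compact_continuous_image[OF ch compact_Icc], of 0 r] unfolding bounded_iff by auto
  then obtain B where B: "\<And>r u. u \<in> {0..r} \<Longrightarrow> \<bar>h u\<bar> \<le> B r" by metis
  have lim: "(\<lambda>m. (\<Sum>j<m. 1 / fact j * (t ^ j * PL p [] * C))) \<longlonglongrightarrow> exp t * C" for t C :: real and p
  proof -
    have "(\<lambda>j. t ^ j / fact j * C) sums (exp t * C)"
      using exp_converges[of t] by (intro sums_mult2) (simp add: field_simps)
    then show ?thesis by (simp add: sums_def)
  qed
  have bd: "\<bar>\<Sum>j<m. 1 / fact j * t ^ j\<bar> \<le> exp \<bar>t\<bar>" for m and t :: real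
  proof -
    have "\<bar>\<Sum>j<m. 1 / fact j * t ^ j\<bar> \<le> (\<Sum>j<m. \<bar>t\<bar> ^ j / fact j)"
      by (rule order_trans[OF sum_abs]) (simp add: abs_mult power_abs)
    also have "\<dots> \<le> exp \<bar>t\<bar>"
      using sum_le_suminf[OF summable_exp[of "\<bar>t\<bar>"], of "{..<m}"] exp_converges[of "\<bar>t\<bar>"]
      by (auto simp: sums_iff field_simps)
    finally show ?thesis .
  qed
  show ?thesis
  proof (rule agree_lim)
    fix m
    show "agree \<mu> \<nu> c (\<lambda>x. \<Sum>j<m. 1 / fact j * ((w * (\<Sum>i<n. h (y x i))) ^ j * PL (pws w n (y x)) [] * cutoff R (pws w n (y x) 1)))
      (\<lambda>x. \<Sum>j<m. 1 / fact j * ((w' * (\<Sum>i<n'. h (y' x i))) ^ j * PL (pws w' n' (y' x)) [] * cutoff R (pws w' n' (y' x) 1)))"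
      unfolding h_def pws_poly[symmetric] by (rule agree_sum, rule match_linear_power)
  next
    fix m x
    have "\<bar>(\<Sum>j<m. 1 / fact j * (w * (\<Sum>i<n. h (y x i))) ^ j) * cutoff R (pws w n (y x) 1)\<bar> \<le> exp (w * (real n * B ((real R + 1) / w)))"
      by (rule cutoff_exp_bound[OF w(1) y(1) B bd])
    then show "\<bar>\<Sum>j<m. 1 / fact j * ((w * (\<Sum>i<n. h (y x i))) ^ j * PL (pws w n (y x)) [] * cutoff R (pws w n (y x) 1))\<bar>
        \<le> exp (w * (real n * B ((real R + 1) / w)))"
      by (simp add: sum_distrib_right)
  next
    fix m x
    have "\<bar>(\<Sum>j<m. 1 / fact j * (w' * (\<Sum>i<n'. h (y' x i))) ^ j) * cutoff R (pws w' n' (y' x) 1)\<bar> \<le> exp (w' * (real n' * B ((real R + 1) / w')))"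
      by (rule cutoff_exp_bound[OF w(2) y(2) B bd])
    then show "\<bar>\<Sum>j<m. 1 / fact j * ((w' * (\<Sum>i<n'. h (y' x i))) ^ j * PL (pws w' n' (y' x)) [] * cutoff R (pws w' n' (y' x) 1))\<bar>
        \<le> exp (w' * (real n' * B ((real R + 1) / w')))"
      by (simp add: sum_distrib_right)
  qed (rule lim const_integrable)+
qed

text \<open>A continuous h is approximated by polynomials on an interval containing every coordinate
  that the cutoff allows, for either of the two weights.\<close>

lemma match_exp_continuous:
  fixes h :: "real \<Rightarrow> real"
  assumes ch: "continuous_on {0..} h"
  shows "agree \<mu> \<nu> c (\<lambda>x. exp (w * (\<Sum>i<n. h (y x i))) * cutoff R (pws w n (y x) 1))
      (\<lambda>x. exp (w' * (\<Sum>i<n'. h (y' x i))) * cutoff R (pws w' n' (y' x) 1))"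
proof -
  define r where "r = max ((real R + 1) / w) ((real R + 1) / w')"
  have ch: "continuous_on {0..r} h" by (rule continuous_on_subset[OF ch]) auto
  obtain B where "\<forall>u\<in>h ` {0..r}. norm u \<le> B"
    using compact_imp_bounded[OF compact_continuous_image[OF ch compact_Icc]] unfolding bounded_iff by blast
  then have B: "\<bar>h u\<bar> \<le> B" if "u \<in> {0..r}" for u using that by auto
  have "\<exists>Q. real_polynomial_function Q \<and> (\<forall>q\<in>{0..r}. \<bar>h q - Q q\<bar> < 1 / (real m + 1))" for m
  proof -
    have "0 < 1 / (real m + 1)" by simp
    obtain g where "real_polynomial_function g" "\<And>x. x \<in> {0..r} \<Longrightarrow> \<bar>h x - g x\<bar> < 1 / (real m + 1)"
      by (rule Stone_Weierstrass_real_polynomial_function[OF compact_Icc ch \<open>0 < 1 / (real m + 1)\<close>], erule that, blast)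
    then show ?thesis by blast
  qed
  then obtain Q where Q: "\<And>m. real_polynomial_function (Q m)" "\<And>m q. q \<in> {0..r} \<Longrightarrow> \<bar>h q - Q m q\<bar> < 1 / (real m + 1)"
    by metis
  have lim: "(\<lambda>m. Q m q) \<longlonglongrightarrow> h q" if "q \<in> {0..r}" for q
  proof (rule LIMSEQ_I)
    fix e :: real assume "e > 0"
    then obtain m0 where m0: "1 / (real m0 + 1) < e" using reals_Archimedean by (metis inverse_eq_divide of_nat_Suc add.commute)
    have "norm (Q m q - h q) < e" if "m \<ge> m0" for m
    proof -
      have "1 / (real m + 1) \<le> 1 / (real m0 + 1)" using that by (simp add: frac_le)
      then show ?thesis using Q(2)[OF \<open>q \<in> {0..r}\<close>, of m] m0 by (simp add: abs_minus_commute)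
    qed
    then show "\<exists>m0. \<forall>m\<ge>m0. norm (Q m q - h q) < e" by blast
  qed
  have QB: "\<bar>Q m q\<bar> \<le> B + 1" if "q \<in> {0..r}" for m q
  proof -
    have "1 / (real m + 1) \<le> 1" by simp
    then show ?thesis using Q(2)[OF that, of m] B[OF that] by linarith
  qed
  have rsub: "{0..(real R + 1) / w} \<subseteq> {0..r}" "{0..(real R + 1) / w'} \<subseteq> {0..r}" by (auto simp: r_def)
  have lim2: "(\<lambda>m. exp (v * (\<Sum>i<k. Q m (z i))) * cutoff R (pws v k z 1)) \<longlonglongrightarrow> exp (v * (\<Sum>i<k. h (z i))) * cutoff R (pws v k z 1)"
    if v: "v > 0" "\<And>i. i < k \<Longrightarrow> 0 \<le> z i" "{0..(real R + 1) / v} \<subseteq> {0..r}" for v k z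
  proof (cases "cutoff R (pws v k z 1) = 0")
    case False
    have "z i \<in> {0..r}" if "i < k" for i
      using bound_coord[OF v(1,2) cutoff_bounds(3)[OF False] that] v(3) by auto
    then show ?thesis by (intro tendsto_intros lim) auto
  qed simp
  show ?thesis
  proof (rule agree_lim)
    fix m
    obtain a d where ad: "Q m = (\<lambda>x. \<Sum>i\<le>d. a i * x ^ i)" using Q(1)[of m] real_polynomial_function_iff_sum by blast
    show "agree \<mu> \<nu> c (\<lambda>x. exp (w * (\<Sum>i<n. Q m (y x i))) * cutoff R (pws w n (y x) 1))
      (\<lambda>x. exp (w' * (\<Sum>i<n'. Q m (y' x i))) * cutoff R (pws w' n' (y' x) 1))"
      unfolding ad by (rule match_exp_poly)
  next
    fix m x
    show "\<bar>exp (w * (\<Sum>i<n. Q m (y x i))) * cutoff R (pws w n (y x) 1)\<bar> \<le> exp (w * (real n * (B + 1)))"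
      by (rule cutoff_exp_bound[OF w(1) y(1), where h="Q m"]) (use rsub QB in auto)
    show "(\<lambda>m. exp (w * (\<Sum>i<n. Q m (y x i))) * cutoff R (pws w n (y x) 1)) \<longlonglongrightarrow> exp (w * (\<Sum>i<n. h (y x i))) * cutoff R (pws w n (y x) 1)"
      by (rule lim2[OF w(1) y(1) rsub(1)])
  next
    fix m x
    show "\<bar>exp (w' * (\<Sum>i<n'. Q m (y' x i))) * cutoff R (pws w' n' (y' x) 1)\<bar> \<le> exp (w' * (real n' * (B + 1)))"
      by (rule cutoff_exp_bound[OF w(2) y(2), where h="Q m"]) (use rsub QB in auto)
    show "(\<lambda>m. exp (w' * (\<Sum>i<n'. Q m (y' x i))) * cutoff R (pws w' n' (y' x) 1)) \<longlonglongrightarrow> exp (w' * (\<Sum>i<n'. h (y' x i))) * cutoff R (pws w' n' (y' x) 1)"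
      by (rule lim2[OF w(2) y(2) rsub(2)])
  qed (rule const_integrable)+
qed

text \<open>For h \<le> 0 the exponentials are at most 1, so the cutoff can be released by letting R
  grow.\<close>

lemma match_exp:
  assumes ch: "continuous_on {0..} h" and h: "\<And>u. h u \<le> 0"
  shows "agree \<mu> \<nu> c (\<lambda>x. exp (w * (\<Sum>i<n. h (y x i)))) (\<lambda>x. exp (w' * (\<Sum>i<n'. h (y' x i))))"
proof (rule agree_lim[OF match_exp_continuous[OF ch]])
  have lim: "(\<lambda>R. E * cutoff R r) \<longlonglongrightarrow> E" for E r
  proof (rule tendsto_eventually)
    obtain R0 :: nat where "r \<le> real R0" using real_arch_simple by blast
    then have "\<forall>R\<ge>R0. E * cutoff R r = E" by (auto simp: cutoff_def)
    then show "\<forall>\<^sub>F R in sequentially. E * cutoff R r = E" unfolding eventually_sequentially by blast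
  qed
  show "(\<lambda>m. exp (w * (\<Sum>i<n. h (y x i))) * cutoff m (pws w n (y x) 1)) \<longlonglongrightarrow> exp (w * (\<Sum>i<n. h (y x i)))"
    "(\<lambda>m. exp (w' * (\<Sum>i<n'. h (y' z i))) * cutoff m (pws w' n' (y' z) 1)) \<longlonglongrightarrow> exp (w' * (\<Sum>i<n'. h (y' z i)))" for x z
    by (rule lim)+
  have le: "\<bar>exp (v * (\<Sum>i<k. h (z i))) * cutoff m r\<bar> \<le> 1" if "v > 0" for v k z m r
  proof -
    have "v * (\<Sum>i<k. h (z i)) \<le> 0" using that h by (intro mult_nonneg_nonpos sum_nonpos) auto
    then have "\<bar>exp (v * (\<Sum>i<k. h (z i)))\<bar> * \<bar>cutoff m r\<bar> \<le> 1 * 1"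
      using cutoff_bounds[of m r] by (intro mult_mono) auto
    then show ?thesis by (simp add: abs_mult)
  qed
  show "\<bar>exp (w * (\<Sum>i<n. h (y x i))) * cutoff m (pws w n (y x) 1)\<bar> \<le> 1" 
    "\<bar>exp (w' * (\<Sum>i<n'. h (y' z i))) * cutoff m (pws w' n' (y' z) 1)\<bar> \<le> 1" for m x z
    by (rule le w)+
qed (rule const_integrable)+

text \<open>The exponentials of the sums of \<open>h m\<close> tend to the indicator of the event
  that all points lie in T. Measurability of the event is a conclusion: the coordinates
  \<open>y x i\<close> are not assumed measurable, only their power sums are.\<close>

theorem match_region:
  fixes h :: "nat \<Rightarrow> real \<Rightarrow> real"
  assumes ch: "\<And>m. continuous_on {0..} (h m)" and h0: "\<And>m u. h m u \<le> 0"
    and inT: "\<And>u. 0 \<le> u \<Longrightarrow> u \<in> T \<Longrightarrow> \<forall>\<^sub>F m in sequentially. h m u = 0"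
    and outT: "\<And>u. 0 \<le> u \<Longrightarrow> u \<notin> T \<Longrightarrow> \<forall>\<^sub>F m in sequentially. h m u \<le> - real m"
  shows "{x \<in> space \<mu>. \<forall>i<n. y x i \<in> T} \<in> sets \<mu>"
    and "c * measure \<mu> {x \<in> space \<mu>. \<forall>i<n. y x i \<in> T} = measure \<nu> {x \<in> space \<nu>. \<forall>i<n'. y' x i \<in> T}"
proof -
  have lim: "(\<lambda>m. exp (v * (\<Sum>i<k. h m (z i)))) \<longlonglongrightarrow> (if \<forall>i<k. z i \<in> T then 1 else 0)"
    if v: "v > 0" and z: "\<And>i. i < k \<Longrightarrow> 0 \<le> z i" for v z and k :: nat
  proof (cases "\<forall>i<k. z i \<in> T")
    case True
    then have "\<forall>\<^sub>F m in sequentially. \<forall>i\<in>{..<k}. h m (z i) = 0" by (intro eventually_ball_finite) (auto intro!: inT z)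
    then have "\<forall>\<^sub>F m in sequentially. exp (v * (\<Sum>i<k. h m (z i))) = 1" by eventually_elim simp
    then show ?thesis unfolding if_P[OF True] by (rule tendsto_eventually)
  next
    case False
    then obtain j where j: "j < k" "z j \<notin> T" by force
    have up: "\<forall>\<^sub>F m in sequentially. norm (exp (v * (\<Sum>i<k. h m (z i)))) \<le> exp (- v * real m)"
      using outT[OF z[OF j(1)] j(2)]
    proof eventually_elim
      case (elim m)
      have "(\<Sum>i<k. h m (z i)) = h m (z j) + (\<Sum>i\<in>{..<k}-{j}. h m (z i))" using j by (simp add: sum.remove)
      also have "\<dots> \<le> - real m + 0" by (intro add_mono elim sum_nonpos h0)
      finally have "v * (\<Sum>i<k. h m (z i)) \<le> v * (- real m)" using v by (intro mult_left_mono) auto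
      then show ?case by simp
    qed
    have "(\<lambda>m. exp (- v * real m)) \<longlonglongrightarrow> 0"
    proof -
      have "(\<lambda>m. exp (- v) ^ m) \<longlonglongrightarrow> 0" using v by (intro LIMSEQ_realpow_zero) auto
      then show ?thesis by (simp add: exp_of_nat_mult[symmetric] mult.commute)
    qed
    from Lim_null_comparison[OF up this] show ?thesis unfolding if_not_P[OF False] .
  qed
  have le: "\<bar>exp (v * (\<Sum>i<k. h m (z i)))\<bar> \<le> 1" if "v > 0" for v k z m
  proof -
    have "v * (\<Sum>i<k. h m (z i)) \<le> 0" using that h0 by (intro mult_nonneg_nonpos sum_nonpos) auto
    then show ?thesis by simp
  qed
  have "agree \<mu> \<nu> c (\<lambda>x. indicator {x. \<forall>i<n. y x i \<in> T} x) (\<lambda>x. indicator {x. \<forall>i<n'. y' x i \<in> T} x)"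
  proof (rule agree_lim[OF match_exp[OF ch h0]])
    show "(\<lambda>m. exp (w * (\<Sum>i<n. h m (y x i)))) \<longlonglongrightarrow> indicator {x. \<forall>i<n. y x i \<in> T} x" for x
      unfolding indicator_def mem_Collect_eq of_bool_def by (rule lim[OF w(1) y(1)])
    show "(\<lambda>m. exp (w' * (\<Sum>i<n'. h m (y' x i)))) \<longlonglongrightarrow> indicator {x. \<forall>i<n'. y' x i \<in> T} x" for x
      unfolding indicator_def mem_Collect_eq of_bool_def by (rule lim[OF w(2) y(2)])
  qed (rule const_integrable le w)+
  then have a: "integrable \<mu> (indicator {x. \<forall>i<n. y x i \<in> T} :: _ \<Rightarrow> real)" "integrable \<nu> (indicator {x. \<forall>i<n'. y' x i \<in> T} :: _ \<Rightarrow> real)"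
    "c * integral\<^sup>L \<mu> (indicator {x. \<forall>i<n. y x i \<in> T}) = integral\<^sup>L \<nu> (indicator {x. \<forall>i<n'. y' x i \<in> T})"
    by (auto simp: agree_def)
  have i1: "{x. \<forall>i<n. y x i \<in> T} \<inter> space \<mu> = {x \<in> space \<mu>. \<forall>i<n. y x i \<in> T}" by auto
  have i2: "{x. \<forall>i<n'. y' x i \<in> T} \<inter> space \<nu> = {x \<in> space \<nu>. \<forall>i<n'. y' x i \<in> T}" by auto
  show "{x \<in> space \<mu>. \<forall>i<n. y x i \<in> T} \<in> sets \<mu>"
    using borel_measurable_integrable[OF a(1)] unfolding borel_measurable_indicator_iff i1 .
  show "c * measure \<mu> {x \<in> space \<mu>. \<forall>i<n. y x i \<in> T} = measure \<nu> {x \<in> space \<nu>. \<forall>i<n'. y' x i \<in> T}"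
    using a(3) by (simp add: Bochner_Integration.integral_indicator i1 i2)
qed

text \<open>The last region tolerates points at 0. It is needed because the smallest positive
  eigenvalue ignores zero eigenvalues.\<close>

lemma match_gap:
  shows "{x \<in> space \<mu>. \<forall>i<n. y x i \<in> {\<tau><..}} \<in> sets \<mu>"
    and "c * measure \<mu> {x \<in> space \<mu>. \<forall>i<n. y x i \<in> {\<tau><..}} = measure \<nu> {x \<in> space \<nu>. \<forall>i<n'. y' x i \<in> {\<tau><..}}"
    and "{x \<in> space \<mu>. \<forall>i<n. y x i \<in> {..0} \<union> {\<tau><..}} \<in> sets \<mu>"
proof -
  \<comment> \<open>For m > 0, g is 1 up to \<tau> and falls to 0 within distance 1/m, while f is 0
    on the nonpositive reals and 1 from 1/m on. Multiplied by - m these become the test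
    functions.\<close>
  define g where "g m u = max 0 (min 1 (1 + m * (\<tau> - u)))" for m u :: real
  define f where "f m u = max 0 (min 1 (m * u))" for m u :: real
  have far: "\<forall>\<^sub>F m in sequentially. 1 < real m * d" if "d > 0" for d :: real
  proof -
    obtain m0 :: nat where m0: "1 / d < real m0" using reals_Archimedean2 by blast
    have "1 < real m * d" if "m \<ge> m0" for m
    proof -
      have "1 / d < real m" using m0 that by linarith
      then show ?thesis using \<open>d > 0\<close> by (simp add: field_simps)
    qed
    then show ?thesis unfolding eventually_sequentially by blast
  qed
  have g0: "\<forall>\<^sub>F m in sequentially. g (real m) u = 0" if "\<tau> < u" for u
  proof -
    have "\<forall>\<^sub>F m in sequentially. 1 < real m * (u - \<tau>)" by (rule far) (use that in simp)
    then show ?thesis by eventually_elim (simp add: g_def algebra_simps)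
  qed
  have g1: "g (real m) u = 1" if "u \<le> \<tau>" for m u
    using mult_nonneg_nonneg[of "real m" "\<tau> - u"] that by (simp add: g_def)
  have f1: "\<forall>\<^sub>F m in sequentially. f (real m) u = 1" if "0 < u" for u
    using far[OF that] by eventually_elim (simp add: f_def)
  have fg: "0 \<le> f m u" "0 \<le> g m u" for m u by (auto simp: f_def g_def)
  have cg: "continuous_on {0..} (\<lambda>u. - real m * g (real m) u)" "continuous_on {0..} (\<lambda>u. - real m * (f (real m) u * g (real m) u))" for m
    unfolding g_def f_def by (intro continuous_intros)+
  note r = match_region[where h = "\<lambda>m u. - real m * g (real m) u" and T = "{\<tau><..}"]
  show "{x \<in> space \<mu>. \<forall>i<n. y x i \<in> {\<tau><..}} \<in> sets \<mu>"
    by (rule r(1)[OF cg(1)]) (auto intro: eventually_mono[OF g0] simp: fg g1 mult_nonneg_nonneg)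
  show "c * measure \<mu> {x \<in> space \<mu>. \<forall>i<n. y x i \<in> {\<tau><..}} = measure \<nu> {x \<in> space \<nu>. \<forall>i<n'. y' x i \<in> {\<tau><..}}"
    by (rule r(2)[OF cg(1)]) (auto intro: eventually_mono[OF g0] simp: fg g1 mult_nonneg_nonneg)
  show "{x \<in> space \<mu>. \<forall>i<n. y x i \<in> {..0} \<union> {\<tau><..}} \<in> sets \<mu>"
  proof (rule match_region(1)[OF cg(2)])
    fix u :: real assume u: "0 \<le> u" "u \<in> {..0} \<union> {\<tau><..}"
    show "\<forall>\<^sub>F m in sequentially. - real m * (f (real m) u * g (real m) u) = 0"
    proof (cases "u = 0")
      case False
      then have "\<tau> < u" using u by auto
      from g0[OF this] show ?thesis by eventually_elim simp
    qed (simp add: f_def)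
  next
    fix u :: real assume u: "0 \<le> u" "u \<notin> {..0} \<union> {\<tau><..}"
    then have "0 < u" "u \<le> \<tau>" by auto
    from f1[OF this(1)] show "\<forall>\<^sub>F m in sequentially. - real m * (f (real m) u * g (real m) u) \<le> - real m"
      by eventually_elim (simp add: g1[OF \<open>u \<le> \<tau>\<close>])
  qed (simp add: fg mult_nonneg_nonneg)
qed

end

section \<open>Exponential weights as a change of the Gaussian parameter\<close>

lemma gauss_tilt:
  assumes "s \<ge> 0"
  shows "gauss (1 + s) = density (gauss 1) (\<lambda>x. ennreal (sqrt (1 + s) * exp (- s * x\<^sup>2)))"
proof -
  have "sqrt ((1 + s) / pi) * exp (- (1 + s) * x\<^sup>2) = (sqrt (1 / pi) * exp (- 1 * x\<^sup>2)) * (sqrt (1 + s) * exp (- s * x\<^sup>2))" for x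
    by (simp add: real_sqrt_divide exp_add[symmetric] algebra_simps)
  then show ?thesis
    unfolding gauss_def by (subst density_density_eq) (auto simp: ennreal_mult[symmetric] assms)
qed

lemma gaussn_tilt:
  assumes I: "finite I" and s: "s \<ge> 0"
  shows "gaussn (1 + s) I = density (gaussn 1 I) (\<lambda>x. ennreal (\<Prod>e\<in>I. sqrt (1 + s) * exp (- s * (x e)\<^sup>2)))"
    (is "_ = ?D")
proof -
  interpret g: product_sigma_finite "\<lambda>_. gauss (1 + s)" by (rule product_sigma_finite_gauss) (use s in simp)
  interpret h: product_sigma_finite "\<lambda>_. gauss 1" by (rule product_sigma_finite_gauss) simp
  let ?g = "\<lambda>u. ennreal (sqrt (1 + s) * exp (- s * u\<^sup>2))"
  have "?D = gaussn (1 + s) I"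
  proof (rule g.PiM_eqI[OF I])
    show "sets ?D = sets (gaussn (1 + s) I)" by (simp add: sets_gaussn)
  next
    fix A assume "\<And>i. i \<in> I \<Longrightarrow> A i \<in> sets (gauss (1 + s))"
    then have A[measurable]: "\<And>i. i \<in> I \<Longrightarrow> A i \<in> sets borel" by simp
    have meas: "(\<lambda>x. ennreal (\<Prod>e\<in>I. sqrt (1 + s) * exp (- s * (x e)\<^sup>2))) \<in> borel_measurable (gaussn 1 I)"
      by measurable
    have sP: "Pi\<^sub>E I A \<in> sets (gaussn 1 I)" by (intro sets_PiM_I_finite I) (use A in auto)
    have "emeasure ?D (Pi\<^sub>E I A) = (\<integral>\<^sup>+x. ennreal (\<Prod>e\<in>I. sqrt (1 + s) * exp (- s * (x e)\<^sup>2)) * indicator (Pi\<^sub>E I A) x \<partial>gaussn 1 I)"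
      by (rule emeasure_density[OF meas sP])
    also have "\<dots> = (\<integral>\<^sup>+x. (\<Prod>e\<in>I. ?g (x e) * indicator (A e) (x e)) \<partial>gaussn 1 I)"
    proof (rule nn_integral_cong)
      fix x assume "x \<in> space (gaussn 1 I)"
      then have x: "x \<in> extensional I" by (auto simp: space_PiM PiE_def)
      have "indicator (Pi\<^sub>E I A) x = (\<Prod>e\<in>I. indicator (A e) (x e) :: ennreal)"
      proof (cases "x \<in> Pi\<^sub>E I A")
        case False
        then obtain e where "e \<in> I" "x e \<notin> A e" using x by (auto simp: PiE_def Pi_def)
        then have "(\<Prod>e\<in>I. indicator (A e) (x e) :: ennreal) = 0" using I by (intro prod_zero bexI[of _ e]) auto
        then show ?thesis using False by simp
      qed (auto simp: PiE_def Pi_def)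
      then show "ennreal (\<Prod>e\<in>I. sqrt (1 + s) * exp (- s * (x e)\<^sup>2)) * indicator (Pi\<^sub>E I A) x = (\<Prod>e\<in>I. ?g (x e) * indicator (A e) (x e))"
        using s by (simp add: prod.distrib prod_ennreal del: prod_constant)
    qed
    also have "\<dots> = (\<Prod>e\<in>I. \<integral>\<^sup>+u. ?g u * indicator (A e) u \<partial>gauss 1)"
      by (rule h.product_nn_integral_prod[OF I]) (use A in measurable)
    also have "\<dots> = (\<Prod>e\<in>I. emeasure (gauss (1 + s)) (A e))"
      unfolding gauss_tilt[OF s] by (intro prod.cong refl emeasure_density[symmetric]) (use A in auto)
    finally show "emeasure ?D (Pi\<^sub>E I A) = (\<Prod>e\<in>I. emeasure (gauss (1 + s)) (A e))" .
  qed
  then show ?thesis by simp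
qed

lemma gaussn_tilt_integral:
  assumes I: "finite I" and s: "s \<ge> 0" and f: "f \<in> borel_measurable (gaussn 1 I)"
  shows "integral\<^sup>L (gaussn (1 + s) I) f = sqrt (1 + s) ^ card I * (\<integral>x. f x * exp (- s * (\<Sum>e\<in>I. (x e)\<^sup>2)) \<partial>gaussn 1 I)"
proof -
  have "(\<Prod>e\<in>I. sqrt (1 + s) * exp (- s * (x e)\<^sup>2)) = sqrt (1 + s) ^ card I * exp (- s * (\<Sum>e\<in>I. (x e)\<^sup>2))" for x
    using I by (simp add: prod.distrib exp_sum[symmetric] sum_distrib_left)
  then have "integral\<^sup>L (gaussn (1 + s) I) f = (\<integral>x. (sqrt (1 + s) ^ card I * exp (- s * (\<Sum>e\<in>I. (x e)\<^sup>2))) *\<^sub>R f x \<partial>gaussn 1 I)"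
    unfolding gaussn_tilt[OF I s] by (subst integral_density) (use f s in \<open>auto intro!: AE_I2 prod_nonneg\<close>)
  also have "\<dots> = (\<integral>x. sqrt (1 + s) ^ card I * (f x * exp (- s * (\<Sum>e\<in>I. (x e)\<^sup>2))) \<partial>gaussn 1 I)"
    by (intro Bochner_Integration.integral_cong refl) (simp add: mult_ac)
  finally show ?thesis by simp
qed

text \<open>The number of matrix entries, split to match the other ensemble: tilting k points gives
  k factors sqrt (1 + s), and the Vandermonde normalization scales with exponent k (k - 1) in 1 +
  s.\<close>

lemma card_prs: "card (prs (2 * k)) = k + 2 * (k * (k - 1))"
proof -
  have "2 * card (prs n) + n = n * n" for n
  proof (induction n)
    case (Suc n)
    have inj: "inj_on (\<lambda>i. (i, n)) {..<n}" by (auto intro: inj_onI)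
    have "card (prs (Suc n)) = card (prs n) + n"
      unfolding prs_Suc by (subst card_Un_disjoint) (simp_all add: card_image[OF inj], auto simp: prs_def)
    then show ?case using Suc by simp
  qed (simp add: prs_def)
  from this[of "2 * k"] show ?thesis by (cases k) (auto simp: algebra_simps)
qed

text \<open>The first power sum is the squared norm of the entries, so exp (- s p) is itself a
  Gaussian weight and tilting only changes b.\<close>

lemma mpsum_one: "mpsum N x 1 = (\<Sum>p\<in>prs N. (x p)\<^sup>2)"
proof -
  have m1: "mpow N A 1 i j = A i j" if "i < N" "j < N" for i j and A :: "nat \<Rightarrow> nat \<Rightarrow> real"
    using mpow_Suc_right[OF that, of A 0] that by (simp add: if_distrib[of "\<lambda>a. a * _"] cong: if_cong)
  have "mtr N (skewm x) 2 = (\<Sum>i<N. \<Sum>j<N. skewm x i j * mpow N (skewm x) 1 j i)"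
    by (simp add: mtr_def numeral_2_eq_2)
  also have "\<dots> = (\<Sum>i<N. \<Sum>j<N. - (skewm x i j)\<^sup>2)"
  proof (intro sum.cong refl)
    fix i j assume "i \<in> {..<N}" "j \<in> {..<N}"
    then show "skewm x i j * mpow N (skewm x) 1 j i = - (skewm x i j)\<^sup>2"
      using m1[of j i "skewm x"] skewm_swap[of x j i] by (simp add: power2_eq_square)
  qed
  also have "\<dots> = 2 * (\<Sum>(i, j)\<in>prs N. - (skewm x i j)\<^sup>2) + (\<Sum>i<N. - (skewm x i i)\<^sup>2)"
    by (rule sum_prs) (simp add: skewm_def)
  also have "\<dots> = - 2 * (\<Sum>p\<in>prs N. (x p)\<^sup>2)"
    by (auto simp: skewm_def prs_def sum_negf[symmetric] intro!: sum.cong)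
  finally show ?thesis by (simp add: mpsum_def)
qed

lemma loop_eq_cmult: "loop_eq b \<kappa> e \<Longrightarrow> loop_eq b \<kappa> (\<lambda>ls. a * e ls)"
proof -
  have sl: "(\<Sum>(c, l')\<leftarrow>xs. c * (a * e l')) = a * (\<Sum>(c, l')\<leftarrow>xs. c * e l')" for xs :: "(real \<times> nat list) list"
    by (induction xs) (auto simp: algebra_simps)
  assume "loop_eq b \<kappa> e"
  then have 1: "e (0 # ls) = \<kappa> * e ls" and 2: "b * e (Suc m # ls) = (\<Sum>a\<le>m. e (a # (m - a) # ls)) - e (m # ls) / 2 + (\<Sum>(c, l')\<leftarrow>join_terms m ls. c * e l')" for m ls
    by (auto simp: loop_eq_def)
  show ?thesis unfolding loop_eq_def sl sum_distrib_left[symmetric] mult.left_commute[of b] 2 1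
    by (simp add: algebra_simps)
qed

text \<open>For b = 1 + s both functionals satisfy the loop equations with the same value k of the
  power sum of order 0, so they are proportional with the factor seen at \<open>[]\<close>. Undoing
  the tilt produces the same power of 1 + s on both sides.\<close>

lemma moments_match:
  "agree (gaussn 1 (prs (2 * k))) (density (gaussn 1 {..<k}) (\<lambda>x. ennreal (vdm2 k x))) (\<integral>x. vdm2 k x \<partial>gaussn 1 {..<k})
     (\<lambda>x. PL (mpsum (2 * k) x) ls * exp (- real s * mpsum (2 * k) x 1)) (\<lambda>x. PL (psum k x) ls * exp (- real s * psum k x 1))"
proof -
  let ?Z = "\<lambda>b. \<integral>x. vdm2 k x \<partial>gaussn b {..<k}" and ?r = "sqrt (1 + real s)"
  let ?b = "1 + real s"
  have v0: "0 \<le> vdm2 k x" for x unfolding vdm2_def by (intro prod_nonneg) auto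
  have b: "?b > 0" by simp
  have mv: "vdm2 k \<in> borel_measurable (gaussn 1 {..<k})" by (rule polyfun_measurable_gaussn[OF polyfun_vdm2])
  have pM: "polyfun (prs (2 * k)) (\<lambda>x. PL (mpsum (2 * k) x) ls)" by (intro polyfun_PL polyfun_mpsum)
  have pV: "polyfun {..<k} (\<lambda>x. vdm2 k x * PL (psum k x) ls)" by (intro polyfun_mult polyfun_vdm2 polyfun_PL polyfun_psum)
  have mp: "(\<lambda>x. PL (psum k x) ls) \<in> borel_measurable (gaussn 1 {..<k})" by (rule polyfun_measurable_gaussn) (intro polyfun_PL polyfun_psum)
  have mp1: "(\<lambda>x. psum k x 1) \<in> borel_measurable (gaussn 1 {..<k})" by (rule polyfun_measurable_gaussn) (rule polyfun_psum)
  have mm1: "(\<lambda>x. mpsum (2 * k) x 1) \<in> borel_measurable (gaussn 1 (prs (2 * k)))" by (rule polyfun_measurable_gaussn) (rule polyfun_mpsum)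
  have mm: "(\<lambda>x. PL (mpsum (2 * k) x) ls) \<in> borel_measurable (gaussn 1 (prs (2 * k)))" by (rule polyfun_measurable_gaussn[OF pM])
  have p1: "psum k x 1 = (\<Sum>i\<in>{..<k}. (x i)\<^sup>2)" for x by (simp add: psum_def)
  have le: "\<bar>a * exp (- real s * u)\<bar> \<le> \<bar>a\<bar>" if "u \<ge> 0" for a u :: real
    using that by (simp add: abs_mult mult_left_le)
  have i1: "integrable (gaussn 1 (prs (2 * k))) (\<lambda>x. PL (mpsum (2 * k) x) ls * exp (- real s * mpsum (2 * k) x 1))"
  proof (rule Bochner_Integration.integrable_bound[OF polyfun_integrable[OF pM]])
    show "(\<lambda>x. PL (mpsum (2 * k) x) ls * exp (- real s * mpsum (2 * k) x 1)) \<in> borel_measurable (gaussn 1 (prs (2 * k)))"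
      using mm mm1 by measurable
    show "AE x in gaussn 1 (prs (2 * k)). norm (PL (mpsum (2 * k) x) ls * exp (- real s * mpsum (2 * k) x 1)) \<le> norm (PL (mpsum (2 * k) x) ls)"
      unfolding real_norm_def by (intro AE_I2 le) (simp only: mpsum_one sum_nonneg zero_le_power2)
  qed auto
  have i2': "integrable (gaussn 1 {..<k}) (\<lambda>x. vdm2 k x * PL (psum k x) ls * exp (- real s * psum k x 1))"
  proof (rule Bochner_Integration.integrable_bound[OF polyfun_integrable[OF pV]])
    show "(\<lambda>x. vdm2 k x * PL (psum k x) ls * exp (- real s * psum k x 1)) \<in> borel_measurable (gaussn 1 {..<k})"
      using mp mp1 mv by measurable
    show "AE x in gaussn 1 {..<k}. norm (vdm2 k x * PL (psum k x) ls * exp (- real s * psum k x 1)) \<le> norm (vdm2 k x * PL (psum k x) ls)"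
      unfolding real_norm_def by (intro AE_I2 le) (simp only: p1 sum_nonneg zero_le_power2)
  qed auto
  have i2: "integrable (density (gaussn 1 {..<k}) (\<lambda>x. ennreal (vdm2 k x))) (\<lambda>x. PL (psum k x) ls * exp (- real s * psum k x 1))"
    by (subst integrable_density) (use i2' mp mp1 mv v0 in \<open>auto simp: mult.assoc\<close>)
  have e2: "integral\<^sup>L (density (gaussn 1 {..<k}) (\<lambda>x. ennreal (vdm2 k x))) (\<lambda>x. PL (psum k x) ls * exp (- real s * psum k x 1))
     = (\<integral>x. vdm2 k x * PL (psum k x) ls * exp (- real s * psum k x 1) \<partial>gaussn 1 {..<k})"
    by (subst integral_density) (use mp mp1 mv v0 in \<open>auto simp: mult.assoc\<close>)
  have uniq: "?Z ?b * (\<integral>x. PL (mpsum (2 * k) x) ls \<partial>gaussn ?b (prs (2 * k))) = (\<integral>x. vdm2 k x * PL (psum k x) ls \<partial>gaussn ?b {..<k})"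
  proof -
    have 1: "loop_eq ?b (real (2 * k) / 2) (\<lambda>ls. \<integral>x. vdm2 k x * PL (psum k x) ls \<partial>gaussn ?b {..<k})"
      using vdm2_loop[OF b, of k] by simp
    have 2: "?Z ?b * (\<integral>x. PL (mpsum (2 * k) x) [] \<partial>gaussn ?b (prs (2 * k))) = (\<integral>x. vdm2 k x * PL (psum k x) [] \<partial>gaussn ?b {..<k})"
      using prob_space.prob_space[OF prob_space_gaussn[OF b, of "prs (2 * k)"]] by simp
    show ?thesis using loop_eq_unique[OF loop_eq_cmult[OF mat_loop[OF b, of "2 * k"]] 1 _ 2] b by simp
  qed
  have t1: "(\<integral>x. PL (mpsum (2 * k) x) ls \<partial>gaussn ?b (prs (2 * k))) = ?r ^ (k + 2 * (k * (k - 1))) * (\<integral>x. PL (mpsum (2 * k) x) ls * exp (- real s * mpsum (2 * k) x 1) \<partial>gaussn 1 (prs (2 * k)))"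
    by (subst gaussn_tilt_integral) (simp_all add: mm card_prs mpsum_one[unfolded One_nat_def])
  have t2: "(\<integral>x. vdm2 k x * PL (psum k x) ls \<partial>gaussn ?b {..<k}) = ?r ^ k * (\<integral>x. vdm2 k x * PL (psum k x) ls * exp (- real s * psum k x 1) \<partial>gaussn 1 {..<k})"
    by (subst gaussn_tilt_integral) (simp_all add: mp mv p1[unfolded One_nat_def] borel_measurable_times)
  have rr: "?r ^ (k + 2 * (k * (k - 1))) = ?r ^ k * ?b ^ (k * (k - 1))"
    by (simp add: power_add power_mult)
  have "?r ^ k \<noteq> 0" "?b ^ (k * (k - 1)) \<noteq> 0" using b by auto
  then have "?Z 1 * (\<integral>x. PL (mpsum (2 * k) x) ls * exp (- real s * mpsum (2 * k) x 1) \<partial>gaussn 1 (prs (2 * k)))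
     = (\<integral>x. vdm2 k x * PL (psum k x) ls * exp (- real s * psum k x 1) \<partial>gaussn 1 {..<k})"
    using uniq unfolding t1 t2 rr vdm2_scale[OF b, of k] by (simp add: field_simps)
  then show ?thesis unfolding agree_def e2 using i1 i2 by simp
qed

section \<open>Gap probabilities of the spectrum as Hankel determinants\<close>

definition hmom :: "nat \<Rightarrow> real \<Rightarrow> real" where
  "hmom n t = (\<integral>u. indicator {t<..} u * (u ^ (2 * n) * exp (- u\<^sup>2)) \<partial>lborel)"

lemma integrable_gauss_lborel: "integrable lborel (\<lambda>u::real. u ^ n * exp (- u\<^sup>2))"
proof -
  have "integrable lborel (\<lambda>u::real. sqrt (1 / pi) * (u ^ n * exp (- u\<^sup>2)))"
    using integrable_gauss_power[of 1 n, simplified] unfolding gauss_def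
    by (subst (asm) integrable_density) (auto simp: mult_ac)
  from integrable_mult_right[OF this, of "sqrt pi"] show ?thesis by (simp add: real_sqrt_divide)
qed

text \<open>The two tails of the even integrand fold onto (t, \<infinity>), whence the 2; sqrt pi is
  the normalization of \<open>gauss 1\<close>.\<close>

lemma gauss_tail_moment:
  assumes t: "t \<ge> 0"
  shows "(\<integral>u. u ^ (2 * n) * indicator {u. t\<^sup>2 < u\<^sup>2} u \<partial>gauss 1) = 2 / sqrt pi * hmom n t"
proof -
  have iff: "t\<^sup>2 < u\<^sup>2 \<longleftrightarrow> t < \<bar>u\<bar>" for u using t by (metis abs_of_nonneg power2_abs power2_less_imp_less abs_ge_zero power_strict_mono zero_less_numeral)
  let ?f = "\<lambda>u. indicator {t<..} u * (u ^ (2 * n) * exp (- u\<^sup>2)) :: real"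
  have i1: "integrable lborel ?f"
    by (rule integrable_real_mult_indicator[unfolded mult.commute[of _ "indicator _ _"]]) (auto simp: integrable_gauss_lborel)
  have i2: "integrable lborel (\<lambda>u. ?f (- u))"
    using lborel_integrable_real_affine[OF i1, of "-1" 0] by simp
  have eq2: "(\<integral>u. ?f (- u) \<partial>lborel) = hmom n t"
    using lborel_integral_real_affine[of "-1" ?f 0] by (simp add: hmom_def)
  have "(\<integral>u. u ^ (2 * n) * indicator {u. t\<^sup>2 < u\<^sup>2} u \<partial>gauss 1) = (\<integral>u. (sqrt (1 / pi) * exp (- u\<^sup>2)) *\<^sub>R (u ^ (2 * n) * indicator {u. t\<^sup>2 < u\<^sup>2} u) \<partial>lborel)"
    unfolding gauss_def by (subst integral_density) auto
  also have "\<dots> = (\<integral>u. sqrt (1 / pi) * (?f u + ?f (- u)) \<partial>lborel)"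
    by (intro Bochner_Integration.integral_cong refl) (use t in \<open>auto simp: iff indicator_def abs_if mult_ac\<close>)
  also have "\<dots> = sqrt (1 / pi) * (hmom n t + hmom n t)"
    using i1 i2 eq2 by (simp add: hmom_def)
  finally show ?thesis by (simp add: real_sqrt_divide)
qed

definition hdet :: "nat \<Rightarrow> real \<Rightarrow> real" where
  "hdet k t = det (mat k k (\<lambda>(i, j). hmom (i + j) t))"

text \<open>A pointwise choice of the spectrum, without any claim that it depends measurably on x.
  Events about it become measurable through \<open>moment_match\<close>.\<close>

definition spec :: "nat \<Rightarrow> (nat \<times> nat \<Rightarrow> real) \<Rightarrow> real list" where
  "spec N x = (SOME hs. length hs = N \<and> (\<forall>m. 2 * mpsum N x m = (\<Sum>h\<leftarrow>hs. h ^ (2 * m))) \<and>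
     (\<forall>lam. is_eigenvalue N (herm x) lam \<longleftrightarrow> lam \<in> set hs))"

lemma spec: "length (spec N x) = N" "2 * mpsum N x m = (\<Sum>h\<leftarrow>spec N x. h ^ (2 * m))"
  "is_eigenvalue N (herm x) lam \<longleftrightarrow> lam \<in> set (spec N x)"
proof -
  have "\<exists>hs. length hs = N \<and> (\<forall>m. 2 * mpsum N x m = (\<Sum>h\<leftarrow>hs. h ^ (2 * m))) \<and>
     (\<forall>lam. is_eigenvalue N (herm x) lam \<longleftrightarrow> lam \<in> set hs)" using herm_spectrum[of N x] by metis
  from someI_ex[OF this] show "length (spec N x) = N" "2 * mpsum N x m = (\<Sum>h\<leftarrow>spec N x. h ^ (2 * m))"
  "is_eigenvalue N (herm x) lam \<longleftrightarrow> lam \<in> set (spec N x)" unfolding spec_def by blast+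
qed

lemma vdm_measure_gap:
  assumes t: "t \<ge> 0"
  shows "measure (density (gaussn 1 {..<k}) (\<lambda>x. ennreal (vdm2 k x))) {x \<in> space (density (gaussn 1 {..<k}) (\<lambda>x. ennreal (vdm2 k x))). \<forall>i<k. t\<^sup>2 < (x i)\<^sup>2}
     = fact k * (2 / sqrt pi) ^ k * hdet k t"
proof -
  let ?\<nu> = "density (gaussn 1 {..<k}) (\<lambda>x. ennreal (vdm2 k x))"
  let ?A = "{x \<in> space ?\<nu>. \<forall>i<k. t\<^sup>2 < (x i)\<^sup>2}"
  have v0: "0 \<le> vdm2 k x" for x unfolding vdm2_def by (intro prod_nonneg) auto
  have mv: "vdm2 k \<in> borel_measurable (gaussn 1 {..<k})" by (rule polyfun_measurable_gaussn[OF polyfun_vdm2])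
  have A: "?A \<in> sets (gaussn 1 {..<k})" by simp
  have "measure ?\<nu> ?A = (\<integral>x. indicator ?A x \<partial>?\<nu>)" by (subst Bochner_Integration.integral_indicator) auto
  also have "\<dots> = (\<integral>x. vdm2 k x *\<^sub>R indicator ?A x \<partial>gaussn 1 {..<k})"
    by (rule integral_density) (use mv v0 A in auto)
  also have "\<dots> = (\<integral>x. vdm2 k x * (\<Prod>i<k. indicator {u. t\<^sup>2 < u\<^sup>2} (x i)) \<partial>gaussn 1 {..<k})"
  proof (intro Bochner_Integration.integral_cong refl)
    fix x assume x: "x \<in> space (gaussn 1 {..<k})"
    show "vdm2 k x *\<^sub>R indicator ?A x = vdm2 k x * (\<Prod>i<k. indicator {u. t\<^sup>2 < u\<^sup>2} (x i))"
    proof (cases "\<forall>i<k. t\<^sup>2 < (x i)\<^sup>2")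
      case False
      then obtain i where "i < k" "\<not> t\<^sup>2 < (x i)\<^sup>2" by blast
      then have "(\<Prod>i<k. indicator {u. t\<^sup>2 < u\<^sup>2} (x i)) = (0::real)" by (intro prod_zero bexI[of _ i]) auto
      then show ?thesis using False by (simp add: indicator_def)
    qed (use x in \<open>simp add: indicator_def\<close>)
  qed
  also have "\<dots> = fact k * det (mat k k (\<lambda>(i, j). \<integral>u. u ^ (2 * (i + j)) * indicator {u. t\<^sup>2 < u\<^sup>2} u \<partial>gauss 1))"
    by (rule vdm2_prod(2)) (auto simp: indicator_def)
  also have "\<dots> = fact k * det (mat k k (\<lambda>(i, j). (2 / sqrt pi) * hmom (i + j) t))"
    unfolding gauss_tail_moment[OF t] ..
  also have "mat k k (\<lambda>(i, j). (2 / sqrt pi) * hmom (i + j) t) = (2 / sqrt pi) \<cdot>\<^sub>m mat k k (\<lambda>(i, j). hmom (i + j) t)"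
    by (rule eq_matI) auto
  also have "det \<dots> = (2 / sqrt pi) ^ k * hdet k t" by (simp add: hdet_def)
  finally show ?thesis by simp
qed

text \<open>\<open>moment_match\<close> is interpreted with the squared eigenvalues at weight 1/2
  against the squared coordinates at weight 1; the threshold is then t^2.\<close>

lemma skew_gap:
  assumes t: "t \<ge> 0" and h0: "hdet k 0 \<noteq> 0"
  defines "A \<equiv> \<lambda>t. {x \<in> space (gaussn 1 (prs (2 * k))). \<forall>h\<in>set (spec (2 * k) x). t < \<bar>h\<bar>}"
    and "A' \<equiv> {x \<in> space (gaussn 1 (prs (2 * k))). \<forall>h\<in>set (spec (2 * k) x). h = 0 \<or> t < \<bar>h\<bar>}"
  shows "A t \<in> sets (gaussn 1 (prs (2 * k)))" "A' \<in> sets (gaussn 1 (prs (2 * k)))" "measure (gaussn 1 (prs (2 * k))) (A t) = hdet k t / hdet k 0"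
proof -
  let ?\<mu> = "gaussn 1 (prs (2 * k))" and ?\<nu> = "density (gaussn 1 {..<k}) (\<lambda>x. ennreal (vdm2 k x))"
  let ?Z = "\<integral>x. vdm2 k x \<partial>gaussn 1 {..<k}"
  let ?y = "\<lambda>x i. (spec (2 * k) x ! i)\<^sup>2" and ?y' = "\<lambda>x i. (x i)\<^sup>2 :: real"
  have p: "pws (1 / 2) (2 * k) (?y x) = mpsum (2 * k) x" for x
  proof
    fix m
    have "2 * mpsum (2 * k) x m = (\<Sum>i<2*k. (spec (2 * k) x ! i) ^ (2 * m))"
      unfolding spec(2) by (simp add: sum_list_sum_nth spec(1) lessThan_atLeast0)
    then show "pws (1 / 2) (2 * k) (?y x) m = mpsum (2 * k) x m" by (simp add: pws_def power_mult)
  qed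
  have p': "pws 1 k (?y' x) = psum k x" for x by (simp add: fun_eq_iff pws_def psum_def power_mult)
  have v0: "0 \<le> vdm2 k x" for x unfolding vdm2_def by (intro prod_nonneg) auto
  have "moment_match ?\<mu> (2 * k) (1 / 2) ?y ?\<nu> k 1 ?y' ?Z"
  proof (rule moment_match.intro)
    show "finite_measure ?\<mu>" by (rule prob_space.axioms(1)[OF prob_space_gaussn]) simp
    have "integrable ?\<nu> (\<lambda>x. 1 :: real)"
      using moments_match[of k "[]" 0] by (simp add: agree_def)
    then have "emeasure ?\<nu> (space ?\<nu>) < \<infinity>" unfolding integrable_iff_bounded by simp
    then show "finite_measure ?\<nu>" by (intro finite_measureI) auto
    show "integrable ?\<mu> (\<lambda>x. PL (pws (1 / 2) (2 * k) (?y x)) ls)" "integrable ?\<nu> (\<lambda>x. PL (pws 1 k (?y' x)) ls)" for ls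
      using moments_match[of k ls 0] unfolding p p' by (simp_all add: agree_def)
    show "agree ?\<mu> ?\<nu> ?Z (\<lambda>x. PL (pws (1 / 2) (2 * k) (?y x)) ls * exp (- real s * pws (1 / 2) (2 * k) (?y x) 1))
        (\<lambda>x. PL (pws 1 k (?y' x)) ls * exp (- real s * pws 1 k (?y' x) 1))" for ls s
      unfolding p p' by (rule moments_match)
  qed auto
  then interpret mm: moment_match ?\<mu> "2 * k" "1 / 2" ?y ?\<nu> k 1 ?y' ?Z .
  have iff: "t\<^sup>2 < h\<^sup>2 \<longleftrightarrow> t < \<bar>h\<bar>" for h :: real
    using t by (metis abs_of_nonneg power2_abs power2_less_imp_less abs_ge_zero power_strict_mono zero_less_numeral)
  have A: "A t = {x \<in> space ?\<mu>. \<forall>i<2*k. ?y x i \<in> {t\<^sup>2<..}}"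
    using iff unfolding A_def by (auto simp: all_set_conv_all_nth spec(1))
  have A': "A' = {x \<in> space ?\<mu>. \<forall>i<2*k. ?y x i \<in> {..0} \<union> {t\<^sup>2<..}}"
    using iff unfolding A'_def by (auto simp: all_set_conv_all_nth spec(1))
  show "A' \<in> sets ?\<mu>" unfolding A' by (rule mm.match_gap(3))
  show "A t \<in> sets ?\<mu>" unfolding A by (rule mm.match_gap(1))
  have Z: "?Z = fact k * (2 / sqrt pi) ^ k * hdet k 0"
  proof -
    have hm: "(\<integral>u. u ^ (2 * n) \<partial>gauss 1) = 2 / sqrt pi * hmom n 0" for n
    proof -
      have "AE u in gauss 1. u \<noteq> 0"
        unfolding gauss_def by (subst AE_density) (auto intro: AE_mp[OF AE_lborel_singleton])
      then have "(\<integral>u. u ^ (2 * n) \<partial>gauss 1) = (\<integral>u. u ^ (2 * n) * indicator {u. 0\<^sup>2 < u\<^sup>2} u \<partial>gauss 1)"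
        by (intro integral_cong_AE) (auto elim!: eventually_mono)
      then show ?thesis using gauss_tail_moment[of 0 n] by simp
    qed
    have "?Z = fact k * det (mat k k (\<lambda>(i, j). (2 / sqrt pi) * hmom (i + j) 0))"
      using vdm2_prod(2)[of 1 "\<lambda>_. 1" k] unfolding hm[symmetric] by simp
    also have "mat k k (\<lambda>(i, j). (2 / sqrt pi) * hmom (i + j) 0) = (2 / sqrt pi) \<cdot>\<^sub>m mat k k (\<lambda>(i, j). hmom (i + j) 0)"
      by (rule eq_matI) auto
    also have "det \<dots> = (2 / sqrt pi) ^ k * hdet k 0" by (simp add: hdet_def)
    finally show ?thesis by simp
  qed
  have "?Z * measure ?\<mu> (A t) = fact k * (2 / sqrt pi) ^ k * hdet k t"
    unfolding A mm.match_gap(2) using vdm_measure_gap[OF t, of k] by simp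
  then show "measure ?\<mu> (A t) = hdet k t / hdet k 0" unfolding Z using h0 by (simp add: field_simps)
qed

section \<open>From the Gaussian matrix to the law of \<open>TFS\<close>\<close>

definition skew_part :: "nat \<Rightarrow> (nat \<times> nat \<Rightarrow> real) \<Rightarrow> nat \<times> nat \<Rightarrow> real" where
  "skew_part N Y = (\<lambda>e\<in>prs N. (Y e - Y (prod.swap e)) / 2)"

text \<open>Half the difference of two independent standard normals has variance 1/2, which is
  \<open>gauss 1\<close>. Different pairs i < j involve disjoint sets of entries, hence
  independence.\<close>

lemma skew_part_law:
  assumes g: "real_gaussian_matrix P N Y" and N: "N \<ge> 2"
  shows "(\<lambda>\<omega>. skew_part N (Y \<omega>)) \<in> measurable P (gaussn 1 (prs N))"
    and "distr P (gaussn 1 (prs N)) (\<lambda>\<omega>. skew_part N (Y \<omega>)) = gaussn 1 (prs N)"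
proof -
  interpret prob_space P using g by (simp add: real_gaussian_matrix_def)
  let ?S = "{..<N} \<times> {..<N}"
  have ind: "indep_vars (\<lambda>_. borel) (\<lambda>e \<omega>. Y \<omega> e) ?S"
    and d: "\<And>e. e \<in> ?S \<Longrightarrow> distributed P lborel (\<lambda>\<omega>. Y \<omega> e) (\<lambda>x. ennreal (std_normal_density x))"
    using g by (auto simp: real_gaussian_matrix_def)
  \<comment> \<open>With the sign moved into \<open>Z\<close>, the entry \<open>X e\<close> is the
    plain sum of \<open>Z e\<close> and \<open>Z (prod.swap e)\<close>, the form required for adding
    independent normals.\<close>
  define sg where "sg e = (if fst e < snd e then 1 / 2 else - 1 / 2 :: real)" for e :: "nat \<times> nat"
  define Z where "Z e \<omega> = sg e * Y \<omega> e" for e \<omega>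
  define X where "X e \<omega> = (Y \<omega> e - Y \<omega> (prod.swap e)) / 2" for e \<omega>
  have indZ: "indep_vars (\<lambda>_. borel) Z ?S"
    using indep_vars_compose2[OF ind, of "\<lambda>e u. sg e * u" "\<lambda>_. borel"] by (simp add: Z_def[abs_def])
  have dZ: "distributed P lborel (Z e) (\<lambda>x. ennreal (normal_density 0 (1 / 2) x))" if "e \<in> ?S" for e
  proof -
    have s: "sg e \<noteq> 0" "\<bar>sg e\<bar> = 1 / 2" by (auto simp: sg_def)
    have "distributed P lborel (Z e) (\<lambda>x. ennreal (normal_density 0 \<bar>sg e\<bar> x))"
      using normal_density_affine[OF d[OF that], of "sg e" 0] s(1) by (simp add: Z_def[abs_def])
    then show ?thesis unfolding s(2) .
  qed
  have K: "{e, prod.swap e} \<subseteq> ?S" if "e \<in> prs N" for e using that by (auto simp: prs_def)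
  have XZ: "X e = (\<lambda>\<omega>. \<Sum>e'\<in>{e, prod.swap e}. Z e' \<omega>)" if "e \<in> prs N" for e
  proof -
    have "e \<noteq> prod.swap e" using that by (auto simp: prs_def)
    then show ?thesis using that by (auto simp: X_def Z_def sg_def prs_def fun_eq_iff)
  qed
  have dX: "distributed P lborel (X e) (\<lambda>x. ennreal (normal_density 0 (sqrt (1 / 2)) x))" if e: "e \<in> prs N" for e
  proof -
    have ne: "e \<noteq> prod.swap e" using e by (auto simp: prs_def)
    have "distributed P lborel (\<lambda>\<omega>. \<Sum>e'\<in>{e, prod.swap e}. Z e' \<omega>)
        (normal_density (\<Sum>e'\<in>{e, prod.swap e}. 0) (sqrt (\<Sum>e'\<in>{e, prod.swap e}. (1 / 2)\<^sup>2)))"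
      by (rule sum_indep_normal) (use K[OF e] in \<open>auto intro!: indep_vars_subset[OF indZ] dZ\<close>)
    then show ?thesis unfolding XZ[OF e] using ne by (simp add: power2_eq_square)
  qed
  have rv: "X e \<in> borel_measurable P" if "e \<in> prs N" for e
    using distributed_measurable[OF dX[OF that]] by simp
  have lawX: "distr P borel (X e) = gauss 1" if "e \<in> prs N" for e
  proof -
    have "distr P borel (X e) = distr P lborel (X e)" by (rule distr_cong) auto
    also have "\<dots> = gauss 1" unfolding distributed_distr_eq_density[OF dX[OF that]] by (simp add: gauss_eq_normal)
    finally show ?thesis .
  qed
  have "indep_vars (\<lambda>e. borel) (\<lambda>e \<omega>. (\<lambda>z. (z e - z (prod.swap e)) / 2) (restrict (\<lambda>i. Y \<omega> i) {e, prod.swap e})) (prs N)"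
  proof (rule indep_vars_compose2[OF indep_vars_restrict[OF ind]])
    show "{e, prod.swap e} \<subseteq> ?S" if "e \<in> prs N" for e by (rule K[OF that])
    show "disjoint_family_on (\<lambda>e. {e, prod.swap e}) (prs N)" by (auto simp: disjoint_family_on_def prs_def)
    show "(\<lambda>z. (z e - z (prod.swap e)) / 2) \<in> borel_measurable (Pi\<^sub>M {e, prod.swap e} (\<lambda>_. borel :: real measure))" for e :: "nat \<times> nat"
      by measurable
  qed
  then have indX: "indep_vars (\<lambda>_. borel) X (prs N)"
    by (rule indep_vars_cong[THEN iffD1, rotated -1]) (auto simp: X_def)
  have "(0, 1) \<in> prs N" using N by (simp add: prs_def)
  then have ne: "prs N \<noteq> {}" by blast
  have "distr P (Pi\<^sub>M (prs N) (\<lambda>_. borel)) (\<lambda>\<omega>. \<lambda>e\<in>prs N. X e \<omega>) = Pi\<^sub>M (prs N) (\<lambda>e. distr P borel (X e))"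
    using indep_vars_iff_distr_eq_PiM'[OF ne rv] indX by simp
  also have "\<dots> = gaussn 1 (prs N)" by (intro PiM_cong lawX refl)
  finally have law: "distr P (Pi\<^sub>M (prs N) (\<lambda>_. borel)) (\<lambda>\<omega>. \<lambda>e\<in>prs N. X e \<omega>) = gaussn 1 (prs N)" .
  have eq: "(\<lambda>\<omega>. skew_part N (Y \<omega>)) = (\<lambda>\<omega>. \<lambda>e\<in>prs N. X e \<omega>)" by (simp add: skew_part_def X_def)
  have "(\<lambda>\<omega>. \<lambda>e\<in>prs N. X e \<omega>) \<in> measurable P (Pi\<^sub>M (prs N) (\<lambda>_. borel))" by (intro measurable_restrict rv)
  then show "(\<lambda>\<omega>. skew_part N (Y \<omega>)) \<in> measurable P (gaussn 1 (prs N))"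
    unfolding eq by (simp cong: measurable_cong_sets add: measurable_cong_sets[OF refl sets_gaussn])
  show "distr P (gaussn 1 (prs N)) (\<lambda>\<omega>. skew_part N (Y \<omega>)) = gaussn 1 (prs N)"
    unfolding eq law[symmetric] by (rule distr_cong) (simp_all add: law sets_gaussn)
qed

lemma aGUE_herm: "i < N \<Longrightarrow> j < N \<Longrightarrow> aGUE Y i j = herm (skew_part N Y) i j"
  by (cases i j rule: linorder_cases) (auto simp: aGUE_def herm_def skewm_def skew_part_def prs_def, simp add: algebra_simps)

lemma is_eigenvalue_aGUE: "is_eigenvalue N (aGUE Y) lam \<longleftrightarrow> lam \<in> set (spec N (skew_part N Y))"
proof -
  have "is_eigenvalue N (aGUE Y) lam \<longleftrightarrow> is_eigenvalue N (herm (skew_part N Y)) lam"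
    unfolding is_eigenvalue_def by (intro ex_cong1 conj_cong refl all_cong) (simp add: aGUE_herm)
  then show ?thesis by (simp add: spec(3))
qed

text \<open>The matrix is i times a real one, so conjugating an eigenvector negates its
  eigenvalue.\<close>

lemma spec_uminus: 
  assumes "lam \<in> set (spec N x)" shows "- lam \<in> set (spec N x)"
proof -
  from assms obtain v where v: "\<exists>i<N. v i \<noteq> 0" "\<And>i. i < N \<Longrightarrow> (\<Sum>j<N. herm x i j * v j) = complex_of_real lam * v i"
    unfolding spec(3)[symmetric] is_eigenvalue_def by blast
  have h: "herm x i j = - cnj (herm x i j)" for i j by (simp add: herm_def)
  have "(\<Sum>j<N. herm x i j * cnj (v j)) = complex_of_real (- lam) * cnj (v i)" if "i < N" for i
  proof -
    have "(\<Sum>j<N. herm x i j * cnj (v j)) = - cnj (\<Sum>j<N. herm x i j * v j)"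
      by (subst h) (simp add: sum_negf)
    then show ?thesis using v(2)[OF that] by simp
  qed
  then show ?thesis using v(1) unfolding spec(3)[symmetric] is_eigenvalue_def
    by (intro exI[of _ "\<lambda>i. cnj (v i)"]) auto
qed

text \<open>Almost surely no eigenvalue is 0. Then the symmetry of the spectrum provides a positive
  eigenvalue, and the smallest one exceeds t exactly when all absolute values do.\<close>

theorem TFS_law:
  assumes g: "real_gaussian_matrix P (2 * k) Y" and k: "k \<ge> 1" and t: "t > 0" and h0: "hdet k 0 \<noteq> 0"
  shows "measure P {\<omega> \<in> space P. TFS k (Y \<omega>) > t} = hdet k t / hdet k 0"
proof -
  interpret prob_space P using g by (simp add: real_gaussian_matrix_def)
  let ?N = "2 * k" and ?G = "gaussn 1 (prs (2 * k))"
  let ?X = "\<lambda>\<omega>. skew_part ?N (Y \<omega>)"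
  have N: "2 \<le> ?N" using k by simp
  note law = skew_part_law[OF g N]
  define sp where "sp \<omega> = set (spec ?N (?X \<omega>))" for \<omega>
  define B where "B s = {\<omega> \<in> space P. \<forall>h\<in>sp \<omega>. s < \<bar>h\<bar>}" for s :: real
  define C where "C = {\<omega> \<in> space P. \<forall>h\<in>sp \<omega>. h = 0 \<or> t < \<bar>h\<bar>}"
  have Xs: "?X \<omega> \<in> space ?G" if "\<omega> \<in> space P" for \<omega> using measurable_space[OF law(1) that] .
  have B: "B s \<in> events" "prob (B s) = hdet k s / hdet k 0" if "s \<ge> 0" for s
  proof -
    let ?A = "{x \<in> space ?G. \<forall>h\<in>set (spec ?N x). s < \<bar>h\<bar>}"
    have e: "B s = ?X -` ?A \<inter> space P" using Xs by (auto simp: B_def sp_def)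
    note a = skew_gap[OF that h0]
    show "B s \<in> events" unfolding e by (rule measurable_sets[OF law(1) a(1)])
    have "prob (B s) = measure (distr P ?G ?X) ?A" unfolding e by (rule measure_distr[OF law(1) a(1), symmetric])
    then show "prob (B s) = hdet k s / hdet k 0" unfolding law(2) a(3) .
  qed
  have C: "C \<in> events"
  proof -
    have "C = ?X -` {x \<in> space ?G. \<forall>h\<in>set (spec ?N x). h = 0 \<or> t < \<bar>h\<bar>} \<inter> space P" using Xs by (auto simp: C_def sp_def)
    then show ?thesis using measurable_sets[OF law(1) skew_gap(2)[OF _ h0, of t]] t by simp
  qed
  have TFS: "TFS k (Y \<omega>) = Inf {h \<in> sp \<omega>. h > 0}" for \<omega>
    unfolding TFS_def is_eigenvalue_aGUE sp_def by (rule arg_cong[of _ _ Inf]) auto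
  have sym: "- h \<in> sp \<omega>" if "h \<in> sp \<omega>" for h \<omega> using spec_uminus that unfolding sp_def by blast
  have fin: "finite (sp \<omega>)" for \<omega> by (simp add: sp_def)
  have nonempty: "{h \<in> sp \<omega>. h > 0} \<noteq> {}" if "h \<in> sp \<omega>" "h \<noteq> 0" for h \<omega>
  proof (cases "h > 0")
    case True then show ?thesis using that by blast
  next
    case False
    then have "- h \<in> {h \<in> sp \<omega>. h > 0}" using that sym[OF that(1)] by simp
    then show ?thesis by blast
  qed
  have iff: "TFS k (Y \<omega>) > t \<longleftrightarrow> (\<forall>h\<in>sp \<omega>. h = 0 \<or> t < \<bar>h\<bar>)" if "h \<in> sp \<omega>" "h \<noteq> 0" for h \<omega>
  proof -
    note ne = nonempty[OF that]
    have "Inf {h \<in> sp \<omega>. h > 0} = Min {h \<in> sp \<omega>. h > 0}" by (rule cInf_eq_Min) (use fin ne in auto)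
    then have "TFS k (Y \<omega>) > t \<longleftrightarrow> (\<forall>h\<in>sp \<omega>. h > 0 \<longrightarrow> t < h)"
      unfolding TFS using fin[of \<omega>] ne by (subst (asm) refl) (auto simp: Min_gr_iff)
    also have "\<dots> \<longleftrightarrow> (\<forall>h\<in>sp \<omega>. h = 0 \<or> t < \<bar>h\<bar>)"
    proof safe
      fix h assume a: "\<forall>h\<in>sp \<omega>. h > 0 \<longrightarrow> t < h" "h \<in> sp \<omega>" "\<not> t < \<bar>h\<bar>"
      show "h = 0" using a(1)[rule_format, OF a(2)] a(1)[rule_format, OF sym[OF a(2)]] a(3) by (cases h "0::real" rule: linorder_cases) auto
    qed (use t in force)
    finally show ?thesis .
  qed
  \<comment> \<open>If all eigenvalues are 0, then \<open>TFS\<close> is the fixed real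
    \<open>Inf {}\<close>. This event is split off so that measurability holds whatever that number
    is.\<close>
  define O0 where "O0 = {\<omega> \<in> space P. \<forall>h\<in>sp \<omega>. h = 0}"
  have O0: "O0 \<in> events"
  proof -
    have "O0 = {\<omega> \<in> space P. mpsum ?N (?X \<omega>) 1 = 0}"
    proof -
      have "mpsum ?N (?X \<omega>) 1 = 0 \<longleftrightarrow> (\<forall>h\<in>sp \<omega>. h = 0)" for \<omega>
      proof -
        have 1: "mpsum ?N (?X \<omega>) 1 = (\<Sum>h\<leftarrow>spec ?N (?X \<omega>). h\<^sup>2) / 2" using spec(2)[of ?N "?X \<omega>" 1] by simp
        have 2: "(\<Sum>h\<leftarrow>hs. h\<^sup>2) = 0 \<longleftrightarrow> (\<forall>h\<in>set hs. h = 0)" for hs :: "real list"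
          by (subst sum_list_nonneg_eq_0_iff) auto
        show ?thesis unfolding 1 sp_def divide_eq_0_iff 2 by simp
      qed
      then show ?thesis by (simp add: O0_def)
    qed
    moreover have "(\<lambda>\<omega>. mpsum ?N (?X \<omega>) 1) \<in> borel_measurable P"
      by (rule measurable_compose[OF law(1) polyfun_measurable_gaussn[OF polyfun_mpsum]])
    ultimately show ?thesis by simp
  qed
  let ?S = "{\<omega> \<in> space P. TFS k (Y \<omega>) > t}"
  have const: "TFS k (Y \<omega>) = Inf {}" if "\<omega> \<in> O0" for \<omega>
    unfolding TFS using that by (auto simp: O0_def intro!: arg_cong[of _ _ Inf])
  have "?S = (C - O0) \<union> (if Inf {} > t then O0 else {})"
  proof (rule Set.set_eqI)
    fix \<omega>
    show "\<omega> \<in> ?S \<longleftrightarrow> \<omega> \<in> (C - O0) \<union> (if Inf {} > t then O0 else {})"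
    proof (cases "\<omega> \<in> O0")
      case True then show ?thesis using const[OF True] by (auto simp: O0_def)
    next
      case False
      then show ?thesis using iff[of _ \<omega>] by (auto simp: O0_def C_def)
    qed
  qed
  then have S: "?S \<in> events" using C O0 by simp
  \<comment> \<open>That 0 is almost surely no eigenvalue is the case t = 0 of the gap formula: the
    quotient is then 1.\<close>
  have B0: "prob (B 0) = 1" using B(2)[of 0] h0 by simp
  have "AE \<omega> in P. \<omega> \<in> B 0" using AE_in_set_eq_1[OF B(1)[of 0]] B0 by simp
  moreover have "\<omega> \<in> ?S \<longleftrightarrow> \<omega> \<in> B t" if "\<omega> \<in> B 0" for \<omega>
  proof -
    have "sp \<omega> \<noteq> {}" unfolding sp_def using spec(1)[of ?N "?X \<omega>"] N by auto
    then obtain h where h: "h \<in> sp \<omega>" by blast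
    moreover have "h \<noteq> 0" using that h by (auto simp: B_def)
    ultimately show ?thesis using iff[of h \<omega>] that by (auto simp: B_def)
  qed
  ultimately have "prob ?S = prob (B t)"
    by (intro finite_measure_eq_AE S B) (use t in \<open>auto elim: eventually_mono\<close>)
  then show ?thesis using B(2)[of t] t by simp
qed

section \<open>A two-level determinant factorization\<close>

lemma det_block_lower:
  fixes f :: "nat \<Rightarrow> nat \<Rightarrow> 'a :: idom"
  assumes "\<And>i j. i < p \<Longrightarrow> p \<le> j \<Longrightarrow> j < p + m \<Longrightarrow> f i j = 0"
  shows "det (mat (p + m) (p + m) (\<lambda>(i, j). f i j)) = det (mat p p (\<lambda>(i, j). f i j)) * det (mat m m (\<lambda>(i, j). f (p + i) (p + j)))"
proof -
  have "mat (p + m) (p + m) (\<lambda>(i, j). f i j) = four_block_mat (mat p p (\<lambda>(i, j). f i j)) (0\<^sub>m p m)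
     (mat m p (\<lambda>(i, j). f (p + i) j)) (mat m m (\<lambda>(i, j). f (p + i) (p + j)))"
    by (rule eq_matI) (auto simp: assms)
  also have "det \<dots> = det (mat p p (\<lambda>(i, j). f i j)) * det (mat m m (\<lambda>(i, j). f (p + i) (p + j)))"
    by (rule det_four_block_mat_upper_right_zero) auto
  finally show ?thesis .
qed

lemma det_col_perm:
  fixes f :: "nat \<Rightarrow> nat \<Rightarrow> 'a :: comm_ring_1"
  assumes "\<pi> permutes {..<n}"
  shows "det (mat n n (\<lambda>(i, j). f i (\<pi> j))) = of_int (sign \<pi>) * det (mat n n (\<lambda>(i, j). f i j))"
proof -
  have pm: "permutation \<pi>" using assms permutation_permutes by blast
  have s: "of_int (sign \<pi>) * of_int (sign (\<pi> \<circ> p)) = (of_int (sign p) :: 'a)" if "p permutes {..<n}" for p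
  proof -
    have "permutation p" using that permutation_permutes by blast
    then have "sign (\<pi> \<circ> p) = sign \<pi> * sign p" by (rule sign_compose[OF pm])
    moreover have "sign \<pi> * (sign \<pi> * sign p) = sign p" by (simp add: sign_def)
    ultimately have "sign \<pi> * sign (\<pi> \<circ> p) = sign p" by simp
    then show ?thesis by (metis of_int_mult)
  qed
  have "det (mat n n (\<lambda>(i, j). f i (\<pi> j))) = (\<Sum>p | p permutes {..<n}. of_int (sign p) * (\<Prod>i<n. f i ((\<pi> \<circ> p) i)))"
    unfolding det_leibniz by simp
  also have "\<dots> = (\<Sum>p | p permutes {..<n}. of_int (sign \<pi>) * of_int (sign (\<pi> \<circ> p)) * (\<Prod>i<n. f i ((\<pi> \<circ> p) i)))"
    by (intro sum.cong refl) (simp add: s)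
  also have "\<dots> = (\<Sum>p | p permutes {..<n}. of_int (sign \<pi>) * of_int (sign p) * (\<Prod>i<n. f i (p i)))"
    by (rule sum.reindex_bij_witness[of _ "\<lambda>p. Hilbert_Choice.inv \<pi> \<circ> p" "\<lambda>p. \<pi> \<circ> p"])
       (auto simp: o_assoc permutes_inv_o[OF assms] intro!: permutes_compose assms permutes_inv)
  finally show ?thesis unfolding det_leibniz sum_distrib_left by (simp add: mult.assoc)
qed

text \<open>The three diagonal blocks appear after a Schur complement and a permutation of the columns of
  the bordered matrix of order \<open>3p + 2\<close> with rows (x, y, v) and columns (x, y, v).\<close>
lemma det_two_level:
  fixes p :: nat
  obtains \<epsilon> :: complex where "\<epsilon> = 1 \<or> \<epsilon> = -1"
    "\<And>La Lb l0 Ra Rb Ph. 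
      det (mat (p + (p + 1)) (p + (p + 1)) (\<lambda>(i, j).
         (if p \<le> i \<and> j < p then Ph (i - p) j else 0) +
         (\<Sum>v<p. (if i < p then La v i else Lb v (i - p)) * (if j < p then Ra v j else Rb v (j - p))) +
         (if i < p then 0 else l0) * (if j < p then Ra p j else Rb p (j - p))))
      = \<epsilon> * det (mat p p (\<lambda>(i, v). La v i)) * det (mat (p + 1) (p + 1) (\<lambda>(l, i). if i < p then Ph l i else l0))
        * det (mat (p + 1) (p + 1) (\<lambda>(v, l). Rb v l :: complex))"
proof -
  define n where "n = p + (p + 1)"
  define N where "N = n + (p + 1)"
  \<comment> \<open>New order of the columns: the first p border columns, the p columns x, the last
    border column, the p + 1 columns y. Against the rows x, y, v this is block lower triangular with
    diagonal blocks \<open>La\<close>, (\<open>Ph\<close>, \<open>l0\<close>) and \<open>Rb\<close>;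
    the entries \<open>Lb\<close> and \<open>Ra\<close> end up below the diagonal.\<close>
  define \<pi> where "\<pi> c = (if c < p then n + c else if c < 2 * p then c - p else if c = 2 * p then n + p else if c < N then c - p - 1 else c)" for c
  have \<pi>: "\<pi> permutes {..<N}"
  proof (rule bij_imp_permutes)
    show "bij_betw \<pi> {..<N} {..<N}"
    proof (rule bij_betwI[where g = "\<lambda>c. if c < p then c + p else if c < n then c + p + 1 else if c < n + p then c - n else 2 * p"])
      show "\<pi> \<in> {..<N} \<rightarrow> {..<N}" by (auto simp: \<pi>_def N_def n_def)
      show "(\<lambda>c. if c < p then c + p else if c < n then c + p + 1 else if c < n + p then c - n else 2 * p) \<in> {..<N} \<rightarrow> {..<N}"
        by (auto simp: N_def n_def)
    qed (auto simp: \<pi>_def N_def n_def)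
    show "\<pi> x = x" if "x \<notin> {..<N}" for x using that by (auto simp: \<pi>_def N_def n_def)
  qed
  define \<epsilon> :: complex where "\<epsilon> = (-1) ^ (p + 1) * of_int (sign \<pi>)"
  have \<epsilon>: "\<epsilon> = 1 \<or> \<epsilon> = -1" unfolding \<epsilon>_def sign_def by (cases "even (p + 1)") auto
  show thesis
  proof (rule that[OF \<epsilon>])
    fix La Lb :: "nat \<Rightarrow> nat \<Rightarrow> complex" and l0 :: complex and Ra Rb Ph :: "nat \<Rightarrow> nat \<Rightarrow> complex"
    define L where "L i v = (if v < p then (if i < p then La v i else Lb v (i - p)) else if i < p then 0 else l0)" for i v
    define R where "R v j = (if j < p then Ra v j else Rb v (j - p))" for v j
    define H where "H i j = (if p \<le> i \<and> j < p then Ph (i - p) j else 0)" for i j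
    define K where "K i j = H i j + (\<Sum>v<p+1. L i v * R v j)" for i j
    have Keq: "(if p \<le> i \<and> j < p then Ph (i - p) j else 0) +
         (\<Sum>v<p. (if i < p then La v i else Lb v (i - p)) * (if j < p then Ra v j else Rb v (j - p))) +
         (if i < p then 0 else l0) * (if j < p then Ra p j else Rb p (j - p)) = K i j" for i j
      by (simp add: K_def H_def L_def R_def)
    \<comment> \<open>The border has - 1 on its diagonal. Multiplication by the unipotent
      \<open>U\<close> adds \<open>L\<close> times the border rows to the upper rows, which cancels
      \<open>L\<close> there and turns \<open>H\<close> into \<open>K\<close>.\<close>
    define G where "G i j = (if i < n then (if j < n then H i j else L i (j - n)) else (if j < n then R (i - n) j else if i = j then -1 else 0))" for i j
    define U where "U i j = (if i = j then 1 else if i < n \<and> n \<le> j then L i (j - n) else 0)" for i j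
    define S where "S i j = (if i < n then (if j < n then K i j else 0) else G i j)" for i j
    have "mat N N (\<lambda>(i, j). U i j) * mat N N (\<lambda>(i, j). G i j) = mat N N (\<lambda>(i, j). S i j)"
    proof (rule eq_matI)
      fix i j assume "i < dim_row (mat N N (\<lambda>(i, j). S i j))" "j < dim_col (mat N N (\<lambda>(i, j). S i j))"
      then have ij: "i < N" "j < N" by auto
      have "(mat N N (\<lambda>(i, j). U i j) * mat N N (\<lambda>(i, j). G i j)) $$ (i, j) = (\<Sum>l<N. U i l * G l j)"
        using ij by (simp add: scalar_prod_def lessThan_atLeast0)
      also have "\<dots> = S i j"
      proof (cases "i < n")
        case False
        have "(\<Sum>l<N. U i l * G l j) = (\<Sum>l<N. if l = i then G i j else 0)"
          using False by (intro sum.cong) (auto simp: U_def)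
        then show ?thesis using ij False by (simp add: S_def)
      next
        case True
        have "(\<Sum>l<N. U i l * G l j) = (\<Sum>l<n. U i l * G l j) + (\<Sum>l=n..<N. U i l * G l j)"
          unfolding lessThan_atLeast0 by (rule sum.atLeastLessThan_concat[symmetric]) (auto simp: N_def)
        also have "(\<Sum>l<n. U i l * G l j) = (\<Sum>l<n. if l = i then G i j else 0)"
          using True by (intro sum.cong) (auto simp: U_def)
        also have "\<dots> = G i j" using True by simp
        also have "(\<Sum>l=n..<N. U i l * G l j) = (\<Sum>v<p+1. L i v * G (n + v) j)"
          by (rule sum.reindex_bij_witness[of _ "\<lambda>v. n + v" "\<lambda>l. l - n"]) (use True in \<open>auto simp: N_def U_def\<close>)
        also have "G i j + (\<Sum>v<p+1. L i v * G (n + v) j) = S i j"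
        proof (cases "j < n")
          case jn: True
          then show ?thesis using True by (simp add: S_def K_def G_def)
        next
          case jn: False
          have "(\<Sum>v<p+1. L i v * G (n + v) j) = (\<Sum>v<p+1. if v = j - n then - L i (j - n) else 0)"
            using jn by (intro sum.cong) (auto simp: G_def)
          also have "\<dots> = - L i (j - n)" using ij jn by (simp only: sum.delta finite_lessThan) (auto simp: N_def)
          finally show ?thesis using True jn by (simp add: S_def G_def)
        qed
        finally show ?thesis .
      qed
      finally show "(mat N N (\<lambda>(i, j). U i j) * mat N N (\<lambda>(i, j). G i j)) $$ (i, j) = mat N N (\<lambda>(i, j). S i j) $$ (i, j)"
        using ij by simp
    qed auto
    moreover have "det (mat N N (\<lambda>(i, j). U i j)) = 1"
    proof -
      have "det (mat N N (\<lambda>(i, j). U i j)) = prod_list (diag_mat (mat N N (\<lambda>(i, j). U i j)))"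
        by (rule det_upper_triangular[of _ N]) (auto simp: upper_triangular_def U_def)
      also have "diag_mat (mat N N (\<lambda>(i, j). U i j)) = map (\<lambda>_. 1) [0..<N]"
        unfolding diag_mat_def by (auto simp: U_def)
      finally show ?thesis by (simp add: map_replicate_const prod_list_replicate)
    qed
    moreover have "det (mat N N (\<lambda>(i, j). U i j) * mat N N (\<lambda>(i, j). G i j)) = det (mat N N (\<lambda>(i, j). U i j)) * det (mat N N (\<lambda>(i, j). G i j))"
      by (rule det_mult[of _ N]) auto
    ultimately have "det (mat N N (\<lambda>(i, j). G i j)) = det (mat N N (\<lambda>(i, j). S i j))" by simp
    also have "\<dots> = det (mat n n (\<lambda>(i, j). S i j)) * det (mat (p + 1) (p + 1) (\<lambda>(i, j). S (n + i) (n + j)))"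
      unfolding N_def by (rule det_block_lower) (auto simp: S_def)
    also have "mat n n (\<lambda>(i, j). S i j) = mat n n (\<lambda>(i, j). K i j)" by (rule cong_mat) (auto simp: S_def)
    also have "mat (p + 1) (p + 1) (\<lambda>(i, j). S (n + i) (n + j)) = (-1) \<cdot>\<^sub>m 1\<^sub>m (p + 1)"
      by (rule eq_matI) (auto simp: S_def G_def)
    also have "det ((-1) \<cdot>\<^sub>m 1\<^sub>m (p + 1)) = (-1 :: complex) ^ (p + 1)" by simp
    finally have GK: "det (mat N N (\<lambda>(i, j). G i j)) = det (mat n n (\<lambda>(i, j). K i j)) * (-1) ^ (p + 1)" .
    have perm: "of_int (sign \<pi>) * det (mat N N (\<lambda>(i, j). G i j)) = det (mat N N (\<lambda>(i, j). G i (\<pi> j)))"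
      by (rule det_col_perm[OF \<pi>, symmetric])
    have NN: "N = p + (p + 1 + (p + 1))" by (simp add: N_def n_def)
    have "det (mat (p + (p + 1 + (p + 1))) (p + (p + 1 + (p + 1))) (\<lambda>(i, j). G i (\<pi> j))) = det (mat p p (\<lambda>(i, j). G i (\<pi> j)))
       * det (mat (p + 1 + (p + 1)) (p + 1 + (p + 1)) (\<lambda>(i, j). G (p + i) (\<pi> (p + j))))"
      by (rule det_block_lower) (auto simp: G_def H_def L_def \<pi>_def N_def n_def)
    also have "det (mat (p + 1 + (p + 1)) (p + 1 + (p + 1)) (\<lambda>(i, j). G (p + i) (\<pi> (p + j)))) =
       det (mat (p + 1) (p + 1) (\<lambda>(i, j). G (p + i) (\<pi> (p + j)))) * det (mat (p + 1) (p + 1) (\<lambda>(i, j). G (p + (p + 1 + i)) (\<pi> (p + (p + 1 + j)))))"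
      by (rule det_block_lower) (auto simp: G_def H_def L_def \<pi>_def N_def n_def)
    also have "mat p p (\<lambda>(i, j). G i (\<pi> j)) = mat p p (\<lambda>(i, v). La v i)"
      by (rule cong_mat) (auto simp: G_def H_def L_def \<pi>_def N_def n_def)
    also have "mat (p + 1) (p + 1) (\<lambda>(i, j). G (p + i) (\<pi> (p + j))) = mat (p + 1) (p + 1) (\<lambda>(l, i). if i < p then Ph l i else l0)"
      by (rule cong_mat) (auto simp: G_def H_def L_def \<pi>_def N_def n_def)
    also have "mat (p + 1) (p + 1) (\<lambda>(i, j). G (p + (p + 1 + i)) (\<pi> (p + (p + 1 + j)))) = mat (p + 1) (p + 1) (\<lambda>(v, l). Rb v l)"
      by (rule cong_mat) (auto simp: G_def H_def R_def \<pi>_def N_def n_def)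
    finally have prod: "det (mat N N (\<lambda>(i, j). G i (\<pi> j))) =
       det (mat p p (\<lambda>(i, v). La v i)) * (det (mat (p + 1) (p + 1) (\<lambda>(l, i). if i < p then Ph l i else l0)) * det (mat (p + 1) (p + 1) (\<lambda>(v, l). Rb v l)))"
      unfolding NN .
    have sg: "\<epsilon> * \<epsilon> = 1" using \<epsilon> by auto
    have "det (mat n n (\<lambda>(i, j). K i j)) = \<epsilon> * (\<epsilon> * det (mat n n (\<lambda>(i, j). K i j)))"
      unfolding mult.assoc[symmetric] sg by simp
    also have "\<epsilon> * det (mat n n (\<lambda>(i, j). K i j)) = of_int (sign \<pi>) * det (mat N N (\<lambda>(i, j). G i j))"
      unfolding GK \<epsilon>_def by (simp only: mult_ac)
    finally have "det (mat n n (\<lambda>(i, j). K i j)) = \<epsilon> * (det (mat p p (\<lambda>(i, v). La v i)) *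
       (det (mat (p + 1) (p + 1) (\<lambda>(l, i). if i < p then Ph l i else l0)) * det (mat (p + 1) (p + 1) (\<lambda>(v, l). Rb v l))))"
      unfolding perm prod .
    then show "det (mat (p + (p + 1)) (p + (p + 1)) (\<lambda>(i, j).
         (if p \<le> i \<and> j < p then Ph (i - p) j else 0) +
         (\<Sum>v<p. (if i < p then La v i else Lb v (i - p)) * (if j < p then Ra v j else Rb v (j - p))) +
         (if i < p then 0 else l0) * (if j < p then Ra p j else Rb p (j - p))))
      = \<epsilon> * det (mat p p (\<lambda>(i, v). La v i)) * det (mat (p + 1) (p + 1) (\<lambda>(l, i). if i < p then Ph l i else l0))
        * det (mat (p + 1) (p + 1) (\<lambda>(v, l). Rb v l))"
      unfolding Keq n_def[symmetric] by (simp only: mult.assoc)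
  qed
qed

section \<open>Hankel determinants of truncated Gaussian moments\<close>

lemma hmom_zero_gauss: "(\<integral>u. u ^ (2 * n) \<partial>gauss 1) = 2 / sqrt pi * hmom n 0"
proof -
  have "AE u in gauss 1. u \<noteq> 0"
    unfolding gauss_def by (subst AE_density) (auto intro: AE_mp[OF AE_lborel_singleton])
  then have "(\<integral>u. u ^ (2 * n) \<partial>gauss 1) = (\<integral>u. u ^ (2 * n) * indicator {u. 0\<^sup>2 < u\<^sup>2} u \<partial>gauss 1)"
    by (intro integral_cong_AE) (auto elim!: eventually_mono)
  then show ?thesis using gauss_tail_moment[of 0 n] by simp
qed

lemma hmom_0: "hmom 0 0 = sqrt pi / 2"
  using hmom_zero_gauss[of 0] prob_space.prob_space[OF prob_space_gauss[of 1]] by simp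

lemma hmom_Suc: "hmom (Suc n) 0 = (real n + 1 / 2) * hmom n 0"
proof -
  have "2 * (\<integral>u. u ^ (2 * Suc n) \<partial>gauss 1) = real (2 * n + 1) * (\<integral>u. u ^ (2 * n) \<partial>gauss 1)"
    using gauss_moment_step[of 1 "2 * n + 1"] by simp
  then show ?thesis unfolding hmom_zero_gauss by (simp add: field_simps)
qed

lemma DERIV_hmom: "((\<lambda>t. hmom n t) has_real_derivative - (t ^ (2 * n) * exp (- t\<^sup>2))) (at t)"
proof -
  let ?h = "\<lambda>u::real. u ^ (2 * n) * exp (- u\<^sup>2)"
  have int: "integrable lborel (\<lambda>u. indicator S u * ?h u)" if "S \<in> sets borel" for S
    using integrable_real_mult_indicator[OF _ integrable_gauss_lborel, of S] that by (simp add: mult.commute)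
  \<comment> \<open>Starting from the base point t - 1 makes t interior to the interval, so that the
    derivative of the indefinite integral is two-sided.\<close>
  have eq: "hmom n s = hmom n (t - 1) - integral {t - 1..s} ?h" if "t - 1 \<le> s" for s
  proof -
    have "hmom n (t - 1) = (\<integral>u. indicator {t-1<..s} u * ?h u + indicator {s<..} u * ?h u \<partial>lborel)"
      unfolding hmom_def by (intro Bochner_Integration.integral_cong refl) (use that in \<open>auto simp: indicator_def\<close>)
    also have "\<dots> = (\<integral>u. indicator {t-1<..s} u * ?h u \<partial>lborel) + hmom n s"
      unfolding hmom_def by (rule Bochner_Integration.integral_add) (auto intro: int)
    also have "(\<integral>u. indicator {t-1<..s} u * ?h u \<partial>lborel) = (\<integral>u. indicator {t-1..s} u *\<^sub>R ?h u \<partial>lborel)"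
    proof (rule integral_cong_AE)
      have "AE u in lborel. u \<noteq> t - 1" by (rule AE_lborel_singleton)
      then show "AE u in lborel. indicator {t-1<..s} u * ?h u = indicator {t-1..s} u *\<^sub>R ?h u"
        by eventually_elim (auto simp: indicator_def)
    qed auto
    also have "\<dots> = integral {t - 1..s} ?h"
      using set_borel_integral_eq_integral(2)[of "{t-1..s}" ?h] int[of "{t-1..s}"]
      by (simp add: set_lebesgue_integral_def set_integrable_def)
    finally show ?thesis by simp
  qed
  have "((\<lambda>s. integral {t - 1..s} ?h) has_real_derivative ?h t) (at t within {t - 1..t + 1})"
    by (rule integral_has_real_derivative) (auto intro!: continuous_intros)
  then have "((\<lambda>s. integral {t - 1..s} ?h) has_real_derivative ?h t) (at t)"
    by (subst (asm) at_within_Icc_at) auto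
  then have "((\<lambda>s. hmom n (t - 1) - integral {t - 1..s} ?h) has_real_derivative - ?h t) (at t)"
    by (auto intro!: derivative_eq_intros)
  moreover have "\<forall>\<^sub>F s in nhds t. hmom n s = hmom n (t - 1) - integral {t - 1..s} ?h"
    using eventually_nhds_in_open[of "{t - 1<..}" t] by (auto elim!: eventually_mono intro!: eq)
  ultimately show ?thesis by (subst DERIV_cong_ev[OF refl _ refl]) auto
qed

text \<open>The integrated correlation function produces exactly these rows, see
  \<open>det_scaled\<close>. At t = 0 row 0 is the first unit vector, and the other rows are those
  of the Hankel matrix.\<close>

definition rdet :: "nat \<Rightarrow> real \<Rightarrow> real" where
  "rdet k t = det (mat k k (\<lambda>(i, j). if i = 0 then t ^ (2 * j) * exp (- t\<^sup>2) else hmom (i + j) t - t ^ (2 * i) * hmom j t))"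

text \<open>Subtracting \<open>t\<^sub>0\<^sup>2\<^sup>i\<close> times row 0 from row \<open>i\<close> leaves only row 0 with a nonzero derivative at \<open>t\<^sub>0\<close>.\<close>
lemma DERIV_hdet:
  assumes k: "k \<ge> 1"
  shows "(hdet k has_real_derivative - rdet k t0) (at t0)"
proof -
  define f where "f i j t = (if i = 0 then hmom j t else hmom (i + j) t - t0 ^ (2 * i) * hmom j t)" for i j t
  define W :: "nat \<Rightarrow> nat \<Rightarrow> real" where "W i j = (if i = j then 1 else if j = 0 then -(t0 ^ (2 * i)) else 0)" for i j
  have hd: "hdet k t = det (mat k k (\<lambda>(i, j). f i j t))" for t
  proof -
    have "mat k k (\<lambda>(i, j). W i j) * mat k k (\<lambda>(i, j). hmom (i + j) t) = mat k k (\<lambda>(i, j). f i j t)"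
    proof (rule eq_matI)
      fix i j assume "i < dim_row (mat k k (\<lambda>(i, j). f i j t))" "j < dim_col (mat k k (\<lambda>(i, j). f i j t))"
      then have ij: "i < k" "j < k" by auto
      have "(mat k k (\<lambda>(i, j). W i j) * mat k k (\<lambda>(i, j). hmom (i + j) t)) $$ (i, j) = (\<Sum>l<k. W i l * hmom (l + j) t)"
        using ij by (simp add: scalar_prod_def lessThan_atLeast0)
      also have "\<dots> = (\<Sum>l<k. (if l = i then hmom (i + j) t else 0) + (if l = 0 then (if i = 0 then 0 else -(t0 ^ (2 * i)) * hmom j t) else 0))"
        by (intro sum.cong refl) (auto simp: W_def)
      also have "\<dots> = f i j t" using ij k by (simp add: sum.distrib f_def)
      finally show "(mat k k (\<lambda>(i, j). W i j) * mat k k (\<lambda>(i, j). hmom (i + j) t)) $$ (i, j) = mat k k (\<lambda>(i, j). f i j t) $$ (i, j)"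
        using ij by simp
    qed auto
    moreover have "det (mat k k (\<lambda>(i, j). W i j)) = 1"
    proof -
      have "det (mat k k (\<lambda>(i, j). W i j)) = prod_list (diag_mat (mat k k (\<lambda>(i, j). W i j)))"
        by (rule det_lower_triangular[of k]) (auto simp: W_def)
      also have "diag_mat (mat k k (\<lambda>(i, j). W i j)) = map (\<lambda>_. 1) [0..<k]"
        unfolding diag_mat_def by (auto simp: W_def)
      finally show ?thesis by (simp add: map_replicate_const prod_list_replicate)
    qed
    moreover have "det (mat k k (\<lambda>(i, j). W i j) * mat k k (\<lambda>(i, j). hmom (i + j) t)) = det (mat k k (\<lambda>(i, j). W i j)) * hdet k t"
      unfolding hdet_def by (rule det_mult[of _ k]) auto
    ultimately show ?thesis by simp
  qed
  have z: "((\<lambda>t. \<Prod>i\<in>S. g i t) has_real_derivative 0) (at t0)"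
    if "finite S" "\<And>i. i \<in> S \<Longrightarrow> (g i has_real_derivative 0) (at t0)" for S :: "nat set" and g :: "nat \<Rightarrow> real \<Rightarrow> real"
    using that by (induction S) (auto intro!: derivative_eq_intros)
  have d0: "(f 0 j has_real_derivative - (t0 ^ (2 * j) * exp (- t0\<^sup>2))) (at t0)" for j
    unfolding f_def using DERIV_hmom[of j t0] by simp
  have d1: "(f i j has_real_derivative 0) (at t0)" if "i \<noteq> 0" for i j
  proof -
    have "((\<lambda>t. hmom (i + j) t - t0 ^ (2 * i) * hmom j t) has_real_derivative
      - (t0 ^ (2 * (i + j)) * exp (- t0\<^sup>2)) - t0 ^ (2 * i) * (- (t0 ^ (2 * j) * exp (- t0\<^sup>2)))) (at t0)"
      by (intro DERIV_diff DERIV_cmult DERIV_hmom)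
    then show ?thesis using that unfolding f_def by (simp add: power_add mult_ac)
  qed
  have prod: "((\<lambda>t. \<Prod>i<k. f i (p i) t) has_real_derivative - (t0 ^ (2 * p 0) * exp (- t0\<^sup>2)) * (\<Prod>i\<in>{..<k}-{0}. f i (p i) t0)) (at t0)" for p
  proof -
    have "(\<Prod>i<k. f i (p i) t) = f 0 (p 0) t * (\<Prod>i\<in>{..<k}-{0}. f i (p i) t)" for t
      using k by (intro prod.remove) auto
    moreover have "((\<lambda>t. f 0 (p 0) t * (\<Prod>i\<in>{..<k}-{0}. f i (p i) t)) has_real_derivative - (t0 ^ (2 * p 0) * exp (- t0\<^sup>2)) * (\<Prod>i\<in>{..<k}-{0}. f i (p i) t0) + 0 * f 0 (p 0) t0) (at t0)"
      by (intro DERIV_mult d0 z d1) auto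
    ultimately show ?thesis by simp
  qed
  have "((\<lambda>t. \<Sum>p | p permutes {..<k}. of_int (sign p) * (\<Prod>i<k. f i (p i) t)) has_real_derivative
     (\<Sum>p | p permutes {..<k}. of_int (sign p) * (- (t0 ^ (2 * p 0) * exp (- t0\<^sup>2)) * (\<Prod>i\<in>{..<k}-{0}. f i (p i) t0)))) (at t0)"
    by (intro DERIV_sum DERIV_cmult prod)
  moreover have "(\<Sum>p | p permutes {..<k}. of_int (sign p) * (- (t0 ^ (2 * p 0) * exp (- t0\<^sup>2)) * (\<Prod>i\<in>{..<k}-{0}. f i (p i) t0))) = - rdet k t0"
    unfolding rdet_def det_leibniz sum_negf[symmetric]
  proof (intro sum.cong refl)
    fix p
    have "(\<Prod>i<k. if i = 0 then t0 ^ (2 * p i) * exp (- t0\<^sup>2) else hmom (i + p i) t0 - t0 ^ (2 * i) * hmom (p i) t0)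
      = (t0 ^ (2 * p 0) * exp (- t0\<^sup>2)) * (\<Prod>i\<in>{..<k}-{0}. f i (p i) t0)"
      using k by (subst prod.remove[of _ 0]) (auto simp: f_def intro!: prod.cong)
    then show "of_int (sign p) * (- (t0 ^ (2 * p 0) * exp (- t0\<^sup>2)) * (\<Prod>i\<in>{..<k}-{0}. f i (p i) t0)) =
       - (of_int (sign p) * (\<Prod>i<k. if i = 0 then t0 ^ (2 * p i) * exp (- t0\<^sup>2) else hmom (i + p i) t0 - t0 ^ (2 * i) * hmom (p i) t0))"
      by simp
  qed
  ultimately show ?thesis unfolding hd[abs_def] det_leibniz by simp
qed

text \<open>The derivative of \<open>rdet\<close> is a multiple of the wanted density; its
  continuity supplies measurability.\<close>

lemma rdet_differentiable:
  obtains r' where "continuous_on UNIV r'" "\<And>t. (rdet k has_real_derivative r' t) (at t)"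
proof -
  define f where "f i j t = (if i = 0 then t ^ (2 * j) * exp (- t\<^sup>2) else hmom (i + j) t - t ^ (2 * i) * hmom j t)" for i j :: nat and t
  define f' where "f' i j t = (if i = 0 then real (2 * j) * t ^ (2 * j - 1) * exp (- t\<^sup>2) - t ^ (2 * j) * (2 * t * exp (- t\<^sup>2))
     else - (t ^ (2 * (i + j)) * exp (- t\<^sup>2)) - (real (2 * i) * t ^ (2 * i - 1) * hmom j t - t ^ (2 * i) * (t ^ (2 * j) * exp (- t\<^sup>2))))" for i j :: nat and t
  have ch: "continuous_on UNIV (hmom j)" for j
    using DERIV_hmom by (auto intro!: continuous_at_imp_continuous_on DERIV_isCont)
  have D: "(f i j has_real_derivative f' i j t) (at t)" for i j t
    unfolding f_def f'_def by (cases "i = 0") (auto intro!: derivative_eq_intros DERIV_hmom simp: algebra_simps)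
  have cf: "continuous_on UNIV (f i j)" "continuous_on UNIV (f' i j)" for i j
    unfolding f_def f'_def by (cases "i = 0"; auto intro!: continuous_intros ch)+
  have P: "\<exists>g. continuous_on UNIV g \<and> (\<forall>t. ((\<lambda>t. \<Prod>i\<in>S. f i (p i) t) has_real_derivative g t) (at t))" if "finite S" for S p
    using that
  proof (induction S)
    case (insert a S)
    then obtain g where g: "continuous_on UNIV g" "\<And>t. ((\<lambda>t. \<Prod>i\<in>S. f i (p i) t) has_real_derivative g t) (at t)" by blast
    have "((\<lambda>t. \<Prod>i\<in>insert a S. f i (p i) t) has_real_derivative f' a (p a) t * (\<Prod>i\<in>S. f i (p i) t) + g t * f a (p a) t) (at t)" for t
      using insert.hyps by (auto intro!: DERIV_mult D g)
    moreover have "continuous_on UNIV (\<lambda>t. f' a (p a) t * (\<Prod>i\<in>S. f i (p i) t) + g t * f a (p a) t)"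
      by (intro continuous_intros cf g)
    ultimately show ?case by blast
  qed (auto intro!: exI[of _ "\<lambda>_. 0"])
  then obtain G where G: "\<And>p. continuous_on UNIV (G p)" "\<And>p t. ((\<lambda>t. \<Prod>i<k. f i (p i) t) has_real_derivative G p t) (at t)"
    by (metis finite_lessThan)
  show thesis
  proof (rule that)
    show "continuous_on UNIV (\<lambda>t. \<Sum>p | p permutes {..<k}. of_int (sign p) * G p t)" by (intro continuous_intros G)
    show "(rdet k has_real_derivative (\<Sum>p | p permutes {..<k}. of_int (sign p) * G p t)) (at t)" for t
      unfolding rdet_def det_leibniz using G(2) unfolding f_def by (intro DERIV_sum DERIV_cmult)
  qed
qed

section \<open>Polynomials with vanishing Gaussian moments\<close>

definition gmom :: "nat \<Rightarrow> real poly \<Rightarrow> real" where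
  "gmom n E = (\<Sum>b\<le>degree E. coeff E b * (-1) ^ b * hmom (n + b) 0)"

text \<open>\<open>gmom n E\<close> stands for the integral of u^(2n) E(- u^2) exp (- u^2) over the
  positive half-line. A common summation bound makes different polynomials comparable.\<close>

lemma gmom_eq: "degree E \<le> d \<Longrightarrow> gmom n E = (\<Sum>b\<le>d. coeff E b * (-1) ^ b * hmom (n + b) 0)"
  unfolding gmom_def by (rule sum.mono_neutral_left) (auto simp: coeff_eq_0)

lemma sums_poly_exp_index:
  fixes c :: "nat \<Rightarrow> real"
  assumes E: "\<And>x. (\<lambda>p. c p * x ^ p) sums (poly E x * exp x)"
  shows "(\<lambda>p. real p * c p * x ^ p) sums (x * ((poly (pderiv E) x + poly E x) * exp x))"
proof -
  have sm: "summable (\<lambda>p. c p * x ^ p)" for x using E[of x] by (simp add: sums_iff)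
  have ser: "(\<Sum>p. c p * x ^ p) = poly E x * exp x" for x using E[of x] by (simp add: sums_iff)
  have "((\<lambda>x. poly E x * exp x) has_real_derivative (\<Sum>p. diffs c p * x ^ p)) (at x)"
    using termdiffs_strong_converges_everywhere[of c x, OF sm] by (simp add: ser)
  moreover have "((\<lambda>x. poly E x * exp x) has_real_derivative (poly (pderiv E) x + poly E x) * exp x) (at x)"
    by (auto intro!: derivative_eq_intros poly_DERIV simp: algebra_simps)
  ultimately have "(\<Sum>p. diffs c p * x ^ p) = (poly (pderiv E) x + poly E x) * exp x" by (rule DERIV_unique)
  then have "(\<lambda>p. diffs c p * x ^ p) sums ((poly (pderiv E) x + poly E x) * exp x)"
    using termdiff_converges_all[OF sm, of x] by (simp add: sums_iff)
  from sums_mult[OF this, of x]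
  have "(\<lambda>p. real (Suc p) * c (Suc p) * x ^ Suc p) sums (x * ((poly (pderiv E) x + poly E x) * exp x))"
    by (simp add: diffs_def mult_ac)
  then show "(\<lambda>p. real p * c p * x ^ p) sums (x * ((poly (pderiv E) x + poly E x) * exp x))"
    by (subst (asm) sums_Suc_iff) simp
qed

text \<open>Multiplying the coefficient of \<open>x\<^sup>p / p!\<close> by \<open>p\<close> is \<open>x d/dx\<close> on the series and, by the recurrence of
  the Gaussian moments, multiplication by \<open>- (n + 1/2)\<close> on the moments.\<close>
lemma poly_exp_series:
  fixes q :: "real poly"
  shows "\<exists>E. degree E \<le> degree q \<and> (\<forall>x. (\<lambda>p. poly q (real p) / fact p * x ^ p) sums (poly E x * exp x)) \<and>
     (\<forall>n. gmom n E = hmom n 0 * poly q (- (real n + 1 / 2)))"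
proof (induction q)
  case 0
  show ?case by (rule exI[of _ 0]) (auto simp: gmom_def)
next
  case (pCons a q)
  then obtain E where E: "degree E \<le> degree q" "\<And>x. (\<lambda>p. poly q (real p) / fact p * x ^ p) sums (poly E x * exp x)"
     "\<And>n. gmom n E = hmom n 0 * poly q (- (real n + 1 / 2))" by blast
  \<comment> \<open>Horner step: \<open>pCons a q\<close> is a + p * q, and x d/dx maps E exp to x
    (E' + E) exp.\<close>
  define F where "F = [:a:] + pCons 0 (pderiv E + E)"
  define c where "c p = poly q (real p) / fact p" for p
  have "(\<lambda>p. poly (pCons a q) (real p) / fact p * x ^ p) sums (poly F x * exp x)" for x
  proof -
    have "(\<lambda>p. real p * c p * x ^ p) sums (x * ((poly (pderiv E) x + poly E x) * exp x))"
      by (rule sums_poly_exp_index) (use E(2) in \<open>simp add: c_def\<close>)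
    moreover have "(\<lambda>p. a / fact p * x ^ p) sums (a * exp x)"
      using sums_mult[OF exp_converges[of x], of a] by (simp add: field_simps)
    ultimately have "(\<lambda>p. a / fact p * x ^ p + real p * c p * x ^ p) sums (a * exp x + x * ((poly (pderiv E) x + poly E x) * exp x))"
      by (intro sums_add)
    then show ?thesis by (simp add: F_def c_def algebra_simps add_divide_distrib)
  qed
  moreover have "degree F \<le> degree (pCons a q)"
  \<comment> \<open>For q = 0 the degree of \<open>pCons a q\<close> is still 0, so E must be shown
    to be 0 itself.\<close>
  proof (cases "q = 0")
    case True
    have "poly E x = 0" for x using E(2)[of x] True by (simp add: sums_iff)
    then have "E = 0" by (simp add: poly_eq_poly_eq_iff[symmetric] fun_eq_iff)
    then show ?thesis by (simp add: F_def)
  next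
    case False
    have "degree (pderiv E + E) \<le> degree q"
      by (rule degree_add_le) (use E(1) in \<open>auto simp: degree_pderiv\<close>)
    then have "degree (pCons 0 (pderiv E + E)) \<le> Suc (degree q)" by (simp add: degree_pCons_le order_trans)
    then have "degree F \<le> Suc (degree q)" unfolding F_def by (intro degree_add_le) auto
    then show ?thesis using False by simp
  qed
  moreover have "gmom n F = hmom n 0 * poly (pCons a q) (- (real n + 1 / 2))" for n
  proof -
    define d where "d = degree E"
    have dF: "degree F \<le> Suc d" unfolding F_def
      by (intro degree_add_le order_trans[OF degree_pCons_le] Suc_le_mono[THEN iffD2] order_trans[OF degree_pderiv_le]) (auto simp: d_def degree_pderiv)
    have "gmom n F = (\<Sum>b\<le>Suc d. coeff F b * (-1) ^ b * hmom (n + b) 0)" by (rule gmom_eq[OF dF])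
    also have "\<dots> = a * hmom n 0 + (\<Sum>b\<le>d. coeff F (Suc b) * (-1) ^ Suc b * hmom (n + Suc b) 0)"
      unfolding sum.atMost_Suc_shift by (simp add: F_def)
    also have "(\<Sum>b\<le>d. coeff F (Suc b) * (-1) ^ Suc b * hmom (n + Suc b) 0) =
       (\<Sum>b\<le>d. real (Suc b) * coeff E (Suc b) * (-1) ^ Suc b * hmom (n + Suc b) 0) + (\<Sum>b\<le>d. coeff E b * (-1) ^ Suc b * hmom (n + Suc b) 0)"
      unfolding sum.distrib[symmetric] by (intro sum.cong refl) (simp add: F_def coeff_pCons coeff_pderiv algebra_simps)
    also have "(\<Sum>b\<le>d. real (Suc b) * coeff E (Suc b) * (-1) ^ Suc b * hmom (n + Suc b) 0) = (\<Sum>b\<le>d. real b * coeff E b * (-1) ^ b * hmom (n + b) 0)"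
    proof -
      have "(\<Sum>b\<le>Suc d. real b * coeff E b * (-1) ^ b * hmom (n + b) 0) = (\<Sum>b\<le>d. real (Suc b) * coeff E (Suc b) * (-1) ^ Suc b * hmom (n + Suc b) 0)"
        unfolding sum.atMost_Suc_shift by simp
      moreover have "coeff E (Suc d) = 0" by (rule coeff_eq_0) (simp add: d_def)
      ultimately show ?thesis by simp
    qed
    also have "(\<Sum>b\<le>d. coeff E b * (-1) ^ Suc b * hmom (n + Suc b) 0) = (\<Sum>b\<le>d. - (real n + real b + 1 / 2) * (coeff E b * (-1) ^ b * hmom (n + b) 0))"
      by (intro sum.cong refl) (simp add: hmom_Suc algebra_simps)
    also have "(\<Sum>b\<le>d. real b * coeff E b * (-1) ^ b * hmom (n + b) 0) + (\<Sum>b\<le>d. - (real n + real b + 1 / 2) * (coeff E b * (-1) ^ b * hmom (n + b) 0)) = - (real n + 1 / 2) * gmom n E"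
      unfolding gmom_def d_def[symmetric] sum_distrib_left sum.distrib[symmetric] by (intro sum.cong refl) (simp add: algebra_simps)
    finally show ?thesis unfolding E(3) by (simp add: algebra_simps)
  qed
  ultimately show ?case by blast
qed

lemma tendsto_poly_gauss: "((\<lambda>u::real. poly P u * exp (- u\<^sup>2)) \<longlongrightarrow> 0) at_top"
proof -
  have m: "((\<lambda>u::real. u ^ n * exp (- u\<^sup>2)) \<longlongrightarrow> 0) at_top" for n
  proof (rule Lim_null_comparison[OF _ tendsto_power_div_exp_0[of n]])
    show "\<forall>\<^sub>F u in at_top. norm (u ^ n * exp (- u\<^sup>2)) \<le> u ^ n / exp (u::real)"
      using eventually_ge_at_top[of 1]
    proof eventually_elim
      case (elim u)
      have "u \<le> u\<^sup>2" using elim by (simp add: power2_eq_square)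
      then have "exp (- u\<^sup>2) \<le> exp (- u)" by simp
      then have "u ^ n * exp (- u\<^sup>2) \<le> u ^ n * exp (- u)" using elim by (intro mult_left_mono) auto
      then show ?case using elim by (simp add: abs_mult exp_minus divide_inverse)
    qed
  qed
  have "((\<lambda>u::real. \<Sum>i\<le>degree P. coeff P i * (u ^ i * exp (- u\<^sup>2))) \<longlongrightarrow> (\<Sum>i\<le>degree P. coeff P i * 0)) at_top"
    by (intro tendsto_sum tendsto_mult_left m)
  then show ?thesis by (simp add: poly_altdef sum_distrib_right mult.assoc)
qed

lemma integrable_poly_gauss: "integrable lborel (\<lambda>u::real. indicator {t<..} u * (poly P u * exp (- u\<^sup>2)))"
proof -
  have "integrable lborel (\<lambda>u::real. \<Sum>i\<le>degree P. coeff P i * (u ^ i * exp (- u\<^sup>2)))"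
    by (intro Bochner_Integration.integrable_sum integrable_mult_right integrable_gauss_lborel)
  then have "integrable lborel (\<lambda>u::real. poly P u * exp (- u\<^sup>2))" by (simp add: poly_altdef sum_distrib_right mult.assoc)
  from integrable_real_mult_indicator[OF _ this, of "{t<..}"] show ?thesis by (simp add: mult.commute)
qed

lemma FTC_poly_gauss:
  fixes t :: real
  shows "(\<integral>u. indicator {t<..} u * ((poly (pderiv P) u - 2 * u * poly P u) * exp (- u\<^sup>2)) \<partial>lborel) = - (poly P t * exp (- t\<^sup>2))"
proof -
  let ?f = "\<lambda>u. (poly (pderiv P) u - 2 * u * poly P u) * exp (- u\<^sup>2)" and ?F = "\<lambda>u. poly P u * exp (- u\<^sup>2)"
  have e: "einterval (ereal t) \<infinity> = {t<..}" by (auto simp: einterval_def)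
  have f: "?f = (\<lambda>u. poly (pderiv P - [:0, 2:] * P) u * exp (- u\<^sup>2))" by (simp add: fun_eq_iff)
  have "(LBINT u=ereal t..\<infinity>. ?f u) = 0 - ?F t"
  proof (rule interval_integral_FTC_integrable)
    show "(?F has_vector_derivative ?f u) (at u)" for u
      unfolding has_real_derivative_iff_has_vector_derivative[symmetric]
      by (auto intro!: derivative_eq_intros poly_DERIV simp: algebra_simps)
    show "set_integrable lborel (einterval (ereal t) \<infinity>) ?f"
      unfolding e set_integrable_def f using integrable_poly_gauss[of t "pderiv P - [:0, 2:] * P"] by simp
    have "isCont ?F t" by (intro continuous_intros)
    then have "(?F \<longlongrightarrow> ?F t) (at t)" by (simp add: isCont_def)
    then show "((?F \<circ> real_of_ereal) \<longlongrightarrow> ?F t) (at_right (ereal t))"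
      unfolding ereal_tendsto_simps by (rule filterlim_at_split[THEN iffD1, THEN conjunct2])
    show "((?F \<circ> real_of_ereal) \<longlongrightarrow> 0) (at_left \<infinity>)"
      unfolding ereal_tendsto_simps by (rule tendsto_poly_gauss)
  qed (auto intro!: continuous_intros)
  then show ?thesis unfolding interval_lebesgue_integral_def e by (simp add: set_lebesgue_integral_def)
qed

text \<open>By \<open>poly_exp_series\<close> a root at - (j + 1/2) makes the j-th moment of the
  associated \<open>epoly\<close> vanish. Index 0 has all the roots with 1 \<le> j < k; index i
  trades its own factor for 2p, which moves that root to 0. The resulting functions are dual to the
  moments, and \<open>gq_qpoly\<close> finds the same polynomials in the residues of the
  kernel.\<close>

definition qpoly :: "nat \<Rightarrow> nat \<Rightarrow> real poly" where
  "qpoly k i = (if i = 0 then \<Prod>j\<in>{1..<k}. [:2 * real j + 1, 2:] else [:0, 2:] * (\<Prod>j\<in>{1..<k}-{i}. [:2 * real j + 1, 2:]))"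

definition epoly :: "nat \<Rightarrow> nat \<Rightarrow> real poly" where
  "epoly k i = (SOME E. degree E \<le> degree (qpoly k i) \<and> (\<forall>x. (\<lambda>p. poly (qpoly k i) (real p) / fact p * x ^ p) sums (poly E x * exp x)) \<and>
     (\<forall>n. gmom n E = hmom n 0 * poly (qpoly k i) (- (real n + 1 / 2))))"

lemma epoly:
  "degree (epoly k i) \<le> degree (qpoly k i)"
  "(\<lambda>p. poly (qpoly k i) (real p) / fact p * x ^ p) sums (poly (epoly k i) x * exp x)"
  "gmom n (epoly k i) = hmom n 0 * poly (qpoly k i) (- (real n + 1 / 2))"
  using someI_ex[OF poly_exp_series[of "qpoly k i"], folded epoly_def] by blast+

lemma degree_qpoly: assumes "i < k" shows "degree (qpoly k i) < k"
proof -
  have d: "degree (\<Prod>j\<in>S. [:2 * real j + 1, 2:]) \<le> card S" if "finite S" for S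
    using that
  proof (induction S)
    case (insert j S)
    have "degree ([:2 * real j + 1, 2:] * (\<Prod>j\<in>S. [:2 * real j + 1, 2:])) \<le> 1 + card S"
      by (rule order_trans[OF degree_mult_le]) (use insert in auto)
    then show ?case using insert.hyps by simp
  qed simp
  show ?thesis
  proof (cases "i = 0")
    case True
    then show ?thesis unfolding qpoly_def using d[of "{1..<k}"] assms by auto
  next
    case False
    have "degree ([:0, 2:] * (\<Prod>j\<in>{1..<k}-{i}. [:2 * real j + 1, 2:])) \<le> 1 + card ({1..<k}-{i})"
      by (rule order_trans[OF degree_mult_le]) (use d[of "{1..<k}-{i}"] in auto)
    also have "\<dots> < k" using False assms by simp
    finally show ?thesis using False by (simp add: qpoly_def)
  qed
qed

lemma degree_epoly: "i < k \<Longrightarrow> degree (epoly k i) < k"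
  using epoly(1)[of k i] degree_qpoly[of i k] by linarith

lemma poly_epoly_0: "poly (epoly k i) 0 = poly (qpoly k i) 0"
proof -
  have "(\<lambda>p. poly (qpoly k i) (real p) / fact p * 0 ^ p) sums poly (epoly k i) 0" using epoly(2)[of k i 0] by simp
  moreover have "(\<lambda>p. poly (qpoly k i) (real p) / fact p * 0 ^ p) sums (poly (qpoly k i) (real 0) / fact 0 * 0 ^ 0)"
    by (rule sums_finite[of "{0}", simplified]) auto
  ultimately show ?thesis using sums_unique2 by fastforce
qed

lemma qpoly_zero_diag: "i < k \<Longrightarrow> n \<in> {1..<k} \<Longrightarrow> n \<noteq> i \<Longrightarrow> poly (qpoly k i) (- (real n + 1 / 2)) = 0"
  by (auto simp: qpoly_def poly_prod intro!: prod_zero bexI[of _ n])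

lemma poly_qpoly_zero: "i \<noteq> 0 \<Longrightarrow> poly (qpoly k i) 0 = 0"
  by (simp add: qpoly_def)

definition ec :: "nat \<Rightarrow> nat \<Rightarrow> nat \<Rightarrow> real" where
  "ec k i b = coeff (epoly k i) b * (-1) ^ b"

text \<open>The derivative in u of E(- u^2) exp (- u^2) for E = \<open>epoly k i\<close>. Times
  \<open>kap k\<close> it is a right-hand function of level 2k + 1, see \<open>Rf_b\<close>.\<close>

definition rfun :: "nat \<Rightarrow> nat \<Rightarrow> real \<Rightarrow> real" where
  "rfun k i u = - 2 * u * (poly (pderiv (epoly k i)) (- u\<^sup>2) + poly (epoly k i) (- u\<^sup>2)) * exp (- u\<^sup>2)"

lemma epoly_sum: "i < k \<Longrightarrow> poly (epoly k i) (- u\<^sup>2) = (\<Sum>b<k. ec k i b * u ^ (2 * b))"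
proof -
  assume "i < k"
  have "poly (epoly k i) (- u\<^sup>2) = (\<Sum>b\<le>degree (epoly k i). coeff (epoly k i) b * (- u\<^sup>2) ^ b)" by (simp add: poly_altdef)
  also have "\<dots> = (\<Sum>b<k. coeff (epoly k i) b * (- u\<^sup>2) ^ b)"
    by (rule sum.mono_neutral_left) (use degree_epoly[OF \<open>i < k\<close>] in \<open>auto simp: coeff_eq_0\<close>)
  also have "\<dots> = (\<Sum>b<k. ec k i b * u ^ (2 * b))"
  proof (intro sum.cong refl)
    fix b
    have "(- u\<^sup>2) ^ b = (-1) ^ b * u ^ (2 * b)" by (subst power_minus) (simp add: power_mult[symmetric])
    then show "coeff (epoly k i) b * (- u\<^sup>2) ^ b = ec k i b * u ^ (2 * b)" by (simp add: ec_def)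
  qed
  finally show ?thesis .
qed

lemma rfun_sums:
  assumes u: "u > 0"
  shows "(\<lambda>p. poly (qpoly k i) (real p) / fact p * (-1) ^ p * (2 * real p * u ^ (2 * p - 1))) sums rfun k i u"
proof -
  have s: "(\<lambda>p. real p * (poly (qpoly k i) (real p) / fact p) * (- u\<^sup>2) ^ p) sums
     ((- u\<^sup>2) * ((poly (pderiv (epoly k i)) (- u\<^sup>2) + poly (epoly k i) (- u\<^sup>2)) * exp (- u\<^sup>2)))"
    by (rule sums_poly_exp_index) (rule epoly(2))
  have aux: "2 / u * ((- u\<^sup>2) * (a * b)) = - 2 * u * a * b" for a b
    using u by (simp add: power2_eq_square)
  have "(\<lambda>p. 2 / u * (real p * (poly (qpoly k i) (real p) / fact p) * (- u\<^sup>2) ^ p)) sums rfun k i u"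
    unfolding rfun_def aux[symmetric] by (rule sums_mult[OF s])
  moreover have "2 / u * (real p * (poly (qpoly k i) (real p) / fact p) * (- u\<^sup>2) ^ p) = poly (qpoly k i) (real p) / fact p * (-1) ^ p * (2 * real p * u ^ (2 * p - 1))" for p
  proof (cases p)
    case (Suc p')
    have "(- u\<^sup>2) ^ p = (-1) ^ p * (u * u ^ (2 * p - 1))"
    proof -
      have "(- u\<^sup>2) ^ p = (-1) ^ p * u ^ (2 * p)" by (subst power_minus) (simp add: power_mult[symmetric])
      then show ?thesis using Suc by simp
    qed
    then show ?thesis using u by simp
  qed simp
  ultimately show ?thesis by simp
qed

lemma rfun_poly: "rfun k i u = poly (pderiv (pcompose (epoly k i) [:0, 0, -1:]) - [:0, 2:] * pcompose (epoly k i) [:0, 0, -1:]) u * exp (- u\<^sup>2)"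
  by (simp add: rfun_def pderiv_pcompose poly_pcompose pderiv_pCons power2_eq_square algebra_simps)

text \<open>Integration by parts; the boundary term sits at t alone because a polynomial times a
  Gaussian vanishes at infinity.\<close>

lemma rfun_parts:
  fixes P :: "real poly"
  assumes i: "i < k"
  shows "(\<integral>u. indicator {t<..} u * (rfun k i u * poly P u) \<partial>lborel) =
    - (\<Sum>b<k. ec k i b * (t ^ (2 * b) * exp (- t\<^sup>2))) * poly P t - (\<integral>u. indicator {t<..} u * ((\<Sum>b<k. ec k i b * u ^ (2 * b)) * poly (pderiv P) u * exp (- u\<^sup>2)) \<partial>lborel)"
proof -
  define E where "E = pcompose (epoly k i) [:0, 0, -1:]"
  have E: "poly E u = (\<Sum>b<k. ec k i b * u ^ (2 * b))" for u
    unfolding E_def using epoly_sum[OF i, of u] by (simp add: poly_pcompose power2_eq_square)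
  have "(\<integral>u. indicator {t<..} u * (poly (E * pderiv P) u * exp (- u\<^sup>2)) \<partial>lborel) + (\<integral>u. indicator {t<..} u * (rfun k i u * poly P u) \<partial>lborel)
    = (\<integral>u. indicator {t<..} u * ((poly (pderiv (E * P)) u - 2 * u * poly (E * P) u) * exp (- u\<^sup>2)) \<partial>lborel)"
  proof (subst Bochner_Integration.integral_add[symmetric])
    show "integrable lborel (\<lambda>u. indicator {t<..} u * (rfun k i u * poly P u))"
      using integrable_poly_gauss[of t "(pderiv E - [:0, 2:] * E) * P"] unfolding rfun_poly E_def[symmetric] by (simp add: mult_ac)
    show "(\<integral>u. indicator {t<..} u * (poly (E * pderiv P) u * exp (- u\<^sup>2)) + indicator {t<..} u * (rfun k i u * poly P u) \<partial>lborel)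
      = (\<integral>u. indicator {t<..} u * ((poly (pderiv (E * P)) u - 2 * u * poly (E * P) u) * exp (- u\<^sup>2)) \<partial>lborel)"
      by (intro Bochner_Integration.integral_cong refl) (simp add: rfun_poly E_def[symmetric] pderiv_mult algebra_simps)
  qed (rule integrable_poly_gauss)
  also have "\<dots> = - (poly (E * P) t * exp (- t\<^sup>2))" by (rule FTC_poly_gauss)
  finally show ?thesis by (simp add: E sum_distrib_right sum_distrib_left mult_ac)
qed

section \<open>Normalizing constants\<close>

lemma prod_odd_even: "(\<Prod>l\<in>{1..n}. 2 * real l - 1) * (\<Prod>m\<in>{1..<n}. 2 * real m) = (if n = 0 then 1 else fact (2 * n - 1))"
proof (induction n)
  case (Suc n)
  show ?case
  proof (cases n)
    case (Suc n')
    have "{1..<Suc n} = insert n {1..<n}" using Suc by auto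
    then have "(\<Prod>l\<in>{1..Suc n}. 2 * real l - 1) * (\<Prod>m\<in>{1..<Suc n}. 2 * real m)
       = ((\<Prod>l\<in>{1..n}. 2 * real l - 1) * (\<Prod>m\<in>{1..<n}. 2 * real m)) * ((2 * real n + 1) * (2 * real n))"
      by (simp add: mult_ac)
    also have "\<dots> = fact (2 * n - 1) * ((2 * real n + 1) * (2 * real n))" using Suc.IH Suc by simp
    also have "\<dots> = fact (2 * Suc n - 1)" using Suc by (simp add: algebra_simps)
    finally show ?thesis by simp
  qed simp
qed simp

text \<open>The factor - 2 comes from the residue of Gamma (- (z + x2) / 2) in z, the sign from
  (-1)^(p + k) in the same residue, and 2^k from \<open>fact_double_shift\<close>.\<close>

definition kap :: "nat \<Rightarrow> real" where "kap k = - 2 * (-1) ^ k * 2 ^ k"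

text \<open>The coefficient of the residue in w at 2j - 1 on level 2k - 1, see
  \<open>acoef_lam\<close>.\<close>

definition lam :: "nat \<Rightarrow> nat \<Rightarrow> real" where
  "lam k j = rGamma (real j + 1 / 2 - real k) * (2 * real j / (2 * real j + 1)) / (fact (2 * j - 1) * fact (2 * k - 1 - 2 * j))"

text \<open>The residue in w at 0 on level 2k + 1, see \<open>lim_wpart_corner\<close>.\<close>

definition l00 :: "nat \<Rightarrow> real" where "l00 k = (-1) ^ k * fact k / (2 * fact (2 * k))"

lemma hmom_Gamma: "hmom n 0 = Gamma (real n + 1 / 2) / 2"
proof (induction n)
  case 0 then show ?case by (simp add: hmom_0 Gamma_one_half_real)
next
  case (Suc n)
  have "Gamma (real (Suc n) + 1 / 2) = (real n + 1 / 2) * Gamma (real n + 1 / 2)"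
  proof -
    have "real n + 1 / 2 \<notin> \<int>\<^sub>\<le>\<^sub>0" using nonpos_Ints_nonpos[of "real n + 1 / 2"] by linarith
    then show ?thesis using Gamma_plus1[of "real n + 1 / 2"] by (simp add: add_ac)
  qed
  then show ?case using Suc by (simp add: hmom_Suc)
qed

lemma rGamma_shift: "rGamma (x - real n) = (\<Prod>l\<in>{1..n}. x - real l) * rGamma (x :: real)"
proof (induction n)
  case (Suc n)
  have "rGamma (x - real (Suc n)) = (x - real (Suc n)) * rGamma (x - real n)"
    using rGamma_plus1[of "x - real (Suc n)"] by (simp add: algebra_simps)
  then show ?case using Suc by (simp add: mult_ac)
qed simp

text \<open>A diagonal entry of the integrated matrix at t = 0. The odd numbers from the quotient of
  Gamma values and the even numbers from \<open>qpoly\<close> interleave to the two factorials in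
  \<open>lam\<close>.\<close>

lemma diag_const:
  assumes j: "j \<in> {1..<k}"
  shows "\<bar>kap k * lam k j / (2 * real j) * (hmom j 0 * poly (qpoly k j) (- (real j + 1 / 2)))\<bar> = 1"
proof -
  have jk: "1 \<le> j" "j < k" using j by auto
  have gp: "Gamma (real j + 1 / 2) > 0" by (intro Gamma_real_pos) simp
  have 1: "rGamma (real j + 1 / 2 - real k) * hmom j 0 = (\<Prod>l\<in>{1..k}. real j + 1 / 2 - real l) / 2"
  proof -
    have r1: "rGamma (real j + 1 / 2) * Gamma (real j + 1 / 2) = 1"
      unfolding rGamma_inverse_Gamma by (rule left_inverse[OF less_imp_neq[OF gp, symmetric]])
    have "(p * a) * (b / 2) = p * (a * b) / 2" for p a b :: real by simp
    then show ?thesis unfolding rGamma_shift hmom_Gamma by (simp only: r1 mult_1_right)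
  qed
  have 2: "poly (qpoly k j) (- (real j + 1 / 2)) = - (2 * real j + 1) * (\<Prod>m\<in>{1..<k}-{j}. 2 * real m - 2 * real j)"
    using jk by (simp add: qpoly_def poly_prod algebra_simps)
  have 3: "2 ^ k * \<bar>\<Prod>l\<in>{1..k}. real j + 1 / 2 - real l\<bar> = (\<Prod>l\<in>{1..j}. 2 * real l - 1) * (\<Prod>l\<in>{1..k-j}. 2 * real l - 1)"
  proof -
    have "2 ^ k * \<bar>\<Prod>l\<in>{1..k}. real j + 1 / 2 - real l\<bar> = (\<Prod>l\<in>{1..k}. 2 * \<bar>real j + 1 / 2 - real l\<bar>)"
      by (simp add: prod.distrib abs_prod)
    also have "\<dots> = (\<Prod>l\<in>{1..k}. \<bar>2 * real j + 1 - 2 * real l\<bar>)"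
      by (intro prod.cong refl) (auto simp: abs_if)
    also have "\<dots> = (\<Prod>l\<in>{1..j}. \<bar>2 * real j + 1 - 2 * real l\<bar>) * (\<Prod>l\<in>{j+1..k}. \<bar>2 * real j + 1 - 2 * real l\<bar>)"
    proof -
      have "{1..k} = {1..j} \<union> {j+1..k}" using jk by auto
      then show ?thesis by (simp only:) (rule prod.union_disjoint, auto)
    qed
    also have "(\<Prod>l\<in>{1..j}. \<bar>2 * real j + 1 - 2 * real l\<bar>) = (\<Prod>l\<in>{1..j}. 2 * real l - 1)"
      by (rule prod.reindex_bij_witness[of _ "\<lambda>l. j + 1 - l" "\<lambda>l. j + 1 - l"]) auto
    also have "(\<Prod>l\<in>{j+1..k}. \<bar>2 * real j + 1 - 2 * real l\<bar>) = (\<Prod>l\<in>{1..k-j}. 2 * real l - 1)"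
      by (rule prod.reindex_bij_witness[of _ "\<lambda>l. j + l" "\<lambda>l. l - j"]) auto
    finally show ?thesis .
  qed
  have 4: "\<bar>\<Prod>m\<in>{1..<k}-{j}. 2 * real m - 2 * real j\<bar> = (\<Prod>m\<in>{1..<j}. 2 * real m) * (\<Prod>m\<in>{1..<k-j}. 2 * real m)"
  proof -
    have "{1..<k}-{j} = {1..<j} \<union> {j+1..<k}" using jk by auto
    then have "\<bar>\<Prod>m\<in>{1..<k}-{j}. 2 * real m - 2 * real j\<bar> = (\<Prod>m\<in>{1..<j}. \<bar>2 * real m - 2 * real j\<bar>) * (\<Prod>m\<in>{j+1..<k}. \<bar>2 * real m - 2 * real j\<bar>)"
      by (simp only: abs_prod) (rule prod.union_disjoint, auto)
    also have "(\<Prod>m\<in>{1..<j}. \<bar>2 * real m - 2 * real j\<bar>) = (\<Prod>m\<in>{1..<j}. 2 * real m)"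
      by (rule prod.reindex_bij_witness[of _ "\<lambda>m. j - m" "\<lambda>m. j - m"]) auto
    also have "(\<Prod>m\<in>{j+1..<k}. \<bar>2 * real m - 2 * real j\<bar>) = (\<Prod>m\<in>{1..<k-j}. 2 * real m)"
      by (rule prod.reindex_bij_witness[of _ "\<lambda>m. j + m" "\<lambda>m. m - j"]) auto
    finally show ?thesis .
  qed
  have 5: "2 ^ k * \<bar>\<Prod>l\<in>{1..k}. real j + 1 / 2 - real l\<bar> * \<bar>\<Prod>m\<in>{1..<k}-{j}. 2 * real m - 2 * real j\<bar> = fact (2 * j - 1) * fact (2 * k - 1 - 2 * j)"
  proof -
    have n0: "j \<noteq> 0" "k - j \<noteq> 0" and idx: "2 * (k - j) - 1 = 2 * k - 1 - 2 * j" using jk by auto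
    have "(a * b) * (c * d) = (a * c) * (b * d)" for a b c d :: real by simp
    then show ?thesis
      unfolding 3 4 using prod_odd_even[of j, unfolded if_not_P[OF n0(1)]] prod_odd_even[of "k - j", unfolded if_not_P[OF n0(2)] idx]
      by (simp only:)
  qed
  have "\<bar>kap k * lam k j / (2 * real j) * (hmom j 0 * poly (qpoly k j) (- (real j + 1 / 2)))\<bar> =
     \<bar>kap k\<bar> * \<bar>rGamma (real j + 1 / 2 - real k) * hmom j 0\<bar> * \<bar>\<Prod>m\<in>{1..<k}-{j}. 2 * real m - 2 * real j\<bar> / (fact (2 * j - 1) * fact (2 * k - 1 - 2 * j))"
    using jk unfolding lam_def 2 by (simp add: abs_mult divide_simps)
  also have "\<dots> = 2 ^ k * \<bar>\<Prod>l\<in>{1..k}. real j + 1 / 2 - real l\<bar> * \<bar>\<Prod>m\<in>{1..<k}-{j}. 2 * real m - 2 * real j\<bar> / (fact (2 * j - 1) * fact (2 * k - 1 - 2 * j))"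
    unfolding 1 by (simp add: kap_def abs_mult power_abs)
  also have "\<dots> = 1" unfolding 5 by simp
  finally show ?thesis .
qed

lemma poly_q0_0: "poly (qpoly k 0) 0 = (\<Prod>j\<in>{1..<k}. 2 * real j + 1)"
  by (simp add: qpoly_def poly_prod)

text \<open>The remaining diagonal entry at t = 0, by (2k)! = 2^k k! (2k-1)!!.\<close>

lemma corner_const: assumes k: "k \<ge> 1" shows "\<bar>l00 k * kap k * poly (qpoly k 0) 0\<bar> = 1"
proof -
  have "fact (2 * k) = 2 ^ k * fact k * (\<Prod>j\<in>{1..<k}. 2 * real j + 1)"
    using k
  proof (induction k rule: nat_induct_at_least)
    case (Suc n)
    have "{1..<Suc n} = insert n {1..<n}" using Suc by auto
    then have "(\<Prod>j\<in>{1..<Suc n}. 2 * real j + 1) = (2 * real n + 1) * (\<Prod>j\<in>{1..<n}. 2 * real j + 1)" by simp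
    moreover have "fact (2 * Suc n) = (2 * real n + 2) * (2 * real n + 1) * fact (2 * n)" by (simp add: algebra_simps)
    ultimately show ?case using Suc.IH by (simp add: algebra_simps)
  qed simp
  moreover have "(\<Prod>j\<in>{1..<k}. 2 * real j + 1) > 0" by (intro prod_pos) auto
  ultimately show ?thesis unfolding poly_q0_0 l00_def kap_def by (simp add: abs_mult power_abs)
qed

lemma dfact_odd: "k \<ge> 1 \<Longrightarrow> real (dfact (2 * k - 1)) = (\<Prod>j\<in>{1..<k}. 2 * real j + 1)"
proof (induction k rule: nat_induct_at_least)
  case (Suc n)
  have "{1..<Suc n} = insert n {1..<n}" using Suc by auto
  then have p: "(\<Prod>j\<in>{1..<Suc n}. 2 * real j + 1) = (2 * real n + 1) * (\<Prod>j\<in>{1..<n}. 2 * real j + 1)" by simp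
  have "dfact (Suc (Suc (2 * n - 1))) = Suc (Suc (2 * n - 1)) * dfact (2 * n - 1)" by (rule dfact.simps(3))
  moreover have "Suc (Suc (2 * n - 1)) = 2 * n + 1" "2 * Suc n - 1 = 2 * n + 1" using Suc by auto
  ultimately have d: "dfact (2 * Suc n - 1) = (2 * n + 1) * dfact (2 * n - 1)" by metis
  show ?case unfolding p d of_nat_mult Suc.IH by simp
qed simp

lemma dfact_even: "k \<ge> 1 \<Longrightarrow> real (dfact (2 * k - 2)) = (\<Prod>j\<in>{1..<k}. 2 * real j)"
proof (induction k rule: nat_induct_at_least)
  case (Suc n)
  have "{1..<Suc n} = insert n {1..<n}" using Suc by auto
  then have p: "(\<Prod>j\<in>{1..<Suc n}. 2 * real j) = 2 * real n * (\<Prod>j\<in>{1..<n}. 2 * real j)" by (simp only:) (subst prod.insert, auto)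
  have "dfact (Suc (Suc (2 * n - 2))) = Suc (Suc (2 * n - 2)) * dfact (2 * n - 2)" by (rule dfact.simps(3))
  moreover have "Suc (Suc (2 * n - 2)) = 2 * n" "2 * Suc n - 2 = 2 * n" using Suc by auto
  ultimately have d: "dfact (2 * Suc n - 2) = (2 * n) * dfact (2 * n - 2)" by metis
  show ?case unfolding p d of_nat_mult Suc.IH by simp
qed simp

text \<open>The prefactor in \<open>ghat\<close>, recognized in \<open>hdet_rdet\<close> as the
  factor between \<open>rdet k 0\<close> and \<open>hdet k 0\<close>.\<close>

definition cst :: "nat \<Rightarrow> real" where
  "cst k = sqrt pi / 2 * real (dfact (2 * k - 2)) / real (dfact (2 * k - 1))"

text \<open>Cramer's rule for the Hankel matrix: its first column of cofactors is read off the polynomial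
  \<open>epoly k 0\<close>, whose moments of order \<open>1, \<dots>, k - 1\<close> vanish.\<close>
lemma hdet_rdet: assumes k: "k \<ge> 1" shows "hdet k 0 = cst k * rdet k 0"
proof -
  define x where "x b = ec k 0 b" for b
  define X where "X i j = (if j = 0 then x i else if i = j then 1 else 0)" for i j :: nat
  define M where "M i j = hmom (i + j) 0" for i j
  define c' where "c' = sqrt pi / 2 * (\<Prod>j\<in>{1..<k}. 2 * real j)"
  \<comment> \<open>\<open>B\<close> is the matrix of \<open>rdet k 0\<close>. The vector x solves M
    x = c' e_0 and replaces the first column of the unit matrix in \<open>X\<close>; comparing M
    times X with the transpose of B times a diagonal matrix is Cramer's rule.\<close>
  define B where "B i j = (if i = 0 then (if j = 0 then 1 else 0) else hmom (i + j) 0)" for i j :: nat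
  have Mx: "(\<Sum>b<k. M i b * x b) = (if i = 0 then c' else 0)" if "i < k" for i
  proof -
    have "(\<Sum>b<k. M i b * x b) = gmom i (epoly k 0)"
      using gmom_eq[of "epoly k 0" "k - 1" i] degree_epoly[of 0 k] k
      by (simp add: M_def x_def ec_def mult_ac lessThan_Suc_atMost[symmetric])
    also have "\<dots> = (if i = 0 then c' else 0)"
      unfolding epoly(3) using qpoly_zero_diag[of 0 k i] that k
      by (auto simp: c'_def hmom_0 qpoly_def poly_prod)
    finally show ?thesis .
  qed
  have "mat k k (\<lambda>(i, j). M i j) * mat k k (\<lambda>(i, j). X i j) = mat k k (\<lambda>(i, j). B j i) * mat k k (\<lambda>(i, j). if i = j then (if i = 0 then c' else 1) else 0)" (is "_ = _ * ?D")
  proof (rule eq_matI)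
    fix i j assume "i < dim_row (mat k k (\<lambda>(i, j). B j i) * ?D)" "j < dim_col (mat k k (\<lambda>(i, j). B j i) * ?D)"
    then have ij: "i < k" "j < k" by auto
    have "(mat k k (\<lambda>(i, j). M i j) * mat k k (\<lambda>(i, j). X i j)) $$ (i, j) = (\<Sum>l<k. M i l * X l j)"
      using ij by (simp add: scalar_prod_def lessThan_atLeast0)
    also have "\<dots> = (if j = 0 then (if i = 0 then c' else 0) else M i j)"
    proof (cases "j = 0")
      case False
      have "(\<Sum>l<k. M i l * X l j) = (\<Sum>l<k. if l = j then M i j else 0)" using False by (intro sum.cong) (auto simp: X_def)
      then show ?thesis using False ij by simp
    qed (use Mx[OF ij(1)] in \<open>simp add: X_def\<close>)
    also have "\<dots> = (\<Sum>l<k. B l i * (if l = j then (if l = 0 then c' else 1) else 0))"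
    proof -
      have "(\<Sum>l<k. B l i * (if l = j then (if l = 0 then c' else 1) else 0)) = (\<Sum>l<k. if l = j then B j i * (if j = 0 then c' else 1) else 0)"
        by (intro sum.cong) auto
      then show ?thesis using ij by (auto simp: B_def M_def add.commute)
    qed
    also have "\<dots> = (mat k k (\<lambda>(i, j). B j i) * ?D) $$ (i, j)"
      using ij by (simp add: scalar_prod_def lessThan_atLeast0)
    finally show "(mat k k (\<lambda>(i, j). M i j) * mat k k (\<lambda>(i, j). X i j)) $$ (i, j) = (mat k k (\<lambda>(i, j). B j i) * ?D) $$ (i, j)" .
  qed auto
  then have "det (mat k k (\<lambda>(i, j). M i j)) * det (mat k k (\<lambda>(i, j). X i j)) = det (mat k k (\<lambda>(i, j). B j i)) * det ?D"
    by (simp add: det_mult[of _ k, symmetric])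
  moreover have "det (mat k k (\<lambda>(i, j). X i j)) = x 0"
  proof -
    have "det (mat k k (\<lambda>(i, j). X i j)) = prod_list (diag_mat (mat k k (\<lambda>(i, j). X i j)))"
      by (rule det_lower_triangular[of k]) (auto simp: X_def)
    also have "diag_mat (mat k k (\<lambda>(i, j). X i j)) = map (\<lambda>i. if i = 0 then x 0 else 1) [0..<k]"
      unfolding diag_mat_def by (auto simp: X_def)
    finally show ?thesis using k by (simp add: prod.distinct_set_conv_list[symmetric])
  qed
  moreover have "det ?D = c'"
  proof -
    have "det ?D = prod_list (diag_mat ?D)"
      by (rule det_lower_triangular[of k]) auto
    also have "diag_mat ?D = map (\<lambda>i. if i = 0 then c' else 1) [0..<k]" unfolding diag_mat_def by auto
    finally show ?thesis using k by (simp add: prod.distinct_set_conv_list[symmetric])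
  qed
  moreover have "det (mat k k (\<lambda>(i, j). B j i)) = rdet k 0"
  proof -
    have "det (mat k k (\<lambda>(i, j). B j i)) = det (transpose_mat (mat k k (\<lambda>(i, j). B i j)))"
      by (rule arg_cong[of _ _ det], rule eq_matI) auto
    also have "\<dots> = det (mat k k (\<lambda>(i, j). B i j))" by (rule det_transpose[of _ k]) simp
    also have "\<dots> = rdet k 0"
      unfolding rdet_def by (rule arg_cong[of _ _ det], rule cong_mat) (auto simp: B_def)
    finally show ?thesis .
  qed
  moreover have "x 0 = (\<Prod>j\<in>{1..<k}. 2 * real j + 1)"
    using poly_epoly_0[of k 0] unfolding poly_q0_0 by (simp add: x_def ec_def poly_0_coeff_0)
  moreover have "(\<Prod>j\<in>{1..<k}. 2 * real j + 1) > 0" by (intro prod_pos) auto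
  ultimately show ?thesis
    unfolding cst_def dfact_odd[OF k] dfact_even[OF k] hdet_def M_def c'_def by (simp add: field_simps)
qed

lemma cst_pos: assumes "k \<ge> 1" shows "cst k > 0"
  unfolding cst_def dfact_odd[OF assms] dfact_even[OF assms]
  by (intro divide_pos_pos mult_pos_pos prod_pos) auto

text \<open>The entries that remain after both levels have been integrated over \<open>(t, \<infinity>)\<close>; the last index stands for
  the extra function of level \<open>2k + 1\<close>.\<close>
definition lev :: "nat \<Rightarrow> nat \<Rightarrow> nat" where "lev k v = (if v < k - 1 then v + 1 else 0)"

definition scal :: "nat \<Rightarrow> nat \<Rightarrow> real" where
  "scal k i = (if i < k - 1 then kap k * lam k (i + 1) / (2 * real (i + 1)) else - (l00 k * kap k))"

text \<open>Factors independent of t reduce the matrix to that of \<open>rdet\<close>, at the price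
  of an unevaluated constant W. At t = 0 the vanishing moments make the matrix diagonal with entries
  of absolute value 1; the sign is settled later by positivity.\<close>

lemma det_scaled:
  assumes k: "k \<ge> 1"
  obtains W where "\<And>t. det (mat k k (\<lambda>(v, i). scal k i * (\<Sum>b<k. ec k (lev k v) b *
        (if i < k - 1 then hmom (i + 1 + b) t - t ^ (2 * (i + 1)) * hmom b t else t ^ (2 * b) * exp (- t\<^sup>2))))) = W * rdet k t"
    "\<bar>W * rdet k 0\<bar> = 1"
proof -
  define m where "m t i b = (if i = 0 then t ^ (2 * b) * exp (- t\<^sup>2) else hmom (i + b) t - t ^ (2 * i) * hmom b t)" for t i b
  define D where "D t = det (mat k k (\<lambda>(v, i). scal k i * (\<Sum>b<k. ec k (lev k v) b * (if i < k - 1 then hmom (i + 1 + b) t - t ^ (2 * (i + 1)) * hmom b t else t ^ (2 * b) * exp (- t\<^sup>2)))))" for t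
  \<comment> \<open>A cyclic shift: the last column, which belongs to the extra function, becomes
    row 0 of \<open>rdet\<close> after transposition.\<close>
  define \<pi> where "\<pi> i = (if i < k then lev k i else i)" for i
  have \<pi>: "\<pi> permutes {..<k}"
  proof (rule bij_imp_permutes)
    show "bij_betw \<pi> {..<k} {..<k}"
      by (rule bij_betwI[where g = "\<lambda>i. if i = 0 then k - 1 else i - 1"]) (use k in \<open>auto simp: \<pi>_def lev_def\<close>)
  qed (auto simp: \<pi>_def)
  define W where "W = (\<Prod>i<k. scal k i) * det (mat k k (\<lambda>(v, b). ec k (lev k v) b)) * of_int (sign \<pi>)"
  have D: "D t = W * rdet k t" for t
  proof -
    have e: "(if i < k - 1 then hmom (i + 1 + b) t - t ^ (2 * (i + 1)) * hmom b t else t ^ (2 * b) * exp (- t\<^sup>2)) = m t (\<pi> i) b" if "i < k" for i b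
      using that by (auto simp: m_def \<pi>_def lev_def)
    have "D t = (\<Prod>i<k. scal k i) * det (mat k k (\<lambda>(v, i). \<Sum>b<k. ec k (lev k v) b * m t (\<pi> i) b))"
    proof -
      have "D t = (\<Sum>p | p permutes {..<k}. of_int (sign p) * (\<Prod>v<k. scal k (p v) * (\<Sum>b<k. ec k (lev k v) b * m t (\<pi> (p v)) b)))"
        unfolding D_def det_leibniz
      proof (rule sum.cong[OF refl], rule arg_cong2[of _ _ _ _ times], rule refl, rule prod.cong[OF refl], rule arg_cong2[of _ _ _ _ times], rule refl)
        fix p v assume "p \<in> {p. p permutes {..<k}}" "v \<in> {..<k}"
        then have "p v < k" using permutes_in_image[of p "{..<k}" v] by simp
        then show "(\<Sum>b<k. ec k (lev k v) b * (if p v < k - 1 then hmom (p v + 1 + b) t - t ^ (2 * (p v + 1)) * hmom b t else t ^ (2 * b) * exp (- t\<^sup>2)))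
          = (\<Sum>b<k. ec k (lev k v) b * m t (\<pi> (p v)) b)" by (simp only: e)
      qed
      also have "\<dots> = (\<Sum>p | p permutes {..<k}. (\<Prod>i<k. scal k i) * (of_int (sign p) * (\<Prod>v<k. \<Sum>b<k. ec k (lev k v) b * m t (\<pi> (p v)) b)))"
      proof (intro sum.cong refl)
        fix p assume "p \<in> {p. p permutes {..<k}}"
        then have "(\<Prod>v<k. scal k (p v)) = (\<Prod>i<k. scal k i)" using prod.permute[of p "{..<k}" "scal k"] by (simp add: o_def)
        then show "of_int (sign p) * (\<Prod>v<k. scal k (p v) * (\<Sum>b<k. ec k (lev k v) b * m t (\<pi> (p v)) b)) =
          (\<Prod>i<k. scal k i) * (of_int (sign p) * (\<Prod>v<k. \<Sum>b<k. ec k (lev k v) b * m t (\<pi> (p v)) b))"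
          by (simp add: prod.distrib)
      qed
      finally show ?thesis unfolding det_leibniz sum_distrib_left .
    qed
    also have "det (mat k k (\<lambda>(v, i). \<Sum>b<k. ec k (lev k v) b * m t (\<pi> i) b)) = of_int (sign \<pi>) * det (mat k k (\<lambda>(v, i). \<Sum>b<k. ec k (lev k v) b * m t i b))"
      by (rule det_col_perm[OF \<pi>])
    also have "mat k k (\<lambda>(v, i). \<Sum>b<k. ec k (lev k v) b * m t i b) = mat k k (\<lambda>(v, b). ec k (lev k v) b) * transpose_mat (mat k k (\<lambda>(i, b). m t i b))"
      by (rule eq_matI) (auto simp: scalar_prod_def lessThan_atLeast0)
    also have "det \<dots> = det (mat k k (\<lambda>(v, b). ec k (lev k v) b)) * det (mat k k (\<lambda>(i, b). m t i b))"
      by (subst det_mult[of _ k]) (auto simp: det_transpose[of _ k])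
    also have "det (mat k k (\<lambda>(i, b). m t i b)) = rdet k t" by (simp add: rdet_def m_def)
    finally show ?thesis by (simp add: W_def)
  qed
  have D0: "\<bar>D 0\<bar> = 1"
  proof -
    define A where "A v i = scal k i * (\<Sum>b<k. ec k (lev k v) b * (if i < k - 1 then hmom (i + 1 + b) 0 - 0 ^ (2 * (i + 1)) * hmom b 0 else 0 ^ (2 * b) * exp (- 0\<^sup>2)))" for v i
    have lk: "lev k v < k" for v using k by (auto simp: lev_def)
    have A1: "A v i = scal k i * (hmom (i + 1) 0 * poly (qpoly k (lev k v)) (- (real (i + 1) + 1 / 2)))" if "i < k - 1" for v i
    proof -
      have "(\<Sum>b<k. ec k (lev k v) b * hmom (i + 1 + b) 0) = gmom (i + 1) (epoly k (lev k v))"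
        using gmom_eq[of "epoly k (lev k v)" "k - 1" "i + 1"] degree_epoly[OF lk, of v] k
        by (simp add: ec_def mult_ac lessThan_Suc_atMost[symmetric])
      then show ?thesis unfolding A_def epoly(3)[symmetric] using that by simp
    qed
    have A2: "A v (k - 1) = scal k (k - 1) * poly (qpoly k (lev k v)) 0" for v
    proof -
      have "(\<Sum>b<k. ec k (lev k v) b * 0 ^ (2 * b)) = poly (qpoly k (lev k v)) 0"
        using epoly_sum[OF lk, of v 0] poly_epoly_0[of k "lev k v"] by simp
      then show ?thesis unfolding A_def by simp
    qed
    have off: "A v i = 0" if "v < k" "i < k" "v \<noteq> i" for v i
    proof (cases "i < k - 1")
      case True
      then show ?thesis unfolding A1[OF True] using qpoly_zero_diag[OF lk, of "i + 1" v] that by (auto simp: lev_def)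
    next
      case False
      then have "i = k - 1" "v < k - 1" using that by auto
      then show ?thesis using A2[of v] poly_qpoly_zero[of "lev k v" k] by (simp add: lev_def)
    qed
    have diag: "\<bar>A i i\<bar> = 1" if "i < k" for i
    proof (cases "i < k - 1")
      case True
      then have s: "scal k i = kap k * lam k (i + 1) / (2 * real (i + 1))" "lev k i = i + 1" by (auto simp: scal_def lev_def)
      show ?thesis unfolding A1[OF True] s by (rule diag_const) (use True in auto)
    next
      case False
      then have "i = k - 1" using that by simp
      then show ?thesis using A2[of i] corner_const[OF k] by (simp add: scal_def lev_def abs_mult)
    qed
    have "D 0 = det (mat k k (\<lambda>(v, i). A v i))" unfolding D_def A_def ..
    also have "\<dots> = prod_list (diag_mat (mat k k (\<lambda>(v, i). A v i)))"
      by (rule det_lower_triangular[of k]) (auto simp: off)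
    also have "diag_mat (mat k k (\<lambda>(v, i). A v i)) = map (\<lambda>i. A i i) [0..<k]" unfolding diag_mat_def by auto
    also have "prod_list \<dots> = (\<Prod>i<k. A i i)" by (simp add: prod.distinct_set_conv_list[symmetric] lessThan_atLeast0)
    finally show ?thesis by (simp add: abs_prod diag)
  qed
  show thesis by (rule that[of W]) (use D D0 in \<open>simp_all add: D_def\<close>)
qed

section \<open>Residue evaluation of the kernel\<close>

lemma powr_exp: "u > 0 \<Longrightarrow> complex_of_real u powr w = exp (w * complex_of_real (ln u))"
  by (simp add: powr_def Ln_of_real)

lemma exp_nat_ln: "u > 0 \<Longrightarrow> exp (of_nat m * complex_of_real (ln u)) = complex_of_real (u ^ m)"
  by (simp add: exp_of_nat_mult exp_of_real)

lemma lim_Gamma_neg: "((\<lambda>w. Gamma (- w) * (w - of_nat m)) \<longlongrightarrow> - ((-1) ^ m / fact m)) (at (of_nat m :: complex))"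
proof -
  have "filterlim (\<lambda>w. - w) (at (- of_nat m)) (at (of_nat m :: complex))"
    by (rule filterlim_atI) (auto intro!: tendsto_intros simp: eventually_at_filter)
  from filterlim_compose[OF Gamma_residues this]
  have "((\<lambda>w. Gamma (- w) * (- w + of_nat m)) \<longlongrightarrow> (-1) ^ m / fact m) (at (of_nat m :: complex))" .
  from tendsto_minus[OF this] show ?thesis by (simp add: algebra_simps)
qed

lemma lim_Gamma_half:
  assumes "n + x = 2 * h"
  shows "((\<lambda>z. Gamma (- (z + of_nat x) / 2) * (z - of_nat n)) \<longlongrightarrow> - 2 * ((-1) ^ h / fact h)) (at (of_nat n :: complex))"
proof -
  have h: "complex_of_nat n + of_nat x = 2 * of_nat h" using assms by (metis of_nat_add of_nat_mult of_nat_numeral)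
  have "filterlim (\<lambda>z. - (z + of_nat x) / 2) (at (- of_nat h)) (at (of_nat n :: complex))"
  proof (rule filterlim_atI)
    have "((\<lambda>z. - (z + of_nat x) / 2) \<longlongrightarrow> - (of_nat n + of_nat x) / 2) (at (of_nat n :: complex))" by (intro tendsto_intros) auto
    then show "((\<lambda>z. - (z + of_nat x) / 2) \<longlongrightarrow> - of_nat h) (at (of_nat n :: complex))" unfolding h by simp
    have "- (z + of_nat x) / 2 \<noteq> - of_nat h" if "z \<noteq> of_nat n" for z :: complex
    proof
      assume "- (z + of_nat x) / 2 = - of_nat h"
      then have "z + of_nat x = of_nat n + of_nat x" unfolding h by (simp add: field_simps minus_equation_iff)
      then show False using that by simp
    qed
    then show "\<forall>\<^sub>F z in at (of_nat n). - (z + of_nat x) / 2 \<noteq> - complex_of_nat h" by (auto simp: eventually_at_filter)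
  qed
  from filterlim_compose[OF Gamma_residues this]
  have "((\<lambda>z. Gamma (- (z + of_nat x) / 2) * (- (z + of_nat x) / 2 + of_nat h)) \<longlongrightarrow> (-1) ^ h / fact h) (at (of_nat n :: complex))" .
  from tendsto_mult_left[OF this, of "-2"]
  have "((\<lambda>z. -2 * (Gamma (- (z + of_nat x) / 2) * (- (z + of_nat x) / 2 + of_nat h))) \<longlongrightarrow> -2 * ((-1) ^ h / fact h)) (at (of_nat n :: complex))" .
  moreover have "-2 * (g * (- (z + of_nat x) / 2 + of_nat h)) = g * (z - of_nat n)" for g z :: complex
  proof -
    have "-2 * (- (z + of_nat x) / 2 + of_nat h) = (z + of_nat x) - 2 * of_nat h" by (simp add: field_simps)
    also have "\<dots> = z - of_nat n" unfolding h[symmetric] by simp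
    finally show ?thesis by (metis mult.left_commute)
  qed
  ultimately show ?thesis by simp
qed

text \<open>1/Gamma has a simple zero at - k. Its slope matters where this zero meets the pole 1/w
  on level 2k + 1.\<close>

lemma lim_rGamma_zero: "((\<lambda>w. rGamma (w / 2 - of_nat k) / w) \<longlongrightarrow> (-1) ^ k * fact k / 2) (at (0 :: complex))"
proof -
  have "filterlim (\<lambda>w. w / 2 - of_nat k) (at (- of_nat k)) (at (0 :: complex))"
    by (rule filterlim_atI) (auto intro!: tendsto_eq_intros simp: eventually_at_filter)
  from filterlim_compose[OF Gamma_residues this]
  have "((\<lambda>w. Gamma (w / 2 - of_nat k) * (w / 2)) \<longlongrightarrow> (-1) ^ k / fact k) (at (0 :: complex))" by simp
  from tendsto_inverse[OF this]
  have "((\<lambda>w. inverse (Gamma (w / 2 - of_nat k) * (w / 2))) \<longlongrightarrow> inverse ((-1) ^ k / fact k)) (at (0 :: complex))" by simp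
  moreover have "inverse (Gamma (w / 2 - of_nat k) * (w / 2)) = 2 * (rGamma (w / 2 - of_nat k) / w)" for w :: complex
    by (simp add: rGamma_inverse_Gamma field_simps)
  moreover have "inverse ((-1) ^ k / fact k) = ((-1) ^ k * fact k :: complex)"
    by (cases "even k") simp_all
  ultimately have "((\<lambda>w. 2 * (rGamma (w / 2 - of_nat k) / w)) \<longlongrightarrow> (-1) ^ k * fact k) (at (0 :: complex))" by simp
  from tendsto_mult_left[OF this, of "1 / 2"] show ?thesis by simp
qed

text \<open>Apart from the linear denominator, the integrand is a function of w times a function of
  z. Writing the power as exp (w ln u) makes holomorphy apparent.\<close>

definition wpart :: "nat \<Rightarrow> nat \<Rightarrow> real \<Rightarrow> complex \<Rightarrow> complex" where
  "wpart k x1 u1 w = Gamma (- w) * rGamma (of_nat x1 - w) * rGamma ((- of_nat x1 + w + 1) / 2)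
     * ((of_nat x1 - w - 2 * of_nat k) / (of_nat x1 - w - 2 * of_nat k - 1)) * exp (w * complex_of_real (ln u1))"

definition zpart :: "nat \<Rightarrow> nat \<Rightarrow> real \<Rightarrow> complex \<Rightarrow> complex" where
  "zpart k x2 u2 z = rGamma (z + 1) * Gamma (z + of_nat x2 + 1) * Gamma (- (z + of_nat x2) / 2)
     * ((z + of_nat x2 - 2 * of_nat k) / (z + of_nat x2 - 2 * of_nat k + 1)) * exp (z * complex_of_real (ln u2))"

lemma Kint_parts:
  assumes "u1 > 0" "u2 > 0"
  shows "Kint k x1 u1 x2 u2 w z = wpart k x1 u1 w * zpart k x2 u2 z / (w + z + of_nat x2 - of_nat x1 + 1)"
  unfolding Kint_def wpart_def zpart_def powr_exp[OF assms(1)] powr_exp[OF assms(2)] by (simp add: mult_ac)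

lemma ball_not_int:
  assumes "w \<in> ball (of_int m) 1 - {of_int m :: complex}" shows "w \<notin> \<int>"
proof
  assume "w \<in> \<int>"
  then obtain j where j: "w = of_int j" by (elim Ints_cases)
  have "norm (of_int j - of_int m :: complex) < 1" using assms j by (simp add: dist_norm norm_minus_commute)
  then have "\<bar>real_of_int (j - m)\<bar> < 1" unfolding of_int_diff[symmetric] norm_of_int .
  then have "j = m" by simp
  then show False using assms j by simp
qed

lemma nonint_facts:
  assumes "w \<notin> (\<int> :: complex set)"
  shows "- w \<notin> \<int>\<^sub>\<le>\<^sub>0" "w + of_nat a \<notin> \<int>\<^sub>\<le>\<^sub>0" "- (w + of_nat a) / 2 \<notin> \<int>\<^sub>\<le>\<^sub>0" "w \<noteq> of_int j"
proof -
  show "- w \<notin> \<int>\<^sub>\<le>\<^sub>0" using assms nonpos_Ints_subset_Ints by (auto simp: minus_in_Ints_iff)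
  have "w + of_nat a \<notin> \<int>" using assms by (metis Ints_diff Ints_of_nat add_diff_cancel_right')
  then show "w + of_nat a \<notin> \<int>\<^sub>\<le>\<^sub>0" using nonpos_Ints_subset_Ints by blast
  show "w \<noteq> of_int j" using assms by auto
  show "- (w + of_nat a) / 2 \<notin> \<int>\<^sub>\<le>\<^sub>0"
  proof
    assume "- (w + of_nat a) / 2 \<in> \<int>\<^sub>\<le>\<^sub>0"
    then obtain i where i: "- (w + of_nat a) / 2 = of_int i" using nonpos_Ints_subset_Ints Ints_cases by (metis subsetD)
    have "w + of_nat a = - 2 * (- (w + of_nat a) / 2)" by simp
    then have "w + of_nat a = - 2 * of_int i" unfolding i .
    then have "w = of_int (- 2 * i - int a)" by (simp add: eq_diff_eq)
    then show False using assms by (metis Ints_of_int)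
  qed
qed

lemma residue_w:
  assumes z: "of_nat m + z + of_nat x2 - of_nat x1 + 1 \<noteq> (0 :: complex)" and u: "u1 > 0" "u2 > 0"
    and lim: "((\<lambda>w. wpart k x1 u1 w * (w - of_nat m)) \<longlongrightarrow> \<alpha>) (at (of_nat m))"
  shows "residue (\<lambda>w. Kint k x1 u1 x2 u2 w z) (of_nat m) = \<alpha> * (zpart k x2 u2 z / (of_nat m + z + of_nat x2 - of_nat x1 + 1))"
proof -
  let ?c = "z + of_nat x2 - of_nat x1 + 1"
  \<comment> \<open>The disc contains neither another integer nor the zero of w + z + x2 - x1 + 1,
    so the only pole in it is that at m.\<close>
  define \<delta> where "\<delta> = min 1 (norm (of_nat m + ?c))"
  have \<delta>: "\<delta> > 0" using z by (simp add: \<delta>_def algebra_simps)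
  let ?S = "ball (of_nat m) \<delta> :: complex set"
  have ni: "w \<notin> \<int>" if "w \<in> ?S - {of_nat m}" for w
    using ball_not_int[of w "int m"] that by (auto simp: \<delta>_def)
  have nz: "w + ?c \<noteq> 0" if "w \<in> ?S" for w
  proof
    assume "w + ?c = 0"
    then have e: "of_nat m + ?c = of_nat m - w" by (simp add: algebra_simps)
    have "norm (of_nat m - w) < norm (of_nat m + ?c)" using that by (simp add: \<delta>_def dist_norm)
    then show False unfolding e by simp
  qed
  have "(\<lambda>w. wpart k x1 u1 w * zpart k x2 u2 z / (w + z + of_nat x2 - of_nat x1 + 1)) holomorphic_on (?S - {of_nat m})"
    unfolding wpart_def
  proof (intro holomorphic_intros)
    fix w assume w: "w \<in> ?S - {of_nat m}"
    show "- w \<notin> \<int>\<^sub>\<le>\<^sub>0" by (rule nonint_facts(1)[OF ni[OF w]])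
    show "of_nat x1 - w - 2 * of_nat k - 1 \<noteq> 0"
    proof
      assume "of_nat x1 - w - 2 * of_nat k - 1 = 0"
      then have "w = of_int (int x1 - 2 * int k - 1)" by (simp add: algebra_simps)
      then show False using nonint_facts(4)[OF ni[OF w]] by metis
    qed
    show "w + z + of_nat x2 - of_nat x1 + 1 \<noteq> 0" using nz[of w] w by (simp add: algebra_simps)
  qed auto
  moreover have "((\<lambda>w. wpart k x1 u1 w * zpart k x2 u2 z / (w + z + of_nat x2 - of_nat x1 + 1) * (w - of_nat m)) \<longlongrightarrow>
      \<alpha> * (zpart k x2 u2 z / (of_nat m + z + of_nat x2 - of_nat x1 + 1))) (at (of_nat m))"
  proof -
    have "((\<lambda>w. (wpart k x1 u1 w * (w - of_nat m)) * (zpart k x2 u2 z / (w + z + of_nat x2 - of_nat x1 + 1))) \<longlongrightarrow>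
      \<alpha> * (zpart k x2 u2 z / (of_nat m + z + of_nat x2 - of_nat x1 + 1))) (at (of_nat m))"
      by (intro tendsto_intros lim z)
    then show ?thesis by (simp add: mult_ac)
  qed
  ultimately have "residue (\<lambda>w. wpart k x1 u1 w * zpart k x2 u2 z / (w + z + of_nat x2 - of_nat x1 + 1)) (of_nat m)
     = \<alpha> * (zpart k x2 u2 z / (of_nat m + z + of_nat x2 - of_nat x1 + 1))"
    by (intro residue_simple'[of ?S]) (use \<delta> in auto)
  then show ?thesis by (simp add: Kint_parts[OF u])
qed

text \<open>Close to n but off it all denominators are nonzero and the inner residues are explicit,
  so the outer residue is a matter of limits at n. These limits are asked for only where the
  coefficient \<alpha> m is nonzero.\<close>

lemma residue_z:
  assumes u: "u1 > 0" "u2 > 0"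
    and \<alpha>: "\<And>m. m < x1 \<Longrightarrow> ((\<lambda>w. wpart k x1 u1 w * (w - of_nat m)) \<longlongrightarrow> \<alpha> m) (at (of_nat m))"
    and \<beta>: "\<And>m. m < x1 \<Longrightarrow> \<alpha> m \<noteq> 0 \<Longrightarrow> ((\<lambda>z. zpart k x2 u2 z / (z + of_nat x2 - of_nat (x1 - 1 - m)) * (z - of_nat n)) \<longlongrightarrow> \<beta> m) (at (of_nat n))"
  shows "residue (\<lambda>z. \<Sum>m<x1. residue (\<lambda>w. Kint k x1 u1 x2 u2 w z) (of_nat m)) (of_nat n) = (\<Sum>m<x1. \<alpha> m * \<beta> m)"
proof -
  let ?S = "ball (of_nat n) 1 :: complex set"
  define g where "g z = (\<Sum>m<x1. \<alpha> m * (zpart k x2 u2 z / (z + of_nat x2 - of_nat (x1 - 1 - m))))" for z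
  have c: "of_nat m + z + of_nat x2 - of_nat x1 + 1 = z + of_nat x2 - of_nat (x1 - 1 - m)" if "m < x1" for m and z :: complex
    using that by (simp add: of_nat_diff)
  have ni: "z \<notin> \<int>" if "z \<in> ?S - {of_nat n}" for z using ball_not_int[of z "int n"] that by auto
  have nz: "z + of_nat x2 - of_nat j \<noteq> 0" if "z \<in> ?S - {of_nat n}" for z j
  proof
    assume "z + of_nat x2 - of_nat j = 0"
    then have "z = of_int (int j - int x2)" by (simp add: algebra_simps)
    then show False using nonint_facts(4)[OF ni[OF that]] by metis
  qed
  have eq: "(\<Sum>m<x1. residue (\<lambda>w. Kint k x1 u1 x2 u2 w z) (of_nat m)) = g z" if z: "z \<in> ?S - {of_nat n}" for z
    unfolding g_def
  proof (intro sum.cong refl)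
    fix m assume "m \<in> {..<x1}"
    then have m: "m < x1" by simp
    have "of_nat m + z + of_nat x2 - of_nat x1 + 1 \<noteq> 0" unfolding c[OF m] by (rule nz[OF z])
    from residue_w[OF this u \<alpha>[OF m]]
    show "residue (\<lambda>w. Kint k x1 u1 x2 u2 w z) (of_nat m) = \<alpha> m * (zpart k x2 u2 z / (z + of_nat x2 - of_nat (x1 - 1 - m)))"
      unfolding c[OF m] .
  qed
  have "residue (\<lambda>z. \<Sum>m<x1. residue (\<lambda>w. Kint k x1 u1 x2 u2 w z) (of_nat m)) (of_nat n) = residue g (of_nat n)"
  proof (rule residue_cong[OF _ refl])
    have "\<forall>\<^sub>F z in at (of_nat n :: complex). z \<in> ?S - {of_nat n}"
      using eventually_at_in_open[of ?S "of_nat n"] by simp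
    then show "\<forall>\<^sub>F z in at (of_nat n). (\<Sum>m<x1. residue (\<lambda>w. Kint k x1 u1 x2 u2 w z) (of_nat m)) = g z"
      by eventually_elim (rule eq)
  qed
  also have "\<dots> = (\<Sum>m<x1. \<alpha> m * \<beta> m)"
  proof (rule residue_simple'[of ?S])
    show "g holomorphic_on (?S - {of_nat n})"
      unfolding g_def zpart_def
    proof (intro holomorphic_intros)
      fix z m assume z: "z \<in> ?S - {of_nat n}"
      show "z + of_nat x2 + 1 \<notin> \<int>\<^sub>\<le>\<^sub>0" using nonint_facts(2)[OF ni[OF z], of "x2 + 1"] by (simp add: add_ac)
      show "- (z + of_nat x2) / 2 \<notin> \<int>\<^sub>\<le>\<^sub>0" by (rule nonint_facts(3)[OF ni[OF z]])
      show "z + of_nat x2 - 2 * of_nat k + 1 \<noteq> 0"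
      proof
        assume "z + of_nat x2 - 2 * of_nat k + 1 = 0"
        then have "z = of_int (2 * int k - 1 - int x2)" by (simp add: algebra_simps)
        then show False using nonint_facts(4)[OF ni[OF z]] by metis
      qed
      show "z + of_nat x2 - of_nat (x1 - 1 - m) \<noteq> 0" by (rule nz[OF z])
    qed auto
    have "((\<lambda>z. \<Sum>m<x1. \<alpha> m * (zpart k x2 u2 z / (z + of_nat x2 - of_nat (x1 - 1 - m)) * (z - of_nat n))) \<longlongrightarrow> (\<Sum>m<x1. \<alpha> m * \<beta> m)) (at (of_nat n))"
    proof (rule tendsto_sum)
      fix m assume "m \<in> {..<x1}"
      then show "((\<lambda>z. \<alpha> m * (zpart k x2 u2 z / (z + of_nat x2 - of_nat (x1 - 1 - m)) * (z - of_nat n))) \<longlongrightarrow> \<alpha> m * \<beta> m) (at (of_nat n))"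
      proof (cases "\<alpha> m = 0")
        case False
        then show ?thesis using \<open>m \<in> {..<x1}\<close> by (intro tendsto_mult_left \<beta>) auto
      qed simp
    qed
    then show "((\<lambda>z. g z * (z - of_nat n)) \<longlongrightarrow> (\<Sum>m<x1. \<alpha> m * \<beta> m)) (at (of_nat n))"
      unfolding g_def by (simp add: sum_distrib_right mult.assoc)
  qed auto
  finally show ?thesis .
qed

section \<open>Simple poles of the two factors\<close>

lemma tendsto_rGamma_complex: "(f \<longlongrightarrow> l) F \<Longrightarrow> ((\<lambda>x. rGamma (f x)) \<longlongrightarrow> rGamma (l :: complex)) F"
  using holomorphic_on_imp_continuous_on[OF holomorphic_rGamma[of UNIV]]
  by (auto simp: continuous_on_eq_continuous_at intro: isCont_tendsto_compose)

lemma Suc_not_nonpos: "complex_of_nat (Suc n) \<notin> \<int>\<^sub>\<le>\<^sub>0"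
proof
  assume "complex_of_nat (Suc n) \<in> \<int>\<^sub>\<le>\<^sub>0"
  then obtain i where "complex_of_nat (Suc n) = - of_nat i" by (elim nonpos_Ints_cases')
  then have "complex_of_nat (Suc n + i) = 0" unfolding of_nat_add by simp
  then show False by (simp only: of_nat_eq_0_iff)
qed

text \<open>Here v = x1 - 1 - m, and u^m is split off. The value v = 2k, a pole of the rational
  factor, is the subject of \<open>lim_wpart_corner\<close>.\<close>

definition acoef :: "nat \<Rightarrow> nat \<Rightarrow> nat \<Rightarrow> real" where
  "acoef k m v = - ((-1) ^ m / fact m) / fact v * rGamma (- real v / 2) * ((real v + 1 - 2 * real k) / (real v - 2 * real k))"

lemma lim_wpart:
  assumes u: "u > 0" and m: "m + v + 1 = x1" and v: "v \<noteq> 2 * k"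
  shows "((\<lambda>w. wpart k x1 u w * (w - of_nat m)) \<longlongrightarrow> complex_of_real (acoef k m v * u ^ m)) (at (of_nat m))"
proof -
  have x1: "(of_nat x1 :: complex) = of_nat m + of_nat v + 1" using m by (metis of_nat_1 of_nat_add)
  have vk: "(of_nat v :: complex) - 2 * of_nat k \<noteq> 0"
  proof
    assume "complex_of_nat v - 2 * of_nat k = 0"
    then have "complex_of_nat v = of_nat (2 * k)" by simp
    then show False using v by (simp only: of_nat_eq_iff)
  qed
  have "((\<lambda>w. (Gamma (- w) * (w - of_nat m)) * rGamma (of_nat x1 - w) * rGamma ((- of_nat x1 + w + 1) / 2)
     * ((of_nat x1 - w - 2 * of_nat k) / (of_nat x1 - w - 2 * of_nat k - 1)) * exp (w * complex_of_real (ln u))) \<longlongrightarrow>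
     - ((-1) ^ m / fact m) * rGamma (of_nat x1 - of_nat m) * rGamma ((- of_nat x1 + of_nat m + 1) / 2)
     * ((of_nat x1 - of_nat m - 2 * of_nat k) / (of_nat x1 - of_nat m - 2 * of_nat k - 1)) * exp (of_nat m * complex_of_real (ln u))) (at (of_nat m))"
    by (intro tendsto_intros lim_Gamma_neg tendsto_rGamma_complex) (use vk in \<open>auto simp: x1\<close>)
  also have "rGamma (of_nat x1 - of_nat m :: complex) = 1 / fact v"
  proof -
    have "of_nat x1 - of_nat m = (of_nat (Suc v) :: complex)" by (simp add: x1)
    then show ?thesis using Gamma_fact[of v, where 'a = complex] by (simp add: rGamma_inverse_Gamma field_simps)
  qed
  also have "(- of_nat x1 + of_nat m + 1) / 2 = complex_of_real (- real v / 2)" by (simp add: x1)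
  also have "of_nat x1 - of_nat m - 2 * of_nat k = complex_of_real (real v + 1 - 2 * real k)" by (simp add: x1)
  also have "rGamma (complex_of_real (- real v / 2)) = complex_of_real (rGamma (- real v / 2))"
    by (rule rGamma_complex_of_real)
  also have "exp (of_nat m * complex_of_real (ln u)) = complex_of_real (u ^ m)" by (rule exp_nat_ln[OF u])
  finally have "((\<lambda>w. (Gamma (- w) * (w - of_nat m)) * rGamma (of_nat x1 - w) * rGamma ((- of_nat x1 + w + 1) / 2)
     * ((of_nat x1 - w - 2 * of_nat k) / (of_nat x1 - w - 2 * of_nat k - 1)) * exp (w * complex_of_real (ln u))) \<longlongrightarrow>
     complex_of_real (acoef k m v * u ^ m)) (at (of_nat m))"
    by (simp add: acoef_def)
  then show ?thesis by (simp add: wpart_def mult_ac)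
qed

text \<open>Even v meet a zero of 1/Gamma, and v = 2k - 1 meets the zero of the rational factor. On
  either level k - 1 odd values of v survive, and on level 2k + 1 also the separate value v = 2k:
  this is the finite rank of the kernel.\<close>

lemma acoef_zero: "even v \<or> v + 1 = 2 * k \<Longrightarrow> acoef k m v = 0"
proof -
  have "rGamma (- real v / 2) = 0" if "even v"
  proof -
    obtain i where "v = 2 * i" using \<open>even v\<close> by (elim evenE)
    then have "- real v / 2 = - real i" by simp
    then show ?thesis by (simp add: rGamma_eq_zero_iff)
  qed
  moreover have "real v + 1 - 2 * real k = 0" if "v + 1 = 2 * k" using that by (simp add: of_nat_add[symmetric] flip: of_nat_Suc)
  ultimately show "even v \<or> v + 1 = 2 * k \<Longrightarrow> acoef k m v = 0" by (auto simp: acoef_def)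
qed

text \<open>At w = 0 the rational factor - (1 - w) / w has a pole, which the zero of 1/Gamma at - k
  cancels; the pole of Gamma (- w) thus stays simple.\<close>

lemma lim_wpart_corner:
  assumes u: "u > 0"
  shows "((\<lambda>w. wpart k (2 * k + 1) u w * (w - of_nat 0)) \<longlongrightarrow> complex_of_real (l00 k)) (at (of_nat 0))"
proof -
  have lr: "((\<lambda>w. rGamma (w / 2 - of_nat k) / w) \<longlongrightarrow> (-1) ^ k * fact k / 2) (at (of_nat 0 :: complex))"
    using lim_rGamma_zero[of k] by simp
  have l1: "((\<lambda>w. rGamma (of_nat (2 * k + 1) - w)) \<longlongrightarrow> rGamma (of_nat (2 * k + 1) - of_nat 0)) (at (of_nat 0 :: complex))"
    by (intro tendsto_intros tendsto_rGamma_complex)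
  have l2: "((\<lambda>w. - (1 - w)) \<longlongrightarrow> - (1 - of_nat 0)) (at (of_nat 0 :: complex))" by (intro tendsto_intros)
  have l3: "((\<lambda>w. exp (w * complex_of_real (ln u))) \<longlongrightarrow> exp (of_nat 0 * complex_of_real (ln u))) (at (of_nat 0 :: complex))" by (intro tendsto_intros)
  note L = tendsto_mult[OF tendsto_mult[OF tendsto_mult[OF tendsto_mult[OF lim_Gamma_neg[of 0] l1] lr] l2] l3]
  have r: "rGamma (of_nat (2 * k + 1) - of_nat 0 :: complex) = 1 / fact (2 * k)"
    using Gamma_fact[of "2 * k", where 'a = complex] by (simp add: rGamma_inverse_Gamma field_simps)
  have val: "- ((-1) ^ 0 / fact 0) * rGamma (of_nat (2 * k + 1) - of_nat 0) * ((-1) ^ k * fact k / 2) * - (1 - of_nat 0) * exp (of_nat 0 * complex_of_real (ln u)) = complex_of_real (l00 k)"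
    unfolding r by (simp add: l00_def)
  have l: "((\<lambda>w. (Gamma (- w) * (w - of_nat 0)) * rGamma (of_nat (2 * k + 1) - w) * (rGamma (w / 2 - of_nat k) / w)
     * (- (1 - w)) * exp (w * complex_of_real (ln u))) \<longlongrightarrow> complex_of_real (l00 k)) (at (of_nat 0))"
    using L unfolding val .
  have "wpart k (2 * k + 1) u w * (w - of_nat 0) = (Gamma (- w) * (w - of_nat 0)) * rGamma (of_nat (2 * k + 1) - w) * (rGamma (w / 2 - of_nat k) / w)
     * (- (1 - w)) * exp (w * complex_of_real (ln u))" for w
  proof -
    have 1: "(- complex_of_nat (2 * k + 1) + w + 1) / 2 = w / 2 - of_nat k" by (simp add: field_simps)
    have 2: "complex_of_nat (2 * k + 1) - w - 2 * of_nat k = 1 - w" by simp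
    have 3: "(1 - w) / (1 - w - 1) = - (1 - w) / w" by (cases "w = 0") (auto simp: field_simps)
    show ?thesis unfolding wpart_def 1 2 3 by (simp add: mult_ac)
  qed
  then show ?thesis using l by simp
qed

text \<open>For even n + x2 the pole at n is that of Gamma (- (z + x2) / 2). The quotient of z + x2
  - 2k and the linear denominator is abstracted to g since it degenerates to the constant 1 when v =
  2k.\<close>

lemma lim_zpart_even:
  assumes u: "u > 0" and s: "n + x2 = 2 * h" and c: "(of_nat (n + x2) :: complex) - 2 * of_nat k + 1 \<noteq> 0"
    and g: "(g \<longlongrightarrow> g0) (at (of_nat n))"
    and eq: "\<forall>\<^sub>F z in at (of_nat n). (z + of_nat x2 - 2 * of_nat k) / (z + of_nat x2 - of_nat v) = g z"
  shows "((\<lambda>z. zpart k x2 u z / (z + of_nat x2 - of_nat v) * (z - of_nat n)) \<longlongrightarrow>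
    (fact (n + x2) / fact n) * (- 2 * ((-1) ^ h / fact h)) * (g0 / (of_nat (n + x2) - 2 * of_nat k + 1)) * complex_of_real (u ^ n)) (at (of_nat n))"
proof -
  have x: "complex_of_nat n + of_nat x2 = of_nat (n + x2)" by simp
  have gp: "complex_of_nat n + of_nat x2 + 1 \<notin> \<int>\<^sub>\<le>\<^sub>0"
  proof -
    have "complex_of_nat n + of_nat x2 + 1 = of_nat (Suc (n + x2))" by simp
    then show ?thesis by (simp only: Suc_not_nonpos not_False_eq_True)
  qed
  have "((\<lambda>z. rGamma (z + 1) * Gamma (z + of_nat x2 + 1) * (Gamma (- (z + of_nat x2) / 2) * (z - of_nat n))
     * (g z / (z + of_nat x2 - 2 * of_nat k + 1)) * exp (z * complex_of_real (ln u))) \<longlongrightarrow>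
     rGamma (of_nat n + 1) * Gamma (of_nat n + of_nat x2 + 1) * (- 2 * ((-1) ^ h / fact h))
     * (g0 / (of_nat n + of_nat x2 - 2 * of_nat k + 1)) * exp (of_nat n * complex_of_real (ln u))) (at (of_nat n))"
    by (intro tendsto_intros lim_Gamma_half[OF s] g gp tendsto_rGamma_complex) (use c in auto)
  also have "rGamma (of_nat n + 1 :: complex) * Gamma (of_nat n + of_nat x2 + 1) = fact (n + x2) / fact n"
  proof -
    have "of_nat n + 1 = (of_nat (Suc n) :: complex)" "of_nat n + of_nat x2 + 1 = (of_nat (Suc (n + x2)) :: complex)" by simp_all
    then show ?thesis using Gamma_fact[of n, where 'a = complex] Gamma_fact[of "n + x2", where 'a = complex]
      by (simp add: rGamma_inverse_Gamma field_simps)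
  qed
  also have "exp (of_nat n * complex_of_real (ln u)) = complex_of_real (u ^ n)" by (rule exp_nat_ln[OF u])
  finally have l: "((\<lambda>z. rGamma (z + 1) * Gamma (z + of_nat x2 + 1) * (Gamma (- (z + of_nat x2) / 2) * (z - of_nat n))
     * (g z / (z + of_nat x2 - 2 * of_nat k + 1)) * exp (z * complex_of_real (ln u))) \<longlongrightarrow>
     (fact (n + x2) / fact n) * (- 2 * ((-1) ^ h / fact h)) * (g0 / (of_nat (n + x2) - 2 * of_nat k + 1)) * complex_of_real (u ^ n)) (at (of_nat n))"
    unfolding x .
  have "\<forall>\<^sub>F z in at (of_nat n). zpart k x2 u z / (z + of_nat x2 - of_nat v) * (z - of_nat n) = rGamma (z + 1) * Gamma (z + of_nat x2 + 1) * (Gamma (- (z + of_nat x2) / 2) * (z - of_nat n))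
     * (g z / (z + of_nat x2 - 2 * of_nat k + 1)) * exp (z * complex_of_real (ln u))"
    using eq
  proof eventually_elim
    case (elim z)
    have e: "(r * G * H * (a / b) * e) / d * y = r * G * (H * y) * ((a / d) / b) * e" for r G H a b e d y :: complex
      by (simp add: divide_inverse mult_ac)
    show ?case unfolding zpart_def e elim by (rule refl)
  qed
  then show ?thesis using l by (simp only: tendsto_cong)
qed

lemma lim_zpart_odd:
  assumes u: "u > 0" and s: "odd (n + x2)" and c: "(n + x2) + 1 \<noteq> 2 * k" "n + x2 \<noteq> v"
  shows "((\<lambda>z. zpart k x2 u z / (z + of_nat x2 - of_nat v) * (z - of_nat n)) \<longlongrightarrow> 0) (at (of_nat n))"
proof -
  have gp: "complex_of_nat n + of_nat x2 + 1 \<notin> \<int>\<^sub>\<le>\<^sub>0"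
  proof -
    have "complex_of_nat n + of_nat x2 + 1 = of_nat (Suc (n + x2))" by simp
    then show ?thesis by (simp only: Suc_not_nonpos not_False_eq_True)
  qed
  have gh: "- (complex_of_nat n + of_nat x2) / 2 \<notin> \<int>\<^sub>\<le>\<^sub>0"
  proof
    assume "- (complex_of_nat n + of_nat x2) / 2 \<in> \<int>\<^sub>\<le>\<^sub>0"
    then obtain i where "- (complex_of_nat n + of_nat x2) / 2 = - of_nat i" by (elim nonpos_Ints_cases')
    then have "complex_of_nat (n + x2) = of_nat (2 * i)" by (simp add: field_simps)
    then have "n + x2 = 2 * i" by (simp only: of_nat_eq_iff)
    then show False using s by simp
  qed
  have c1: "complex_of_nat n + of_nat x2 - 2 * of_nat k + 1 \<noteq> 0"
  proof
    assume "complex_of_nat n + of_nat x2 - 2 * of_nat k + 1 = 0"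
    then have "complex_of_nat (n + x2 + 1) = of_nat (2 * k)" by (simp add: algebra_simps)
    then show False using c(1) by (simp only: of_nat_eq_iff)
  qed
  have c2: "complex_of_nat n + of_nat x2 - of_nat v \<noteq> 0"
  proof
    assume "complex_of_nat n + of_nat x2 - of_nat v = 0"
    then have "complex_of_nat (n + x2) = of_nat v" by simp
    then show False using c(2) by (simp only: of_nat_eq_iff)
  qed
  have "((\<lambda>z. zpart k x2 u z / (z + of_nat x2 - of_nat v) * (z - of_nat n)) \<longlongrightarrow> zpart k x2 u (of_nat n) / (of_nat n + of_nat x2 - of_nat v) * (of_nat n - of_nat n)) (at (of_nat n))"
    unfolding zpart_def by (intro tendsto_intros gp gh c1 c2 tendsto_rGamma_complex) simp_all
  then show ?thesis by simp
qed

text \<open>On level 2k - 1 the denominator z + x2 - 2k + 1 is z itself, so n = 0 carries a pole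
  although n + x2 is odd. Existence of the limit gives \<open>bet\<close> its meaning there.\<close>

lemma lim_zpart_first:
  assumes u: "u > 0" and k: "k \<ge> 1" and c: "2 * k - 1 \<noteq> v"
  shows "\<exists>l. ((\<lambda>z. zpart k (2 * k - 1) u z / (z + of_nat (2 * k - 1) - of_nat v) * (z - of_nat 0)) \<longlongrightarrow> l) (at (of_nat 0))"
proof -
  have kk: "complex_of_nat (2 * k - 1) = 2 * of_nat k - 1" using k by (simp add: of_nat_diff)
  have gp: "0 + complex_of_nat (2 * k - 1) + 1 \<notin> \<int>\<^sub>\<le>\<^sub>0"
  proof -
    have "0 + complex_of_nat (2 * k - 1) + 1 = of_nat (Suc (2 * k - 1))" by simp
    then show ?thesis by (simp only: Suc_not_nonpos not_False_eq_True)
  qed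
  have gh: "- (0 + complex_of_nat (2 * k - 1)) / 2 \<notin> \<int>\<^sub>\<le>\<^sub>0"
  proof
    assume "- (0 + complex_of_nat (2 * k - 1)) / 2 \<in> \<int>\<^sub>\<le>\<^sub>0"
    then obtain i where "- (0 + complex_of_nat (2 * k - 1)) / 2 = - of_nat i" by (elim nonpos_Ints_cases')
    then have "complex_of_nat (2 * k - 1) = of_nat (2 * i)" by (simp add: field_simps)
    then have "2 * k - 1 = 2 * i" by (simp only: of_nat_eq_iff)
    then show False using k by presburger
  qed
  have c2: "0 + complex_of_nat (2 * k - 1) - of_nat v \<noteq> 0"
  proof
    assume "0 + complex_of_nat (2 * k - 1) - of_nat v = 0"
    then have "complex_of_nat (2 * k - 1) = of_nat v" by simp
    then show False using c by (simp only: of_nat_eq_iff)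
  qed
  have l: "((\<lambda>z. rGamma (z + 1) * Gamma (z + of_nat (2 * k - 1) + 1) * Gamma (- (z + of_nat (2 * k - 1)) / 2) * (z - 1)
     * exp (z * complex_of_real (ln u)) / (z + of_nat (2 * k - 1) - of_nat v)) \<longlongrightarrow>
     rGamma (0 + 1) * Gamma (0 + of_nat (2 * k - 1) + 1) * Gamma (- (0 + of_nat (2 * k - 1)) / 2) * (0 - 1)
     * exp (0 * complex_of_real (ln u)) / (0 + of_nat (2 * k - 1) - of_nat v)) (at (0 :: complex))"
    by (intro tendsto_intros gp gh c2 tendsto_rGamma_complex) simp_all
  have "\<forall>\<^sub>F z in at (0::complex). zpart k (2 * k - 1) u z / (z + of_nat (2 * k - 1) - of_nat v) * (z - of_nat 0) =
     rGamma (z + 1) * Gamma (z + of_nat (2 * k - 1) + 1) * Gamma (- (z + of_nat (2 * k - 1)) / 2) * (z - 1)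
     * exp (z * complex_of_real (ln u)) / (z + of_nat (2 * k - 1) - of_nat v)"
  proof -
    have "\<forall>\<^sub>F z in at (0::complex). z \<noteq> 0" by (simp add: eventually_at_filter)
    then show ?thesis
    proof eventually_elim
      case (elim z)
      have 1: "z + complex_of_nat (2 * k - 1) - 2 * of_nat k = z - 1" unfolding kk by simp
      show ?case unfolding zpart_def 1 using elim by simp
    qed
  qed
  from tendsto_cong[OF this] l show ?thesis by auto
qed

section \<open>Summation of the residues in z\<close>

lemma fact_double_shift: "fact (2 * p + 2 * k) * fact p = 2 ^ k * (\<Prod>o'<k. 2 * real p + 2 * real o' + 1) * fact (2 * p) * fact (p + k)"
proof (induction k)
  case (Suc k)
  have "2 * p + 2 * Suc k = Suc (Suc (2 * p + 2 * k))" by simp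
  then have "(fact (2 * p + 2 * Suc k) :: real) * fact p = (2 * real p + 2 * real k + 2) * (2 * real p + 2 * real k + 1) * (fact (2 * p + 2 * k) * fact p)"
    by (simp only: fact_Suc of_nat_Suc of_nat_add of_nat_mult of_nat_numeral) (simp add: algebra_simps)
  also have "\<dots> = 2 ^ Suc k * (\<Prod>o'<Suc k. 2 * real p + 2 * real o' + 1) * fact (2 * p) * ((real p + real k + 1) * fact (p + k))"
    unfolding Suc by (simp add: algebra_simps)
  also have "(real p + real k + 1) * fact (p + k) = fact (p + Suc k)" by (simp add: algebra_simps)
  finally show ?case .
qed simp

text \<open>The surviving values of x1 - 1 - m. Those with v < k - 1 occur on both levels, so their
  functions of z are shared; the last one belongs to level 2k + 1 alone.\<close>

definition qidx :: "nat \<Rightarrow> nat \<Rightarrow> nat" where "qidx k v = (if v < k - 1 then 2 * k - 3 - 2 * v else 2 * k)"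

text \<open>The limit of (z + x2 - 2k) / (z + x2 - \<open>qidx k v\<close>) at z = n when n + x2 =
  2p + 2k.\<close>

definition gq :: "nat \<Rightarrow> nat \<Rightarrow> nat \<Rightarrow> real" where "gq k v p = (if v < k - 1 then 2 * real p / (2 * real p + 2 * real (v + 1) + 1) else 1)"

text \<open>The odd factors stem from the quotient of factorials in the residue. The factor of index
  0 is 2p + 1, and for v < k - 1 the denominator of \<open>gq\<close> cancels the factor of index v
  + 1.\<close>

lemma gq_qpoly:
  assumes v: "v < k"
  shows "(\<Prod>o'<k. 2 * real p + 2 * real o' + 1) * gq k v p = (2 * real p + 1) * poly (qpoly k (lev k v)) (real p)"
proof -
  let ?f = "\<lambda>o'. 2 * real p + 2 * real o' + 1"
  have e: "{..<k} = insert 0 {1..<k}" using v by auto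
  have 1: "(\<Prod>o'<k. ?f o') = (2 * real p + 1) * (\<Prod>o'\<in>{1..<k}. ?f o')" unfolding e by simp
  show ?thesis
  proof (cases "v < k - 1")
    case True
    have m: "v + 1 \<in> {1..<k}" using True by auto
    have "(\<Prod>o'\<in>{1..<k}. ?f o') = ?f (v + 1) * (\<Prod>o'\<in>{1..<k} - {v + 1}. ?f o')" by (rule prod.remove[OF _ m]) simp
    moreover have "?f (v + 1) \<noteq> 0" by (simp add: add_pos_nonneg add_nonneg_eq_0_iff)
    moreover have "(\<Prod>o'\<in>{1..<k} - {v + 1}. ?f o') = (\<Prod>o'\<in>{1..<k} - {v + 1}. 2 * real o' + 1 + real p * 2)"
      by (rule prod.cong) auto
    ultimately show ?thesis using True unfolding 1 by (simp add: lev_def qpoly_def poly_prod gq_def)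
  next
    case False
    moreover have "(\<Prod>o'\<in>{1..<k}. ?f o') = (\<Prod>o'\<in>{1..<k}. 2 * real o' + 1 + real p * 2)"
      by (rule prod.cong) auto
    ultimately show ?thesis unfolding 1 by (simp add: lev_def qpoly_def poly_prod gq_def)
  qed
qed

text \<open>A limit rather than a formula, to have one name for all n, including the exceptional
  pole at n = 0 on level 2k - 1.\<close>

definition bet :: "nat \<Rightarrow> nat \<Rightarrow> nat \<Rightarrow> real \<Rightarrow> nat \<Rightarrow> complex" where
  "bet k x2 v u n = Lim (at (of_nat n)) (\<lambda>z. zpart k x2 u z / (z + of_nat x2 - of_nat (qidx k v)) * (z - of_nat n))"

lemma bet_odd:
  assumes k: "k \<ge> 1" and u: "u > 0" and v: "v < k" and n: "n + x2 = 2 * p + 2 * k"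
  defines "f \<equiv> (\<lambda>z. zpart k x2 u z / (z + of_nat x2 - of_nat (qidx k v)) * (z - of_nat n))"
    and "l \<equiv> complex_of_real ((fact (2 * p + 2 * k) / fact n) * (- 2 * ((-1) ^ (p + k) / fact (p + k))) * (gq k v p / (2 * real p + 1)) * u ^ n)"
  shows "(f \<longlongrightarrow> l) (at (of_nat n))" "bet k x2 v u n = l"
proof -
  have nc: "(of_nat n :: complex) + of_nat x2 = 2 * of_nat p + 2 * of_nat k" using n by (metis of_nat_add of_nat_mult of_nat_numeral)
  have c1: "(of_nat (n + x2) :: complex) - 2 * of_nat k + 1 = complex_of_real (2 * real p + 1)" unfolding n by simp
  have c: "(of_nat (n + x2) :: complex) - 2 * of_nat k + 1 \<noteq> 0" unfolding c1 of_real_eq_0_iff by (simp add: add_nonneg_eq_0_iff)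
  have n': "n + x2 = 2 * (p + k)" using n by simp
  have "\<exists>g. (g \<longlongrightarrow> complex_of_real (gq k v p)) (at (of_nat n)) \<and>
    (\<forall>\<^sub>F z in at (of_nat n). (z + of_nat x2 - 2 * of_nat k) / (z + of_nat x2 - of_nat (qidx k v)) = g z)"
  proof (cases "v < k - 1")
    case True
    have q: "qidx k v + 2 * (v + 1) + 1 = 2 * k" using True by (simp add: qidx_def)
    have q': "complex_of_nat (qidx k v) = 2 * of_nat k - 2 * of_nat (v + 1) - 1"
      using arg_cong[OF q, of complex_of_nat] by (simp add: algebra_simps)
    have d: "(of_nat n :: complex) + of_nat x2 - of_nat (qidx k v) = complex_of_real (2 * real p + 2 * real (v + 1) + 1)"
      unfolding nc q' by (simp add: algebra_simps)
    have d0: "2 * real p + 2 * real (v + 1) + 1 \<noteq> 0" by (simp add: add_nonneg_eq_0_iff)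
    have "((\<lambda>z. (z + of_nat x2 - 2 * of_nat k) / (z + of_nat x2 - of_nat (qidx k v))) \<longlongrightarrow>
       (of_nat n + of_nat x2 - 2 * of_nat k) / (of_nat n + of_nat x2 - of_nat (qidx k v))) (at (of_nat n :: complex))"
      by (intro tendsto_intros) (unfold d of_real_eq_0_iff, rule d0)
    moreover have "(of_nat n + of_nat x2 - 2 * of_nat k) / (of_nat n + of_nat x2 - of_nat (qidx k v)) = complex_of_real (gq k v p)"
    proof -
      have nn: "(of_nat n :: complex) + of_nat x2 - 2 * of_nat k = complex_of_real (2 * real p)" unfolding nc by simp
      show ?thesis unfolding d nn of_real_divide[symmetric] gq_def using True by (simp only: if_True)
    qed
    ultimately show ?thesis by auto
  next
    case False
    have "\<forall>\<^sub>F z in at (of_nat n :: complex). z \<noteq> 2 * of_nat k - of_nat x2" by (rule eventually_neq_at_within)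
    then have "\<forall>\<^sub>F z in at (of_nat n :: complex). (z + of_nat x2 - 2 * of_nat k) / (z + of_nat x2 - of_nat (qidx k v)) = 1"
      by eventually_elim (use False in \<open>simp add: qidx_def algebra_simps\<close>)
    then show ?thesis using False by (intro exI[of _ "\<lambda>_. 1"]) (simp add: gq_def)
  qed
  then obtain g where g: "(g \<longlongrightarrow> complex_of_real (gq k v p)) (at (of_nat n))"
    "\<forall>\<^sub>F z in at (of_nat n). (z + of_nat x2 - 2 * of_nat k) / (z + of_nat x2 - of_nat (qidx k v)) = g z" by blast
  note L = lim_zpart_even[OF u n' c g]
  have "fact (n + x2) / fact n * (- 2 * ((-1) ^ (p + k) / fact (p + k))) * (complex_of_real (gq k v p) / (of_nat (n + x2) - 2 * of_nat k + 1)) * complex_of_real (u ^ n) = l"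
    unfolding c1 l_def n by simp
  with L show t: "(f \<longlongrightarrow> l) (at (of_nat n))" unfolding f_def by simp
  show "bet k x2 v u n = l" unfolding bet_def using tendsto_Lim[OF _ t] unfolding f_def by simp
qed

text \<open>The odd indices are at most 2k - 3 and the last index is even, whereas n + x is odd and
  at least 2k - 1.\<close>

lemma qidx_ne: "v < k \<Longrightarrow> n + x = 2 * q + 1 \<Longrightarrow> q + 1 \<ge> k \<Longrightarrow> n + x \<noteq> qidx k v"
  unfolding qidx_def by (auto split: if_splits) presburger

lemma bet_even:
  assumes k: "k \<ge> 1" and u: "u > 0" and v: "v < k" and n: "n + x2 = 2 * q + 1" "q \<ge> k"
  defines "f \<equiv> (\<lambda>z. zpart k x2 u z / (z + of_nat x2 - of_nat (qidx k v)) * (z - of_nat n))"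
  shows "(f \<longlongrightarrow> 0) (at (of_nat n))" "bet k x2 v u n = 0"
proof -
  show t: "(f \<longlongrightarrow> 0) (at (of_nat n))" unfolding f_def
  proof (rule lim_zpart_odd[OF u])
    show "odd (n + x2)" using n by simp
    show "n + x2 + 1 \<noteq> 2 * k" using n by linarith
    show "n + x2 \<noteq> qidx k v" by (rule qidx_ne[OF v n(1)]) (use n in simp)
  qed
  show "bet k x2 v u n = 0" unfolding bet_def using tendsto_Lim[OF _ t] unfolding f_def by simp
qed

lemma bet_lim:
  assumes k: "k \<ge> 1" and u: "u > 0" and v: "v < k" and x2: "x2 = 2 * k - 1 \<or> x2 = 2 * k + 1"
  shows "((\<lambda>z. zpart k x2 u z / (z + of_nat x2 - of_nat (qidx k v)) * (z - of_nat n)) \<longlongrightarrow> bet k x2 v u n) (at (of_nat n))"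
proof (cases "odd n")
  case True
  then obtain i where i: "n = 2 * i + 1" by (elim oddE)
  have "\<exists>p. n + x2 = 2 * p + 2 * k" using x2 k
    by (elim disjE) (rule exI[of _ i] exI[of _ "i + 1"], simp add: i)+
  then obtain p where p: "n + x2 = 2 * p + 2 * k" by blast
  show ?thesis using bet_odd[OF k u v p] by simp
next
  case False
  then have "even n" by simp
  then obtain i where i: "n = 2 * i" by (elim evenE)
  show ?thesis
  proof (cases "n = 0 \<and> x2 = 2 * k - 1")
    case True
    have e: "0 + (2 * k - 1) = 2 * (k - 1) + 1" "k - 1 + 1 \<ge> k" using k by linarith+
    have "2 * k - 1 \<noteq> qidx k v" using qidx_ne[OF v e] unfolding add_0 .
    from lim_zpart_first[OF u k this] obtain l where l: "((\<lambda>z. zpart k x2 u z / (z + of_nat x2 - of_nat (qidx k v)) * (z - of_nat n)) \<longlongrightarrow> l) (at (of_nat n))"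
      using True by auto
    show ?thesis unfolding bet_def using tendsto_Lim[OF _ l] l by simp
  next
    case F: False
    have "\<exists>q. n + x2 = 2 * q + 1 \<and> q \<ge> k"
    proof (cases "x2 = 2 * k + 1")
      case True
      then show ?thesis by (intro exI[of _ "i + k"]) (simp add: i)
    next
      case False
      then show ?thesis using F x2 i k by (intro exI[of _ "i + k - 1"]) auto
    qed
    then obtain q where q: "n + x2 = 2 * q + 1" "q \<ge> k" by blast
    show ?thesis using bet_even[OF k u v q] by simp
  qed
qed

text \<open>Only odd n = 2p + 1 contribute, and they match the terms of index p + 1 in
  \<open>rfun_sums\<close>, whose term of index 0 is 0.\<close>

lemma bet_sums_b:
  assumes k: "k \<ge> 1" and u: "u > 0" and v: "v < k"
  shows "bet k (2 * k + 1) v u sums complex_of_real (kap k * rfun k (lev k v) u)"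
proof -
  let ?c = "\<lambda>p. kap k * (poly (qpoly k (lev k v)) (real p) / fact p * (-1) ^ p * (2 * real p * u ^ (2 * p - 1)))"
  have s: "?c sums (kap k * rfun k (lev k v) u)" by (rule sums_mult[OF rfun_sums[OF u]])
  have s1: "(\<lambda>p. ?c (Suc p)) sums (kap k * rfun k (lev k v) u)"
    using s by (subst sums_Suc_iff) simp
  have eq: "bet k (2 * k + 1) v u (2 * p + 1) = complex_of_real (?c (Suc p))" for p
  proof -
    let ?P = "Suc p"
    have n: "2 * p + 1 + (2 * k + 1) = 2 * ?P + 2 * k" by simp
    define A where "A = (\<Prod>o'<k. 2 * real ?P + 2 * real o' + 1)"
    have nz: "2 * real ?P + 1 \<noteq> 0" by (simp add: add_nonneg_eq_0_iff)
    have q: "poly (qpoly k (lev k v)) (real ?P) = A * gq k v ?P / (2 * real ?P + 1)"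
      using gq_qpoly[OF v, of ?P] nz unfolding A_def by (simp add: field_simps)
    have f: "fact (2 * ?P + 2 * k) = 2 ^ k * A * fact (2 * ?P) * fact (?P + k) / fact ?P"
      using fact_double_shift[of ?P k] unfolding A_def by (simp add: field_simps del: fact_Suc of_nat_Suc)
    have f2: "(fact (2 * ?P) :: real) = 2 * real ?P * fact (2 * p + 1)"
    proof -
      have "2 * ?P = Suc (2 * p + 1)" by simp
      then show ?thesis by (simp only: fact_Suc) (simp add: algebra_simps)
    qed
    have "(fact (2 * ?P + 2 * k) / fact (2 * p + 1)) * (- 2 * ((-1) ^ (?P + k) / fact (?P + k))) * (gq k v ?P / (2 * real ?P + 1)) * u ^ (2 * p + 1) = ?c ?P"
      unfolding f q kap_def f2 using nz by (simp add: field_simps power_add del: fact_Suc of_nat_Suc)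
    then show ?thesis using bet_odd(2)[OF k u v n] by simp
  qed
  have z: "bet k (2 * k + 1) v u n = 0" if "n \<notin> range (\<lambda>p. 2 * p + 1)" for n
  proof -
    have "even n" using \<open>n \<notin> range (\<lambda>p. 2 * p + 1)\<close> by (metis oddE rangeI)
    then obtain i where "n = 2 * i" by (elim evenE)
    then show ?thesis using bet_even(2)[OF k u v, of n "2 * k + 1" "i + k"] by simp
  qed
  have "strict_mono (\<lambda>p::nat. 2 * p + 1)" by (simp add: strict_mono_def)
  from sums_mono_reindex[OF this z] have "(\<lambda>p. bet k (2 * k + 1) v u (2 * p + 1)) sums complex_of_real (kap k * rfun k (lev k v) u) \<longleftrightarrow> ?thesis" by simp
  moreover have "(\<lambda>p. bet k (2 * k + 1) v u (2 * p + 1)) sums complex_of_real (kap k * rfun k (lev k v) u)"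
    unfolding eq using sums_of_real[OF s1] .
  ultimately show ?thesis by blast
qed

lemma qpoly_nonneg: "poly (qpoly k i) (real p) \<ge> 0"
  by (auto simp: qpoly_def poly_prod intro!: prod_nonneg mult_nonneg_nonneg)

text \<open>Comparison with the series of \<open>epoly\<close> at u^2, whose terms are nonnegative.
  Convergence is the point here: the functions of this level stand below the diagonal in
  \<open>det_two_level\<close>.\<close>

lemma bet_summable_a:
  assumes k: "k \<ge> 1" and u: "u > 0" and v: "v < k"
  shows "summable (bet k (2 * k - 1) v u)"
proof -
  let ?Q = "\<lambda>p. poly (qpoly k (lev k v)) (real p)"
  let ?c = "\<lambda>p. kap k * (?Q p / fact p * (-1) ^ p * (u ^ (2 * p + 1) / (2 * real p + 1)))"
  have eq: "bet k (2 * k - 1) v u (2 * p + 1) = complex_of_real (?c p)" for p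
  proof -
    have n: "2 * p + 1 + (2 * k - 1) = 2 * p + 2 * k" using k by simp
    define A where "A = (\<Prod>o'<k. 2 * real p + 2 * real o' + 1)"
    have nz: "2 * real p + 1 \<noteq> 0" by (simp add: add_nonneg_eq_0_iff)
    have q: "poly (qpoly k (lev k v)) (real p) = A * gq k v p / (2 * real p + 1)"
      using gq_qpoly[OF v, of p] nz unfolding A_def by (simp add: field_simps)
    have f: "fact (2 * p + 2 * k) = 2 ^ k * A * fact (2 * p) * fact (p + k) / fact p"
      using fact_double_shift[of p k] unfolding A_def by (simp add: field_simps del: fact_Suc of_nat_Suc)
    have f2: "(fact (2 * p + 1) :: real) = (2 * real p + 1) * fact (2 * p)" by (simp add: algebra_simps)
    have "(fact (2 * p + 2 * k) / fact (2 * p + 1)) * (- 2 * ((-1) ^ (p + k) / fact (p + k))) * (gq k v p / (2 * real p + 1)) * u ^ (2 * p + 1) = ?c p"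
    proof -
      have x: "2 ^ k * A * F2 * F / fp / ((2 * real p + 1) * F2) * (- 2 * ((-1) ^ (p + k) / F)) * (gq k v p / (2 * real p + 1)) * U =
        - 2 * (-1) ^ k * 2 ^ k * (A * gq k v p / (2 * real p + 1) / fp * (-1) ^ p * (U / (2 * real p + 1)))" if "F \<noteq> 0" "F2 \<noteq> 0" for F F2 fp U :: real
      proof -
        define d where "d = 2 * real p + 1"
        have "F2 * (F * (inverse F2 * inverse F)) = 1" using that by (simp add: field_simps)
        then show ?thesis unfolding d_def[symmetric] by (simp add: power_add divide_inverse mult_ac)
      qed
      show ?thesis unfolding f q kap_def f2 by (rule x) simp_all
    qed
    then show ?thesis using bet_odd(2)[OF k u v n] by simp
  qed
  have "summable (\<lambda>p. \<bar>kap k\<bar> * u * (?Q p / fact p * (u\<^sup>2) ^ p))"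
    by (intro summable_mult sums_summable[OF epoly(2)])
  moreover have "norm (bet k (2 * k - 1) v u (2 * p + 1)) \<le> \<bar>kap k\<bar> * u * (?Q p / fact p * (u\<^sup>2) ^ p)" for p
  proof -
    have "norm (bet k (2 * k - 1) v u (2 * p + 1)) = \<bar>?c p\<bar>" unfolding eq norm_of_real ..
    also have "\<dots> = \<bar>kap k\<bar> * (?Q p / fact p * (u ^ (2 * p + 1) / (2 * real p + 1)))"
      using u qpoly_nonneg[of k "lev k v" p] by (simp add: abs_mult power_abs)
    also have "\<dots> \<le> \<bar>kap k\<bar> * (?Q p / fact p * u ^ (2 * p + 1))"
    proof -
      have "u ^ (2 * p + 1) / (2 * real p + 1) \<le> u ^ (2 * p + 1) / 1" by (rule divide_left_mono) (use u in auto)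
      then show ?thesis using qpoly_nonneg[of k "lev k v" p] by (intro mult_left_mono) auto
    qed
    also have "\<dots> = \<bar>kap k\<bar> * u * (?Q p / fact p * (u\<^sup>2) ^ p)" by (simp add: power_mult[symmetric] mult_ac)
    finally show ?thesis .
  qed
  ultimately have s: "summable (\<lambda>p. bet k (2 * k - 1) v u (2 * p + 1))" by (rule summable_comparison_test'[where N = 0])
  \<comment> \<open>Changing the exceptional term n = 0 preserves summability and leaves a sequence
    supported on odd n.\<close>
  define c' where "c' n = (if n = 0 then 0 else bet k (2 * k - 1) v u n)" for n
  have z: "c' n = 0" if "n \<notin> range (\<lambda>p. 2 * p + 1)" for n
  proof -
    have "even n" using \<open>n \<notin> range (\<lambda>p. 2 * p + 1)\<close> by (metis oddE rangeI)
    then obtain i where "n = 2 * i" by (elim evenE)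
    then show ?thesis using bet_even(2)[OF k u v, of n "2 * k - 1" "i + k - 1"] k by (cases i) (auto simp: c'_def)
  qed
  have "strict_mono (\<lambda>p::nat. 2 * p + 1)" by (simp add: strict_mono_def)
  from summable_mono_reindex[OF this z] have "summable (\<lambda>p. c' (2 * p + 1)) \<longleftrightarrow> summable c'" by simp
  then have "summable c'" using s by (simp add: c'_def)
  moreover have "eventually (\<lambda>n. c' n = bet k (2 * k - 1) v u n) sequentially"
    by (rule eventually_sequentiallyI[of 1]) (simp add: c'_def)
  ultimately show ?thesis by (simp add: summable_cong)
qed

section \<open>The kernel on the levels 2k - 1 and 2k + 1\<close>

definition Rf :: "nat \<Rightarrow> nat \<Rightarrow> nat \<Rightarrow> real \<Rightarrow> complex" where "Rf k x2 v u = (\<Sum>n. bet k x2 v u n)"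

lemma Rf_b: "k \<ge> 1 \<Longrightarrow> u > 0 \<Longrightarrow> v < k \<Longrightarrow> Rf k (2 * k + 1) v u = complex_of_real (kap k * rfun k (lev k v) u)"
  unfolding Rf_def by (rule sums_unique[symmetric, OF bet_sums_b])

lemma bet_summable: "k \<ge> 1 \<Longrightarrow> u > 0 \<Longrightarrow> v < k \<Longrightarrow> x2 = 2 * k - 1 \<or> x2 = 2 * k + 1 \<Longrightarrow> summable (bet k x2 v u)"
  by (elim disjE) (simp_all only: bet_summable_a sums_summable[OF bet_sums_b])

definition Lf :: "nat \<Rightarrow> nat \<Rightarrow> nat \<Rightarrow> real \<Rightarrow> real" where
  "Lf k x1 v u = (if x1 = 2 * k - 1 then lam k (v + 1) * u ^ (2 * v + 1) else acoef k (2 * v + 3) (2 * k - 3 - 2 * v) * u ^ (2 * v + 3))"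

lemma acoef_lam:
  assumes "v < k - 1" shows "acoef k (2 * v + 1) (2 * k - 3 - 2 * v) = lam k (v + 1)"
proof -
  have V: "real (2 * k - 3 - 2 * v) = 2 * real k - 3 - 2 * real v" using assms by (simp add: of_nat_diff)
  have e: "2 * k - 1 - 2 * (v + 1) = 2 * k - 3 - 2 * v" "2 * (v + 1) - 1 = 2 * v + 1" by simp_all
  have r: "- (2 * real k - 3 - 2 * real v) / 2 = real (v + 1) + 1 / 2 - real k" by (simp add: field_simps)
  have d: "(2 * real k - 3 - 2 * real v + 1 - 2 * real k) / (2 * real k - 3 - 2 * real v - 2 * real k) = 2 * real (v + 1) / (2 * real (v + 1) + 1)"
  proof -
    have "2 * real k - 3 - 2 * real v + 1 - 2 * real k = - (2 * real (v + 1))" "2 * real k - 3 - 2 * real v - 2 * real k = - (2 * real (v + 1) + 1)" by simp_all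
    then show ?thesis by (simp only: minus_divide_divide)
  qed
  show ?thesis unfolding acoef_def lam_def V e r d by simp
qed

lemma residue_double:
  assumes k: "k \<ge> 1" and u: "u1 > 0" "u2 > 0" and x1: "x1 = 2 * k - 1 \<or> x1 = 2 * k + 1" and x2: "x2 = 2 * k - 1 \<or> x2 = 2 * k + 1"
  shows "residue (\<lambda>z. \<Sum>m<x1. residue (\<lambda>w. Kint k x1 u1 x2 u2 w z) (of_nat m)) (of_nat n) =
    (\<Sum>v<k-1. complex_of_real (Lf k x1 v u1) * bet k x2 v u2 n) + (if x1 = 2 * k - 1 then 0 else complex_of_real (l00 k)) * bet k x2 (k - 1) u2 n"
proof -
  define \<alpha> where "\<alpha> m = (if m = 0 \<and> x1 = 2 * k + 1 then complex_of_real (l00 k) else complex_of_real (acoef k m (x1 - 1 - m) * u1 ^ m))" for m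
  \<comment> \<open>Inverts the indexing: \<open>qidx k (vi m)\<close> is x1 - 1 - m whenever
    \<open>\<alpha> m\<close> is nonzero.\<close>
  define vi where "vi m = (if x1 = 2 * k - 1 then (m - 1) div 2 else if m = 0 then k - 1 else (m - 3) div 2)" for m
  have ne: "2 * k - 1 \<noteq> 2 * k + 1" using k by simp
  have \<alpha>: "((\<lambda>w. wpart k x1 u1 w * (w - of_nat m)) \<longlongrightarrow> \<alpha> m) (at (of_nat m))" if m: "m < x1" for m
  proof (cases "m = 0 \<and> x1 = 2 * k + 1")
    case True
    then show ?thesis using lim_wpart_corner[OF u(1), of k] by (simp add: \<alpha>_def)
  next
    case False
    have "m + (x1 - 1 - m) + 1 = x1" "x1 - 1 - m \<noteq> 2 * k" using m x1 False k by auto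
    from lim_wpart[OF u(1) this] show ?thesis using False by (auto simp: \<alpha>_def)
  qed
  have vi: "vi m < k \<and> qidx k (vi m) = x1 - 1 - m" if m: "m < x1" "\<alpha> m \<noteq> 0" for m
  proof (cases "m = 0 \<and> x1 = 2 * k + 1")
    case True
    then show ?thesis using k by (simp add: vi_def qidx_def)
  next
    case False
    then have "acoef k m (x1 - 1 - m) \<noteq> 0" using m(2) by (auto simp: \<alpha>_def)
    then have o: "odd (x1 - 1 - m)" and e: "x1 - 1 - m + 1 \<noteq> 2 * k" using acoef_zero by blast+
    from o obtain q where q: "x1 - 1 - m = 2 * q + 1" by (elim oddE)
    show ?thesis
    proof (cases "x1 = 2 * k - 1")
      case True
      then have mm: "m = 2 * (k - 2 - q) + 1" "q + 2 \<le> k" using q m(1) by auto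
      then have vm: "vi m = k - 2 - q" using True by (simp add: vi_def)
      have "k - 2 - q < k - 1" "2 * k - 3 - 2 * (k - 2 - q) = 2 * q + 1" "k - 2 - q < k" using mm(2) by linarith+
      then show ?thesis unfolding vm q by (simp add: qidx_def)
    next
      case F: False
      then have xb: "x1 = 2 * k + 1" using x1 by simp
      then have "2 * q + 2 \<noteq> 2 * k" "2 * q + 1 + m = 2 * k" using q m(1) e by auto
      then have "q + 1 \<noteq> k" "q < k" by linarith+
      then have q2: "q + 2 \<le> k" by linarith
      then have mm: "m = 2 * (k - 2 - q) + 3" "q + 2 \<le> k" using \<open>2 * q + 1 + m = 2 * k\<close> by linarith+
      then have vm: "vi m = k - 2 - q" using F by (simp add: vi_def)
      have "k - 2 - q < k - 1" "2 * k - 3 - 2 * (k - 2 - q) = 2 * q + 1" "k - 2 - q < k" using mm(2) by linarith+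
      then show ?thesis unfolding vm q by (simp add: qidx_def)
    qed
  qed
  have "residue (\<lambda>z. \<Sum>m<x1. residue (\<lambda>w. Kint k x1 u1 x2 u2 w z) (of_nat m)) (of_nat n) = (\<Sum>m<x1. \<alpha> m * bet k x2 (vi m) u2 n)"
  proof (rule residue_z[OF u \<alpha>])
    fix m assume m: "m < x1" "\<alpha> m \<noteq> 0"
    show "((\<lambda>z. zpart k x2 u2 z / (z + of_nat x2 - of_nat (x1 - 1 - m)) * (z - of_nat n)) \<longlongrightarrow> bet k x2 (vi m) u2 n) (at (of_nat n))"
      using bet_lim[OF k u(2) conjunct1[OF vi[OF m]] x2] unfolding conjunct2[OF vi[OF m]] .
  qed
  also have "\<dots> = (\<Sum>v<k-1. complex_of_real (Lf k x1 v u1) * bet k x2 v u2 n) + (if x1 = 2 * k - 1 then 0 else complex_of_real (l00 k)) * bet k x2 (k - 1) u2 n"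
  proof (cases "x1 = 2 * k - 1")
    case True
    have "(\<Sum>m<x1. \<alpha> m * bet k x2 (vi m) u2 n) = (\<Sum>m\<in>(\<lambda>v. 2 * v + 1) ` {..<k-1}. \<alpha> m * bet k x2 (vi m) u2 n)"
    proof (rule sum.mono_neutral_right)
      show "(\<lambda>v. 2 * v + 1) ` {..<k-1} \<subseteq> {..<x1}" using True by auto
      show "\<forall>m\<in>{..<x1} - (\<lambda>v. 2 * v + 1) ` {..<k-1}. \<alpha> m * bet k x2 (vi m) u2 n = 0"
      proof
        fix m assume m: "m \<in> {..<x1} - (\<lambda>v. 2 * v + 1) ` {..<k-1}"
        have "even m"
        proof (rule ccontr)
          assume "odd m"
          then obtain i where "m = 2 * i + 1" by (elim oddE)
          moreover from this have "i < k - 1" using m True by auto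
          ultimately show False using m by auto
        qed
        then have "even (x1 - 1 - m)" using True m k by auto
        then have "\<alpha> m = 0" using acoef_zero True ne by (auto simp: \<alpha>_def)
        then show "\<alpha> m * bet k x2 (vi m) u2 n = 0" by simp
      qed
    qed simp
    also have "\<dots> = (\<Sum>v<k-1. \<alpha> (2 * v + 1) * bet k x2 (vi (2 * v + 1)) u2 n)"
      by (subst sum.reindex) (auto simp: inj_on_def)
    also have "\<dots> = (\<Sum>v<k-1. complex_of_real (Lf k x1 v u1) * bet k x2 v u2 n)"
    proof (rule sum.cong)
      fix v assume "v \<in> {..<k-1}"
      then have v: "v < k - 1" by simp
      have e: "x1 - 1 - (2 * v + 1) = 2 * k - 3 - 2 * v" using True by simp
      have "\<alpha> (2 * v + 1) = complex_of_real (Lf k x1 v u1)" unfolding \<alpha>_def e acoef_lam[OF v] using True by (simp add: Lf_def)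
      moreover have "vi (2 * v + 1) = v" using True by (simp add: vi_def)
      ultimately show "\<alpha> (2 * v + 1) * bet k x2 (vi (2 * v + 1)) u2 n = complex_of_real (Lf k x1 v u1) * bet k x2 v u2 n" by simp
    qed simp
    finally show ?thesis using True by simp
  next
    case False
    then have xb: "x1 = 2 * k + 1" using x1 by simp
    have "(\<Sum>m<x1. \<alpha> m * bet k x2 (vi m) u2 n) = (\<Sum>m\<in>insert 0 ((\<lambda>v. 2 * v + 3) ` {..<k-1}). \<alpha> m * bet k x2 (vi m) u2 n)"
    proof (rule sum.mono_neutral_right)
      show "insert 0 ((\<lambda>v. 2 * v + 3) ` {..<k-1}) \<subseteq> {..<x1}" using xb by auto
      show "\<forall>m\<in>{..<x1} - insert 0 ((\<lambda>v. 2 * v + 3) ` {..<k-1}). \<alpha> m * bet k x2 (vi m) u2 n = 0"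
      proof
        fix m assume m: "m \<in> {..<x1} - insert 0 ((\<lambda>v. 2 * v + 3) ` {..<k-1})"
        have "even m \<or> m = 1"
        proof (rule ccontr)
          assume "\<not> (even m \<or> m = 1)"
          then obtain i where i: "m = 2 * i + 1" "i \<noteq> 0" by (auto elim: oddE)
          then have "m = 2 * (i - 1) + 3" "i - 1 < k - 1" using m xb by auto
          then show False using m by auto
        qed
        then have "even (x1 - 1 - m) \<or> (x1 - 1 - m) + 1 = 2 * k" using xb m k by auto
        then have "\<alpha> m = 0" using acoef_zero[of "x1 - 1 - m" k m] m by (auto simp: \<alpha>_def)
        then show "\<alpha> m * bet k x2 (vi m) u2 n = 0" by simp
      qed
    qed simp
    also have "\<dots> = \<alpha> 0 * bet k x2 (vi 0) u2 n + (\<Sum>m\<in>(\<lambda>v. 2 * v + 3) ` {..<k-1}. \<alpha> m * bet k x2 (vi m) u2 n)"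
      by (rule sum.insert) auto
    also have "(\<Sum>m\<in>(\<lambda>v. 2 * v + 3) ` {..<k-1}. \<alpha> m * bet k x2 (vi m) u2 n) = (\<Sum>v<k-1. \<alpha> (2 * v + 3) * bet k x2 (vi (2 * v + 3)) u2 n)"
      by (subst sum.reindex) (auto simp: inj_on_def)
    also have "\<dots> = (\<Sum>v<k-1. complex_of_real (Lf k x1 v u1) * bet k x2 v u2 n)"
    proof (rule sum.cong)
      fix v assume "v \<in> {..<k-1}"
      then have v: "v < k - 1" by simp
      have e: "x1 - 1 - (2 * v + 3) = 2 * k - 3 - 2 * v" using xb by simp
      have "\<alpha> (2 * v + 3) = complex_of_real (Lf k x1 v u1)" unfolding \<alpha>_def e using False by (simp add: Lf_def)
      moreover have "vi (2 * v + 3) = v" using False by (simp add: vi_def)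
      ultimately show "\<alpha> (2 * v + 3) * bet k x2 (vi (2 * v + 3)) u2 n = complex_of_real (Lf k x1 v u1) * bet k x2 v u2 n" by simp
    qed simp
    also have "\<alpha> 0 = complex_of_real (l00 k)" using xb by (simp add: \<alpha>_def)
    also have "vi 0 = k - 1" using False by (simp add: vi_def)
    finally show ?thesis using False by simp
  qed
  finally show ?thesis .
qed

text \<open>The residues contribute rank k - 1 in the rows of level 2k - 1 and rank k in those of
  level 2k + 1. The explicit term of the kernel appears only from level 2k + 1 to level 2k - 1,
  where its exponent x1 - x2 - 1 is 1.\<close>

lemma Kprime_formula:
  assumes k: "k \<ge> 1" and u: "u1 > 0" "u2 > 0" and x1: "x1 = 2 * k - 1 \<or> x1 = 2 * k + 1" and x2: "x2 = 2 * k - 1 \<or> x2 = 2 * k + 1"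
  shows "Kprime k (x1, u1) (x2, u2) =
    (if x1 = 2 * k + 1 \<and> x2 = 2 * k - 1 then complex_of_real (- max 0 (u1 - u2)) else 0)
    + (\<Sum>v<k-1. complex_of_real (Lf k x1 v u1) * Rf k x2 v u2) + (if x1 = 2 * k - 1 then 0 else complex_of_real (l00 k)) * Rf k x2 (k - 1) u2"
proof -
  have s: "summable (bet k x2 v u2)" if "v < k" for v using bet_summable[OF k u(2) that x2] .
  have s1: "summable (\<lambda>n. \<Sum>v<k-1. complex_of_real (Lf k x1 v u1) * bet k x2 v u2 n)"
    by (intro summable_sum summable_mult s) auto
  have s2: "summable (\<lambda>n. (if x1 = 2 * k - 1 then 0 else complex_of_real (l00 k)) * bet k x2 (k - 1) u2 n)"
    using k by (intro summable_mult s) auto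
  have "(\<Sum>n. residue (\<lambda>z. \<Sum>m<x1. residue (\<lambda>w. Kint k x1 u1 x2 u2 w z) (of_nat m)) (of_nat n)) =
    (\<Sum>n. (\<Sum>v<k-1. complex_of_real (Lf k x1 v u1) * bet k x2 v u2 n) + (if x1 = 2 * k - 1 then 0 else complex_of_real (l00 k)) * bet k x2 (k - 1) u2 n)"
    unfolding residue_double[OF assms] ..
  also have "\<dots> = (\<Sum>n. \<Sum>v<k-1. complex_of_real (Lf k x1 v u1) * bet k x2 v u2 n) + (\<Sum>n. (if x1 = 2 * k - 1 then 0 else complex_of_real (l00 k)) * bet k x2 (k - 1) u2 n)"
    by (rule suminf_add[OF s1 s2, symmetric])
  also have "(\<Sum>n. (if x1 = 2 * k - 1 then 0 else complex_of_real (l00 k)) * bet k x2 (k - 1) u2 n) = (if x1 = 2 * k - 1 then 0 else complex_of_real (l00 k)) * Rf k x2 (k - 1) u2"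
    unfolding Rf_def by (rule suminf_mult) (use k s in auto)
  also have "(\<Sum>n. \<Sum>v<k-1. complex_of_real (Lf k x1 v u1) * bet k x2 v u2 n) = (\<Sum>v<k-1. \<Sum>n. complex_of_real (Lf k x1 v u1) * bet k x2 v u2 n)"
    by (rule suminf_sum) (auto intro!: summable_mult s)
  also have "\<dots> = (\<Sum>v<k-1. complex_of_real (Lf k x1 v u1) * Rf k x2 v u2)"
    unfolding Rf_def by (intro sum.cong suminf_mult s) auto
  finally have S: "(\<Sum>n. residue (\<lambda>z. \<Sum>m<x1. residue (\<lambda>w. Kint k x1 u1 x2 u2 w z) (of_nat m)) (of_nat n)) =
    (\<Sum>v<k-1. complex_of_real (Lf k x1 v u1) * Rf k x2 v u2) + (if x1 = 2 * k - 1 then 0 else complex_of_real (l00 k)) * Rf k x2 (k - 1) u2" .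
  have F: "(if u2 < u1 \<and> x2 < x1 then complex_of_real ((u2 - u1) ^ (x1 - x2 - 1) / fact (x1 - x2 - 1)) else 0)
    = (if x1 = 2 * k + 1 \<and> x2 = 2 * k - 1 then complex_of_real (- max 0 (u1 - u2)) else 0)"
  proof (cases "x1 = 2 * k + 1 \<and> x2 = 2 * k - 1")
    case True
    then have "x1 - x2 - 1 = 1" "x2 < x1" using k by auto
    then show ?thesis using True by simp
  next
    case False
    then have "\<not> x2 < x1" using x1 x2 by auto
    then show ?thesis unfolding if_not_P[OF False] by simp
  qed
  show ?thesis unfolding Kprime_def prod.case S F by (simp add: add.assoc)
qed

section \<open>Integrating the top correlation function\<close>

lemma det_of_real: "det (mat n n (\<lambda>(i, j). complex_of_real (A i j))) = complex_of_real (det (mat n n (\<lambda>(i, j). A i j)))"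
  unfolding det_leibniz by simp

lemma det_mat_transpose: "det (mat n n (\<lambda>(i, j). A j i)) = det (mat n n (\<lambda>(i, j). A i j))"
proof -
  have "mat n n (\<lambda>(i, j). A j i) = transpose_mat (mat n n (\<lambda>(i, j). A i j))" by (rule eq_matI) auto
  then show ?thesis by (simp add: det_transpose[of _ n])
qed

lemma det_mat_cong: "(\<And>i j. i < n \<Longrightarrow> j < n \<Longrightarrow> A i j = B i j) \<Longrightarrow> det (mat n n (\<lambda>(i, j). A i j)) = det (mat n n (\<lambda>(i, j). B i j))"
  by (rule arg_cong[of _ _ det], rule eq_matI) auto

text \<open>Open at t, so that coordinates are positive even for t = 0, as the evaluation of the
  kernel demands.\<close>

definition Nt :: "real \<Rightarrow> real measure" where "Nt t = restrict_space lborel {t<..}"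

lemma space_Nt: "space (Nt t) = {t<..}" by (simp add: Nt_def space_restrict_space)

lemma sigma_finite_Nt: "sigma_finite_measure (Nt t)"
  unfolding Nt_def by (rule sigma_finite_measure_restrict_space) (auto simp: lborel.sigma_finite_measure_axioms)

lemma Nt_integral: "integral\<^sup>L (Nt t) f = (\<integral>x. indicator {t<..} x * f x \<partial>lborel)" for f :: "real \<Rightarrow> real"
  unfolding Nt_def by (subst integral_restrict_space) auto

lemma Nt_integrable: "integrable (Nt t) f \<longleftrightarrow> integrable lborel (\<lambda>x. indicator {t<..} x * f x)" for f :: "real \<Rightarrow> real"
  unfolding Nt_def by (subst integrable_restrict_space) auto

text \<open>For i < k - 1, the integral over x in (t, y) of the i-th left function of level 2k - 1
  against - (y - x), as a polynomial in y. The last index is the constant row of the middle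
  determinant.\<close>

definition Gp :: "nat \<Rightarrow> real \<Rightarrow> nat \<Rightarrow> real poly" where
  "Gp k t i = (if i < k - 1 then Polynomial.smult (- lam k (i + 1)) (monom (1 / (real (2 * i + 2) * real (2 * i + 3))) (2 * i + 3)
      - monom (t ^ (2 * i + 2) / real (2 * i + 2)) 1 + [:t ^ (2 * i + 3) / real (2 * i + 3):]) else [:l00 k:])"

lemma int_x:
  assumes i: "i < k - 1" and y: "t < y"
  shows "integrable (Nt t) (\<lambda>x. Lf k (2 * k - 1) i x * - max 0 (y - x))"
    and "(\<integral>x. Lf k (2 * k - 1) i x * - max 0 (y - x) \<partial>Nt t) = poly (Gp k t i) y"
proof -
  define F where "F x = - lam k (i + 1) * (y * (x ^ (2 * i + 2) / real (2 * i + 2)) - x ^ (2 * i + 3) / real (2 * i + 3))" for x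
  define f where "f x = - lam k (i + 1) * (y * x ^ (2 * i + 1) - x ^ (2 * i + 2))" for x
  have D: "(F has_real_derivative f x) (at x)" for x
  proof -
    have p: "((\<lambda>x. x ^ Suc n / real (Suc n)) has_real_derivative x ^ n) (at x)" for n
      using DERIV_cdivide[OF DERIV_power[OF DERIV_ident, of "Suc n"], of "real (Suc n)" x] by (simp del: of_nat_Suc)
    have e: "2 * i + 2 = Suc (2 * i + 1)" "2 * i + 3 = Suc (2 * i + 2)" by simp_all
    show ?thesis unfolding F_def f_def unfolding e
      by (rule DERIV_cmult DERIV_diff DERIV_cmult p)+ 
  qed
  have "has_bochner_integral lborel (\<lambda>x. f x * indicator {t..y} x) (F y - F t)"
    by (rule has_bochner_integral_FTC_Icc_real) (use y D in \<open>auto simp: f_def intro!: continuous_intros\<close>)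
  moreover have ae: "AE x in lborel. f x * indicator {t..y} x = indicator {t<..} x * (Lf k (2 * k - 1) i x * - max 0 (y - x))"
    using AE_lborel_singleton[of t]
  proof eventually_elim
    case (elim x)
    then show ?case by (auto simp: f_def Lf_def indicator_def of_bool_def algebra_simps max_def)
  qed
  moreover have "F y - F t = poly (Gp k t i) y"
  proof -
    define a b where "a = real (2 * i + 2)" and "b = real (2 * i + 3)"
    have ab: "b = a + 1" "a \<noteq> 0" "b \<noteq> 0" by (simp_all add: a_def b_def)
    have 1: "y * (y ^ (2 * i + 2) / a) - y ^ (2 * i + 3) / b = y ^ (2 * i + 3) / (a * b)"
    proof -
      have "y * (y ^ (2 * i + 2) / a) = y ^ (2 * i + 3) / a" by (simp add: power_Suc2[symmetric] eval_nat_numeral)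
      also have "\<dots> - y ^ (2 * i + 3) / b = y ^ (2 * i + 3) * (1 / a - 1 / b)" by (simp add: algebra_simps)
      also have "1 / a - 1 / b = 1 / (a * b)" using ab by (simp add: field_simps)
      finally show ?thesis by simp
    qed
    have 2: "poly (Gp k t i) y = - lam k (i + 1) * (y ^ (2 * i + 3) / (a * b) - t ^ (2 * i + 2) / a * y + t ^ (2 * i + 3) / b)"
      using i unfolding Gp_def a_def b_def by (simp add: poly_monom)
    show ?thesis unfolding 2 unfolding F_def a_def[symmetric] b_def[symmetric] unfolding 1 by (simp add: algebra_simps)
  qed
  ultimately have "has_bochner_integral lborel (\<lambda>x. indicator {t<..} x * (Lf k (2 * k - 1) i x * - max 0 (y - x))) (poly (Gp k t i) y)"
    using has_bochner_integral_cong_AE[OF _ _ ae] by (simp add: Lf_def f_def)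
  then show "integrable (Nt t) (\<lambda>x. Lf k (2 * k - 1) i x * - max 0 (y - x))"
    and "(\<integral>x. Lf k (2 * k - 1) i x * - max 0 (y - x) \<partial>Nt t) = poly (Gp k t i) y"
    unfolding Nt_integrable Nt_integral has_bochner_integral_iff by blast+
qed

lemma has_bochner_hmom: "has_bochner_integral lborel (\<lambda>u. indicator {t<..} u * (u ^ (2 * n) * exp (- u\<^sup>2))) (hmom n t)"
  using integrable_poly_gauss[of t "monom 1 (2 * n)"] unfolding has_bochner_integral_iff hmom_def by (simp add: poly_monom)

text \<open>Integration by parts. For i < k - 1 the boundary term drops out because
  \<open>Gp k t i\<close> vanishes at t; for the last index \<open>Gp\<close> is constant and the
  boundary term is all that is left.\<close>

lemma int_y:
  assumes k: "k \<ge> 1" and i: "i < k"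
  shows "integrable (Nt t) (\<lambda>y. kap k * rfun k (lev k v) y * poly (Gp k t i) y)"
    and "(\<integral>y. kap k * rfun k (lev k v) y * poly (Gp k t i) y \<partial>Nt t) = scal k i * (\<Sum>b<k. ec k (lev k v) b *
        (if i < k - 1 then hmom (i + 1 + b) t - t ^ (2 * (i + 1)) * hmom b t else t ^ (2 * b) * exp (- t\<^sup>2)))"
proof -
  have lv: "lev k v < k" using k by (auto simp: lev_def)
  define Q where "Q = pderiv (pcompose (epoly k (lev k v)) [:0, 0, -1:]) - [:0, 2:] * pcompose (epoly k (lev k v)) [:0, 0, -1:]"
  have r: "rfun k (lev k v) u = poly Q u * exp (- u\<^sup>2)" for u unfolding Q_def by (rule rfun_poly)
  have "integrable lborel (\<lambda>u. indicator {t<..} u * (poly (Polynomial.smult (kap k) (Q * Gp k t i)) u * exp (- u\<^sup>2)))"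
    by (rule integrable_poly_gauss)
  moreover have "kap k * rfun k (lev k v) u * poly (Gp k t i) u = poly (Polynomial.smult (kap k) (Q * Gp k t i)) u * exp (- u\<^sup>2)" for u
    unfolding r by simp
  ultimately show "integrable (Nt t) (\<lambda>y. kap k * rfun k (lev k v) y * poly (Gp k t i) y)"
    unfolding Nt_integrable by (simp only:)
  have "(\<integral>y. kap k * rfun k (lev k v) y * poly (Gp k t i) y \<partial>Nt t) = kap k * (\<integral>u. indicator {t<..} u * (rfun k (lev k v) u * poly (Gp k t i) u) \<partial>lborel)"
  proof -
    have "indicator {t<..} u * (kap k * rfun k (lev k v) u * poly (Gp k t i) u) = kap k * (indicator {t<..} u * (rfun k (lev k v) u * poly (Gp k t i) u))" for u
      by (simp add: mult_ac)
    then show ?thesis unfolding Nt_integral by (simp only: integral_mult_right_zero)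
  qed
  also have "\<dots> = kap k * (- (\<Sum>b<k. ec k (lev k v) b * (t ^ (2 * b) * exp (- t\<^sup>2))) * poly (Gp k t i) t
     - (\<integral>u. indicator {t<..} u * ((\<Sum>b<k. ec k (lev k v) b * u ^ (2 * b)) * poly (pderiv (Gp k t i)) u * exp (- u\<^sup>2)) \<partial>lborel))"
    unfolding rfun_parts[OF lv] ..
  also have "\<dots> = scal k i * (\<Sum>b<k. ec k (lev k v) b *
        (if i < k - 1 then hmom (i + 1 + b) t - t ^ (2 * (i + 1)) * hmom b t else t ^ (2 * b) * exp (- t\<^sup>2)))"
  proof (cases "i < k - 1")
    case False
    then show ?thesis by (simp add: Gp_def scal_def pderiv_pCons)
  next
    case True
    define a b where "a = real (2 * i + 2)" and "b = real (2 * i + 3)"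
    have ab: "b = a + 1" "a \<noteq> 0" "b \<noteq> 0" by (simp_all add: a_def b_def)
    have p: "poly (Gp k t i) y = - lam k (i + 1) * (y ^ (2 * i + 3) / (a * b) - t ^ (2 * i + 2) / a * y + t ^ (2 * i + 3) / b)" for y
      using True unfolding Gp_def a_def b_def by (simp add: poly_monom)
    have z: "poly (Gp k t i) t = 0"
    proof -
      have e1: "t ^ (2 * i + 2) / a * t = t ^ (2 * i + 3) / a" by (simp add: eval_nat_numeral mult.commute)
      have e2: "t ^ (2 * i + 3) / (a * b) - t ^ (2 * i + 3) / a + t ^ (2 * i + 3) / b = t ^ (2 * i + 3) * (1 / (a * b) - 1 / a + 1 / b)"
        by (simp add: algebra_simps)
      have e3: "1 / (a * b) - 1 / a + 1 / b = 0" using ab by (simp add: field_simps)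
      show ?thesis unfolding p e1 e2 e3 by simp
    qed
    have d: "poly (pderiv (Gp k t i)) u = - lam k (i + 1) / a * (u ^ (2 * (i + 1)) - t ^ (2 * (i + 1)))" for u
    proof -
      have "pderiv (Gp k t i) = Polynomial.smult (- lam k (i + 1)) (monom (b * (1 / (a * b))) (2 * i + 2) - monom (t ^ (2 * i + 2) / a) 0)"
      proof -
        have g: "Gp k t i = Polynomial.smult (- lam k (i + 1)) (monom (1 / (a * b)) (2 * i + 3) - monom (t ^ (2 * i + 2) / a) 1 + [:t ^ (2 * i + 3) / b:])"
          using True by (simp only: Gp_def a_def b_def if_True)
        have m: "pderiv (monom (1 / (a * b)) (2 * i + 3)) = monom (b * (1 / (a * b))) (2 * i + 2)" "pderiv (monom (t ^ (2 * i + 2) / a) 1) = monom (t ^ (2 * i + 2) / a) 0"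
          "pderiv [:t ^ (2 * i + 3) / b:] = 0"
          unfolding pderiv_monom b_def by (simp_all add: pderiv_pCons)
        show ?thesis unfolding g pderiv_smult pderiv_add pderiv_diff m by simp
      qed
      moreover have "b * (1 / (a * b)) = 1 / a" using ab by simp
      moreover have "2 * i + 2 = 2 * (i + 1)" by simp
      ultimately show ?thesis by (simp add: poly_monom algebra_simps diff_divide_distrib)
    qed
    have hb: "has_bochner_integral lborel (\<lambda>u. - lam k (i + 1) / a * (\<Sum>b<k. ec k (lev k v) b * (indicator {t<..} u * (u ^ (2 * (i + 1 + b)) * exp (- u\<^sup>2))
        - t ^ (2 * (i + 1)) * (indicator {t<..} u * (u ^ (2 * b) * exp (- u\<^sup>2))))))
        (- lam k (i + 1) / a * (\<Sum>b<k. ec k (lev k v) b * (hmom (i + 1 + b) t - t ^ (2 * (i + 1)) * hmom b t)))"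
      by (intro has_bochner_integral_mult_right has_bochner_integral_sum has_bochner_integral_diff has_bochner_hmom)
    have fe: "- lam k (i + 1) / a * (\<Sum>b<k. ec k (lev k v) b * (indicator {t<..} u * (u ^ (2 * (i + 1 + b)) * exp (- u\<^sup>2))
        - t ^ (2 * (i + 1)) * (indicator {t<..} u * (u ^ (2 * b) * exp (- u\<^sup>2))))) =
       indicator {t<..} u * ((\<Sum>b<k. ec k (lev k v) b * u ^ (2 * b)) * poly (pderiv (Gp k t i)) u * exp (- u\<^sup>2))" for u
    proof -
      have "ec k (lev k v) b * (indicator {t<..} u * (u ^ (2 * (i + 1 + b)) * exp (- u\<^sup>2)) - t ^ (2 * (i + 1)) * (indicator {t<..} u * (u ^ (2 * b) * exp (- u\<^sup>2))))
        = ec k (lev k v) b * u ^ (2 * b) * (indicator {t<..} u * exp (- u\<^sup>2) * (u ^ (2 * (i + 1)) - t ^ (2 * (i + 1))))" for b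
        unfolding distrib_left power_add by (simp add: algebra_simps)
      then show ?thesis unfolding d by (simp only: sum_distrib_right[symmetric]) (simp only: mult_ac)
    qed
    have I: "(\<integral>u. indicator {t<..} u * ((\<Sum>b<k. ec k (lev k v) b * u ^ (2 * b)) * poly (pderiv (Gp k t i)) u * exp (- u\<^sup>2)) \<partial>lborel)
       = - lam k (i + 1) / a * (\<Sum>b<k. ec k (lev k v) b * (hmom (i + 1 + b) t - t ^ (2 * (i + 1)) * hmom b t))"
      using hb unfolding fe by (rule has_bochner_integral_integral_eq)
    have a2: "a = 2 * real (i + 1)" by (simp add: a_def)
    have s: "scal k i = kap k * lam k (i + 1) / a" using True unfolding scal_def a2 by simp
    show ?thesis unfolding I z s using True by simp
  qed
  finally show "(\<integral>y. kap k * rfun k (lev k v) y * poly (Gp k t i) y \<partial>Nt t) = scal k i * (\<Sum>b<k. ec k (lev k v) b *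
        (if i < k - 1 then hmom (i + 1 + b) t - t ^ (2 * (i + 1)) * hmom b t else t ^ (2 * b) * exp (- t\<^sup>2)))" .
qed

text \<open>The three diagonal blocks of \<open>det_two_level\<close>: up to a global sign, the
  joint correlation function of k - 1 points x on the lower and k points y on the upper
  level.\<close>

definition Hker :: "nat \<Rightarrow> (nat \<Rightarrow> real) \<Rightarrow> (nat \<Rightarrow> real) \<Rightarrow> real" where
  "Hker k y x = det (mat (k - 1) (k - 1) (\<lambda>(i, v). Lf k (2 * k - 1) v (x i)))
     * det (mat k k (\<lambda>(l, i). if i < k - 1 then - max 0 (y l - x i) else l00 k))
     * det (mat k k (\<lambda>(v, l). kap k * rfun k (lev k v) (y l)))"

text \<open>The rectangular form of Andreief's identity handles the k - 1 points x for fixed y, with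
  \<open>l00 k\<close> as its constant row; the square form then handles the k points y.\<close>

lemma Hker_integral:
  fixes t :: real
  assumes k: "k \<ge> 1"
  defines "I \<equiv> (\<lambda>y. \<integral>x. Hker k y x \<partial>Pi\<^sub>M {..<k-1} (\<lambda>_. Nt t))"
  shows "y \<in> space (Pi\<^sub>M {..<k} (\<lambda>_. Nt t)) \<Longrightarrow> integrable (Pi\<^sub>M {..<k-1} (\<lambda>_. Nt t)) (Hker k y)"
    and "integrable (Pi\<^sub>M {..<k} (\<lambda>_. Nt t)) I"
    and "integral\<^sup>L (Pi\<^sub>M {..<k} (\<lambda>_. Nt t)) I = fact (k - 1) * fact k * det (mat k k (\<lambda>(v, i). scal k i * (\<Sum>b<k. ec k (lev k v) b *
        (if i < k - 1 then hmom (i + 1 + b) t - t ^ (2 * (i + 1)) * hmom b t else t ^ (2 * b) * exp (- t\<^sup>2)))))"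
proof -
  let ?D3 = "\<lambda>y. det (mat k k (\<lambda>(v, l). kap k * rfun k (lev k v) (y l)))"
  let ?F = "\<lambda>y x. det (mat (k - 1) (k - 1) (\<lambda>(i, a). Lf k (2 * k - 1) a (x i))) * det (mat k k (\<lambda>(i, j). if i < k - 1 then - max 0 (y j - x i) else l00 k))"
  have H: "Hker k y = (\<lambda>x. ?F y x * ?D3 y)" for y
  proof
    fix x
    have "det (mat k k (\<lambda>(l, i). if i < k - 1 then - max 0 (y l - x i) else l00 k)) = det (mat k k (\<lambda>(i, j). if i < k - 1 then - max 0 (y j - x i) else l00 k))"
      by (rule det_mat_transpose[where A = "\<lambda>i j. if i < k - 1 then - max 0 (y j - x i) else l00 k"])
    then show "Hker k y x = ?F y x * ?D3 y" unfolding Hker_def by simp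
  qed
  have x: "integrable (Pi\<^sub>M {..<k-1} (\<lambda>_. Nt t)) (?F y)"
    "integral\<^sup>L (Pi\<^sub>M {..<k-1} (\<lambda>_. Nt t)) (?F y) = fact (k - 1) * det (mat k k (\<lambda>(i, j). if i < k - 1 then (\<integral>x. Lf k (2 * k - 1) i x * - max 0 (y j - x) \<partial>Nt t) else l00 k))"
    if y: "y \<in> space (Pi\<^sub>M {..<k} (\<lambda>_. Nt t))" for y
  proof -
    have "integrable (Nt t) (\<lambda>x. Lf k (2 * k - 1) a x * - max 0 (y j - x))" if "a < k - 1" "j < k" for a j
    proof (rule int_x)
      show "t < y j" using y that(2) by (auto simp: space_PiM space_Nt)
    qed (rule that)
    note A = andreief[where M = "Nt t" and p = "k - 1" and q = k and f = "Lf k (2 * k - 1)" and g = "\<lambda>j x. - max 0 (y j - x)" and c = "\<lambda>i j. l00 k", OF sigma_finite_Nt _ this]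
    show "integrable (Pi\<^sub>M {..<k-1} (\<lambda>_. Nt t)) (?F y)" using A(1) by simp
    show "integral\<^sup>L (Pi\<^sub>M {..<k-1} (\<lambda>_. Nt t)) (?F y) = fact (k - 1) * det (mat k k (\<lambda>(i, j). if i < k - 1 then (\<integral>x. Lf k (2 * k - 1) i x * - max 0 (y j - x) \<partial>Nt t) else l00 k))"
      using A(2) by simp
  qed
  show "integrable (Pi\<^sub>M {..<k-1} (\<lambda>_. Nt t)) (Hker k y)" if "y \<in> space (Pi\<^sub>M {..<k} (\<lambda>_. Nt t))"
    unfolding H by (intro integrable_mult_left x(1)[OF that])
  define f where "f v y = kap k * rfun k (lev k v) y" for v y
  define G where "G y = det (mat k k (\<lambda>(i, a). f a (y i))) * det (mat k k (\<lambda>(i, j). if i < k then poly (Gp k t j) (y i) else 0))" for y :: "nat \<Rightarrow> real"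
  have Ieq: "I y = fact (k - 1) * G y" if y: "y \<in> space (Pi\<^sub>M {..<k} (\<lambda>_. Nt t))" for y
  proof -
    have "I y = fact (k - 1) * det (mat k k (\<lambda>(i, j). if i < k - 1 then (\<integral>x. Lf k (2 * k - 1) i x * - max 0 (y j - x) \<partial>Nt t) else l00 k)) * ?D3 y"
      unfolding I_def H integral_mult_left_zero x(2)[OF y] ..
    also have "det (mat k k (\<lambda>(i, j). if i < k - 1 then (\<integral>x. Lf k (2 * k - 1) i x * - max 0 (y j - x) \<partial>Nt t) else l00 k)) = det (mat k k (\<lambda>(i, j). poly (Gp k t i) (y j)))"
    proof (rule det_mat_cong)
      fix i j assume "i < k" "j < k"
      show "(if i < k - 1 then (\<integral>x. Lf k (2 * k - 1) i x * - max 0 (y j - x) \<partial>Nt t) else l00 k) = poly (Gp k t i) (y j)"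
      proof (cases "i < k - 1")
        case True
        have "t < y j" using y \<open>j < k\<close> by (auto simp: space_PiM space_Nt)
        then show ?thesis using int_x(2)[OF True] True by simp
      qed (simp add: Gp_def)
    qed
    also have "\<dots> = det (mat k k (\<lambda>(i, j). poly (Gp k t j) (y i)))"
      by (rule det_mat_transpose[where A = "\<lambda>i j. poly (Gp k t j) (y i)"])
    also have "\<dots> = det (mat k k (\<lambda>(i, j). if i < k then poly (Gp k t j) (y i) else 0))"
      by (rule det_mat_cong) simp
    also have "?D3 y = det (mat k k (\<lambda>(i, a). f a (y i)))"
      unfolding f_def[symmetric] by (rule det_mat_transpose[where A = "\<lambda>i a. f a (y i)"])
    finally show ?thesis unfolding G_def by (simp only: mult_ac)
  qed
  note A = andreief[where M = "Nt t" and p = k and q = k and f = f and g = "\<lambda>i. poly (Gp k t i)" and c = "\<lambda>_ _. 0", OF sigma_finite_Nt order_refl, folded G_def]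
  have int: "integrable (Nt t) (\<lambda>x. f a x * poly (Gp k t j) x)" if "a < k" "j < k" for a j
    unfolding f_def by (rule int_y(1)[OF k that(2)])
  have G1: "integrable (Pi\<^sub>M {..<k} (\<lambda>_. Nt t)) G" by (rule A(1)[OF int])
  have G2: "integral\<^sup>L (Pi\<^sub>M {..<k} (\<lambda>_. Nt t)) G = fact k * det (mat k k (\<lambda>(i, j). if i < k then \<integral>x. f i x * poly (Gp k t j) x \<partial>Nt t else 0))" by (rule A(2)[OF int])
  have "integrable (Pi\<^sub>M {..<k} (\<lambda>_. Nt t)) I \<longleftrightarrow> integrable (Pi\<^sub>M {..<k} (\<lambda>_. Nt t)) (\<lambda>y. fact (k - 1) * G y)"
    by (rule Bochner_Integration.integrable_cong[OF refl Ieq])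
  then show "integrable (Pi\<^sub>M {..<k} (\<lambda>_. Nt t)) I" using G1 by simp
  have "integral\<^sup>L (Pi\<^sub>M {..<k} (\<lambda>_. Nt t)) I = (\<integral>y. fact (k - 1) * G y \<partial>Pi\<^sub>M {..<k} (\<lambda>_. Nt t))"
    by (rule Bochner_Integration.integral_cong[OF refl Ieq])
  also have "\<dots> = fact (k - 1) * fact k * det (mat k k (\<lambda>(i, j). if i < k then \<integral>x. f i x * poly (Gp k t j) x \<partial>Nt t else 0))"
    unfolding integral_mult_right_zero G2 by simp
  also have "det (mat k k (\<lambda>(i, j). if i < k then \<integral>x. f i x * poly (Gp k t j) x \<partial>Nt t else 0)) = det (mat k k (\<lambda>(v, i). scal k i * (\<Sum>b<k. ec k (lev k v) b *
        (if i < k - 1 then hmom (i + 1 + b) t - t ^ (2 * (i + 1)) * hmom b t else t ^ (2 * b) * exp (- t\<^sup>2)))))"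
    by (rule det_mat_cong) (simp only: f_def int_y(2)[OF k] if_True)
  finally show "integral\<^sup>L (Pi\<^sub>M {..<k} (\<lambda>_. Nt t)) I = fact (k - 1) * fact k * det (mat k k (\<lambda>(v, i). scal k i * (\<Sum>b<k. ec k (lev k v) b *
        (if i < k - 1 then hmom (i + 1 + b) t - t ^ (2 * (i + 1)) * hmom b t else t ^ (2 * b) * exp (- t\<^sup>2)))))" .
qed

section \<open>The reference measure on prescribed levels\<close>

lemma sigma_finite_half: "sigma_finite_measure (restrict_space lborel {0::real..})"
  by (rule sigma_finite_measure_restrict_space) (auto simp: lborel.sigma_finite_measure_axioms)

lemma sigma_finite_Xmeas: "sigma_finite_measure Xmeas"
  unfolding Xmeas_def by (rule sigma_finite_pair_measure[OF sigma_finite_measure_count_space sigma_finite_half])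

lemma space_Xmeas: "space Xmeas = UNIV \<times> {0..}"
  by (simp add: Xmeas_def space_pair_measure space_restrict_space)

lemma sets_cyl: assumes "B \<in> sets borel" "B \<subseteq> {0::real..}" shows "{l} \<times> B \<in> sets Xmeas"
  unfolding Xmeas_def by (rule pair_measureI) (use assms in \<open>auto simp: sets_restrict_space_iff\<close>)

lemma slice_measurable:
  assumes B: "B \<in> sets Xmeas"
  shows "{u. 0 \<le> u \<and> (l, u) \<in> B} \<in> sets lborel"
proof -
  have "Pair l \<in> measurable (restrict_space lborel {0..}) Xmeas" unfolding Xmeas_def by simp
  from measurable_sets[OF this B] have "Pair l -` B \<inter> {0..} \<in> sets (restrict_space lborel {0..})" by (simp add: space_restrict_space)
  then have "Pair l -` B \<inter> {0..} \<in> sets lborel" by (subst (asm) sets_restrict_space_iff) auto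
  moreover have "Pair l -` B \<inter> {0..} = {u. 0 \<le> u \<and> (l, u) \<in> B}" by auto
  ultimately show ?thesis by simp
qed

lemma Xmeas_slice:
  assumes B: "B \<in> sets Xmeas" and t: "t \<ge> 0"
  shows "emeasure Xmeas (({l} \<times> {t..}) \<inter> B) = emeasure (Nt t) {u \<in> space (Nt t). (l, u) \<in> B}"
    and "{u \<in> space (Nt t). (l, u) \<in> B} \<in> sets (Nt t)"
proof -
  interpret R: sigma_finite_measure "restrict_space lborel {0::real..}" by (rule sigma_finite_half)
  define C where "C = {u. 0 \<le> u \<and> (l, u) \<in> B} \<inter> {t..}"
  have C: "C \<in> sets lborel" unfolding C_def using slice_measurable[OF B] by auto
  have C0: "C \<subseteq> {0..}" using t by (auto simp: C_def)
  then have C': "C \<in> sets (restrict_space lborel {0..})" using C by (subst sets_restrict_space_iff) auto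
  have e: "({l} \<times> {t..}) \<inter> B = {l} \<times> C" using t by (auto simp: C_def)
  have "emeasure Xmeas (({l} \<times> {t..}) \<inter> B) = emeasure (restrict_space lborel {0..}) C"
    unfolding e Xmeas_def by (subst R.emeasure_pair_measure_Times) (use C' in auto)
  also have "\<dots> = emeasure lborel C" by (rule emeasure_restrict_space) (use C0 in auto)
  also have "\<dots> = emeasure lborel (C - {t})" by (rule emeasure_Diff_null_set[symmetric]) (use C in auto)
  also have C2: "C - {t} = {u \<in> space (Nt t). (l, u) \<in> B}" using t by (auto simp: C_def space_Nt)
  also have "emeasure lborel {u \<in> space (Nt t). (l, u) \<in> B} = emeasure (Nt t) {u \<in> space (Nt t). (l, u) \<in> B}"
    unfolding Nt_def by (rule emeasure_restrict_space[symmetric]) (auto simp: space_restrict_space)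
  finally show "emeasure Xmeas (({l} \<times> {t..}) \<inter> B) = emeasure (Nt t) {u \<in> space (Nt t). (l, u) \<in> B}" .
  have "C - {t} \<in> sets lborel" using C by auto
  then have "{u \<in> space (Nt t). (l, u) \<in> B} \<in> sets lborel" unfolding C2 .
  then show "{u \<in> space (Nt t). (l, u) \<in> B} \<in> sets (Nt t)"
    unfolding Nt_def by (subst sets_restrict_space_iff) (auto simp: space_restrict_space)
qed

definition lvmap :: "nat \<Rightarrow> (nat \<Rightarrow> nat) \<Rightarrow> (nat \<Rightarrow> real) \<Rightarrow> nat \<Rightarrow> nat \<times> real" where
  "lvmap n lv x = (\<lambda>i\<in>{..<n}. (lv i, x i))"

lemma lvmap_measurable: assumes "t \<ge> 0" shows "lvmap n lv \<in> measurable (Pi\<^sub>M {..<n} (\<lambda>_. Nt t)) (Pi\<^sub>M {..<n} (\<lambda>_. Xmeas))"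
  unfolding lvmap_def
proof (rule measurable_restrict)
  fix i assume i: "i \<in> {..<n}"
  have "Pair (lv i) \<in> measurable (Nt t) Xmeas"
  proof (rule measurableI)
    fix u assume "u \<in> space (Nt t)" then show "(lv i, u) \<in> space Xmeas" using assms by (simp add: space_Nt space_Xmeas)
  next
    fix B assume "B \<in> sets Xmeas"
    then have "{u \<in> space (Nt t). (lv i, u) \<in> B} \<in> sets (Nt t)" by (rule Xmeas_slice(2)[OF _ assms])
    moreover have "Pair (lv i) -` B \<inter> space (Nt t) = {u \<in> space (Nt t). (lv i, u) \<in> B}" by auto
    ultimately show "Pair (lv i) -` B \<inter> space (Nt t) \<in> sets (Nt t)" by simp
  qed
  from measurable_compose[OF measurable_component_singleton[OF i] this]
  show "(\<lambda>x. (lv i, x i)) \<in> measurable (Pi\<^sub>M {..<n} (\<lambda>_. Nt t)) Xmeas" .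
qed

text \<open>Counting measure gives each level mass 1 and the end point t is a null set, so the
  reference measure restricted to prescribed levels is a product of Lebesgue measures on
  half-lines.\<close>

lemma lvmap_distr:
  assumes t: "t \<ge> 0"
  shows "distr (Pi\<^sub>M {..<n} (\<lambda>_. Nt t)) (Pi\<^sub>M {..<n} (\<lambda>_. Xmeas)) (lvmap n lv)
    = density (Pi\<^sub>M {..<n} (\<lambda>_. Xmeas)) (indicator (Pi\<^sub>E {..<n} (\<lambda>i. {lv i} \<times> {t..})))" (is "?P = ?Q")
proof -
  interpret X: product_sigma_finite "\<lambda>_::nat. Xmeas" by (intro product_sigma_finite.intro sigma_finite_Xmeas)
  interpret N: product_sigma_finite "\<lambda>_::nat. Nt t" by (intro product_sigma_finite.intro sigma_finite_Nt)
  let ?S = "\<lambda>i. {lv i} \<times> {t..}"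
  have S: "?S i \<in> sets Xmeas" for i by (rule sets_cyl) (use t in auto)
  have SP: "Pi\<^sub>E {..<n} ?S \<in> sets (Pi\<^sub>M {..<n} (\<lambda>_. Xmeas))" by (rule sets_PiM_I_finite) (auto intro: S)
  have Pv: "emeasure ?P (Pi\<^sub>E {..<n} A) = (\<Prod>i<n. emeasure (Nt t) {u \<in> space (Nt t). (lv i, u) \<in> A i})" if A: "\<And>i. i \<in> {..<n} \<Longrightarrow> A i \<in> sets Xmeas" for A
  proof -
    have "emeasure ?P (Pi\<^sub>E {..<n} A) = emeasure (Pi\<^sub>M {..<n} (\<lambda>_. Nt t)) (lvmap n lv -` (Pi\<^sub>E {..<n} A) \<inter> space (Pi\<^sub>M {..<n} (\<lambda>_. Nt t)))"
      by (rule emeasure_distr[OF lvmap_measurable[OF t]]) (auto intro!: sets_PiM_I_finite A)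
    also have "lvmap n lv -` (Pi\<^sub>E {..<n} A) \<inter> space (Pi\<^sub>M {..<n} (\<lambda>_. Nt t)) = Pi\<^sub>E {..<n} (\<lambda>i. {u \<in> space (Nt t). (lv i, u) \<in> A i})"
    proof -
      have "lvmap n lv x \<in> Pi\<^sub>E {..<n} A \<longleftrightarrow> (\<forall>i\<in>{..<n}. (lv i, x i) \<in> A i)" for x by (simp add: lvmap_def PiE_iff)
      then show ?thesis by (auto simp: space_PiM PiE_iff)
    qed
    also have "emeasure (Pi\<^sub>M {..<n} (\<lambda>_. Nt t)) \<dots> = (\<Prod>i<n. emeasure (Nt t) {u \<in> space (Nt t). (lv i, u) \<in> A i})"
      by (rule N.emeasure_PiM) (auto intro!: Xmeas_slice(2) A t)
    finally show ?thesis .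
  qed
  show ?thesis
  \<comment> \<open>The exhausting boxes contain all levels; they have finite mass because the
    measures live on one level per coordinate.\<close>
  proof (rule measure_eqI_PiM_finite[where I = "{..<n}" and M = "\<lambda>_. Xmeas" and A = "\<lambda>j. Pi\<^sub>E {..<n} (\<lambda>_. UNIV \<times> {0..real j})"])
    fix A assume A: "\<And>i. i \<in> {..<n} \<Longrightarrow> A i \<in> sets Xmeas"
    have "emeasure ?Q (Pi\<^sub>E {..<n} A) = (\<integral>\<^sup>+y. indicator (Pi\<^sub>E {..<n} ?S) y * indicator (Pi\<^sub>E {..<n} A) y \<partial>Pi\<^sub>M {..<n} (\<lambda>_. Xmeas))"
      by (rule emeasure_density) (use SP in \<open>auto intro!: sets_PiM_I_finite A\<close>)
    also have "\<dots> = (\<integral>\<^sup>+y. indicator (Pi\<^sub>E {..<n} (\<lambda>i. ?S i \<inter> A i)) y \<partial>Pi\<^sub>M {..<n} (\<lambda>_. Xmeas))"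
      unfolding indicator_inter_arith[symmetric] PiE_Int ..
    also have "\<dots> = emeasure (Pi\<^sub>M {..<n} (\<lambda>_. Xmeas)) (Pi\<^sub>E {..<n} (\<lambda>i. ?S i \<inter> A i))"
      by (rule nn_integral_indicator) (auto intro!: sets_PiM_I_finite A S sets.Int)
    also have "\<dots> = (\<Prod>i<n. emeasure Xmeas (?S i \<inter> A i))"
      by (rule X.emeasure_PiM) (auto intro!: A S sets.Int)
    also have "\<dots> = (\<Prod>i<n. emeasure (Nt t) {u \<in> space (Nt t). (lv i, u) \<in> A i})"
      by (rule prod.cong) (auto intro!: Xmeas_slice(1) A t)
    finally have q: "emeasure ?Q (Pi\<^sub>E {..<n} A) = (\<Prod>i<n. emeasure (Nt t) {u \<in> space (Nt t). (lv i, u) \<in> A i})" .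
    have "emeasure ?P (Pi\<^sub>E {..<n} A) = (\<Prod>i<n. emeasure (Nt t) {u \<in> space (Nt t). (lv i, u) \<in> A i})" by (rule Pv) (rule A)
    then show "emeasure ?P (Pi\<^sub>E {..<n} A) = emeasure ?Q (Pi\<^sub>E {..<n} A)" unfolding q .
  next
    have c: "UNIV \<times> {0..real j} \<in> sets Xmeas" for j
      unfolding Xmeas_def by (rule pair_measureI) (auto simp: sets_restrict_space_iff)
    show "range (\<lambda>j. Pi\<^sub>E {..<n} (\<lambda>_. UNIV \<times> {0..real j})) \<subseteq> prod_algebra {..<n} (\<lambda>_. Xmeas)"
      using c by (auto intro!: prod_algebraI_finite)
    show "(\<Union>j. Pi\<^sub>E {..<n} (\<lambda>_. UNIV \<times> {0..real j})) = space (Pi\<^sub>M {..<n} (\<lambda>_. Xmeas))"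
    proof (intro equalityI subsetI)
      fix x :: "nat \<Rightarrow> nat \<times> real" assume "x \<in> (\<Union>j. Pi\<^sub>E {..<n} (\<lambda>_. UNIV \<times> {0..real j})) " then show "x \<in> space (Pi\<^sub>M {..<n} (\<lambda>_. Xmeas))"
        by (auto simp: space_PiM space_Xmeas PiE_iff mem_Times_iff)
    next
      fix x assume x: "x \<in> space (Pi\<^sub>M {..<n} (\<lambda>_. Xmeas))"
      obtain j where j: "(\<Sum>i<n. \<bar>snd (x i)\<bar>) \<le> real j" using real_arch_simple by blast
      have "snd (x i) \<le> real j" if "i < n" for i
        using member_le_sum[of i "{..<n}" "\<lambda>i. \<bar>snd (x i)\<bar>"] that j by auto
      then show "x \<in> (\<Union>j. Pi\<^sub>E {..<n} (\<lambda>_. UNIV \<times> {0..real j}))" using x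
        by (auto simp: space_PiM space_Xmeas PiE_iff mem_Times_iff intro!: exI[of _ j])
    qed
    fix j
    have fin: "emeasure (Nt t) {u \<in> space (Nt t). (lv i, u) \<in> UNIV \<times> {0..real j}} < \<top>" for i
    proof -
      have "emeasure (Nt t) {u \<in> space (Nt t). (lv i, u) \<in> UNIV \<times> {0..real j}} = emeasure lborel {u \<in> space (Nt t). (lv i, u) \<in> UNIV \<times> {0..real j}}"
        unfolding Nt_def by (rule emeasure_restrict_space) (auto simp: space_restrict_space)
      also have "\<dots> \<le> emeasure lborel {0..real j}" by (rule emeasure_mono) auto
      also have "\<dots> < \<top>" by simp
      finally show ?thesis .
    qed
    have "emeasure ?P (Pi\<^sub>E {..<n} (\<lambda>_. UNIV \<times> {0..real j})) = (\<Prod>i<n. emeasure (Nt t) {u \<in> space (Nt t). (lv i, u) \<in> UNIV \<times> {0..real j}})"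
      by (rule Pv) (rule c)
    also have "\<dots> < \<top>"
    proof -
      have "(\<Prod>i<m. emeasure (Nt t) {u \<in> space (Nt t). (lv i, u) \<in> UNIV \<times> {0..real j}}) < \<top>" for m
        by (induction m) (simp_all only: prod.lessThan_Suc ennreal_mult_less_top fin, simp_all)
      then show ?thesis .
    qed
    finally show "emeasure ?P (Pi\<^sub>E {..<n} (\<lambda>_. UNIV \<times> {0..real j})) \<noteq> \<infinity>" by simp
  qed simp_all
qed

lemma lvmap_nn_integral:
  assumes t: "t \<ge> 0" and f: "f \<in> borel_measurable (Pi\<^sub>M {..<n} (\<lambda>_. Xmeas))"
  shows "(\<integral>\<^sup>+y. indicator (Pi\<^sub>E {..<n} (\<lambda>i. {lv i} \<times> {t..})) y * f y \<partial>Pi\<^sub>M {..<n} (\<lambda>_. Xmeas)) = (\<integral>\<^sup>+x. f (lvmap n lv x) \<partial>Pi\<^sub>M {..<n} (\<lambda>_. Nt t))"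
proof -
  have SP: "Pi\<^sub>E {..<n} (\<lambda>i. {lv i} \<times> {t..}) \<in> sets (Pi\<^sub>M {..<n} (\<lambda>_. Xmeas))" by (rule sets_PiM_I_finite) (use t in \<open>auto intro!: sets_cyl\<close>)
  have "(\<integral>\<^sup>+y. indicator (Pi\<^sub>E {..<n} (\<lambda>i. {lv i} \<times> {t..})) y * f y \<partial>Pi\<^sub>M {..<n} (\<lambda>_. Xmeas))
     = integral\<^sup>N (density (Pi\<^sub>M {..<n} (\<lambda>_. Xmeas)) (indicator (Pi\<^sub>E {..<n} (\<lambda>i. {lv i} \<times> {t..})))) f"
    by (rule nn_integral_density[symmetric]) (use SP f in auto)
  also have "\<dots> = integral\<^sup>N (distr (Pi\<^sub>M {..<n} (\<lambda>_. Nt t)) (Pi\<^sub>M {..<n} (\<lambda>_. Xmeas)) (lvmap n lv)) f"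
    unfolding lvmap_distr[OF t] ..
  also have "\<dots> = (\<integral>\<^sup>+x. f (lvmap n lv x) \<partial>Pi\<^sub>M {..<n} (\<lambda>_. Nt t))"
    by (rule nn_integral_distr[OF lvmap_measurable[OF t]]) (use f in simp)
  finally show ?thesis .
qed

lemma lvmap_AE:
  assumes t: "t \<ge> 0" and Q: "AE y in Pi\<^sub>M {..<n} (\<lambda>_. Xmeas). Q y"
  shows "AE x in Pi\<^sub>M {..<n} (\<lambda>_. Nt t). Q (lvmap n lv x)"
proof -
  have SP: "Pi\<^sub>E {..<n} (\<lambda>i. {lv i} \<times> {t..}) \<in> sets (Pi\<^sub>M {..<n} (\<lambda>_. Xmeas))" by (rule sets_PiM_I_finite) (use t in \<open>auto intro!: sets_cyl\<close>)
  have "AE y in density (Pi\<^sub>M {..<n} (\<lambda>_. Xmeas)) (indicator (Pi\<^sub>E {..<n} (\<lambda>i. {lv i} \<times> {t..}))). Q y"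
    by (subst AE_density) (use SP Q in auto)
  then have "AE y in distr (Pi\<^sub>M {..<n} (\<lambda>_. Nt t)) (Pi\<^sub>M {..<n} (\<lambda>_. Xmeas)) (lvmap n lv). Q y" unfolding lvmap_distr[OF t] .
  then show ?thesis by (rule AE_distrD[OF lvmap_measurable[OF t]])
qed

text \<open>The pair is ordered (y, x), so that Tonelli integrates over x first, as in
  \<open>Hker_integral\<close>.\<close>

definition joinmap :: "nat \<Rightarrow> nat \<Rightarrow> (nat \<Rightarrow> 'a) \<times> (nat \<Rightarrow> 'a) \<Rightarrow> nat \<Rightarrow> 'a" where
  "joinmap p k z = (\<lambda>i\<in>{..<p+k}. if i < p then snd z i else fst z (i - p))"

lemma joinmap_measurable: "joinmap p k \<in> measurable (Pi\<^sub>M {..<k} (\<lambda>_. N) \<Otimes>\<^sub>M Pi\<^sub>M {..<p} (\<lambda>_. N)) (Pi\<^sub>M {..<p+k} (\<lambda>_. N))"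
  unfolding joinmap_def
proof (rule measurable_restrict)
  fix i assume i: "i \<in> {..<p+k}"
  show "(\<lambda>z. if i < p then snd z i else fst z (i - p)) \<in> measurable (Pi\<^sub>M {..<k} (\<lambda>_. N) \<Otimes>\<^sub>M Pi\<^sub>M {..<p} (\<lambda>_. N)) N"
  proof (cases "i < p")
    case True
    then have "i \<in> {..<p}" by simp
    from measurable_compose[OF measurable_snd measurable_component_singleton[OF this]] show ?thesis using True by simp
  next
    case False
    then have "i - p \<in> {..<k}" using i by auto
    from measurable_compose[OF measurable_fst measurable_component_singleton[OF this]] show ?thesis using False by simp
  qed
qed

lemma joinmap_distr:
  assumes sf: "sigma_finite_measure N"
  shows "distr (Pi\<^sub>M {..<k} (\<lambda>_. N) \<Otimes>\<^sub>M Pi\<^sub>M {..<p} (\<lambda>_. N)) (Pi\<^sub>M {..<p+k} (\<lambda>_. N)) (joinmap p k) = Pi\<^sub>M {..<p+k} (\<lambda>_. N)"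
proof -
  interpret N: product_sigma_finite "\<lambda>_::nat. N" by (intro product_sigma_finite.intro sf)
  interpret P: sigma_finite_measure "Pi\<^sub>M {..<p} (\<lambda>_. N)" by (rule N.sigma_finite) simp
  show ?thesis
  proof (rule N.PiM_eqI)
    fix A assume A: "\<And>i. i \<in> {..<p+k} \<Longrightarrow> A i \<in> sets N"
    let ?B = "Pi\<^sub>E {..<k} (\<lambda>l. A (p + l))" and ?C = "Pi\<^sub>E {..<p} A"
    have sub: "A i \<subseteq> space N" if "i < p + k" for i using A[of i] that sets.sets_into_space by auto
    have "emeasure (distr (Pi\<^sub>M {..<k} (\<lambda>_. N) \<Otimes>\<^sub>M Pi\<^sub>M {..<p} (\<lambda>_. N)) (Pi\<^sub>M {..<p+k} (\<lambda>_. N)) (joinmap p k)) (Pi\<^sub>E {..<p+k} A)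
       = emeasure (Pi\<^sub>M {..<k} (\<lambda>_. N) \<Otimes>\<^sub>M Pi\<^sub>M {..<p} (\<lambda>_. N)) (joinmap p k -` (Pi\<^sub>E {..<p+k} A) \<inter> space (Pi\<^sub>M {..<k} (\<lambda>_. N) \<Otimes>\<^sub>M Pi\<^sub>M {..<p} (\<lambda>_. N)))"
      by (rule emeasure_distr[OF joinmap_measurable]) (auto intro!: sets_PiM_I_finite A)
    also have "joinmap p k -` (Pi\<^sub>E {..<p+k} A) \<inter> space (Pi\<^sub>M {..<k} (\<lambda>_. N) \<Otimes>\<^sub>M Pi\<^sub>M {..<p} (\<lambda>_. N)) = ?B \<times> ?C"
    proof (intro equalityI subsetI)
      fix z assume "z \<in> joinmap p k -` (Pi\<^sub>E {..<p+k} A) \<inter> space (Pi\<^sub>M {..<k} (\<lambda>_. N) \<Otimes>\<^sub>M Pi\<^sub>M {..<p} (\<lambda>_. N))"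
      then have j0: "\<forall>i\<in>{..<p+k}. joinmap p k z i \<in> A i"
        and e: "fst z \<in> extensional {..<k}" "snd z \<in> extensional {..<p}" by (auto simp: space_pair_measure space_PiM PiE_iff)
      have j: "joinmap p k z i \<in> A i" if "i < p + k" for i using j0 that by simp
      have "fst z l \<in> A (p + l)" if "l < k" for l using j[of "p + l"] that by (simp add: joinmap_def)
      moreover have "snd z i \<in> A i" if "i < p" for i using j[of i] that by (simp add: joinmap_def)
      ultimately show "z \<in> ?B \<times> ?C" using e by (auto simp: mem_Times_iff PiE_iff)
    next
      fix z assume z: "z \<in> ?B \<times> ?C"
      have "z \<in> space (Pi\<^sub>M {..<k} (\<lambda>_. N) \<Otimes>\<^sub>M Pi\<^sub>M {..<p} (\<lambda>_. N))"
      proof -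
        have "?B \<subseteq> space (Pi\<^sub>M {..<k} (\<lambda>_. N))" "?C \<subseteq> space (Pi\<^sub>M {..<p} (\<lambda>_. N))"
          unfolding space_PiM by (rule PiE_mono, rule sub, simp)+
        then show ?thesis using z unfolding space_pair_measure by blast
      qed
      moreover have "joinmap p k z i \<in> A i" if "i < p + k" for i
      proof (cases "i < p")
        case True
        then show ?thesis using z that by (auto simp: joinmap_def PiE_iff)
      next
        case False
        have "fst z \<in> ?B" using z by auto
        from PiE_mem[OF this, of "i - p"] have "fst z (i - p) \<in> A (p + (i - p))" using False that by simp
        then show ?thesis using False that by (simp add: joinmap_def)
      qed
      ultimately show "z \<in> joinmap p k -` (Pi\<^sub>E {..<p+k} A) \<inter> space (Pi\<^sub>M {..<k} (\<lambda>_. N) \<Otimes>\<^sub>M Pi\<^sub>M {..<p} (\<lambda>_. N))"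
        by (auto simp: PiE_iff joinmap_def)
    qed
    also have "emeasure (Pi\<^sub>M {..<k} (\<lambda>_. N) \<Otimes>\<^sub>M Pi\<^sub>M {..<p} (\<lambda>_. N)) (?B \<times> ?C) = emeasure (Pi\<^sub>M {..<k} (\<lambda>_. N)) ?B * emeasure (Pi\<^sub>M {..<p} (\<lambda>_. N)) ?C"
      by (rule P.emeasure_pair_measure_Times) (auto intro!: sets_PiM_I_finite A)
    also have "emeasure (Pi\<^sub>M {..<k} (\<lambda>_. N)) ?B = (\<Prod>l<k. emeasure N (A (p + l)))" by (rule N.emeasure_PiM) (auto intro!: A)
    also have "emeasure (Pi\<^sub>M {..<p} (\<lambda>_. N)) ?C = (\<Prod>i<p. emeasure N (A i))" by (rule N.emeasure_PiM) (auto intro!: A)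
    also have "(\<Prod>l<k. emeasure N (A (p + l))) * (\<Prod>i<p. emeasure N (A i)) = (\<Prod>i<p+k. emeasure N (A i))"
    proof -
      have e: "{..<p+k} = {..<p} \<union> (\<lambda>l. p + l) ` {..<k}"
      proof (intro equalityI subsetI)
        fix i assume "i \<in> {..<p+k}"
        then show "i \<in> {..<p} \<union> (\<lambda>l. p + l) ` {..<k}" by (cases "i < p") (auto intro!: image_eqI[of _ _ "i - p"])
      qed auto
      show ?thesis unfolding e by (subst prod.union_disjoint) (auto simp: prod.reindex mult.commute)
    qed
    finally show "emeasure (distr (Pi\<^sub>M {..<k} (\<lambda>_. N) \<Otimes>\<^sub>M Pi\<^sub>M {..<p} (\<lambda>_. N)) (Pi\<^sub>M {..<p+k} (\<lambda>_. N)) (joinmap p k)) (Pi\<^sub>E {..<p+k} A) = (\<Prod>i<p+k. emeasure N (A i))" .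
  qed simp_all
qed

section \<open>Correlation functions on the two levels\<close>

lemma det_low_rank:
  fixes f g :: "nat \<Rightarrow> nat \<Rightarrow> complex"
  assumes "m < n" shows "det (mat n n (\<lambda>(i, j). \<Sum>v<m. f i v * g v j)) = 0"
proof -
  let ?B = "mat n n (\<lambda>(i, v). if v < m then f i v else 0)" and ?C = "mat n n (\<lambda>(v, j). g v j)"
  have "mat n n (\<lambda>(i, j). \<Sum>v<m. f i v * g v j) = ?B * ?C"
  proof (rule eq_matI)
    fix i j assume ij: "i < dim_row (?B * ?C)" "j < dim_col (?B * ?C)"
    have "(\<Sum>v = 0..<n. (if v < m then f i v else 0) * g v j) = (\<Sum>v<m. f i v * g v j)"
      using assms by (intro sum.mono_neutral_cong_right) auto
    then show "mat n n (\<lambda>(i, j). \<Sum>v<m. f i v * g v j) $$ (i, j) = (?B * ?C) $$ (i, j)"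
      using ij by (simp add: scalar_prod_def)
  qed simp_all
  then have "det (mat n n (\<lambda>(i, j). \<Sum>v<m. f i v * g v j)) = det ?B * det ?C" by (simp add: det_mult[of _ n])
  also have "det ?B = 0"
    unfolding det_leibniz
  proof (rule sum.neutral, rule ballI)
    fix \<pi> assume "\<pi> \<in> {\<pi>. \<pi> permutes {..<n}}"
    then have p: "\<pi> permutes {..<n}" by simp
    obtain i where i: "i < n" "\<pi> i = m" using permutes_surj[OF p] assms permutes_in_image[OF p] by (metis lessThan_iff surjD)
    have "(\<Prod>i<n. if \<pi> i < m then f i (\<pi> i) else 0) = 0" by (rule prod_zero) (use i in auto)
    then show "of_int (sign \<pi>) * (\<Prod>i<n. if \<pi> i < m then f i (\<pi> i) else 0) = 0" by simp
  qed
  finally show ?thesis by simp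
qed

lemma detn_det: "detn n A = det (mat n n (\<lambda>(i, j). A i j))" unfolding detn_def det_leibniz ..

text \<open>On a single level the kernel is a sum of n - 1 products, so the determinant has
  deficient rank.\<close>

lemma detn_level_zero:
  assumes k: "k \<ge> 1" and y: "\<And>i. i < n \<Longrightarrow> u i > 0" and l: "l = 2 * k - 1 \<and> n = k \<or> l = 2 * k + 1 \<and> n = k + 1"
  shows "detn n (\<lambda>i j. Kprime k (l, u i) (l, u j)) = 0"
proof -
  define m where "m = n - 1"
  have m: "m < n" using l k by (auto simp: m_def)
  have "Kprime k (l, u i) (l, u j) = (\<Sum>v<m. (complex_of_real (if v < k - 1 then Lf k l v (u i) else l00 k)) * Rf k l v (u j))" if "i < n" "j < n" for i j
  proof -
    have l': "l = 2 * k - 1 \<or> l = 2 * k + 1" using l by auto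
    note K = Kprime_formula[OF k y[OF that(1)] y[OF that(2)] l' l']
    show ?thesis
    proof (cases "l = 2 * k - 1")
      case True
      then have "m = k - 1" using l k by (auto simp: m_def)
      then show ?thesis unfolding K using True k by simp
    next
      case False
      then have "m = Suc (k - 1)" using l k by (auto simp: m_def)
      then show ?thesis unfolding K using False by simp
    qed
  qed
  then have "detn n (\<lambda>i j. Kprime k (l, u i) (l, u j)) = det (mat n n (\<lambda>(i, j). \<Sum>v<m. (complex_of_real (if v < k - 1 then Lf k l v (u i) else l00 k)) * Rf k l v (u j)))"
    unfolding detn_det
    by (rule det_mat_cong[where A = "\<lambda>i j. Kprime k (l, u i) (l, u j)" and B = "\<lambda>i j. \<Sum>v<m. (complex_of_real (if v < k - 1 then Lf k l v (u i) else l00 k)) * Rf k l v (u j)"])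
  also have "\<dots> = 0" by (rule det_low_rank[OF m])
  finally show ?thesis .
qed

lemma rho_level_zero:
  assumes k: "k \<ge> 1" and l: "l = 2 * k - 1 \<and> n = k \<or> l = 2 * k + 1 \<and> n = k + 1"
    and meas: "\<rho> \<in> borel_measurable (Pi\<^sub>M {..<n} (\<lambda>_. Xmeas))"
    and \<rho>: "AE y in Pi\<^sub>M {..<n} (\<lambda>_. Xmeas). detn n (\<lambda>i j. Kprime k (y i) (y j)) = complex_of_real (\<rho> y)"
  shows "(\<integral>\<^sup>+ y. indicator (Pi\<^sub>E {..<n} (\<lambda>_. {l} \<times> {0..})) y * ennreal (\<rho> y) \<partial>Pi\<^sub>M {..<n} (\<lambda>_. Xmeas)) = 0"
proof -
  have "(\<integral>\<^sup>+ y. indicator (Pi\<^sub>E {..<n} (\<lambda>_. {l} \<times> {0..})) y * ennreal (\<rho> y) \<partial>Pi\<^sub>M {..<n} (\<lambda>_. Xmeas)) = (\<integral>\<^sup>+x. ennreal (\<rho> (lvmap n (\<lambda>_. l) x)) \<partial>Pi\<^sub>M {..<n} (\<lambda>_. Nt 0))"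
    by (rule lvmap_nn_integral) (use meas in auto)
  also have "\<dots> = (\<integral>\<^sup>+x. 0 \<partial>Pi\<^sub>M {..<n} (\<lambda>_. Nt 0))"
  proof (rule nn_integral_cong_AE)
    show "AE x in Pi\<^sub>M {..<n} (\<lambda>_. Nt 0). ennreal (\<rho> (lvmap n (\<lambda>_. l) x)) = 0"
      using lvmap_AE[OF order_refl \<rho>, of "\<lambda>_. l"] AE_space
    proof eventually_elim
      case (elim x)
      have "detn n (\<lambda>i j. Kprime k (lvmap n (\<lambda>_. l) x i) (lvmap n (\<lambda>_. l) x j)) = detn n (\<lambda>i j. Kprime k (l, x i) (l, x j))"
        unfolding detn_det by (rule det_mat_cong[where A = "\<lambda>i j. Kprime k (lvmap n (\<lambda>_. l) x i) (lvmap n (\<lambda>_. l) x j)" and B = "\<lambda>i j. Kprime k (l, x i) (l, x j)"]) (simp add: lvmap_def)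
      also have "\<dots> = 0" by (rule detn_level_zero[OF k _ l]) (use elim(2) in \<open>auto simp: space_PiM space_Nt\<close>)
      finally show ?case using elim(1) by simp
    qed
  qed
  finally show ?thesis by simp
qed

definition lvl :: "nat \<Rightarrow> nat \<Rightarrow> nat" where "lvl k i = (if i < k - 1 then 2 * k - 1 else 2 * k + 1)"

text \<open>The sign e is inherited from \<open>det_two_level\<close>; it depends on k alone and not
  on the points, so it can be taken out of the integral.\<close>

lemma detn_joint:
  assumes k: "k \<ge> 1"
  obtains e :: real where "e = 1 \<or> e = -1"
    "\<And>x y. (\<And>i. i < k - 1 \<Longrightarrow> x i > 0) \<Longrightarrow> (\<And>i. i < k \<Longrightarrow> y i > 0) \<Longrightarrow>
       detn (k - 1 + k) (\<lambda>i j. Kprime k (lvmap (k - 1 + k) (lvl k) (joinmap (k - 1) k (y, x)) i) (lvmap (k - 1 + k) (lvl k) (joinmap (k - 1) k (y, x)) j))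
       = complex_of_real (e * Hker k y x)"
proof -
  define p where "p = k - 1"
  have kp: "k = p + 1" using k by (simp add: p_def)
  obtain \<epsilon> :: complex where \<epsilon>: "\<epsilon> = 1 \<or> \<epsilon> = -1" and E: "\<And>La Lb l0 Ra Rb Ph. 
      det (mat (p + (p + 1)) (p + (p + 1)) (\<lambda>(i, j).
         (if p \<le> i \<and> j < p then Ph (i - p) j else 0) +
         (\<Sum>v<p. (if i < p then La v i else Lb v (i - p)) * (if j < p then Ra v j else Rb v (j - p))) +
         (if i < p then 0 else l0) * (if j < p then Ra p j else Rb p (j - p))))
      = \<epsilon> * det (mat p p (\<lambda>(i, v). La v i)) * det (mat (p + 1) (p + 1) (\<lambda>(l, i). if i < p then Ph l i else l0))
        * det (mat (p + 1) (p + 1) (\<lambda>(v, l). Rb v l :: complex))" using det_two_level[of p] by blast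
  define e where "e = Re \<epsilon>"
  have e: "e = 1 \<or> e = -1" "\<epsilon> = complex_of_real e" using \<epsilon> by (auto simp: e_def)
  have main: "detn (k - 1 + k) (\<lambda>i j. Kprime k (lvmap (k - 1 + k) (lvl k) (joinmap (k - 1) k (y, x)) i) (lvmap (k - 1 + k) (lvl k) (joinmap (k - 1) k (y, x)) j))
       = complex_of_real (e * Hker k y x)" if x: "\<And>i. i < k - 1 \<Longrightarrow> x i > 0" and y: "\<And>i. i < k \<Longrightarrow> y i > 0" for x y
  proof -
    let ?a = "2 * k - 1" and ?b = "2 * k + 1"
    define La Lb Ra Rb Ph where "La v i = complex_of_real (Lf k ?a v (x i))" and "Lb v l = complex_of_real (Lf k ?b v (y l))"
      and "Ra v j = Rf k ?a v (x j)" and "Rb v l = Rf k ?b v (y l)" and "Ph l i = complex_of_real (- max 0 (y l - x i))" for v i l j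
    define l0 where "l0 = complex_of_real (l00 k)"
    have ab: "?a \<noteq> ?b" using k by simp
    have "detn (k - 1 + k) (\<lambda>i j. Kprime k (lvmap (k - 1 + k) (lvl k) (joinmap (k - 1) k (y, x)) i) (lvmap (k - 1 + k) (lvl k) (joinmap (k - 1) k (y, x)) j))
      = det (mat (p + (p + 1)) (p + (p + 1)) (\<lambda>(i, j). Kprime k (lvmap (k - 1 + k) (lvl k) (joinmap (k - 1) k (y, x)) i) (lvmap (k - 1 + k) (lvl k) (joinmap (k - 1) k (y, x)) j)))"
      unfolding detn_det p_def[symmetric] by (simp only: kp)
    also have "\<dots> = det (mat (p + (p + 1)) (p + (p + 1)) (\<lambda>(i, j).
         (if p \<le> i \<and> j < p then Ph (i - p) j else 0) +
         (\<Sum>v<p. (if i < p then La v i else Lb v (i - p)) * (if j < p then Ra v j else Rb v (j - p))) +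
         (if i < p then 0 else l0) * (if j < p then Ra p j else Rb p (j - p))))"
    proof (rule det_mat_cong)
      fix i j assume ij: "i < p + (p + 1)" "j < p + (p + 1)"
      define U where "U i = (if i < p then x i else y (i - p))" for i
      have L: "lvmap (k - 1 + k) (lvl k) (joinmap (k - 1) k (y, x)) i = (lvl k i, U i)" if "i < p + (p + 1)" for i
        using that kp by (simp add: lvmap_def joinmap_def U_def)
      have U: "U i > 0" if "i < p + (p + 1)" for i using that x[of i] y[of "i - p"] kp by (auto simp: U_def)
      have lv: "lvl k i = ?a \<or> lvl k i = ?b" for i by (simp add: lvl_def)
      have Lv: "complex_of_real (Lf k (lvl k i) v (U i)) = (if i < p then La v i else Lb v (i - p))" for v i
        using ab by (simp add: lvl_def p_def U_def La_def Lb_def)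
      have Rv: "Rf k (lvl k j) v (U j) = (if j < p then Ra v j else Rb v (j - p))" for v j
        using ab by (simp add: lvl_def p_def U_def Ra_def Rb_def)
      have Pv: "(if lvl k i = ?b \<and> lvl k j = ?a then complex_of_real (- max 0 (U i - U j)) else 0) = (if p \<le> i \<and> j < p then Ph (i - p) j else 0)"
        using ab unfolding lvl_def p_def[symmetric] U_def Ph_def by (auto simp: not_less)
      have Cv: "(if lvl k i = ?a then 0 else complex_of_real (l00 k)) = (if i < p then 0 else l0)"
        using ab by (simp add: lvl_def p_def l0_def)
      show "Kprime k (lvmap (k - 1 + k) (lvl k) (joinmap (k - 1) k (y, x)) i) (lvmap (k - 1 + k) (lvl k) (joinmap (k - 1) k (y, x)) j) =
         (if p \<le> i \<and> j < p then Ph (i - p) j else 0) +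
         (\<Sum>v<p. (if i < p then La v i else Lb v (i - p)) * (if j < p then Ra v j else Rb v (j - p))) +
         (if i < p then 0 else l0) * (if j < p then Ra p j else Rb p (j - p))"
        unfolding L[OF ij(1)] L[OF ij(2)] unfolding Kprime_formula[OF k U[OF ij(1)] U[OF ij(2)] lv lv] unfolding Pv Cv Lv Rv p_def[symmetric] ..
    qed
    also have "\<dots> = \<epsilon> * det (mat p p (\<lambda>(i, v). La v i)) * det (mat (p + 1) (p + 1) (\<lambda>(l, i). if i < p then Ph l i else l0))
        * det (mat (p + 1) (p + 1) (\<lambda>(v, l). Rb v l))" by (rule E)
    also have "det (mat p p (\<lambda>(i, v). La v i)) = complex_of_real (det (mat p p (\<lambda>(i, v). Lf k ?a v (x i))))"
      unfolding La_def by (rule det_of_real)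
    also have "det (mat (p + 1) (p + 1) (\<lambda>(l, i). if i < p then Ph l i else l0)) = det (mat (p + 1) (p + 1) (\<lambda>(l, i). complex_of_real (if i < p then - max 0 (y l - x i) else l00 k)))"
      by (rule det_mat_cong) (simp add: Ph_def l0_def)
    also have "\<dots> = complex_of_real (det (mat (p + 1) (p + 1) (\<lambda>(l, i). if i < p then - max 0 (y l - x i) else l00 k)))"
      by (rule det_of_real)
    also have "det (mat (p + 1) (p + 1) (\<lambda>(v, l). Rb v l)) = det (mat (p + 1) (p + 1) (\<lambda>(v, l). complex_of_real (kap k * rfun k (lev k v) (y l))))"
    proof (rule det_mat_cong)
      fix v l assume vl: "v < p + 1" "l < p + 1"
      show "Rb v l = complex_of_real (kap k * rfun k (lev k v) (y l))" unfolding Rb_def by (rule Rf_b[OF k y]) (use vl kp in auto)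
    qed
    also have "\<dots> = complex_of_real (det (mat (p + 1) (p + 1) (\<lambda>(v, l). kap k * rfun k (lev k v) (y l))))"
      by (rule det_of_real)
    finally show ?thesis unfolding Hker_def e(2) p_def[symmetric] kp[symmetric] by (simp only: of_real_mult mult.assoc)
  qed
  show thesis by (rule that[OF e(1) main])
qed

text \<open>The density is replaced by \<open>Hker\<close> almost everywhere and integrated with
  Tonelli. As the integral of a nonnegative function the result is nonnegative, and at t = 0 its
  absolute value is known from \<open>det_scaled\<close>: this decides the sign.\<close>

lemma rho_joint:
  assumes k: "k \<ge> 1"
    and meas: "\<rho> \<in> borel_measurable (Pi\<^sub>M {..<k-1+k} (\<lambda>_. Xmeas))" and nn: "\<And>y. 0 \<le> \<rho> y"
    and \<rho>: "AE y in Pi\<^sub>M {..<k-1+k} (\<lambda>_. Xmeas). detn (k - 1 + k) (\<lambda>i j. Kprime k (y i) (y j)) = complex_of_real (\<rho> y)"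
  obtains c where "c * rdet k 0 = 1" "\<And>t. t \<ge> 0 \<Longrightarrow> c * rdet k t \<ge> 0"
    "\<And>t. t \<ge> 0 \<Longrightarrow> (\<integral>\<^sup>+ y. indicator (Pi\<^sub>E {..<k-1+k} (\<lambda>i. {lvl k i} \<times> {t..})) y * ennreal (\<rho> y) \<partial>Pi\<^sub>M {..<k-1+k} (\<lambda>_. Xmeas))
       = ennreal (fact (k - 1) * fact k * (c * rdet k t))"
proof -
  obtain e :: real where e: "e = 1 \<or> e = -1" and det: 
    "\<And>x y. (\<And>i. i < k - 1 \<Longrightarrow> x i > 0) \<Longrightarrow> (\<And>i. i < k \<Longrightarrow> y i > 0) \<Longrightarrow>
       detn (k - 1 + k) (\<lambda>i j. Kprime k (lvmap (k - 1 + k) (lvl k) (joinmap (k - 1) k (y, x)) i) (lvmap (k - 1 + k) (lvl k) (joinmap (k - 1) k (y, x)) j))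
       = complex_of_real (e * Hker k y x)"
    using detn_joint[OF k] by blast
  obtain W where W: "\<And>t. det (mat k k (\<lambda>(v, i). scal k i * (\<Sum>b<k. ec k (lev k v) b *
        (if i < k - 1 then hmom (i + 1 + b) t - t ^ (2 * (i + 1)) * hmom b t else t ^ (2 * b) * exp (- t\<^sup>2))))) = W * rdet k t"
    "\<bar>W * rdet k 0\<bar> = 1" using det_scaled[OF k] by blast
  define c where "c = e * W"
  let ?X = "Pi\<^sub>M {..<k-1+k} (\<lambda>_. Xmeas)"
  have main: "c * rdet k t \<ge> 0 \<and> (\<integral>\<^sup>+ y. indicator (Pi\<^sub>E {..<k-1+k} (\<lambda>i. {lvl k i} \<times> {t..})) y * ennreal (\<rho> y) \<partial>?X)
       = ennreal (fact (k - 1) * fact k * (c * rdet k t))" if t: "t \<ge> 0" for t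
  proof -
    let ?N = "\<lambda>n. Pi\<^sub>M {..<n::nat} (\<lambda>_. Nt t)"
    interpret N: product_sigma_finite "\<lambda>_::nat. Nt t" by (intro product_sigma_finite.intro sigma_finite_Nt)
    interpret P: sigma_finite_measure "?N (k - 1)" by (rule N.sigma_finite) simp
    interpret Q: sigma_finite_measure "?N k" by (rule N.sigma_finite) simp
    interpret PQ: pair_sigma_finite "?N k" "?N (k - 1)" ..
    define r where "r z = \<rho> (lvmap (k - 1 + k) (lvl k) (joinmap (k - 1) k z))" for z
    have jm: "joinmap (k - 1) k \<in> measurable (?N k \<Otimes>\<^sub>M ?N (k - 1)) (?N (k - 1 + k))" by (rule joinmap_measurable)
    have rm: "r \<in> borel_measurable (?N k \<Otimes>\<^sub>M ?N (k - 1))"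
      unfolding r_def using measurable_compose[OF measurable_compose[OF jm lvmap_measurable[OF t]] meas] .
    have A: "AE z in ?N k \<Otimes>\<^sub>M ?N (k - 1). complex_of_real (r z) = complex_of_real (e * Hker k (fst z) (snd z))"
    proof -
      have "AE x in ?N (k - 1 + k). detn (k - 1 + k) (\<lambda>i j. Kprime k (lvmap (k - 1 + k) (lvl k) x i) (lvmap (k - 1 + k) (lvl k) x j)) = complex_of_real (\<rho> (lvmap (k - 1 + k) (lvl k) x))"
        by (rule lvmap_AE[OF t \<rho>])
      then have "AE x in distr (?N k \<Otimes>\<^sub>M ?N (k - 1)) (?N (k - 1 + k)) (joinmap (k - 1) k). detn (k - 1 + k) (\<lambda>i j. Kprime k (lvmap (k - 1 + k) (lvl k) x i) (lvmap (k - 1 + k) (lvl k) x j)) = complex_of_real (\<rho> (lvmap (k - 1 + k) (lvl k) x))"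
        unfolding joinmap_distr[OF sigma_finite_Nt] .
      from AE_distrD[OF jm this] show ?thesis using AE_space
      proof eventually_elim
        case (elim z)
        have "t < fst z i" if "i < k" for i using elim(2) that by (auto simp: space_pair_measure space_PiM space_Nt PiE_iff)
        then have pos: "fst z i > 0" if "i < k" for i using that t by (meson le_less_trans)
        have "t < snd z i" if "i < k - 1" for i using elim(2) that by (auto simp: space_pair_measure space_PiM space_Nt PiE_iff)
        then have pos': "snd z i > 0" if "i < k - 1" for i using that t by (meson le_less_trans)
        have "detn (k - 1 + k) (\<lambda>i j. Kprime k (lvmap (k - 1 + k) (lvl k) (joinmap (k - 1) k (fst z, snd z)) i) (lvmap (k - 1 + k) (lvl k) (joinmap (k - 1) k (fst z, snd z)) j))
          = complex_of_real (e * Hker k (fst z) (snd z))" by (rule det) (rule pos' pos, assumption)+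
        then show ?case using elim(1) unfolding r_def prod.collapse by simp
      qed
    qed
    have AA: "AE y in ?N k. AE x in ?N (k - 1). r (y, x) = e * Hker k y x"
      using PQ.AE_pair[OF A] by (simp only: fst_conv snd_conv of_real_eq_iff)
    define I where "I y = (\<integral>x. Hker k y x \<partial>?N (k - 1))" for y
    note HI = Hker_integral[OF k, where t = t, folded I_def]
    have inner: "AE y in ?N k. 0 \<le> e * I y \<and> (\<integral>\<^sup>+x. ennreal (r (y, x)) \<partial>?N (k - 1)) = ennreal (e * I y)"
      using AA AE_space
    proof eventually_elim
      case (elim y)
      have nn': "AE x in ?N (k - 1). 0 \<le> e * Hker k y x" using elim(1)
      proof eventually_elim
        case (elim x) then show ?case using nn by (metis r_def)
      qed
      have ig: "integrable (?N (k - 1)) (\<lambda>x. e * Hker k y x)" using HI(1)[OF elim(2)] by simp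
      have eI: "(\<integral>x. e * Hker k y x \<partial>?N (k - 1)) = e * I y" unfolding I_def by simp
      have "0 \<le> e * I y" unfolding eI[symmetric] by (rule integral_nonneg_AE[OF nn'])
      moreover have "(\<integral>\<^sup>+x. ennreal (r (y, x)) \<partial>?N (k - 1)) = (\<integral>\<^sup>+x. ennreal (e * Hker k y x) \<partial>?N (k - 1))"
        by (rule nn_integral_cong_AE) (use elim(1) in \<open>auto elim: eventually_mono\<close>)
      moreover have "\<dots> = ennreal (e * I y)" using nn_integral_eq_integral[OF ig nn'] unfolding eI .
      ultimately show ?case by simp
    qed
    have Iint: "integrable (?N k) (\<lambda>y. e * I y)" using HI(2) by simp
    have Inn: "AE y in ?N k. 0 \<le> e * I y" using inner by (auto elim: eventually_mono)
    have Ival: "(\<integral>y. e * I y \<partial>?N k) = fact (k - 1) * fact k * (c * rdet k t)"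
      using HI(3) unfolding W(1) c_def by (simp add: mult_ac)
    have "0 \<le> (\<integral>y. e * I y \<partial>?N k)" by (rule integral_nonneg_AE[OF Inn])
    moreover have "(0::real) < fact (k - 1) * fact k" by simp
    ultimately have pos: "c * rdet k t \<ge> 0" unfolding Ival using mult_le_cancel_left_pos[of "fact (k - 1) * fact k :: real" 0 "c * rdet k t"] by simp
    have "(\<integral>\<^sup>+ y. indicator (Pi\<^sub>E {..<k-1+k} (\<lambda>i. {lvl k i} \<times> {t..})) y * ennreal (\<rho> y) \<partial>?X) = (\<integral>\<^sup>+x. ennreal (\<rho> (lvmap (k - 1 + k) (lvl k) x)) \<partial>?N (k - 1 + k))"
      by (rule lvmap_nn_integral[OF t]) (use meas in simp)
    also have "\<dots> = (\<integral>\<^sup>+x. ennreal (\<rho> (lvmap (k - 1 + k) (lvl k) x)) \<partial>distr (?N k \<Otimes>\<^sub>M ?N (k - 1)) (?N (k - 1 + k)) (joinmap (k - 1) k))"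
      unfolding joinmap_distr[OF sigma_finite_Nt] ..
    also have "\<dots> = (\<integral>\<^sup>+z. ennreal (r z) \<partial>(?N k \<Otimes>\<^sub>M ?N (k - 1)))"
      unfolding r_def by (rule nn_integral_distr[OF jm]) (use measurable_compose[OF lvmap_measurable[OF t] meas] in simp)
    also have "\<dots> = (\<integral>\<^sup>+y. \<integral>\<^sup>+x. ennreal (r (y, x)) \<partial>?N (k - 1) \<partial>?N k)"
      by (rule P.nn_integral_fst[symmetric]) (use rm in simp)
    also have "\<dots> = (\<integral>\<^sup>+y. ennreal (e * I y) \<partial>?N k)"
      by (rule nn_integral_cong_AE) (use inner in \<open>auto elim: eventually_mono\<close>)
    also have "\<dots> = ennreal (\<integral>y. e * I y \<partial>?N k)" by (rule nn_integral_eq_integral[OF Iint Inn])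
    finally show ?thesis unfolding Ival using pos by simp
  qed
  have "\<bar>c * rdet k 0\<bar> = 1" using W(2) e by (auto simp: c_def abs_mult)
  then have "c * rdet k 0 = 1" using main[of 0] by linarith
  then show thesis using that main by blast
qed

section \<open>Counting particles\<close>

text \<open>Dyadic numbering of the half-line from t with mesh 2^(-r). The moment identities are
  available for disjoint sets, and fine cells separate distinct particles.\<close>

definition idx :: "nat \<Rightarrow> real \<Rightarrow> real \<Rightarrow> nat" where "idx r t u = nat \<lfloor>(u - t) * 2 ^ r\<rfloor>"

definition cell :: "nat \<Rightarrow> real \<Rightarrow> nat \<Rightarrow> real set" where "cell r t j = {u. t \<le> u \<and> idx r t u = j}"

lemma cell_borel: "cell r t j \<in> sets borel"
proof -
  have m: "idx r t \<in> measurable borel (count_space UNIV)" unfolding idx_def by measurable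
  have "cell r t j = {t..} \<inter> (idx r t -` {j} \<inter> space borel)" by (auto simp: cell_def)
  then show ?thesis using measurable_sets[OF m, of "{j}"] by simp
qed

lemma idx_separate:
  assumes "t \<le> u" "t \<le> u'" "u \<noteq> u'"
  shows "\<forall>\<^sub>F r in sequentially. idx r t u \<noteq> idx r t u'"
proof -
  have *: "\<forall>\<^sub>F r in sequentially. idx r t u < idx r t u'" if u: "t \<le> u" "u < u'" for u u'
  proof -
    obtain n where n: "1 / (u' - u) < 2 ^ n" using real_arch_pow[of 2 "1 / (u' - u)"] by auto
    show ?thesis
    proof (rule eventually_sequentiallyI[of n])
      fix r assume "n \<le> r"
      then have "(2::real) ^ n \<le> 2 ^ r" by simp
      then have "1 / (u' - u) < 2 ^ r" using n by linarith
      then have "1 < (u' - u) * 2 ^ r" using u by (simp add: field_simps)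
      then have "(u - t) * 2 ^ r + 1 < (u' - t) * 2 ^ r" by (simp add: algebra_simps)
      moreover have "0 \<le> (u - t) * 2 ^ r" using u by simp
      ultimately show "idx r t u < idx r t u'" unfolding idx_def by linarith
    qed
  qed
  show ?thesis
  proof (cases "u < u'")
    case True
    from *[OF assms(1) this] show ?thesis by (auto elim: eventually_mono)
  next
    case False
    then have "u' < u" using assms by simp
    from *[OF assms(2) this] show ?thesis by (auto elim: eventually_mono)
  qed
qed

lemma idx_range: assumes "t \<le> u" shows "\<forall>\<^sub>F r in sequentially. idx r t u < r * 2 ^ r"
proof -
  obtain n where n: "u - t < real n" using reals_Archimedean2 by blast
  show ?thesis
  proof (rule eventually_sequentiallyI[of n])
    fix r assume "n \<le> r"
    then have "u - t < real r" using n by linarith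
    then have "(u - t) * 2 ^ r < real r * 2 ^ r" by simp
    then have "(u - t) * 2 ^ r < of_int (int (r * 2 ^ r))" by simp
    then have "\<lfloor>(u - t) * 2 ^ r\<rfloor> < int (r * 2 ^ r)" unfolding floor_less_iff .
    moreover have "0 \<le> \<lfloor>(u - t) * 2 ^ r\<rfloor>" using assms by simp
    ultimately show "idx r t u < r * 2 ^ r" unfolding idx_def by (simp add: nat_less_iff)
  qed
qed

text \<open>Admissible choices of cells: different slots receive disjoint sets, and the range r *
  2^r keeps the number of choices finite while exhausting the half-line as r grows.\<close>

definition good :: "nat \<Rightarrow> (nat \<Rightarrow> nat) \<Rightarrow> nat \<Rightarrow> (nat \<Rightarrow> nat) \<Rightarrow> bool" where
  "good n lv r c \<longleftrightarrow> inj_on (\<lambda>i. (lv i, c i)) {..<n} \<and> (\<forall>i<n. c i < r * 2 ^ r)"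

lemma good_eventually:
  assumes t: "\<And>i. i < n \<Longrightarrow> t \<le> u i" and inj: "inj_on (\<lambda>i. (lv i, u i)) {..<n}"
  shows "\<forall>\<^sub>F r in sequentially. good n lv r (\<lambda>i. idx r t (u i))"
proof -
  have 1: "\<forall>\<^sub>F r in sequentially. \<forall>i\<in>{..<n}. idx r t (u i) < r * 2 ^ r"
    by (rule eventually_ball_finite) (auto intro!: idx_range t)
  have "\<forall>\<^sub>F r in sequentially. lv i = lv j \<longrightarrow> i \<noteq> j \<longrightarrow> idx r t (u i) \<noteq> idx r t (u j)" if "i < n" "j < n" for i j
  proof (cases "lv i = lv j \<and> i \<noteq> j")
    case True
    then have "u i \<noteq> u j" using inj that by (auto simp: inj_on_def)
    from idx_separate[OF t t this] that show ?thesis by (auto elim: eventually_mono)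
  qed auto
  then have 2: "\<forall>\<^sub>F r in sequentially. \<forall>i\<in>{..<n}. \<forall>j\<in>{..<n}. lv i = lv j \<longrightarrow> i \<noteq> j \<longrightarrow> idx r t (u i) \<noteq> idx r t (u j)"
    by (intro eventually_ball_finite ballI) auto
  show ?thesis using 1 2
  proof eventually_elim
    case (elim r)
    have "x = y" if "x \<in> {..<n}" "y \<in> {..<n}" "(lv x, idx r t (u x)) = (lv y, idx r t (u y))" for x y
      by (rule ccontr) (use elim(2) that in auto)
    then show ?case unfolding good_def inj_on_def using elim(1) by simp
  qed
qed

definition cells :: "nat \<Rightarrow> (nat \<Rightarrow> nat) \<Rightarrow> nat \<Rightarrow> (nat \<Rightarrow> nat) set" where
  "cells n lv r = {c \<in> {..<n} \<rightarrow>\<^sub>E {..<r * 2 ^ r}. good n lv r c}"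

lemma finite_cells: "finite (cells n lv r)"
  unfolding cells_def by (rule finite_subset[OF _ finite_PiE[of "{..<n}" "\<lambda>_. {..<r * 2 ^ r}"]]) auto

lemma good_restrict: "good n lv r (\<lambda>i\<in>{..<n}. f i) \<longleftrightarrow> good n lv r f"
  by (auto simp: good_def inj_on_def)

text \<open>The cardinality is the factorial moment count. Distinctness concerns pairs of level and
  position, since particles on different levels may share a position.\<close>

definition tups :: "nat \<Rightarrow> (nat \<Rightarrow> nat) \<Rightarrow> (nat \<times> real) set \<Rightarrow> real \<Rightarrow> (nat \<Rightarrow> real) set" where
  "tups n lv S t = {u \<in> (\<Pi>\<^sub>E i\<in>{..<n}. {u. t \<le> u \<and> (lv i, u) \<in> S}). inj_on (\<lambda>i. (lv i, u i)) {..<n}}"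

text \<open>At resolution r the products of cell counts enumerate the tuples whose members lie in
  different cells. There are finitely many tuples, so all of them are separated eventually.\<close>

lemma cell_sum:
  assumes fin: "\<And>i. i < n \<Longrightarrow> finite {u. t \<le> u \<and> (lv i, u) \<in> S}"
  defines "Tr \<equiv> (\<lambda>r. {u \<in> (\<Pi>\<^sub>E i\<in>{..<n}. {u. t \<le> u \<and> (lv i, u) \<in> S}). good n lv r (\<lambda>i. idx r t (u i))})"
  shows "(\<Sum>c\<in>cells n lv r. \<Prod>i<n. cnt (S \<inter> ({lv i} \<times> cell r t (c i)))) = of_nat (card (Tr r))"
    and "Tr r \<subseteq> tups n lv S t" and "finite (tups n lv S t)" and "\<forall>\<^sub>F r in sequentially. Tr r = tups n lv S t"
proof -
  let ?X = "\<lambda>i. {u. t \<le> u \<and> (lv i, u) \<in> S}"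
  let ?B = "\<lambda>c. \<Pi>\<^sub>E i\<in>{..<n}. ?X i \<inter> cell r t (c i)"
  have cn: "cnt (S \<inter> ({lv i} \<times> cell r t j)) = of_nat (card (?X i \<inter> cell r t j))" if "i < n" for i j
  proof -
    have "S \<inter> ({lv i} \<times> cell r t j) = Pair (lv i) ` (?X i \<inter> cell r t j)" by (auto simp: cell_def)
    then show ?thesis using fin[OF that] by (simp add: cnt_def card_image inj_on_def)
  qed
  have "(\<Sum>c\<in>cells n lv r. \<Prod>i<n. cnt (S \<inter> ({lv i} \<times> cell r t (c i)))) = (\<Sum>c\<in>cells n lv r. of_nat (card (?B c)))"
    by (rule sum.cong) (simp_all add: cn card_PiE)
  also have "\<dots> = of_nat (\<Sum>c\<in>cells n lv r. card (?B c))" by simp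
  also have "(\<Sum>c\<in>cells n lv r. card (?B c)) = card (\<Union>(?B ` cells n lv r))"
  proof (rule card_UN_disjoint[symmetric, OF finite_cells])
    show "\<forall>c\<in>cells n lv r. finite (?B c)" using fin by (auto intro!: finite_PiE)
    show "\<forall>c\<in>cells n lv r. \<forall>d\<in>cells n lv r. c \<noteq> d \<longrightarrow> ?B c \<inter> ?B d = {}"
    proof (intro ballI impI, rule ccontr)
      fix c d assume cd: "c \<in> cells n lv r" "d \<in> cells n lv r" "c \<noteq> d" and "?B c \<inter> ?B d \<noteq> {}"
      then obtain u where u: "u \<in> ?B c" "u \<in> ?B d" by blast
      have "c i = d i" if "i < n" for i using PiE_mem[OF u(1), of i] PiE_mem[OF u(2), of i] that by (auto simp: cell_def)
      moreover have "c \<in> extensional {..<n}" "d \<in> extensional {..<n}" using cd by (auto simp: cells_def PiE_iff)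
      ultimately have "c = d" by (intro extensionalityI) auto
      then show False using cd by simp
    qed
  qed
  also have "\<Union>(?B ` cells n lv r) = Tr r"
  proof (intro equalityI subsetI)
    fix u assume "u \<in> \<Union>(?B ` cells n lv r)"
    then obtain c where c: "c \<in> cells n lv r" "u \<in> ?B c" by blast
    have ic: "idx r t (u i) = c i" if "i < n" for i using PiE_mem[OF c(2), of i] that by (auto simp: cell_def)
    have "u \<in> (\<Pi>\<^sub>E i\<in>{..<n}. ?X i)" using c(2) by (auto simp: PiE_iff)
    moreover have "good n lv r (\<lambda>i. idx r t (u i))" using c(1) ic by (auto simp: cells_def good_def inj_on_def)
    ultimately show "u \<in> Tr r" by (simp add: Tr_def)
  next
    fix u assume u: "u \<in> Tr r"
    let ?c = "\<lambda>i\<in>{..<n}. idx r t (u i)"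
    have g: "good n lv r (\<lambda>i. idx r t (u i))" and uX: "u \<in> (\<Pi>\<^sub>E i\<in>{..<n}. ?X i)" using u by (auto simp: Tr_def)
    have "?c \<in> cells n lv r" using g unfolding cells_def mem_Collect_eq good_restrict by (auto simp: good_def)
    moreover have "u \<in> ?B ?c" using uX by (auto simp: PiE_iff cell_def)
    ultimately show "u \<in> \<Union>(?B ` cells n lv r)" by blast
  qed
  finally show "(\<Sum>c\<in>cells n lv r. \<Prod>i<n. cnt (S \<inter> ({lv i} \<times> cell r t (c i)))) = of_nat (card (Tr r))" .
  have sub: "Tr r \<subseteq> tups n lv S t" for r
    unfolding Tr_def tups_def good_def inj_on_def by auto
  then show "Tr r \<subseteq> tups n lv S t" .
  show f: "finite (tups n lv S t)"
    by (rule finite_subset[of _ "\<Pi>\<^sub>E i\<in>{..<n}. ?X i"]) (use fin in \<open>auto simp: tups_def intro!: finite_PiE\<close>)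
  have "\<forall>\<^sub>F r in sequentially. \<forall>u\<in>tups n lv S t. u \<in> Tr r"
  proof (rule eventually_ball_finite[OF f], rule ballI)
    fix u assume u: "u \<in> tups n lv S t"
    then have uX: "u \<in> (\<Pi>\<^sub>E i\<in>{..<n}. ?X i)" and inj: "inj_on (\<lambda>i. (lv i, u i)) {..<n}" by (auto simp: tups_def)
    have "t \<le> u i" if "i < n" for i using PiE_mem[OF uX, of i] that by auto
    from good_eventually[OF this inj] show "\<forall>\<^sub>F r in sequentially. u \<in> Tr r"
      by (rule eventually_mono) (use uX in \<open>simp_all add: Tr_def\<close>)
  qed
  then show "\<forall>\<^sub>F r in sequentially. Tr r = tups n lv S t" by (rule eventually_mono) (use sub in blast)
qed

text \<open>The counterpart of \<open>cell_sum\<close> for the correlation function: a point belongs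
  to at most one choice of cells, the one given by its own indices.\<close>

lemma cell_sum_indicator:
  assumes t: "t \<ge> 0"
  shows "(\<Sum>c\<in>cells n lv r. indicator (\<Pi>\<^sub>E i\<in>{..<n}. {lv i} \<times> cell r t (c i)) y :: ennreal)
    = (if good n lv r (\<lambda>i. idx r t (snd (y i))) then indicator (\<Pi>\<^sub>E i\<in>{..<n}. {lv i} \<times> {t..}) y else 0)"
proof -
  let ?c = "\<lambda>i\<in>{..<n}. idx r t (snd (y i))"
  have e: "indicator (\<Pi>\<^sub>E i\<in>{..<n}. {lv i} \<times> cell r t (c i)) y = (if c = ?c then indicator (\<Pi>\<^sub>E i\<in>{..<n}. {lv i} \<times> {t..}) y else 0 :: ennreal)"
    if c: "c \<in> cells n lv r" for c
  proof -
    have ce: "c \<in> extensional {..<n}" using c by (auto simp: cells_def PiE_iff)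
    show ?thesis
    proof (cases "y \<in> (\<Pi>\<^sub>E i\<in>{..<n}. {lv i} \<times> {t..})")
      case True
      have "y \<in> (\<Pi>\<^sub>E i\<in>{..<n}. {lv i} \<times> cell r t (c i)) \<longleftrightarrow> (\<forall>i<n. idx r t (snd (y i)) = c i)"
        using True by (auto simp: PiE_iff cell_def mem_Times_iff)
      also have "\<dots> \<longleftrightarrow> c = ?c"
      proof
        assume "\<forall>i<n. idx r t (snd (y i)) = c i"
        then show "c = ?c" by (intro extensionalityI[OF ce]) auto
      next
        assume "c = ?c"
        then have "c i = ?c i" for i by simp
        then show "\<forall>i<n. idx r t (snd (y i)) = c i" by simp
      qed
      finally show ?thesis using True by (simp add: indicator_def)
    next
      case False
      then have "y \<notin> (\<Pi>\<^sub>E i\<in>{..<n}. {lv i} \<times> cell r t (c i))" by (auto simp: PiE_iff cell_def mem_Times_iff)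
      then show ?thesis using False by (simp add: indicator_def)
    qed
  qed
  have "(\<Sum>c\<in>cells n lv r. indicator (\<Pi>\<^sub>E i\<in>{..<n}. {lv i} \<times> cell r t (c i)) y :: ennreal) = (\<Sum>c\<in>cells n lv r. if c = ?c then indicator (\<Pi>\<^sub>E i\<in>{..<n}. {lv i} \<times> {t..}) y else 0)"
    by (rule sum.cong) (simp_all only: e)
  also have "\<dots> = (if ?c \<in> cells n lv r then indicator (\<Pi>\<^sub>E i\<in>{..<n}. {lv i} \<times> {t..}) y else 0)"
    by (simp only: sum.delta[OF finite_cells])
  also have "?c \<in> cells n lv r \<longleftrightarrow> good n lv r (\<lambda>i. idx r t (snd (y i)))"
    unfolding cells_def mem_Collect_eq good_restrict by (auto simp: good_def)
  finally show ?thesis .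
qed

lemma cnt_eq_0: "cnt S = 0 \<longleftrightarrow> S = {}" by (auto simp: cnt_def)

lemma ennreal_prod_nonzero: fixes n :: nat shows "(\<And>i. i < n \<Longrightarrow> f i \<noteq> 0) \<Longrightarrow> (\<Prod>i<n. f i :: ennreal) \<noteq> 0"
  by (induction n) auto

lemma card_inj_tuples_le:
  assumes "finite X" "card X \<le> m"
  shows "card {f \<in> {..<m} \<rightarrow>\<^sub>E X. inj_on f {..<m}} \<le> fact m"
proof -
  have "card {f \<in> {..<m} \<rightarrow>\<^sub>E X. inj_on f {..<m}} = prod ((-) (card X)) {0 ..< m}"
    using card_inj_on_subset_funcset[of "{..<m}" X "{..<m}"] assms by simp
  also have "\<dots> \<le> prod ((-) m) {0 ..< m}" using assms by (intro prod_mono) auto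
  also have "\<dots> = fact m" by (simp add: fact_prod_rev)
  finally show ?thesis .
qed

section \<open>The point process: level sizes and factorial moments\<close>

locale kproc = prob_space M for M :: "'a measure" +
  fixes k :: nat and xi :: "'a \<Rightarrow> (nat \<times> real) set" and \<rho> :: "nat \<Rightarrow> (nat \<Rightarrow> nat \<times> real) \<Rightarrow> real"
  assumes k: "k \<ge> 1" and sub: "\<And>\<omega>. \<omega> \<in> space M \<Longrightarrow> xi \<omega> \<subseteq> space Xmeas"
    and cm: "\<And>A. A \<in> sets Xmeas \<Longrightarrow> (\<lambda>\<omega>. cnt (xi \<omega> \<inter> A)) \<in> borel_measurable M"
    and nn: "\<And>n y. 0 \<le> \<rho> n y" and rm: "\<And>n. \<rho> n \<in> borel_measurable (Pi\<^sub>M {..<n} (\<lambda>_. Xmeas))"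
    and mom: "\<And>n A. (\<And>i. i < n \<Longrightarrow> A i \<in> sets Xmeas) \<Longrightarrow> disjoint_family_on A {..<n} \<Longrightarrow>
       (\<integral>\<^sup>+ \<omega>. (\<Prod>i<n. cnt (xi \<omega> \<inter> A i)) \<partial>M) = (\<integral>\<^sup>+ y. indicator (PiE {..<n} A) y * ennreal (\<rho> n y) \<partial>(PiM {..<n} (\<lambda>_. Xmeas)))"
    and rdt: "\<And>n. AE y in PiM {..<n} (\<lambda>_. Xmeas). detn n (\<lambda>i j. Kprime k (y i) (y j)) = complex_of_real (\<rho> n y)"
begin

lemma prod_cnt_measurable:
  assumes "\<And>i. i < n \<Longrightarrow> A i \<in> sets Xmeas"
  shows "(\<lambda>\<omega>. \<Prod>i<n. cnt (xi \<omega> \<inter> A i)) \<in> borel_measurable M"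
  by (rule borel_measurable_prod_ennreal) (use assms cm in auto)

lemma cell_sets: "t \<ge> 0 \<Longrightarrow> {l} \<times> cell r t j \<in> sets Xmeas"
  by (rule sets_cyl[OF cell_borel]) (auto simp: cell_def)

text \<open>If n particles sat on the level, some dyadic resolution would put them into different
  cells, and the product of the counts of these cells would be nonzero. There are countably many
  resolutions and choices of cells, and each product has expectation 0.\<close>

lemma level_bound:
  assumes l: "l = 2 * k - 1 \<and> n = k \<or> l = 2 * k + 1 \<and> n = k + 1"
  shows "AE \<omega> in M. finite {u. (l, u) \<in> xi \<omega>} \<and> card {u. (l, u) \<in> xi \<omega>} < n"
proof -
  \<comment> \<open>Lists of cell numbers form a countable type, unlike functions on the naturals,
    so the exceptional sets can be united.\<close>
  have "AE \<omega> in M. distinct cs \<and> length cs = n \<longrightarrow> (\<Prod>i<n. cnt (xi \<omega> \<inter> ({l} \<times> cell r 0 (cs ! i)))) = 0" for r cs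
  proof (cases "distinct cs \<and> length cs = n")
    case True
    let ?A = "\<lambda>i. {l} \<times> cell r 0 (cs ! i)"
    have A: "?A i \<in> sets Xmeas" for i by (rule cell_sets) simp
    have d: "disjoint_family_on ?A {..<n}"
      unfolding disjoint_family_on_def using True by (auto simp: cell_def nth_eq_iff_index_eq)
    have "(\<integral>\<^sup>+ \<omega>. (\<Prod>i<n. cnt (xi \<omega> \<inter> ?A i)) \<partial>M) = (\<integral>\<^sup>+ y. indicator (PiE {..<n} ?A) y * ennreal (\<rho> n y) \<partial>(PiM {..<n} (\<lambda>_. Xmeas)))"
      by (rule mom[OF A d])
    also have "\<dots> \<le> (\<integral>\<^sup>+ y. indicator (Pi\<^sub>E {..<n} (\<lambda>_. {l} \<times> {0..})) y * ennreal (\<rho> n y) \<partial>Pi\<^sub>M {..<n} (\<lambda>_. Xmeas))"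
      by (intro nn_integral_mono mult_right_mono indicator_leI) (auto simp: PiE_iff cell_def mem_Times_iff)
    also have "\<dots> = 0" by (rule rho_level_zero[OF k l rm rdt])
    finally have "(\<integral>\<^sup>+ \<omega>. (\<Prod>i<n. cnt (xi \<omega> \<inter> ?A i)) \<partial>M) = 0" by simp
    then have "AE \<omega> in M. (\<Prod>i<n. cnt (xi \<omega> \<inter> ?A i)) = 0"
      by (subst (asm) nn_integral_0_iff_AE) (auto intro!: prod_cnt_measurable A)
    then show ?thesis by (auto elim: eventually_mono)
  qed auto
  then have "AE \<omega> in M. \<forall>r cs. distinct cs \<and> length cs = n \<longrightarrow> (\<Prod>i<n. cnt (xi \<omega> \<inter> ({l} \<times> cell r 0 (cs ! i)))) = 0"
    unfolding AE_all_countable by blast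
  then show ?thesis using AE_space
  proof eventually_elim
    case (elim \<omega>)
    let ?X = "{u. (l, u) \<in> xi \<omega>}"
    show ?case
    proof (rule ccontr)
      assume "\<not> (finite ?X \<and> card ?X < n)"
      then have "\<exists>Y. Y \<subseteq> ?X \<and> card Y = n \<and> finite Y"
      proof (cases "finite ?X")
        case True
        then have "n \<le> card ?X" using \<open>\<not> (finite ?X \<and> card ?X < n)\<close> by simp
        from obtain_subset_with_card_n[OF this] obtain T where "T \<subseteq> ?X" "card T = n" "finite T" .
        then show ?thesis by blast
      next
        case False
        from infinite_arbitrarily_large[OF this, of n] show ?thesis by blast
      qed
      then obtain Y where Y: "Y \<subseteq> ?X" "card Y = n" "finite Y" by blast
      have pos: "0 \<le> u" if "u \<in> Y" for u using that Y(1) sub[OF elim(2)] by (auto simp: space_Xmeas)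
      define us where "us = sorted_list_of_set Y"
      have us: "distinct us" "set us = Y" "length us = n" using Y by (simp_all add: us_def)
      have "inj_on (\<lambda>i. ((\<lambda>_. l) i, us ! i)) {..<n}" using us by (auto simp: inj_on_def nth_eq_iff_index_eq)
      moreover have usY: "us ! i \<in> Y" if "i < n" for i using nth_mem[of i us] that us(2,3) by simp
      moreover have "0 \<le> us ! i" if "i < n" for i by (rule pos[OF usY[OF that]])
      ultimately have "\<forall>\<^sub>F r in sequentially. good n (\<lambda>_. l) r (\<lambda>i. idx r 0 (us ! i))" by (intro good_eventually)
      from eventually_happens'[OF sequentially_bot this] obtain r where g: "good n (\<lambda>_. l) r (\<lambda>i. idx r 0 (us ! i))" ..
      define cs where "cs = map (idx r 0) us"
      have "distinct cs" unfolding cs_def distinct_conv_nth using g us(3) by (auto simp: good_def inj_on_def)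
      moreover have "length cs = n" using us by (simp add: cs_def)
      ultimately have 0: "(\<Prod>i<n. cnt (xi \<omega> \<inter> ({l} \<times> cell r 0 (cs ! i)))) = 0" using elim(1) by blast
      have "cnt (xi \<omega> \<inter> ({l} \<times> cell r 0 (cs ! i))) \<noteq> 0" if i: "i < n" for i
      proof -
        have "us ! i \<in> Y" by (rule usY[OF i])
        then have "(l, us ! i) \<in> xi \<omega> \<inter> ({l} \<times> cell r 0 (cs ! i))" using Y(1) pos i us(3) by (auto simp: cell_def cs_def)
        then show ?thesis unfolding cnt_eq_0 by blast
      qed
      then show False using ennreal_prod_nonzero[of n "\<lambda>i. cnt (xi \<omega> \<inter> ({l} \<times> cell r 0 (cs ! i)))"] 0 by blast
    qed
  qed
qed

text \<open>Coinciding points give equal rows in the determinant. This disposes of the diagonal,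
  which the cell sums never see.\<close>

lemma rho_diagonal:
  "AE y in PiM {..<n} (\<lambda>_. Xmeas). \<forall>i<n. \<forall>j<n. i \<noteq> j \<longrightarrow> y i = y j \<longrightarrow> \<rho> n y = 0"
  using rdt[of n]
proof eventually_elim
  case (elim y)
  show ?case
  proof (intro allI impI)
    fix i j assume ij: "i < n" "j < n" "i \<noteq> j" "y i = y j"
    have "det (mat n n (\<lambda>(i, j). Kprime k (y i) (y j))) = 0"
      by (rule det_identical_rows[OF _ ij(3,1,2)]) (use ij in \<open>auto intro!: eq_vecI\<close>)
    then show "\<rho> n y = 0" using elim unfolding detn_det by simp
  qed
qed

text \<open>Several slots may ask for the same level, so the sets are not disjoint. Summing the
  identity over admissible cells and shrinking the mesh covers this case, with dominated convergence
  on both sides. The lower limit g of the cell sums is a measurable version of the count.\<close>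

lemma factorial_moment:
  assumes t: "t \<ge> 0" and fin: "AE \<omega> in M. \<forall>i<n. finite {u. t \<le> u \<and> (lv i, u) \<in> xi \<omega>}"
    and bd: "AE \<omega> in M. card (tups n lv (xi \<omega>) t) \<le> Bd"
    and w: "(\<integral>\<^sup>+ y. indicator (Pi\<^sub>E {..<n} (\<lambda>i. {lv i} \<times> {t..})) y * ennreal (\<rho> n y) \<partial>Pi\<^sub>M {..<n} (\<lambda>_. Xmeas)) < \<infinity>"
  shows "\<exists>g\<in>borel_measurable M. (AE \<omega> in M. g \<omega> = of_nat (card (tups n lv (xi \<omega>) t))) \<and>
    (\<integral>\<^sup>+ \<omega>. g \<omega> \<partial>M) = (\<integral>\<^sup>+ y. indicator (Pi\<^sub>E {..<n} (\<lambda>i. {lv i} \<times> {t..})) y * ennreal (\<rho> n y) \<partial>Pi\<^sub>M {..<n} (\<lambda>_. Xmeas))"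
proof -
  let ?X = "Pi\<^sub>M {..<n} (\<lambda>_. Xmeas)"
  define Sr where "Sr r \<omega> = (\<Sum>c\<in>cells n lv r. \<Prod>i<n. cnt (xi \<omega> \<inter> ({lv i} \<times> cell r t (c i))))" for r \<omega>
  define w' where "w' y = indicator (Pi\<^sub>E {..<n} (\<lambda>i. {lv i} \<times> {t..})) y * ennreal (\<rho> n y)" for y
  define V where "V r y = (\<Sum>c\<in>cells n lv r. indicator (\<Pi>\<^sub>E i\<in>{..<n}. {lv i} \<times> cell r t (c i)) y * ennreal (\<rho> n y))" for r y
  have Vif: "V r y = (if good n lv r (\<lambda>i. idx r t (snd (y i))) then w' y else 0)" for r y
    unfolding V_def sum_distrib_right[symmetric] cell_sum_indicator[OF t] w'_def by simp
  have cs: "{lv i} \<times> cell r t j \<in> sets Xmeas" for i r j by (rule cell_sets[OF t])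
  have SP: "Pi\<^sub>E {..<n} (\<lambda>i. {lv i} \<times> {t..}) \<in> sets ?X" by (rule sets_PiM_I_finite) (use t in \<open>auto intro!: sets_cyl\<close>)
  have rn: "(\<lambda>y. ennreal (\<rho> n y)) \<in> borel_measurable ?X" using rm[of n] by simp
  have w'm: "w' \<in> borel_measurable ?X" unfolding w'_def using SP rn by (intro borel_measurable_times_ennreal borel_measurable_indicator)
  have tm: "(\<lambda>y. indicator (\<Pi>\<^sub>E i\<in>{..<n}. {lv i} \<times> cell r t (c i)) y * ennreal (\<rho> n y)) \<in> borel_measurable ?X" for r c
    using rn by (intro borel_measurable_times_ennreal borel_measurable_indicator sets_PiM_I_finite) (auto intro!: cs)
  have Vm: "V r \<in> borel_measurable ?X" for r unfolding V_def by (rule borel_measurable_sum) (rule tm)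
  have Sm: "Sr r \<in> borel_measurable M" for r unfolding Sr_def
    by (rule borel_measurable_sum) (rule prod_cnt_measurable, rule cs)
  have SV: "(\<integral>\<^sup>+\<omega>. Sr r \<omega> \<partial>M) = (\<integral>\<^sup>+y. V r y \<partial>?X)" for r
  proof -
    have "(\<integral>\<^sup>+\<omega>. Sr r \<omega> \<partial>M) = (\<Sum>c\<in>cells n lv r. \<integral>\<^sup>+\<omega>. (\<Prod>i<n. cnt (xi \<omega> \<inter> ({lv i} \<times> cell r t (c i)))) \<partial>M)"
      unfolding Sr_def by (rule nn_integral_sum) (rule prod_cnt_measurable, rule cs)
    also have "\<dots> = (\<Sum>c\<in>cells n lv r. \<integral>\<^sup>+y. indicator (\<Pi>\<^sub>E i\<in>{..<n}. {lv i} \<times> cell r t (c i)) y * ennreal (\<rho> n y) \<partial>?X)"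
    proof (rule sum.cong[OF refl])
      fix c assume c: "c \<in> cells n lv r"
      have "disjoint_family_on (\<lambda>i. {lv i} \<times> cell r t (c i)) {..<n}"
        unfolding disjoint_family_on_def
      proof (intro ballI impI)
        fix i j assume ij: "i \<in> {..<n}" "j \<in> {..<n}" "i \<noteq> j"
        have "inj_on (\<lambda>i. (lv i, c i)) {..<n}" using c by (simp add: cells_def good_def)
        then have "(lv i, c i) \<noteq> (lv j, c j)" by (rule inj_on_contraD[OF _ ij(3,1,2)])
        then show "({lv i} \<times> cell r t (c i)) \<inter> ({lv j} \<times> cell r t (c j)) = {}" by (auto simp: cell_def)
      qed
      then show "(\<integral>\<^sup>+\<omega>. (\<Prod>i<n. cnt (xi \<omega> \<inter> ({lv i} \<times> cell r t (c i)))) \<partial>M) = (\<integral>\<^sup>+y. indicator (\<Pi>\<^sub>E i\<in>{..<n}. {lv i} \<times> cell r t (c i)) y * ennreal (\<rho> n y) \<partial>?X)"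
        by (rule mom[OF cs])
    qed
    also have "\<dots> = (\<integral>\<^sup>+y. V r y \<partial>?X)" unfolding V_def by (rule nn_integral_sum[symmetric]) (rule tm)
    finally show ?thesis .
  qed
  have limV: "(\<lambda>r. \<integral>\<^sup>+y. V r y \<partial>?X) \<longlonglongrightarrow> (\<integral>\<^sup>+y. w' y \<partial>?X)"
  proof (rule nn_integral_dominated_convergence[where w = w'])
    show "AE y in ?X. V r y \<le> w' y" for r unfolding Vif by simp
    show "(\<integral>\<^sup>+y. w' y \<partial>?X) < \<infinity>" using w unfolding w'_def .
    show "AE y in ?X. (\<lambda>r. V r y) \<longlonglongrightarrow> w' y" using rho_diagonal[of n]
    proof eventually_elim
      case (elim y)
      show ?case
      proof (cases "y \<in> Pi\<^sub>E {..<n} (\<lambda>i. {lv i} \<times> {t..}) \<and> \<rho> n y \<noteq> 0")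
        case True
        have f: "fst (y i) = lv i" "t \<le> snd (y i)" if "i < n" for i using PiE_mem[OF conjunct1[OF True], of i] that by auto
        have "inj_on (\<lambda>i. (lv i, snd (y i))) {..<n}"
        proof (rule inj_onI)
          fix i j assume ij: "i \<in> {..<n}" "j \<in> {..<n}" "(lv i, snd (y i)) = (lv j, snd (y j))"
          then have "y i = y j" using f(1)[of i] f(1)[of j] by (auto simp: prod_eq_iff)
          then show "i = j" using elim True ij by auto
        qed
        from good_eventually[OF f(2) this] have "\<forall>\<^sub>F r in sequentially. V r y = w' y"
          by (rule eventually_mono) (simp_all add: Vif)
        then show ?thesis by (rule tendsto_eventually)
      next
        case False
        have "w' y = 0"
        proof (cases "\<rho> n y = 0")
          case True
          then show ?thesis by (simp only: w'_def ennreal_0 mult_zero_right)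
        next
          case nz: False
          then have "y \<notin> Pi\<^sub>E {..<n} (\<lambda>i. {lv i} \<times> {t..})" using False by blast
          then have "indicator (Pi\<^sub>E {..<n} (\<lambda>i. {lv i} \<times> {t..})) y = (0 :: ennreal)" by (simp only: indicator_eq_0_iff not_False_eq_True)
          then show ?thesis by (simp only: w'_def mult_zero_left)
        qed
        then have "V r y = 0" for r unfolding Vif by simp
        then show ?thesis using \<open>w' y = 0\<close> by simp
      qed
    qed
  qed (rule Vm w'm)+
  define g where "g \<omega> = liminf (\<lambda>r. Sr r \<omega>)" for \<omega>
  have gm: "g \<in> borel_measurable M" unfolding g_def by (rule borel_measurable_liminf) (rule Sm)
  have lim: "AE \<omega> in M. (\<lambda>r. Sr r \<omega>) \<longlonglongrightarrow> of_nat (card (tups n lv (xi \<omega>) t)) \<and> (\<forall>r. Sr r \<omega> \<le> of_nat Bd)"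
    using fin bd
  proof eventually_elim
    case (elim \<omega>)
    have f: "finite {u. t \<le> u \<and> (lv i, u) \<in> xi \<omega>}" if "i < n" for i using elim(1) that by blast
    define Tr where "Tr r = {u \<in> (\<Pi>\<^sub>E i\<in>{..<n}. {u. t \<le> u \<and> (lv i, u) \<in> xi \<omega>}). good n lv r (\<lambda>i. idx r t (u i))}" for r
    have C1: "Sr r \<omega> = of_nat (card (Tr r))" for r unfolding Sr_def Tr_def by (rule cell_sum(1)) (rule f)
    have C2: "Tr r \<subseteq> tups n lv (xi \<omega>) t" for r unfolding Tr_def by (rule cell_sum(2)) (rule f)
    have C3: "finite (tups n lv (xi \<omega>) t)" by (rule cell_sum(3)) (rule f)
    have C4: "\<forall>\<^sub>F r in sequentially. Tr r = tups n lv (xi \<omega>) t" unfolding Tr_def by (rule cell_sum(4)) (rule f)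
    have "\<forall>\<^sub>F r in sequentially. Sr r \<omega> = of_nat (card (tups n lv (xi \<omega>) t))"
      by (rule eventually_mono[OF C4]) (simp only: C1)
    moreover have "Sr r \<omega> \<le> of_nat Bd" for r
    proof -
      have "Sr r \<omega> \<le> of_nat (card (tups n lv (xi \<omega>) t))" unfolding C1 of_nat_le_iff by (rule card_mono[OF C3 C2])
      also have "\<dots> \<le> of_nat Bd" using elim(2) by simp
      finally show ?thesis .
    qed
    ultimately show ?case by (auto intro: tendsto_eventually)
  qed
  have gv: "AE \<omega> in M. g \<omega> = of_nat (card (tups n lv (xi \<omega>) t))" using lim
  proof eventually_elim
    case (elim \<omega>)
    then show ?case unfolding g_def by (intro lim_imp_Liminf) auto
  qed
  have "(\<lambda>r. \<integral>\<^sup>+\<omega>. Sr r \<omega> \<partial>M) \<longlonglongrightarrow> (\<integral>\<^sup>+\<omega>. g \<omega> \<partial>M)"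
  proof (rule nn_integral_dominated_convergence[where w = "\<lambda>_. of_nat Bd"])
    show "AE \<omega> in M. Sr r \<omega> \<le> of_nat Bd" for r using lim by (auto elim: eventually_mono)
    show "(\<integral>\<^sup>+\<omega>. of_nat Bd \<partial>M) < \<infinity>" by (simp add: emeasure_space_1 ennreal_mult_less_top of_nat_less_top)
    show "AE \<omega> in M. (\<lambda>r. Sr r \<omega>) \<longlonglongrightarrow> g \<omega>" using lim gv by eventually_elim simp
  qed (use Sm gm in auto)
  then have "(\<integral>\<^sup>+\<omega>. g \<omega> \<partial>M) = (\<integral>\<^sup>+y. w' y \<partial>?X)" using LIMSEQ_unique[OF _ limV] unfolding SV by blast
  then show ?thesis using gm gv unfolding w'_def by blast
qed

end

lemma tups_lvl_split:
  assumes "u \<in> tups (k - 1 + k) (lvl k) S t"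
  shows "(\<lambda>i\<in>{..<k-1}. u i) \<in> {f \<in> {..<k-1} \<rightarrow>\<^sub>E {u. t \<le> u \<and> (2 * k - 1, u) \<in> S}. inj_on f {..<k-1}}"
    and "(\<lambda>i\<in>{..<k}. u (k - 1 + i)) \<in> {f \<in> {..<k} \<rightarrow>\<^sub>E {u. t \<le> u \<and> (2 * k + 1, u) \<in> S}. inj_on f {..<k}}"
proof -
  have u: "t \<le> u i \<and> (lvl k i, u i) \<in> S" if "i < k - 1 + k" for i
    using assms that by (auto simp: tups_def PiE_iff)
  have inj: "lvl k i = lvl k j \<Longrightarrow> u i = u j \<Longrightarrow> i = j" if "i < k - 1 + k" "j < k - 1 + k" for i j
    using assms that by (auto simp: tups_def inj_on_def)
  have "inj_on (\<lambda>i\<in>{..<k-1}. u i) {..<k-1}" using inj by (auto simp: inj_on_def lvl_def)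
  moreover have "u i \<in> {u. t \<le> u \<and> (2 * k - 1, u) \<in> S}" if "i < k - 1" for i using u[of i] that by (simp add: lvl_def)
  ultimately show "(\<lambda>i\<in>{..<k-1}. u i) \<in> {f \<in> {..<k-1} \<rightarrow>\<^sub>E {u. t \<le> u \<and> (2 * k - 1, u) \<in> S}. inj_on f {..<k-1}}" by auto
  have "inj_on (\<lambda>i\<in>{..<k}. u (k - 1 + i)) {..<k}"
  proof (rule inj_onI)
    fix i j assume ij: "i \<in> {..<k}" "j \<in> {..<k}" "(\<lambda>i\<in>{..<k}. u (k - 1 + i)) i = (\<lambda>i\<in>{..<k}. u (k - 1 + i)) j"
    have e: "u (k - 1 + i) = u (k - 1 + j)" using ij by simp
    have l: "lvl k (k - 1 + i) = lvl k (k - 1 + j)" by (simp only: lvl_def not_add_less1 if_False)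
    have "k - 1 + i = k - 1 + j" by (rule inj[OF _ _ l e]) (use ij in simp_all)
    then show "i = j" by simp
  qed
  moreover have "u (k - 1 + i) \<in> {u. t \<le> u \<and> (2 * k + 1, u) \<in> S}" if "i < k" for i
  proof -
    have l: "lvl k (k - 1 + i) = 2 * k + 1" by (simp only: lvl_def not_add_less1 if_False)
    have "k - 1 + i < k - 1 + k" using that by simp
    from u[OF this] show ?thesis by (simp only: l mem_Collect_eq)
  qed
  ultimately show "(\<lambda>i\<in>{..<k}. u (k - 1 + i)) \<in> {f \<in> {..<k} \<rightarrow>\<^sub>E {u. t \<le> u \<and> (2 * k + 1, u) \<in> S}. inj_on f {..<k}}" by auto
qed

text \<open>A tuple splits into an injective choice of k - 1 among at most k - 1 particles and one
  of k among at most k.\<close>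

lemma tups_card_le:
  assumes fa: "finite {u. (2 * k - 1, u) \<in> S}" "card {u. (2 * k - 1, u) \<in> S} \<le> k - 1"
    and fb: "finite {u. (2 * k + 1, u) \<in> S}" "card {u. (2 * k + 1, u) \<in> S} \<le> k"
  shows "card (tups (k - 1 + k) (lvl k) S t) \<le> fact (k - 1) * fact k"
proof -
  let ?A = "{u. t \<le> u \<and> (2 * k - 1, u) \<in> S}" and ?B = "{u. t \<le> u \<and> (2 * k + 1, u) \<in> S}"
  let ?F = "{f \<in> {..<k-1} \<rightarrow>\<^sub>E ?A. inj_on f {..<k-1}}" and ?G = "{f \<in> {..<k} \<rightarrow>\<^sub>E ?B. inj_on f {..<k}}"
  have sA: "?A \<subseteq> {u. (2 * k - 1, u) \<in> S}" and sB: "?B \<subseteq> {u. (2 * k + 1, u) \<in> S}" by blast+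
  have A: "finite ?A" "card ?A \<le> k - 1" by (rule finite_subset[OF sA fa(1)], rule order_trans[OF card_mono[OF fa(1) sA] fa(2)])
  have B: "finite ?B" "card ?B \<le> k" by (rule finite_subset[OF sB fb(1)], rule order_trans[OF card_mono[OF fb(1) sB] fb(2)])
  have "finite ({..<k-1} \<rightarrow>\<^sub>E ?A)" by (rule finite_PiE) (rule finite_lessThan, rule A(1))
  then have fF: "finite ?F" by (rule rev_finite_subset) blast
  have "finite ({..<k} \<rightarrow>\<^sub>E ?B)" by (rule finite_PiE) (rule finite_lessThan, rule B(1))
  then have fG: "finite ?G" by (rule rev_finite_subset) blast
  have "card (tups (k - 1 + k) (lvl k) S t) \<le> card (?F \<times> ?G)"
  proof (rule card_inj_on_le[where f = "\<lambda>u. (\<lambda>i\<in>{..<k-1}. u i, \<lambda>i\<in>{..<k}. u (k - 1 + i))"])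
    show "inj_on (\<lambda>u. (\<lambda>i\<in>{..<k-1}. u i, \<lambda>i\<in>{..<k}. u (k - 1 + i))) (tups (k - 1 + k) (lvl k) S t)"
    proof (rule inj_onI)
      fix u v assume uv: "u \<in> tups (k - 1 + k) (lvl k) S t" "v \<in> tups (k - 1 + k) (lvl k) S t"
        and e: "(\<lambda>i\<in>{..<k-1}. u i, \<lambda>i\<in>{..<k}. u (k - 1 + i)) = (\<lambda>i\<in>{..<k-1}. v i, \<lambda>i\<in>{..<k}. v (k - 1 + i))"
      show "u = v"
      proof (rule extensionalityI[of _ "{..<k-1+k}"])
        show "u \<in> extensional {..<k-1+k}" "v \<in> extensional {..<k-1+k}" using uv by (auto simp: tups_def PiE_iff)
        fix i assume i: "i \<in> {..<k-1+k}"
        show "u i = v i"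
        proof (cases "i < k - 1")
          case True
          have "(\<lambda>i\<in>{..<k-1}. u i) i = (\<lambda>i\<in>{..<k-1}. v i) i" using e by simp
          then show ?thesis using True by simp
        next
          case False
          define j where "j = i - (k - 1)"
          have j: "j < k" "k - 1 + j = i" using i False by (auto simp: j_def)
          have "(\<lambda>i\<in>{..<k}. u (k - 1 + i)) j = (\<lambda>i\<in>{..<k}. v (k - 1 + i)) j" using e by simp
          then have "u (k - 1 + j) = v (k - 1 + j)" using j(1) by simp
          then show ?thesis unfolding j(2) .
        qed
      qed
    qed
    show "(\<lambda>u. (\<lambda>i\<in>{..<k-1}. u i, \<lambda>i\<in>{..<k}. u (k - 1 + i))) ` tups (k - 1 + k) (lvl k) S t \<subseteq> ?F \<times> ?G"
      by (rule image_subsetI, rule SigmaI) (rule tups_lvl_split, assumption)+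
    show "finite (?F \<times> ?G)" using fF fG by simp
  qed
  also have "\<dots> = card ?F * card ?G" by (rule card_cartesian_product)
  also have "\<dots> \<le> fact (k - 1) * fact k" by (intro mult_mono card_inj_tuples_le A B) auto
  finally show ?thesis .
qed

lemma tups_empty:
  assumes fa: "finite {u. t \<le> u \<and> (2 * k - 1, u) \<in> S}" and fb: "finite {u. t \<le> u \<and> (2 * k + 1, u) \<in> S}"
    and c: "card {u. t \<le> u \<and> (2 * k - 1, u) \<in> S} < k - 1 \<or> card {u. t \<le> u \<and> (2 * k + 1, u) \<in> S} < k"
  shows "tups (k - 1 + k) (lvl k) S t = {}"
proof (rule ccontr)
  assume "tups (k - 1 + k) (lvl k) S t \<noteq> {}"
  then obtain u where u: "u \<in> tups (k - 1 + k) (lvl k) S t" by blast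
  have le: "m \<le> card X" if f: "f \<in> {f \<in> {..<m} \<rightarrow>\<^sub>E X. inj_on f {..<m}}" and X: "finite X" for f :: "nat \<Rightarrow> real" and m X
  proof -
    have f1: "f \<in> {..<m} \<rightarrow>\<^sub>E X" and f2: "inj_on f {..<m}" using f by blast+
    have "f ` {..<m} \<subseteq> X" by (rule image_subsetI) (rule PiE_mem[OF f1])
    from card_inj_on_le[OF f2 this X] show ?thesis by simp
  qed
  have "k - 1 \<le> card {u. t \<le> u \<and> (2 * k - 1, u) \<in> S}" by (rule le[OF tups_lvl_split(1)[OF u] fa])
  moreover have "k \<le> card {u. t \<le> u \<and> (2 * k + 1, u) \<in> S}" by (rule le[OF tups_lvl_split(2)[OF u] fb])
  ultimately show False using c by linarith
qed

lemma Zlev_ge: "y \<le> Zlev xi l \<omega> \<longleftrightarrow> (\<forall>u. (l, u) \<in> xi \<omega> \<longrightarrow> y \<le> ereal u)"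
  by (auto simp: Zlev_def le_Inf_iff)

context kproc
begin

lemma Zlev_measurable: "Zlev xi l \<in> borel_measurable M"
proof (rule borel_measurableI_ge)
  fix y :: ereal
  let ?A = "{l} \<times> {u. 0 \<le> u \<and> ereal u < y}"
  have "{u. 0 \<le> u \<and> ereal u < y} = {u \<in> space borel. 0 \<le> u \<and> ereal u < y}" by simp
  also have "\<dots> \<in> sets borel" by measurable
  finally have A: "?A \<in> sets Xmeas" by (rule sets_cyl) auto
  have "{\<omega> \<in> space M. y \<le> Zlev xi l \<omega>} = {\<omega> \<in> space M. cnt (xi \<omega> \<inter> ?A) = 0}"
  proof -
    have "y \<le> Zlev xi l \<omega> \<longleftrightarrow> cnt (xi \<omega> \<inter> ?A) = 0" if "\<omega> \<in> space M" for \<omega>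
    proof -
      have p: "0 \<le> u" if "(l, u) \<in> xi \<omega>" for u using sub[OF \<open>\<omega> \<in> space M\<close>] that by (auto simp: space_Xmeas)
      have "cnt (xi \<omega> \<inter> ?A) = 0 \<longleftrightarrow> (\<forall>u. (l, u) \<in> xi \<omega> \<longrightarrow> \<not> ereal u < y)"
        unfolding cnt_eq_0 using p by (auto simp: set_eq_iff)
      then show ?thesis unfolding Zlev_ge by (simp add: not_less)
    qed
    then show ?thesis by blast
  qed
  also have "\<dots> \<in> sets M" using cm[OF A] by measurable
  finally show "{\<omega> \<in> space M. y \<le> Zlev xi l \<omega>} \<in> sets M" .
qed

abbreviation "Zmin \<equiv> (\<lambda>\<omega>. min (Zlev xi (2 * k - 1) \<omega>) (Zlev xi (2 * k + 1) \<omega>))"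

lemma Zmin_measurable: "Zmin \<in> borel_measurable M"
  by (intro borel_measurable_min Zlev_measurable)

lemma Zmin_nonneg: "\<omega> \<in> space M \<Longrightarrow> 0 \<le> Zmin \<omega>"
  using sub[of \<omega>] by (auto simp: Zlev_ge space_Xmeas)

text \<open>The number of tuples is almost surely at most F = (k - 1)! k!, and at t = 0 its
  expectation equals F; so both levels are almost surely full. On full levels the tuples above t
  number F if no particle lies below t, and 0 otherwise because a slot stays empty. The expectation
  is thus F times the probability sought.\<close>

lemma gap_law:
  obtains c where "c * rdet k 0 = 1" "\<And>t. t \<ge> 0 \<Longrightarrow> c * rdet k t \<ge> 0"
    "\<And>t. t \<ge> 0 \<Longrightarrow> emeasure M {\<omega> \<in> space M. ereal t \<le> Zmin \<omega>} = ennreal (c * rdet k t)"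
    "AE \<omega> in M. Zmin \<omega> < \<infinity>"
proof -
  let ?n = "k - 1 + k" and ?a = "2 * k - 1" and ?b = "2 * k + 1"
  define F :: nat where "F = fact (k - 1) * fact k"
  have F: "F > 0" "real F = fact (k - 1) * fact k" by (simp_all add: F_def)
  obtain c where c: "c * rdet k 0 = 1" "\<And>t. t \<ge> 0 \<Longrightarrow> c * rdet k t \<ge> 0"
    "\<And>t. t \<ge> 0 \<Longrightarrow> (\<integral>\<^sup>+ y. indicator (Pi\<^sub>E {..<?n} (\<lambda>i. {lvl k i} \<times> {t..})) y * ennreal (\<rho> ?n y) \<partial>Pi\<^sub>M {..<?n} (\<lambda>_. Xmeas))
       = ennreal (real F * (c * rdet k t))"
    unfolding F(2) using rho_joint[OF k rm nn rdt] by blast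
  have B: "AE \<omega> in M. finite {u. (?a, u) \<in> xi \<omega>} \<and> card {u. (?a, u) \<in> xi \<omega>} \<le> k - 1 \<and> finite {u. (?b, u) \<in> xi \<omega>} \<and> card {u. (?b, u) \<in> xi \<omega>} \<le> k"
  proof -
    have "AE \<omega> in M. finite {u. (?a, u) \<in> xi \<omega>} \<and> card {u. (?a, u) \<in> xi \<omega>} < k" by (rule level_bound) simp
    moreover have "AE \<omega> in M. finite {u. (?b, u) \<in> xi \<omega>} \<and> card {u. (?b, u) \<in> xi \<omega>} < k + 1" by (rule level_bound) simp
    ultimately show ?thesis
    proof eventually_elim
      case (elim \<omega>)
      then have "card {u. (?a, u) \<in> xi \<omega>} \<le> k - 1" "card {u. (?b, u) \<in> xi \<omega>} \<le> k" by linarith+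
      then show ?case using elim by blast
    qed
  qed
  have G: "\<exists>g\<in>borel_measurable M. (AE \<omega> in M. g \<omega> = of_nat (card (tups ?n (lvl k) (xi \<omega>) t))) \<and> (\<integral>\<^sup>+ \<omega>. g \<omega> \<partial>M) = ennreal (real F * (c * rdet k t))"
    if t: "t \<ge> 0" for t
    unfolding c(3)[OF t, symmetric]
  proof (rule factorial_moment[OF t, where Bd = F])
    show "AE \<omega> in M. \<forall>i<?n. finite {u. t \<le> u \<and> (lvl k i, u) \<in> xi \<omega>}" using B
    proof eventually_elim
      case (elim \<omega>)
      show ?case
      proof (intro allI impI)
        fix i
        have "finite {u. (lvl k i, u) \<in> xi \<omega>}" using elim by (simp add: lvl_def)
        then show "finite {u. t \<le> u \<and> (lvl k i, u) \<in> xi \<omega>}" by (rule rev_finite_subset) auto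
      qed
    qed
    show "AE \<omega> in M. card (tups ?n (lvl k) (xi \<omega>) t) \<le> F" using B
    proof eventually_elim
      case (elim \<omega>)
      show ?case unfolding F_def by (rule tups_card_le) (use elim in blast)+
    qed
    show "(\<integral>\<^sup>+ y. indicator (Pi\<^sub>E {..<?n} (\<lambda>i. {lvl k i} \<times> {t..})) y * ennreal (\<rho> ?n y) \<partial>Pi\<^sub>M {..<?n} (\<lambda>_. Xmeas)) < \<infinity>"
      unfolding c(3)[OF t] by simp
  qed
  have full: "AE \<omega> in M. card (tups ?n (lvl k) (xi \<omega>) 0) = F"
  proof -
    obtain g where g: "g \<in> borel_measurable M" "AE \<omega> in M. g \<omega> = of_nat (card (tups ?n (lvl k) (xi \<omega>) 0))" "(\<integral>\<^sup>+ \<omega>. g \<omega> \<partial>M) = ennreal (real F * (c * rdet k 0))"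
      using G[of 0] by auto
    have gi: "(\<integral>\<^sup>+ \<omega>. g \<omega> \<partial>M) = of_nat F" using g(3) unfolding c(1) by (simp add: ennreal_of_nat_eq_real_of_nat)
    have le: "AE \<omega> in M. g \<omega> \<le> of_nat F \<and> card (tups ?n (lvl k) (xi \<omega>) 0) \<le> F" using B g(2)
    proof eventually_elim
      case (elim \<omega>)
      have "card (tups ?n (lvl k) (xi \<omega>) 0) \<le> F" unfolding F_def by (rule tups_card_le) (use elim(1) in blast)+
      then show ?case using elim(2) by simp
    qed
    have "(\<integral>\<^sup>+ \<omega>. (of_nat F - g \<omega>) \<partial>M) = (\<integral>\<^sup>+ \<omega>. of_nat F \<partial>M) - (\<integral>\<^sup>+ \<omega>. g \<omega> \<partial>M)"
      by (rule nn_integral_diff) (use g(1) gi le in \<open>auto elim: eventually_mono\<close>)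
    also have "\<dots> = 0" unfolding gi by (simp add: emeasure_space_1)
    finally have "AE \<omega> in M. of_nat F - g \<omega> = 0" by (subst (asm) nn_integral_0_iff_AE) (use g(1) in auto)
    then show ?thesis using le g(2)
    proof eventually_elim
      case (elim \<omega>)
      then have "(of_nat F :: ennreal) \<le> of_nat (card (tups ?n (lvl k) (xi \<omega>) 0))" by (simp add: diff_eq_0_iff_ennreal)
      then show ?case using elim(2) by simp
    qed
  qed
  have em: "emeasure M {\<omega> \<in> space M. ereal t \<le> Zmin \<omega>} = ennreal (c * rdet k t)" if t: "t \<ge> 0" for t
  proof -
    let ?V = "{\<omega> \<in> space M. ereal t \<le> Zmin \<omega>}"
    have V: "?V \<in> sets M" using Zmin_measurable by measurable
    obtain g where g: "g \<in> borel_measurable M" "AE \<omega> in M. g \<omega> = of_nat (card (tups ?n (lvl k) (xi \<omega>) t))" "(\<integral>\<^sup>+ \<omega>. g \<omega> \<partial>M) = ennreal (real F * (c * rdet k t))"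
      using G[OF t] by auto
    have "AE \<omega> in M. g \<omega> = of_nat F * indicator ?V \<omega>" using g(2) B full AE_space
    proof eventually_elim
      case (elim \<omega>)
      have p: "0 \<le> u" if "(l, u) \<in> xi \<omega>" for l u using sub[OF elim(4)] that by (auto simp: space_Xmeas)
      show ?case
      proof (cases "\<omega> \<in> ?V")
        case True
        then have "t \<le> u" if "(?a, u) \<in> xi \<omega> \<or> (?b, u) \<in> xi \<omega>" for u using that by (auto simp: Zlev_ge)
        then have "{u. t \<le> u \<and> (lvl k i, u) \<in> xi \<omega>} = {u. 0 \<le> u \<and> (lvl k i, u) \<in> xi \<omega>}" for i using p by (auto simp: lvl_def)
        then have "tups ?n (lvl k) (xi \<omega>) t = tups ?n (lvl k) (xi \<omega>) 0" by (simp add: tups_def)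
        then show ?thesis using elim(1,3) True by simp
      next
        case False
        then have "\<exists>u<t. (?a, u) \<in> xi \<omega> \<or> (?b, u) \<in> xi \<omega>" using elim(4) by (auto simp: Zlev_ge not_le)
        then obtain u where u: "u < t" "(?a, u) \<in> xi \<omega> \<or> (?b, u) \<in> xi \<omega>" by blast
        have "tups ?n (lvl k) (xi \<omega>) t = {}"
        proof (rule tups_empty)
          have fs: "finite {u. t \<le> u \<and> (l, u) \<in> xi \<omega>}" if "finite {u. (l, u) \<in> xi \<omega>}" for l using that by (rule rev_finite_subset) auto
          then show "finite {u. t \<le> u \<and> (?a, u) \<in> xi \<omega>}" "finite {u. t \<le> u \<and> (?b, u) \<in> xi \<omega>}" using elim(2) by blast+
          have ps: "card {u. t \<le> u \<and> (l, u) \<in> xi \<omega>} < card {u. (l, u) \<in> xi \<omega>}" if "finite {u. (l, u) \<in> xi \<omega>}" "(l, u) \<in> xi \<omega>" for l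
          proof (rule psubset_card_mono[OF that(1)])
            have "u \<in> {u. (l, u) \<in> xi \<omega>}" "u \<notin> {u. t \<le> u \<and> (l, u) \<in> xi \<omega>}" using that u(1) by simp_all
            then show "{u. t \<le> u \<and> (l, u) \<in> xi \<omega>} \<subset> {u. (l, u) \<in> xi \<omega>}" by blast
          qed
          show "card {u. t \<le> u \<and> (?a, u) \<in> xi \<omega>} < k - 1 \<or> card {u. t \<le> u \<and> (?b, u) \<in> xi \<omega>} < k"
            using u(2)
          proof
            assume "(?a, u) \<in> xi \<omega>"
            from ps[OF _ this] elim(2) show ?thesis by linarith
          next
            assume "(?b, u) \<in> xi \<omega>"
            from ps[OF _ this] elim(2) show ?thesis by linarith
          qed
        qed
        then show ?thesis using elim(1) False by simp
      qed
    qed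
    then have "(\<integral>\<^sup>+ \<omega>. g \<omega> \<partial>M) = (\<integral>\<^sup>+ \<omega>. of_nat F * indicator ?V \<omega> \<partial>M)" by (rule nn_integral_cong_AE)
    also have "\<dots> = of_nat F * emeasure M ?V" by (rule nn_integral_cmult_indicator[OF V])
    finally have "of_nat F * emeasure M ?V = ennreal (real F * (c * rdet k t))" using g(3) by simp
    also have "\<dots> = of_nat F * ennreal (c * rdet k t)" using c(2)[OF t] by (simp add: ennreal_mult ennreal_of_nat_eq_real_of_nat)
    finally show ?thesis using F(1) by (simp add: ennreal_mult_cancel_left)
  qed
  \<comment> \<open>Level 2k + 1 almost surely holds k \<ge> 1 particles, which keeps the minimum
    finite.\<close>
  have "AE \<omega> in M. Zmin \<omega> < \<infinity>" using full
  proof eventually_elim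
    case (elim \<omega>)
    then have "tups ?n (lvl k) (xi \<omega>) 0 \<noteq> {}" using F(1) by auto
    then obtain u where "u \<in> tups ?n (lvl k) (xi \<omega>) 0" by blast
    then have "(\<lambda>i\<in>{..<k}. u (k - 1 + i)) \<in> {..<k} \<rightarrow>\<^sub>E {u. 0 \<le> u \<and> (?b, u) \<in> xi \<omega>}" using tups_lvl_split(2) by blast
    from PiE_mem[OF this, of 0] k obtain v where "(?b, v) \<in> xi \<omega>" by auto
    then have "Zlev xi ?b \<omega> \<le> ereal v" unfolding Zlev_def by (intro Inf_lower) auto
    then have "Zmin \<omega> \<le> ereal v" by (rule min.coboundedI2)
    also have "ereal v < \<infinity>" by simp
    finally show ?case .
  qed
  then show thesis using that c(1,2) em by blast
qed

end

section \<open>The law of the minimum\<close>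

lemma ghat_formula:
  assumes k: "k \<ge> 1" and P: "real_gaussian_matrix P (2 * k) Y" and c: "c * rdet k 0 = 1"
    and r': "\<And>t. (rdet k has_real_derivative r' t) (at t)"
  shows "ghat k P Y x = (if x > 0 then - c * r' x else 0)"
proof (cases "x > 0")
  case True
  let ?T = "\<lambda>t. measure P {\<omega> \<in> space P. TFS k (Y \<omega>) > t}"
  have h0: "hdet k 0 = cst k * rdet k 0" by (rule hdet_rdet[OF k])
  have r0: "rdet k 0 \<noteq> 0" using c by auto
  have nz: "hdet k 0 \<noteq> 0" unfolding h0 using cst_pos[OF k] r0 by simp
  have T: "?T t = hdet k t / hdet k 0" if "t \<in> {0<..}" for t using TFS_law[OF P k _ nz] that by simp
  have d1: "(?T has_real_derivative - rdet k t / hdet k 0) (at t)" if t: "t \<in> {0<..}" for t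
  proof (rule has_field_derivative_transform_within_open[where S = "{0<..}" and f = "\<lambda>t. hdet k t / hdet k 0"])
    show "((\<lambda>t. hdet k t / hdet k 0) has_real_derivative - rdet k t / hdet k 0) (at t)" by (rule DERIV_cdivide[OF DERIV_hdet[OF k]])
  qed (use t T in auto)
  have d1': "deriv ?T t = - rdet k t / hdet k 0" if "t \<in> {0<..}" for t by (rule DERIV_imp_deriv[OF d1[OF that]])
  have "(deriv ?T has_real_derivative - r' x / hdet k 0) (at x)"
  proof (rule has_field_derivative_transform_within_open[where S = "{0<..}" and f = "\<lambda>t. - rdet k t / hdet k 0"])
    show "((\<lambda>t. - rdet k t / hdet k 0) has_real_derivative - r' x / hdet k 0) (at x)" by (intro DERIV_cdivide DERIV_minus r')
  qed (use True d1' in auto)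
  then have "deriv (deriv ?T) x = - r' x / hdet k 0" by (rule DERIV_imp_deriv)
  then have "ghat k P Y x = cst k * (- r' x / hdet k 0)" unfolding ghat_def cst_def using True by simp
  \<comment> \<open>Since \<open>hdet k 0\<close> is \<open>cst k\<close> times
    \<open>rdet k 0\<close>, the prefactor cancels and 1 / \<open>rdet k 0\<close> = c is
    left.\<close>
  also have "\<dots> = - c * r' x"
  proof -
    have "c = 1 / rdet k 0" using c r0 by (simp add: field_simps)
    then show ?thesis unfolding h0 using cst_pos[OF k] by simp
  qed
  finally show ?thesis using True by simp
qed (simp add: ghat_def)

text \<open>Both laws are compared on the rays [y, \<infinity>] of the extended reals. The tail D of
  the minimum decreases to 0, so - D' is a nonnegative function that integrates back to D. For y =
  \<infinity> both sides are 0, as the minimum is almost surely finite.\<close>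

lemma (in kproc) Zmin_distr:
  assumes P: "real_gaussian_matrix P (2 * k) Y"
  shows "distr M borel Zmin = distr (density lborel (\<lambda>x. ennreal (ghat k P Y x))) borel ereal"
proof -
  obtain c where c: "c * rdet k 0 = 1" "\<And>t. t \<ge> 0 \<Longrightarrow> c * rdet k t \<ge> 0"
    "\<And>t. t \<ge> 0 \<Longrightarrow> emeasure M {\<omega> \<in> space M. ereal t \<le> Zmin \<omega>} = ennreal (c * rdet k t)"
    "AE \<omega> in M. Zmin \<omega> < \<infinity>" using gap_law by blast
  obtain r' where r'c: "continuous_on UNIV r'" and r': "\<And>t. (rdet k has_real_derivative r' t) (at t)" using rdet_differentiable by blast
  define D where "D t = c * rdet k t" for t
  have D': "(D has_real_derivative c * r' t) (at t)" for t unfolding D_def by (rule DERIV_cmult[OF r'])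
  define gg where "gg x = (if x > 0 then - c * r' x else 0)" for x
  have gh: "ghat k P Y x = gg x" for x unfolding gg_def by (rule ghat_formula[OF k P c(1) r'])
  have r'm: "r' \<in> borel_measurable borel" using r'c by (rule borel_measurable_continuous_onI)
  have ggm: "gg \<in> borel_measurable borel" unfolding gg_def using r'm by measurable
  have Vm: "{\<omega> \<in> space M. y \<le> Zmin \<omega>} \<in> sets M" for y using Zmin_measurable by measurable
  have mono: "D t \<le> D s" if st: "0 \<le> s" "s \<le> t" for s t
  proof -
    have "emeasure M {\<omega> \<in> space M. ereal t \<le> Zmin \<omega>} \<le> emeasure M {\<omega> \<in> space M. ereal s \<le> Zmin \<omega>}"
    proof (rule emeasure_mono[OF _ Vm], rule subsetI)
      fix \<omega> assume w: "\<omega> \<in> {\<omega> \<in> space M. ereal t \<le> Zmin \<omega>}"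
      have "ereal s \<le> ereal t" using st by simp
      then show "\<omega> \<in> {\<omega> \<in> space M. ereal s \<le> Zmin \<omega>}" using w order_trans by blast
    qed
    then have "ennreal (D t) \<le> ennreal (D s)" using c(3) st unfolding D_def by simp
    then show ?thesis using c(2)[of s] st unfolding D_def by simp
  qed
  \<comment> \<open>Nonnegativity of the density is inferred from the monotonicity of the tail,
    without a formula for the derivative.\<close>
  have f0: "0 \<le> - c * r' x" if x: "0 \<le> x" for x
  proof (rule ccontr)
    assume "\<not> 0 \<le> - c * r' x"
    then have "0 < c * r' x" by simp
    from DERIV_pos_inc_right[OF D' this] obtain d where d: "d > 0" "\<And>h. 0 < h \<Longrightarrow> h < d \<Longrightarrow> D x < D (x + h)" by blast
    have "D x < D (x + d / 2)" using d by simp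
    moreover have "D (x + d / 2) \<le> D x" by (rule mono) (use x d in auto)
    ultimately show False by simp
  qed
  have seq: "(\<lambda>n. D (real n)) \<longlonglongrightarrow> 0"
  proof -
    let ?A = "\<lambda>n. {\<omega> \<in> space M. ereal (real n) \<le> Zmin \<omega>}"
    have "(\<lambda>n. measure M (?A n)) \<longlonglongrightarrow> measure M (\<Inter>n. ?A n)"
    proof (rule finite_Lim_measure_decseq)
      show "range ?A \<subseteq> sets M" using Vm by blast
      show "decseq ?A"
      proof (rule decseq_SucI, rule subsetI)
        fix n \<omega> assume w: "\<omega> \<in> ?A (Suc n)"
        have "ereal (real n) \<le> ereal (real (Suc n))" by simp
        then show "\<omega> \<in> ?A n" using w order_trans by blast
      qed
    qed
    moreover have "measure M (?A n) = D (real n)" for n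
      using c(3)[of "real n"] c(2)[of "real n"] unfolding D_def measure_def by simp
    moreover have "measure M (\<Inter>n. ?A n) = 0"
    proof -
      have "AE \<omega> in M. \<omega> \<notin> (\<Inter>n. ?A n)" using c(4)
      proof eventually_elim
        case (elim \<omega>)
        show ?case
        proof
          assume w: "\<omega> \<in> (\<Inter>n. ?A n)"
          then have "ereal (real n) \<le> Zmin \<omega>" for n by blast
          then have "Zmin \<omega> = \<infinity>" by (intro ereal_top) (metis ereal_less_eq(3) order_trans real_arch_simple)
          then show False using elim by simp
        qed
      qed
      then have "emeasure M (\<Inter>n. ?A n) = 0" by (subst (asm) AE_iff_measurable[of "\<Inter>n. ?A n"]) (use Vm in auto)
      then show ?thesis by (simp add: measure_def)
    qed
    ultimately show ?thesis by simp
  qed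
  have lim: "((\<lambda>x. - D x) \<longlongrightarrow> 0) at_top"
  proof (rule tendstoI)
    fix e :: real assume "e > 0"
    with order_tendstoD(2)[OF seq] obtain n where n: "D (real n) < e" by (auto simp: eventually_sequentially)
    show "\<forall>\<^sub>F x in at_top. dist (- D x) 0 < e"
    proof (rule eventually_at_top_linorderI[of "real n"])
      fix x assume x: "real n \<le> x"
      have "0 \<le> D x" unfolding D_def by (rule c(2)) (use x in linarith)
      moreover have "D x \<le> D (real n)" by (rule mono) (use x in auto)
      ultimately show "dist (- D x) 0 < e" using n by (simp add: dist_norm)
    qed
  qed
  have FTC: "(\<integral>\<^sup>+x. ennreal (gg x) * indicator {t..} x \<partial>lborel) = ennreal (D t)" if t: "0 \<le> t" for t
  proof -
    have "(\<integral>\<^sup>+x. ennreal (gg x) * indicator {t..} x \<partial>lborel) = (\<integral>\<^sup>+x. ennreal (- c * r' x) * indicator {t..} x \<partial>lborel)"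
    proof (rule nn_integral_cong_AE)
      show "AE x in lborel. ennreal (gg x) * indicator {t..} x = ennreal (- c * r' x) * indicator {t..} x"
        using AE_lborel_singleton[of 0]
        by eventually_elim (use t in \<open>auto simp: gg_def indicator_def\<close>)
    qed
    also have "\<dots> = ennreal (0 - (- D t))"
    proof (rule nn_integral_FTC_atLeast[OF _ _ _ lim])
      show "(\<lambda>x. - c * r' x) \<in> borel_measurable borel" using r'm by measurable
      show "((\<lambda>x. - D x) has_real_derivative - c * r' x) (at x)" for x using DERIV_minus[OF D'[of x]] by simp
      show "0 \<le> - c * r' x" if "t \<le> x" for x by (rule f0) (use t that in linarith)
    qed
    finally show ?thesis by simp
  qed
  let ?Q = "distr (density lborel (\<lambda>x. ennreal (ghat k P Y x))) borel ereal"
  have Qv: "emeasure ?Q {y..} = (\<integral>\<^sup>+x. ennreal (gg x) * indicator {x. y \<le> ereal x} x \<partial>lborel)" for y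
  proof -
    have S: "{x. y \<le> ereal x} \<in> sets borel"
    proof -
      have "{x. y \<le> ereal x} = {x \<in> space borel. y \<le> ereal x}" by simp
      also have "\<dots> \<in> sets borel" by measurable
      finally show ?thesis .
    qed
    have "emeasure ?Q {y..} = emeasure (density lborel (\<lambda>x. ennreal (gg x))) (ereal -` {y..} \<inter> space (density lborel (\<lambda>x. ennreal (gg x))))"
      unfolding gh by (rule emeasure_distr) auto
    also have "ereal -` {y..} \<inter> space (density lborel (\<lambda>x. ennreal (gg x))) = {x. y \<le> ereal x}" by auto
    also have "emeasure (density lborel (\<lambda>x. ennreal (gg x))) {x. y \<le> ereal x} = (\<integral>\<^sup>+x. ennreal (gg x) * indicator {x. y \<le> ereal x} x \<partial>lborel)"
      by (rule emeasure_density) (use ggm S in auto)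
    finally show ?thesis .
  qed
  have Mv: "emeasure (distr M borel Zmin) {y..} = emeasure M {\<omega> \<in> space M. y \<le> Zmin \<omega>}" for y
  proof -
    have "emeasure (distr M borel Zmin) {y..} = emeasure M (Zmin -` {y..} \<inter> space M)"
      by (rule emeasure_distr[OF Zmin_measurable]) simp
    also have "Zmin -` {y..} \<inter> space M = {\<omega> \<in> space M. y \<le> Zmin \<omega>}" by auto
    finally show ?thesis .
  qed
  have low: "emeasure (distr M borel Zmin) {y..} = emeasure ?Q {y..}" if y: "y \<le> 0" for y :: ereal
  proof -
    have "{\<omega> \<in> space M. y \<le> Zmin \<omega>} = {\<omega> \<in> space M. ereal 0 \<le> Zmin \<omega>}"
    proof -
      have "ereal 0 \<le> Zmin \<omega> \<and> y \<le> Zmin \<omega>" if "\<omega> \<in> space M" for \<omega>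
        using Zmin_nonneg[OF that] order_trans[OF y Zmin_nonneg[OF that]] unfolding zero_ereal_def by blast
      then show ?thesis by blast
    qed
    moreover have "ennreal (gg x) * indicator {x. y \<le> ereal x} x = ennreal (gg x) * indicator {0..} x" for x
    proof (cases "x > 0")
      case True
      then have "y \<le> ereal x" using y by (metis ereal_less_eq(5) less_imp_le order_trans)
      then show ?thesis using True by simp
    qed (simp add: gg_def)
    ultimately show ?thesis unfolding Mv Qv using c(3)[of 0] FTC[of 0] unfolding D_def by simp
  qed
  have eq: "emeasure (distr M borel Zmin) {y..} = emeasure ?Q {y..}" for y
  proof (cases "y \<le> 0")
    case True
    then show ?thesis by (rule low)
  next
    case False
    show ?thesis
    proof (cases y)
      case (real t)
      then have t: "0 \<le> t" using False by simp
      have "{x. y \<le> ereal x} = {t..}" using real by auto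
      then show ?thesis unfolding Mv Qv using c(3)[OF t] FTC[OF t] real unfolding D_def by simp
    next
      case PInf
      have "AE \<omega> in M. \<not> (y \<le> Zmin \<omega>)" using c(4) by eventually_elim (simp only: PInf not_le)
      then have "emeasure M {\<omega> \<in> space M. y \<le> Zmin \<omega>} = 0" by (subst (asm) AE_iff_measurable[OF Vm[of y]]) auto
      moreover have "{x. y \<le> ereal x} = {}" using PInf by auto
      ultimately show ?thesis unfolding Mv Qv by simp
    qed (use False in simp)
  qed
  show ?thesis
  \<comment> \<open>Closed rays are stable under intersection, and the ray from - \<infinity> is
    already the whole space, so a constant exhausting sequence is enough.\<close>
  proof (rule measure_eqI_generator_eq[where E = "range (\<lambda>y::ereal. {y..})" and \<Omega> = UNIV and A = "\<lambda>_. {-\<infinity>..}"])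
    show "Int_stable (range (\<lambda>y::ereal. {y..}))"
    proof (rule Int_stableI)
      fix A B :: "ereal set" assume "A \<in> range (\<lambda>y. {y..})" "B \<in> range (\<lambda>y. {y..})"
      then obtain a b where "A = {a..}" "B = {b..}" by blast
      then have "A \<inter> B = {max a b..}" by auto
      then show "A \<inter> B \<in> range (\<lambda>y. {y..})" by blast
    qed
    show "sets (distr M borel Zmin) = sigma_sets UNIV (range (\<lambda>y::ereal. {y..}))" "sets ?Q = sigma_sets UNIV (range (\<lambda>y::ereal. {y..}))"
    proof -
      have "sets (borel :: ereal measure) = sigma_sets UNIV (range (\<lambda>y. {y..}))"
      proof (rule antisym)
        have "borel = sigma UNIV (range (\<lambda>y::ereal. {..<y}))" by (rule borel_Iio)
        then have "sets (borel :: ereal measure) = sigma_sets UNIV (range (\<lambda>y::ereal. {..<y}))" by (metis sets_measure_of top_greatest Pow_UNIV)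
        also have "\<dots> \<subseteq> sigma_sets UNIV (range (\<lambda>y::ereal. {y..}))"
        proof (rule sigma_sets_mono, rule image_subsetI)
          fix y :: ereal
          have "UNIV - {y..} \<in> sigma_sets UNIV (range (\<lambda>y::ereal. {y..}))" by (intro sigma_sets.Compl sigma_sets.Basic) auto
          moreover have "UNIV - {y..} = {..<y}" by auto
          ultimately show "{..<y} \<in> sigma_sets UNIV (range (\<lambda>y::ereal. {y..}))" by simp
        qed
        finally show "sets (borel :: ereal measure) \<subseteq> sigma_sets UNIV (range (\<lambda>y. {y..}))" .
        show "sigma_sets UNIV (range (\<lambda>y. {y..})) \<subseteq> sets (borel :: ereal measure)"
        proof -
          have "range (\<lambda>y::ereal. {y..}) \<subseteq> sets borel" by auto
          from sets.sigma_sets_subset[OF this] show ?thesis by (simp only: space_borel)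
        qed
      qed
      then show "sets (distr M borel Zmin) = sigma_sets UNIV (range (\<lambda>y::ereal. {y..}))" "sets ?Q = sigma_sets UNIV (range (\<lambda>y::ereal. {y..}))" by simp_all
    qed
    show "(\<Union>i::nat. {- \<infinity>::ereal..}) = UNIV" by auto
    show "emeasure (distr M borel Zmin) {- \<infinity>..} \<noteq> \<infinity>" unfolding Mv by simp
    show "emeasure (distr M borel Zmin) X = emeasure ?Q X" if "X \<in> range (\<lambda>y::ereal. {y..})" for X using that eq by blast
  qed auto
qed

theorem theorem1p18:
  fixes k :: nat
    and M :: "'a measure" and xi :: "'a \<Rightarrow> (nat \<times> real) set"
    and P :: "'b measure" and Y :: "'b \<Rightarrow> nat \<times> nat \<Rightarrow> real"
  assumes "k \<ge> 1"
    and "is_DPP M xi (Kprime k)"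
    and "real_gaussian_matrix P (2 * k) Y"
  shows "(k = 1 \<longrightarrow>
            distr M borel (Zlev xi 3)
            = distr (density lborel (\<lambda>x. ennreal (ghat k P Y x))) borel ereal)
       \<and> (k \<ge> 2 \<longrightarrow>
            distr M borel (\<lambda>\<omega>. min (Zlev xi (2 * k - 1) \<omega>) (Zlev xi (2 * k + 1) \<omega>))
            = distr (density lborel (\<lambda>x. ennreal (ghat k P Y x))) borel ereal)"
proof -
  from assms(2) obtain \<rho> where M: "prob_space M"
    and D: "\<forall>\<omega>\<in>space M. xi \<omega> \<subseteq> space Xmeas" "\<forall>A\<in>sets Xmeas. (\<lambda>\<omega>. cnt (xi \<omega> \<inter> A)) \<in> borel_measurable M"
      "\<forall>n y. 0 \<le> \<rho> n y" "\<forall>n. \<rho> n \<in> borel_measurable (PiM {..<n} (\<lambda>_. Xmeas))"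
      "\<forall>n A. (\<forall>i<n. A i \<in> sets Xmeas) \<and> disjoint_family_on A {..<n} \<longrightarrow>
           (\<integral>\<^sup>+ \<omega>. (\<Prod>i<n. cnt (xi \<omega> \<inter> A i)) \<partial>M)
           = (\<integral>\<^sup>+ y. indicator (PiE {..<n} A) y * ennreal (\<rho> n y) \<partial>(PiM {..<n} (\<lambda>_. Xmeas)))"
      "\<forall>n. AE y in PiM {..<n} (\<lambda>_. Xmeas). detn n (\<lambda>i j. Kprime k (y i) (y j)) = complex_of_real (\<rho> n y)"
    unfolding is_DPP_def by auto
  interpret prob_space M by (rule M)
  interpret kproc M k xi \<rho>
  proof unfold_locales
    show "1 \<le> k" by (rule assms(1))
    show "xi \<omega> \<subseteq> space Xmeas" if "\<omega> \<in> space M" for \<omega> using D(1) that by blast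
    show "(\<lambda>\<omega>. cnt (xi \<omega> \<inter> A)) \<in> borel_measurable M" if "A \<in> sets Xmeas" for A using D(2) that by blast
    show "0 \<le> \<rho> n y" for n y using D(3) by blast
    show "\<rho> n \<in> borel_measurable (PiM {..<n} (\<lambda>_. Xmeas))" for n using D(4) by blast
    show "(\<integral>\<^sup>+ \<omega>. (\<Prod>i<n. cnt (xi \<omega> \<inter> A i)) \<partial>M) = (\<integral>\<^sup>+ y. indicator (PiE {..<n} A) y * ennreal (\<rho> n y) \<partial>(PiM {..<n} (\<lambda>_. Xmeas)))"
      if "\<And>i. i < n \<Longrightarrow> A i \<in> sets Xmeas" "disjoint_family_on A {..<n}" for n A using D(5) that by blast
    show "AE y in PiM {..<n} (\<lambda>_. Xmeas). detn n (\<lambda>i j. Kprime k (y i) (y j)) = complex_of_real (\<rho> n y)" for n using D(6) by blast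
  qed
  note main = Zmin_distr[OF assms(3)]
  have "distr M borel (Zlev xi 3) = distr (density lborel (\<lambda>x. ennreal (ghat k P Y x))) borel ereal" if k1: "k = 1"
  proof -
    \<comment> \<open>For k = 1 the lower level is level 1 and holds no particle; its coordinate is
      the infimum of the empty set, \<infinity>, so the minimum is the coordinate of level
      3.\<close>
    have "AE \<omega> in M. finite {u. (1, u) \<in> xi \<omega>} \<and> card {u. (1, u) \<in> xi \<omega>} < 1" by (rule level_bound) (simp add: k1)
    then have "AE \<omega> in M. Zlev xi 3 \<omega> = Zmin \<omega>"
    proof eventually_elim
      case (elim \<omega>)
      have z: "card {u. (1, u) \<in> xi \<omega>} = 0" using elim by linarith
      have "{u. (1, u) \<in> xi \<omega>} = {}" by (rule iffD1[OF card_0_eq[OF conjunct1[OF elim]] z])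
      then have "Zlev xi 1 \<omega> = \<infinity>" by (simp add: Zlev_def top_ereal_def)
      then show ?case using k1 by (simp add: numeral_3_eq_3)
    qed
    then have "distr M borel (Zlev xi 3) = distr M borel Zmin"
      by (rule distr_cong_AE[OF refl refl _ Zlev_measurable Zmin_measurable])
    then show ?thesis using main by simp
  qed
  then show ?thesis using main by blast
qed

end
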